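(* Let $P\in\mathbb{C}[\xi_1,\ldots,\xi_d]$ be elliptic and let $X\subseteq\mathbb{R}^d$ be open. Let $K$ be a compact subset of $X$ that is the closure of an open set with continuous boundary. Suppose that $X$ does not contain a bounded connected component of $\mathbb{R}^d\setminus K$. Let $Y\subseteq\mathbb{R}^d$ be open with $K\subseteq Y\subseteq X$. Then, for all compact $L\subseteq Y$ with $K\subseteq\operatorname{int}L$ and all compact $M\subseteq X$ there are $s,C>0$ such that for all $f\in\mathscr{E}_P(Y)$ and all $\varepsilon\in(0,1)$ there exists $h_\varepsilon\in\mathscr{E}_P(X)$ with $$\|f-h_\varepsilon\|_{K}\leq\varepsilon\|f\|_{L}\quad\text{and}\quad\|h_\varepsilon\|_{M}\leq\frac{C}{\varepsilon^s}\|f\|_{L}.$$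
   Context: For a polynomial $P\in\mathbb{C}[\xi_1,\ldots,\xi_d]$, $P(D)=P(-i\frac{\partial}{\partial x_1},\ldots,-i\frac{\partial}{\partial x_d})$. $P$ (of degree $m$, with principal part $P_m$) is elliptic if $P_m(\xi)\neq0$ for all $\xi\in\mathbb{R}^d\setminus\{0\}$. For $X\subseteq\mathbb{R}^d$ open, $\mathscr{E}(X)$ is the space of (complex-valued) smooth functions on $X$, and $\mathscr{E}_P(X)=\{f\in\mathscr{E}(X): P(D)f=0\}$. For $K\subseteq X$ compact, $\|f\|_K=\sup_{x\in K}|f(x)|$. An open set $U\subseteq\mathbb{R}^d$ has continuous boundary if for each $\xi\in\partial U$ there exists a homeomorphism $h$ from the closed unit ball $\overline{B}(0,1)$ of $\mathbb{R}^d$ onto a compact neighborhood $N$ of $\xi$ such that $h(0)=\xi$ and $\overline{U}\cap N=h(\{x\in\overline{B}(0,1): x_d\leq0\})$. *)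

theory Defs
  imports "HOL-Analysis.Analysis" "HOL-Library.Poly_Mapping"
begin

text \<open>
  The coordinates of \<open>\<real>\<^sup>d\<close> are indexed by a finite type \<open>'n\<close> with \<open>d = CARD('n)\<close>; its linear order
  plays the role of the order on \<open>1, \<dots>, d\<close>, so that \<open>Max UNIV\<close> is the index \<open>d\<close>.
  Functions on a subset \<open>X\<close> of \<open>\<real>\<^sup>d\<close> are total functions of which only the values on \<open>X\<close> matter;
  \<open>X\<close> is open wherever derivatives are taken.
\<close>

type_synonym 'n cpoly = "('n \<Rightarrow>\<^sub>0 nat) \<Rightarrow>\<^sub>0 complex"

definition multideg :: "('n::finite \<Rightarrow>\<^sub>0 nat) \<Rightarrow> nat" where
  "multideg \<alpha> = (\<Sum>j\<in>UNIV. Poly_Mapping.lookup \<alpha> j)"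

text \<open>The zero polynomial gets degree 0; it is not elliptic.\<close>

definition total_degree :: "('n::finite) cpoly \<Rightarrow> nat" where
  "total_degree P = Max (insert 0 (multideg ` Poly_Mapping.keys P))"

definition principal_part :: "('n::finite) cpoly \<Rightarrow> 'n cpoly" where
  "principal_part P =
    Poly_Mapping.mapp (\<lambda>\<alpha> c. if multideg \<alpha> = total_degree P then c else 0) P"

definition poly_eval :: "('n::finite) cpoly \<Rightarrow> complex ^ 'n \<Rightarrow> complex" where
  "poly_eval P z = (\<Sum>\<alpha>\<in>Poly_Mapping.keys P.
     Poly_Mapping.lookup P \<alpha> * (\<Prod>j\<in>UNIV. (z $ j) ^ Poly_Mapping.lookup \<alpha> j))"

definition elliptic :: "('n::finite) cpoly \<Rightarrow> bool" where
  "elliptic P \<longleftrightarrow>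
    (\<forall>\<xi>::real ^ 'n. \<xi> \<noteq> 0 \<longrightarrow> poly_eval (principal_part P) (\<chi> j. complex_of_real (\<xi> $ j)) \<noteq> 0)"

text \<open>
  Used only where \<open>f\<close> is differentiable; there it is the derivative of \<open>f\<close> along the \<open>j\<close>-th unit vector.
\<close>

definition partial_deriv :: "'n::finite \<Rightarrow> (real ^ 'n \<Rightarrow> complex) \<Rightarrow> real ^ 'n \<Rightarrow> complex" where
  "partial_deriv j f x = frechet_derivative f (at x) (axis j 1)"

primrec Ck_on :: "nat \<Rightarrow> (real ^ 'n::finite) set \<Rightarrow> (real ^ 'n \<Rightarrow> complex) \<Rightarrow> bool" where
  "Ck_on 0 X f \<longleftrightarrow> continuous_on X f"
| "Ck_on (Suc k) X f \<longleftrightarrow>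
     (\<forall>x\<in>X. f differentiable (at x)) \<and> (\<forall>j. Ck_on k X (partial_deriv j f))"

definition smooth_functions :: "(real ^ 'n::finite) set \<Rightarrow> (real ^ 'n \<Rightarrow> complex) set" where
  "smooth_functions X = {f. \<forall>k. Ck_on k X f}"

definition D_op :: "'n::finite \<Rightarrow> (real ^ 'n \<Rightarrow> complex) \<Rightarrow> real ^ 'n \<Rightarrow> complex" where
  "D_op j f x = - \<i> * partial_deriv j f x"

text \<open>This is \<open>D\<^sub>1^(\<alpha>\<^sub>1) \<circ> \<dots> \<circ> D\<^sub>d^(\<alpha>\<^sub>d)\<close>; on smooth functions the order of the factors is irrelevant.\<close>

definition D_multi ::
  "('n::{finite,linorder} \<Rightarrow>\<^sub>0 nat) \<Rightarrow> (real ^ 'n::{finite,linorder} \<Rightarrow> complex) \<Rightarrow>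
    real ^ 'n::{finite,linorder} \<Rightarrow> complex" where
  "D_multi \<alpha> f =
    foldr (\<lambda>j g. (D_op j ^^ Poly_Mapping.lookup \<alpha> j) g) (sorted_list_of_set UNIV) f"

definition diff_op ::
  "('n::{finite,linorder}) cpoly \<Rightarrow> (real ^ 'n::{finite,linorder} \<Rightarrow> complex) \<Rightarrow>
    real ^ 'n::{finite,linorder} \<Rightarrow> complex" where
  "diff_op P f x = (\<Sum>\<alpha>\<in>Poly_Mapping.keys P. Poly_Mapping.lookup P \<alpha> * D_multi \<alpha> f x)"

definition kernel_functions ::
  "('n::{finite,linorder}) cpoly \<Rightarrow> (real ^ 'n::{finite,linorder}) set \<Rightarrow>
    (real ^ 'n::{finite,linorder} \<Rightarrow> complex) set" where
  "kernel_functions P X = {f \<in> smooth_functions X. \<forall>x\<in>X. diff_op P f x = 0}"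

text \<open>The supremum is taken in \<open>[0, \<infinity>)\<close>, hence is 0 for the empty set.\<close>

definition sup_norm_on :: "(real ^ 'n::finite) set \<Rightarrow> (real ^ 'n \<Rightarrow> complex) \<Rightarrow> real" where
  "sup_norm_on K f = (if K = {} then 0 else (SUP x\<in>K. norm (f x)))"

definition has_continuous_boundary :: "(real ^ 'n::{finite,linorder}) set \<Rightarrow> bool" where
  "has_continuous_boundary U \<longleftrightarrow>
    (\<forall>\<xi>\<in>frontier U. \<exists>N h g. compact N \<and> \<xi> \<in> interior N \<and>
       homeomorphism (cball (0 :: real ^ 'n::{finite,linorder}) 1) N h g \<and> h 0 = \<xi> \<and>
       closure U \<inter> N = h ` {x \<in> cball 0 1. x $ Max UNIV \<le> 0})"

end

theory Submission
  imports Defs "HOL-Computational_Algebra.Polynomial"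
begin

text \<open>
  After scaling, everything happens in \<open>ball 0 (1/2)\<close>. For a lattice \<open>\<theta> + \<int>\<^sup>d\<close> avoiding the zeros of the symbol,
  the sum \<open>E(x)\<close> of \<open>exp(i k x) / P(k)\<close> over the lattice points \<open>k\<close> (regularised by a mollifier) is a fundamental
  solution of \<open>P(D)\<close> near the origin; it is real analytic off its pole by Cauchy estimates that are uniform in the
  regularisation. If \<open>f\<close> is a solution near \<open>L\<close> and
  \<open>\<zeta>\<close> is a cutoff equal to 1 near \<open>K\<close>, then \<open>f\<close> is on \<open>K\<close> a superposition of translates \<open>E(x - a)\<close> with poles \<open>a\<close> in the
  support of the derivatives of \<open>\<zeta>\<close>. A pole is pushed out of \<open>K\<close> along a path: each Taylor step approximates
  \<open>E(x - a)\<close> on \<open>K\<close> with error \<open>q\<^sup>N\<close> by derivatives of order \<open>O(N)\<close> of \<open>E\<close> with a new pole, whose size grows at most like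
  \<open>C\<^sup>N\<close>. Finitely many steps suffice, and \<open>N\<close> proportional to \<open>log (1/\<epsilon>)\<close> gives error \<open>\<epsilon>\<close> at the price of a power
  of \<open>1/\<epsilon>\<close>. This yields a quantitative approximation by solutions near any given compact subset of \<open>X\<close>; the
  classical qualitative Runge argument along an exhaustion of \<open>X\<close> then replaces them by solutions on \<open>X\<close>.
\<close>

section \<open>Calculus of smooth functions\<close>

text \<open>The numbers \<open>1 / P(k)\<close> are bounded but in general not summable, so the
  mollifier is needed to make the series converge. Its width depends on \<open>f\<close> and
  \<epsilon>, hence no constant may depend on it: away from the pole \<open>E\<close> is controlled
  by an elliptic bootstrap that starts from a bound on Fourier coefficients alone. The series
  inverts the operator only near the origin, because it is periodic up to a phase; in a ball of
  radius 1/2 all differences \<open>x - a\<close> have norm at most 1 and stay clear of the other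
  poles. The number of translates representing \<open>f\<close> is uncontrolled as well; only the
  sum of their weights is bounded, and this suffices. In pole pushing the length of a step is
  dictated by the growth of the derivatives of \<open>E\<close> and must not shrink with the desired
  rate; a better rate is bought by more Taylor terms. As a step loses a factor \<open>2^N\<close>,
  the rate \<open>q\<close> at one pole rests on \<open>q / 2\<close> at the next one, so all rates
  are treated at once. The hypothesis on the components of \<open>- K\<close> supplies, for each
  pole, an endpoint outside the compact subset of \<open>X\<close> under consideration; with its
  pole there, \<open>E\<close> already solves the equation on that subset.\<close>

lemma partial_deriv_eq:
  assumes "(f has_derivative f') (at x)"
  shows "partial_deriv j f x = f' (axis j 1)"
  unfolding partial_deriv_def using frechet_derivative_at[OF assms] by simp

lemma vec_eq_sum_axis: "(h :: real ^ 'n::finite) = (\<Sum>j\<in>UNIV. (h $ j) *\<^sub>R axis j 1)"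
  by (simp add: vec_eq_iff axis_def if_distrib cong: if_cong)

lemma sum_axis_coeff: "(\<Sum>i\<in>UNIV. complex_of_real (axis j 1 $ i) * c i) = c j" for j :: "'n::finite"
  by (subst sum.remove[of _ j]) (auto simp: axis_def intro!: sum.neutral)

lemma has_derivative_partial:
  assumes "f differentiable (at x)"
  shows "(f has_derivative (\<lambda>h. \<Sum>j\<in>UNIV. of_real (h $ j) * partial_deriv j f x)) (at x)"
proof -
  have *: "(f has_derivative frechet_derivative f (at x)) (at x)"
    using assms frechet_derivative_works by blast
  interpret linear "frechet_derivative f (at x)"
    using assms by (rule linear_frechet_derivative)
  have "frechet_derivative f (at x) h = (\<Sum>j\<in>UNIV. of_real (h $ j) * partial_deriv j f x)" for h
  proof -
    have "frechet_derivative f (at x) h = frechet_derivative f (at x) (\<Sum>j\<in>UNIV. (h $ j) *\<^sub>R axis j 1)"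
      using vec_eq_sum_axis[of h] by simp
    also have "\<dots> = (\<Sum>j\<in>UNIV. of_real (h $ j) * partial_deriv j f x)"
      unfolding sum scale by (simp add: partial_deriv_def scaleR_conv_of_real)
    finally show ?thesis .
  qed
  then have "frechet_derivative f (at x) = (\<lambda>h. \<Sum>j\<in>UNIV. of_real (h $ j) * partial_deriv j f x)" by (rule ext)
  then show ?thesis using * by simp
qed

lemma partial_deriv_cong:
  assumes "open S" "x \<in> S" "\<And>y. y \<in> S \<Longrightarrow> f y = g y"
  shows "partial_deriv j f x = partial_deriv j g x"
proof -
  have "(f has_derivative D) (at x) \<longleftrightarrow> (g has_derivative D) (at x)" for D
    using has_derivative_transform_within_open[of f D x UNIV S g]
      has_derivative_transform_within_open[of g D x UNIV S f] assms by auto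
  then show ?thesis by (simp add: partial_deriv_def frechet_derivative_def)
qed

lemma differentiable_cong_open:
  assumes "open S" "x \<in> S" "\<And>y. y \<in> S \<Longrightarrow> f y = g y" "f differentiable (at x)"
  shows "g differentiable (at x)"
  using assms unfolding differentiable_def
  by (meson has_derivative_transform_within_open)

lemma Ck_on_cong:
  assumes "open S" "\<And>y. y \<in> S \<Longrightarrow> f y = g y" "Ck_on k S f"
  shows "Ck_on k S g"
  using assms(2,3)
proof (induction k arbitrary: f g)
  case 0
  then show ?case by (auto cong: continuous_on_cong)
next
  case (Suc k)
  have "Ck_on k S (partial_deriv j g)" for j
    using Suc.IH[of "partial_deriv j f" "partial_deriv j g"] partial_deriv_cong[OF assms(1), of _ f g j] Suc.prems
    by auto
  then show ?case
    using Suc.prems differentiable_cong_open[OF assms(1), of _ f g] by auto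
qed

lemma Ck_on_mono: "Ck_on (Suc k) S f \<Longrightarrow> Ck_on k S f"
proof (induction k arbitrary: f)
  case 0
  then show ?case
    by (auto intro!: continuous_at_imp_continuous_on differentiable_imp_continuous_within)
next
  case (Suc k)
  then show ?case by (metis Ck_on.simps(2))
qed

lemma Ck_on_subset: "T \<subseteq> S \<Longrightarrow> Ck_on k S f \<Longrightarrow> Ck_on k T f"
  by (induction k arbitrary: f) (auto intro: continuous_on_subset)

lemma Ck_on_local:
  assumes "open S" "\<And>x. x \<in> S \<Longrightarrow> \<exists>T. open T \<and> x \<in> T \<and> Ck_on k T f"
  shows "Ck_on k S f"
  using assms(2)
proof (induction k arbitrary: f)
  case 0
  have "isCont f x" if "x \<in> S" for x
    using 0[OF that] continuous_on_eq_continuous_at by auto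
  then show ?case by (auto intro: continuous_at_imp_continuous_on)
next
  case (Suc k)
  have "Ck_on k S (partial_deriv j f)" for j
    using Suc.prems by (intro Suc.IH) (metis Ck_on.simps(2))
  then show ?case using Suc.prems by (metis Ck_on.simps(2))
qed

lemma partial_deriv_const: "partial_deriv j (\<lambda>x. c) x = 0"
  by (rule trans[OF partial_deriv_eq[OF has_derivative_const]]) simp

lemma partial_deriv_add:
  assumes "f differentiable (at x)" "g differentiable (at x)"
  shows "partial_deriv j (\<lambda>x. f x + g x) x = partial_deriv j f x + partial_deriv j g x"
  by (rule trans[OF partial_deriv_eq[OF has_derivative_add[OF has_derivative_partial[OF assms(1)] has_derivative_partial[OF assms(2)]]]])
    (simp add: sum_axis_coeff)

lemma partial_deriv_mult:
  assumes "f differentiable (at x)" "g differentiable (at x)"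
  shows "partial_deriv j (\<lambda>x. f x * g x) x = partial_deriv j f x * g x + f x * partial_deriv j g x"
  by (rule trans[OF partial_deriv_eq[OF has_derivative_mult[OF has_derivative_partial[OF assms(1)] has_derivative_partial[OF assms(2)]]]])
    (simp add: sum_axis_coeff)

lemma Ck_on_const: "Ck_on k S (\<lambda>x. c)"
proof (induction k arbitrary: c)
  case (Suc k)
  then show ?case by (simp add: partial_deriv_const[abs_def])
qed simp

lemma Ck_on_add:
  assumes "open S" "Ck_on k S f" "Ck_on k S g"
  shows "Ck_on k S (\<lambda>x. f x + g x)"
  using assms(2,3)
proof (induction k arbitrary: f g)
  case 0
  then show ?case by (auto intro: continuous_intros)
next
  case (Suc k)
  have "Ck_on k S (partial_deriv j (\<lambda>x. f x + g x))" for j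
  proof (rule Ck_on_cong[OF assms(1)])
    show "Ck_on k S (\<lambda>x. partial_deriv j f x + partial_deriv j g x)"
      by (rule Suc.IH) (use Suc.prems in simp_all)
    show "partial_deriv j f y + partial_deriv j g y = partial_deriv j (\<lambda>x. f x + g x) y" if "y \<in> S" for y
      using Suc.prems that partial_deriv_add[of f y g] by simp
  qed
  moreover have "(\<lambda>x. f x + g x) differentiable (at x)" if "x \<in> S" for x
    using Suc.prems that by (intro differentiable_add) simp_all
  ultimately show ?case by simp
qed

lemma Ck_on_mult:
  assumes "open S" "Ck_on k S f" "Ck_on k S g"
  shows "Ck_on k S (\<lambda>x. f x * g x)"
  using assms(2,3)
proof (induction k arbitrary: f g)
  case 0
  then show ?case by (auto intro: continuous_intros)
next
  case (Suc k)
  have "Ck_on k S (\<lambda>x. partial_deriv j f x * g x + f x * partial_deriv j g x)" for j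
  proof (rule Ck_on_add[OF assms(1)])
    show "Ck_on k S (\<lambda>x. partial_deriv j f x * g x)"
      by (rule Suc.IH[OF _ Ck_on_mono[OF Suc.prems(2)]]) (use Suc.prems in simp)
    show "Ck_on k S (\<lambda>x. f x * partial_deriv j g x)"
      by (rule Suc.IH[OF Ck_on_mono[OF Suc.prems(1)]]) (use Suc.prems in simp)
  qed
  then have "Ck_on k S (partial_deriv j (\<lambda>x. f x * g x))" for j
  proof (rule Ck_on_cong[OF assms(1), rotated])
    fix y assume "y \<in> S"
    then show "partial_deriv j f y * g y + f y * partial_deriv j g y = partial_deriv j (\<lambda>x. f x * g x) y" for j
      using Suc.prems partial_deriv_mult[of f y g] by simp
  qed
  moreover have "(\<lambda>x. f x * g x) differentiable (at x)" if "x \<in> S" for x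
    using Suc.prems that by (intro differentiable_mult) simp_all
  ultimately show ?case by simp
qed

section \<open>Smooth functions as an algebra closed under partial derivatives\<close>

lemma smooth_cong:
  "open S \<Longrightarrow> (\<And>y. y \<in> S \<Longrightarrow> f y = g y) \<Longrightarrow> f \<in> smooth_functions S \<Longrightarrow> g \<in> smooth_functions S"
  by (auto simp: smooth_functions_def intro: Ck_on_cong)

lemma smooth_subset: "T \<subseteq> S \<Longrightarrow> f \<in> smooth_functions S \<Longrightarrow> f \<in> smooth_functions T"
  by (auto simp: smooth_functions_def intro: Ck_on_subset)

lemma smooth_const: "(\<lambda>x. c) \<in> smooth_functions S"
  by (simp add: smooth_functions_def Ck_on_const)

lemma smooth_add:
  "open S \<Longrightarrow> f \<in> smooth_functions S \<Longrightarrow> g \<in> smooth_functions S \<Longrightarrow> (\<lambda>x. f x + g x) \<in> smooth_functions S"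
  by (simp add: smooth_functions_def Ck_on_add)

lemma smooth_mult:
  "open S \<Longrightarrow> f \<in> smooth_functions S \<Longrightarrow> g \<in> smooth_functions S \<Longrightarrow> (\<lambda>x. f x * g x) \<in> smooth_functions S"
  by (simp add: smooth_functions_def Ck_on_mult)

lemma smooth_cmult:
  "open S \<Longrightarrow> f \<in> smooth_functions S \<Longrightarrow> (\<lambda>x. c * f x) \<in> smooth_functions S"
  by (rule smooth_mult[OF _ smooth_const])

lemma smooth_diff:
  "open S \<Longrightarrow> f \<in> smooth_functions S \<Longrightarrow> g \<in> smooth_functions S \<Longrightarrow> (\<lambda>x. f x - g x) \<in> smooth_functions S"
  using smooth_add[of S f "\<lambda>x. (-1) * g x"] smooth_cmult[of S g "-1"] by simp

lemma smooth_sum: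
  assumes "open S" "\<And>i. i \<in> I \<Longrightarrow> f i \<in> smooth_functions S"
  shows "(\<lambda>x. \<Sum>i\<in>I. f i x) \<in> smooth_functions S"
  using assms(2)
  by (induction I rule: infinite_finite_induct) (auto intro: smooth_const smooth_add[OF assms(1)])

lemma smooth_local:
  assumes "open S" "\<And>x. x \<in> S \<Longrightarrow> \<exists>T. open T \<and> x \<in> T \<and> f \<in> smooth_functions T"
  shows "f \<in> smooth_functions S"
  using assms(2) unfolding smooth_functions_def
  by (auto intro!: Ck_on_local[OF assms(1)])

lemma smooth_differentiable:
  assumes "f \<in> smooth_functions S" "x \<in> S"
  shows "f differentiable (at x)"
proof -
  have "Ck_on (Suc 0) S f" using assms unfolding smooth_functions_def by blast
  then show ?thesis using assms(2) by simp
qed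

lemma smooth_isCont: "f \<in> smooth_functions S \<Longrightarrow> x \<in> S \<Longrightarrow> isCont f x"
  using smooth_differentiable differentiable_imp_continuous_within by blast

lemma smooth_continuous_on: "f \<in> smooth_functions S \<Longrightarrow> continuous_on S f"
  using smooth_isCont continuous_at_imp_continuous_on by blast

lemma smooth_partial:
  assumes "f \<in> smooth_functions S"
  shows "partial_deriv j f \<in> smooth_functions S"
proof -
  have "Ck_on (Suc k) S f" for k using assms unfolding smooth_functions_def by blast
  then show ?thesis by (simp add: smooth_functions_def)
qed

text \<open>The order of differentiability is raised for all members of the family at once, since a
  partial derivative of a member agrees on \<open>S\<close> with another member. This suits
  functions whose derivatives have an explicit shape, such as trigonometric series or limits of
  solutions.\<close>

lemma smooth_coinduct:
  assumes "open S" "f \<in> F"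
    and "\<And>g x. g \<in> F \<Longrightarrow> x \<in> S \<Longrightarrow> g differentiable (at x)"
    and "\<And>g j. g \<in> F \<Longrightarrow> \<exists>g'\<in>F. \<forall>x\<in>S. partial_deriv j g x = g' x"
  shows "f \<in> smooth_functions S"
proof -
  have "\<forall>g\<in>F. Ck_on k S g" for k
  proof (induction k)
    case 0
    have "isCont g x" if "g \<in> F" "x \<in> S" for g x
      using differentiable_imp_continuous_within[OF assms(3)[OF that]] by simp
    then show ?case by (simp add: continuous_at_imp_continuous_on)
  next
    case (Suc k)
    have "Ck_on k S (partial_deriv j g)" if gF: "g \<in> F" for g j
    proof -
      obtain g' where "g' \<in> F" "\<forall>x\<in>S. partial_deriv j g x = g' x" using assms(4)[OF gF, of j] by blast
      then show ?thesis using Suc Ck_on_cong[OF assms(1), of g' "partial_deriv j g" k] by auto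
    qed
    then show ?case using assms(3) by auto
  qed
  then show ?thesis using assms(2) by (auto simp: smooth_functions_def)
qed

section \<open>The operators \<open>D_op j\<close> and their iterates\<close>

lemma D_op_cong:
  "open S \<Longrightarrow> x \<in> S \<Longrightarrow> (\<And>y. y \<in> S \<Longrightarrow> f y = g y) \<Longrightarrow> D_op j f x = D_op j g x"
  unfolding D_op_def using partial_deriv_cong by metis

lemma smooth_D_op: "open S \<Longrightarrow> f \<in> smooth_functions S \<Longrightarrow> D_op j f \<in> smooth_functions S"
  using smooth_cmult[OF _ smooth_partial, of S f "-\<i>" j] by (simp add: D_op_def[abs_def])

lemma D_op_eq:
  assumes "(f has_derivative f') (at x)"
  shows "D_op j f x = - \<i> * f' (axis j 1)"
  by (simp add: D_op_def partial_deriv_eq[OF assms])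

lemma has_derivative_D_op:
  assumes "f differentiable (at x)"
  shows "(f has_derivative (\<lambda>h. \<Sum>j\<in>UNIV. \<i> * of_real (h $ j) * D_op j f x)) (at x)"
  using has_derivative_partial[OF assms] by (simp add: D_op_def algebra_simps)

lemma D_op_const [simp]: "D_op j (\<lambda>x. c) = (\<lambda>x. 0)"
  by (simp add: D_op_def[abs_def] partial_deriv_const)

lemma D_op_add:
  "f differentiable (at x) \<Longrightarrow> g differentiable (at x) \<Longrightarrow>
    D_op j (\<lambda>x. f x + g x) x = D_op j f x + D_op j g x"
  by (simp add: D_op_def partial_deriv_add algebra_simps)

lemma D_op_mult:
  "f differentiable (at x) \<Longrightarrow> g differentiable (at x) \<Longrightarrow>
    D_op j (\<lambda>x. f x * g x) x = D_op j f x * g x + f x * D_op j g x"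
  by (simp add: D_op_def partial_deriv_mult algebra_simps)

lemma D_op_cmult:
  "f differentiable (at x) \<Longrightarrow> D_op j (\<lambda>x. c * f x) x = c * D_op j f x"
  using D_op_mult[of "\<lambda>x. c" x f j] by simp

lemma D_op_diff:
  "f differentiable (at x) \<Longrightarrow> g differentiable (at x) \<Longrightarrow>
    D_op j (\<lambda>x. f x - g x) x = D_op j f x - D_op j g x"
  using D_op_add[of f x "\<lambda>x. (-1) * g x" j] D_op_cmult[of g x j "-1"] by simp

text \<open>Words instead of multi-indices make induction on the order a list induction, and the
  rules below can be proved without knowing that derivatives commute. Commutation is obtained only
  later, from Fourier inversion.\<close>

abbreviation Dw :: "'n list \<Rightarrow> (real ^ 'n::finite \<Rightarrow> complex) \<Rightarrow> real ^ 'n \<Rightarrow> complex" where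
  "Dw w f \<equiv> foldr D_op w f"

lemma smooth_Dw: "open S \<Longrightarrow> f \<in> smooth_functions S \<Longrightarrow> Dw w f \<in> smooth_functions S"
  by (induction w) (simp_all add: smooth_D_op)

lemma Dw_Cons: "Dw (j # w) f = D_op j (Dw w f)"
  by simp

lemma Dw_cong:
  assumes "open S" "\<And>y. y \<in> S \<Longrightarrow> f y = g y" "x \<in> S"
  shows "Dw w f x = Dw w g x"
  using assms(3)
proof (induction w arbitrary: x)
  case (Cons j w)
  show ?case unfolding Dw_Cons
    by (rule D_op_cong[OF assms(1) Cons.prems Cons.IH])
qed (simp add: assms(2))

lemma Dw_add:
  assumes "open S" "f \<in> smooth_functions S" "g \<in> smooth_functions S" "x \<in> S"
  shows "Dw w (\<lambda>x. f x + g x) x = Dw w f x + Dw w g x"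
  using assms(4)
proof (induction w arbitrary: x)
  case (Cons j w)
  have "D_op j (Dw w (\<lambda>x. f x + g x)) x = D_op j (\<lambda>x. Dw w f x + Dw w g x) x"
    by (rule D_op_cong[OF assms(1)]) (use Cons in auto)
  also have "\<dots> = D_op j (Dw w f) x + D_op j (Dw w g) x"
    using assms Cons by (intro D_op_add smooth_differentiable[OF smooth_Dw]) auto
  finally show ?case by simp
qed simp

lemma Dw_cmult:
  assumes "open S" "f \<in> smooth_functions S" "x \<in> S"
  shows "Dw w (\<lambda>x. c * f x) x = c * Dw w f x"
  using assms(3)
proof (induction w arbitrary: x)
  case (Cons j w)
  have "D_op j (Dw w (\<lambda>x. c * f x)) x = D_op j (\<lambda>x. c * Dw w f x) x"
    by (rule D_op_cong[OF assms(1)]) (use Cons in auto)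
  also have "\<dots> = c * D_op j (Dw w f) x"
    using assms Cons by (intro D_op_cmult smooth_differentiable[OF smooth_Dw]) auto
  finally show ?case by simp
qed simp

lemma Dw_zero [simp]: "Dw w (\<lambda>x. 0) = (\<lambda>x. 0)"
  by (induction w) auto

lemma Dw_diff:
  assumes "open S" "f \<in> smooth_functions S" "g \<in> smooth_functions S" "x \<in> S"
  shows "Dw w (\<lambda>x. f x - g x) x = Dw w f x - Dw w g x"
  using Dw_add[OF assms(1,2) smooth_cmult[OF assms(1,3), of "-1"] assms(4)] Dw_cmult[OF assms(1,3,4), of w "-1"] by simp

section \<open>Affine substitutions and composition with functions of one variable\<close>

lemma has_derivative_affine:
  assumes "f differentiable (at (a + t *\<^sub>R x))"
  shows "((\<lambda>x. f (a + t *\<^sub>R x)) has_derivative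
    (\<lambda>h. \<Sum>j\<in>UNIV. \<i> * of_real (t * h $ j) * D_op j f (a + t *\<^sub>R x))) (at x)"
proof -
  have "((\<lambda>x. a + t *\<^sub>R x) has_derivative (\<lambda>h. t *\<^sub>R h)) (at x)"
    by (auto intro!: derivative_eq_intros)
  from diff_chain_at[OF this has_derivative_D_op[OF assms]]
  show ?thesis by (simp add: o_def)
qed

lemma D_op_affine:
  assumes "f differentiable (at (a + t *\<^sub>R x))"
  shows "D_op j (\<lambda>x. f (a + t *\<^sub>R x)) x = of_real t * D_op j f (a + t *\<^sub>R x)"
proof -
  have "(\<Sum>ja\<in>UNIV. \<i> * (complex_of_real (t * axis j 1 $ ja) * D_op ja f (a + t *\<^sub>R x)))
     = \<i> * (of_real t * D_op j f (a + t *\<^sub>R x))"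
    by (subst sum.remove[of _ j]) (auto simp: axis_def intro!: sum.neutral)
  then show ?thesis by (subst D_op_eq[OF has_derivative_affine[OF assms]]) (simp add: mult.assoc)
qed

lemma open_affine_preimage:
  fixes S :: "(real ^ 'n::finite) set"
  assumes "open S"
  shows "open {x. a + t *\<^sub>R x \<in> S}"
proof -
  have "continuous_on UNIV (\<lambda>x. a + t *\<^sub>R x)" by (intro continuous_intros)
  from continuous_open_preimage[OF this open_UNIV assms] show ?thesis by (simp add: vimage_def)
qed

lemma smooth_affine:
  assumes "open S" "f \<in> smooth_functions S"
  shows "(\<lambda>x. f (a + t *\<^sub>R x)) \<in> smooth_functions {x. a + t *\<^sub>R x \<in> S}"
proof (rule smooth_coinduct[where F = "{\<lambda>x. g (a + t *\<^sub>R x) |g. g \<in> smooth_functions S}"])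
  show "open {x. a + t *\<^sub>R x \<in> S}" by (rule open_affine_preimage[OF assms(1)])
  show "(\<lambda>x. f (a + t *\<^sub>R x)) \<in> {\<lambda>x. g (a + t *\<^sub>R x) |g. g \<in> smooth_functions S}"
    using assms by auto
  show "g differentiable at x" if gF: "g \<in> {\<lambda>x. g (a + t *\<^sub>R x) |g. g \<in> smooth_functions S}"
    and gx: "x \<in> {x. a + t *\<^sub>R x \<in> S}" for g x
  proof -
    obtain g0 where "g = (\<lambda>x. g0 (a + t *\<^sub>R x))" "g0 \<in> smooth_functions S" using gF by auto
    then show ?thesis
      using has_derivative_affine[OF smooth_differentiable, of g0 S a t x] gx by (auto intro: differentiableI)
  qed
  show "\<exists>g'\<in>{\<lambda>x. g (a + t *\<^sub>R x) |g. g \<in> smooth_functions S}.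
              \<forall>x\<in>{x. a + t *\<^sub>R x \<in> S}. partial_deriv j g x = g' x"
    if gF: "g \<in> {\<lambda>x. g (a + t *\<^sub>R x) |g. g \<in> smooth_functions S}" for g j
  proof -
    obtain g0 where g: "g = (\<lambda>x. g0 (a + t *\<^sub>R x))" and g0: "g0 \<in> smooth_functions S" using gF by auto
    have "partial_deriv j g x = \<i> * of_real t * D_op j g0 (a + t *\<^sub>R x)" if "a + t *\<^sub>R x \<in> S" for x
      using D_op_affine[OF smooth_differentiable[OF g0 that], of j] unfolding g
      by (simp add: D_op_def algebra_simps)
    moreover have "(\<lambda>y. \<i> * of_real t * D_op j g0 y) \<in> smooth_functions S"
      using assms(1) g0 by (intro smooth_cmult smooth_D_op)
    ultimately show ?thesis by (intro bexI[of _ "\<lambda>x. \<i> * of_real t * D_op j g0 (a + t *\<^sub>R x)"])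
        (auto intro!: exI[of _ "\<lambda>y. \<i> * of_real t * D_op j g0 y"])
  qed
qed

lemma Dw_affine:
  assumes "open S" "f \<in> smooth_functions S" "a + t *\<^sub>R x \<in> S"
  shows "Dw w (\<lambda>x. f (a + t *\<^sub>R x)) x = of_real t ^ length w * Dw w f (a + t *\<^sub>R x)"
  using assms(3)
proof (induction w arbitrary: x)
  case (Cons j w)
  let ?S = "{x. a + t *\<^sub>R x \<in> S}"
  have d: "Dw w f differentiable (at (a + t *\<^sub>R x))"
    using assms Cons.prems by (intro smooth_differentiable[OF smooth_Dw]) auto
  have d': "(\<lambda>x. Dw w f (a + t *\<^sub>R x)) differentiable (at x)"
    using has_derivative_affine[OF d] unfolding differentiable_def by blast
  have "D_op j (Dw w (\<lambda>x. f (a + t *\<^sub>R x))) x = D_op j (\<lambda>x. of_real t ^ length w * Dw w f (a + t *\<^sub>R x)) x"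
    by (rule D_op_cong[OF open_affine_preimage[OF assms(1), of a t]]) (use Cons in auto)
  also have "\<dots> = of_real t ^ length w * D_op j (\<lambda>x. Dw w f (a + t *\<^sub>R x)) x"
    by (rule D_op_cmult[OF d'])
  also have "\<dots> = of_real t ^ length w * (of_real t * D_op j (Dw w f) (a + t *\<^sub>R x))"
    by (simp add: D_op_affine[OF d])
  finally show ?case by simp
qed simp

lemma smooth_linear_form: "(\<lambda>x. complex_of_real (\<xi> \<bullet> x)) \<in> smooth_functions UNIV"
proof (rule smooth_coinduct[where F = "{\<lambda>x. complex_of_real (\<xi> \<bullet> x) |\<xi>. True} \<union> {\<lambda>x. c |c. True}"])
  have *: "((\<lambda>x. complex_of_real (\<xi> \<bullet> x)) has_derivative (\<lambda>h. complex_of_real (\<xi> \<bullet> h))) (at x)"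
    for \<xi> x :: "real ^ 'n"
    by (auto intro!: derivative_eq_intros)
  have **: "partial_deriv j (\<lambda>x. complex_of_real (\<xi> \<bullet> x)) x = \<xi> $ j" for \<xi> x :: "real ^ 'n" and j
    by (rule trans[OF partial_deriv_eq[OF *]]) (simp add: inner_axis)
  show "g differentiable at x" if "g \<in> {\<lambda>x. complex_of_real (\<xi> \<bullet> x) |\<xi>. True} \<union> {\<lambda>x. c |c. True}"
    for g :: "real ^ 'n \<Rightarrow> complex" and x
  proof -
    from that consider \<xi> where "g = (\<lambda>x. complex_of_real (\<xi> \<bullet> x))" | c where "g = (\<lambda>x. c)" by blast
    then show ?thesis using *[THEN differentiableI] by cases auto
  qed
  show "\<exists>g'\<in>{\<lambda>x. complex_of_real (\<xi> \<bullet> x) |\<xi>. True} \<union> {\<lambda>x. c |c. True}. \<forall>x\<in>UNIV. partial_deriv j g x = g' x"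
    if "g \<in> {\<lambda>x. complex_of_real (\<xi> \<bullet> x) |\<xi>. True} \<union> {\<lambda>x. c |c. True}" for g :: "real ^ 'n \<Rightarrow> complex" and j
  proof -
    have "\<exists>c. \<forall>x. partial_deriv j g x = c" using that ** partial_deriv_const by blast
    then obtain c where "\<forall>x. partial_deriv j g x = c" ..
    then show ?thesis by (intro bexI[of _ "\<lambda>x. c"]) auto
  qed
qed auto

text \<open>All \<open>F n\<close> are treated together because the derivative of
  \<open>F n (g x)\<close> is \<open>F (Suc n) (g x)\<close> times a derivative of \<open>g\<close>;
  the induction on the order then closes by the product rule. The case \<open>n = 0\<close> serves
  cutoffs and waves.\<close>

lemma smooth_compose:
  fixes F :: "nat \<Rightarrow> real \<Rightarrow> complex"
  assumes "open S" "(\<lambda>x. complex_of_real (g x)) \<in> smooth_functions S"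
    and F: "\<And>n t. (F n has_vector_derivative F (Suc n) t) (at t)"
  shows "(\<lambda>x. F n (g x)) \<in> smooth_functions S"
proof -
  have gd: "g differentiable (at x)" if "x \<in> S" for x
    using smooth_differentiable[OF assms(2) that]
      differentiable_compose[of Re "\<lambda>x. complex_of_real (g x)" x UNIV]
    by (auto simp: bounded_linear_Re bounded_linear_imp_differentiable)
  have D: "((\<lambda>x. F n (g x)) has_derivative (\<lambda>h. frechet_derivative g (at x) h *\<^sub>R F (Suc n) (g x))) (at x)"
    if "x \<in> S" for n x
    using diff_chain_at[of g "frechet_derivative g (at x)" x "F n" "\<lambda>h. h *\<^sub>R F (Suc n) (g x)"]
      F[of n "g x"] gd[OF that] frechet_derivative_works by (auto simp: o_def has_vector_derivative_def)
  have pd: "partial_deriv j (\<lambda>x. F n (g x)) x = F (Suc n) (g x) * partial_deriv j (\<lambda>x. complex_of_real (g x)) x"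
    if "x \<in> S" for n x j
  proof -
    have "((\<lambda>x. complex_of_real (g x)) has_derivative (\<lambda>h. complex_of_real (frechet_derivative g (at x) h))) (at x)"
      using gd[OF that] frechet_derivative_works by (auto intro!: has_derivative_of_real)
    then show ?thesis using partial_deriv_eq[OF D[OF that]]
      by (simp add: partial_deriv_eq scaleR_conv_of_real mult.commute)
  qed
  have "Ck_on k S (\<lambda>x. F n (g x))" for k n
  proof (induction k arbitrary: n)
    case 0
    then show ?case using D
      by (auto intro!: continuous_at_imp_continuous_on has_derivative_continuous)
  next
    case (Suc k)
    have "Ck_on k S (partial_deriv j (\<lambda>x. complex_of_real (g x)))" for j
      using smooth_partial[OF assms(2)] by (auto simp: smooth_functions_def)
    then have *: "Ck_on k S (\<lambda>x. F (Suc n) (g x) * partial_deriv j (\<lambda>x. complex_of_real (g x)) x)" for j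
      using Suc by (intro Ck_on_mult[OF assms(1)])
    have "Ck_on k S (partial_deriv j (\<lambda>x. F n (g x)))" for j
      by (rule Ck_on_cong[OF assms(1) _ *[of j]]) (simp add: pd)
    moreover have "(\<lambda>x. F n (g x)) differentiable (at x)" if "x \<in> S" for x
      using differentiableI[OF D[OF that]] .
    ultimately show ?case by simp
  qed
  then show ?thesis by (simp add: smooth_functions_def)
qed

section \<open>Cutoff functions\<close>

text \<open>The functions \<open>p(1/t) exp(-1/t)\<close> for \<open>t > 0\<close>, extended by \<open>0\<close>, are closed under differentiation.\<close>

definition flat_poly :: "real poly \<Rightarrow> real \<Rightarrow> real" where
  "flat_poly p t = (if t > 0 then poly p (1 / t) * exp (- (1 / t)) else 0)"

lemma poly_times_exp_tendsto_0: "((\<lambda>s. poly p s * exp (- s)) \<longlongrightarrow> 0) at_top" for p :: "real poly"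
proof (induction p)
  case (pCons a p)
  have "((\<lambda>s::real. s ^ 1 / exp s) \<longlongrightarrow> 0) at_top" by (rule tendsto_power_div_exp_0)
  have e: "((\<lambda>s::real. s ^ k * exp (- s)) \<longlongrightarrow> 0) at_top" for k
    using tendsto_power_div_exp_0[of k] by (simp add: exp_minus field_simps)
  have "((\<lambda>s. \<Sum>i\<le>degree (pCons a p). coeff (pCons a p) i * (s ^ i * exp (- s))) \<longlongrightarrow> (\<Sum>i\<le>degree (pCons a p). coeff (pCons a p) i * 0)) at_top"
    by (intro tendsto_sum tendsto_mult tendsto_const e)
  then show ?case by (simp add: poly_altdef sum_distrib_right mult.assoc)
qed simp

lemma flat_poly_tendsto_0: "((\<lambda>t. poly p (1 / t) * exp (- (1 / t))) \<longlongrightarrow> 0) (at_right 0)" for p :: "real poly"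
  using filterlim_compose[OF poly_times_exp_tendsto_0 filterlim_inverse_at_top_right, of p]
  by (simp add: inverse_eq_divide)

text \<open>With \<open>s = 1 / t\<close> the derivative of \<open>p(s) exp(-s)\<close> with respect
  to \<open>t\<close> is \<open>s^2 (p(s) - p'(s)) exp(-s)\<close>.\<close>

definition flat_deriv :: "real poly \<Rightarrow> real poly" where
  "flat_deriv p = [:0, 0, 1:] * (p - pderiv p)"

lemma flat_poly_DERIV: "(flat_poly p has_real_derivative flat_poly (flat_deriv p) t) (at t)"
proof -
  consider "t > 0" | "t < 0" | "t = 0" by linarith
  then show ?thesis
  proof cases
    case 1
    have "((\<lambda>t. poly p (1 / t) * exp (- (1 / t))) has_real_derivative
        poly (pderiv p) (1 / t) * (- 1 / t\<^sup>2) * exp (- (1 / t)) + poly p (1 / t) * (exp (- (1 / t)) * (1 / t\<^sup>2))) (at t)"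
      using 1 by (auto intro!: derivative_eq_intros poly_DERIV[THEN DERIV_chain2] simp: power2_eq_square)
    also have "poly (pderiv p) (1 / t) * (- 1 / t\<^sup>2) * exp (- (1 / t)) + poly p (1 / t) * (exp (- (1 / t)) * (1 / t\<^sup>2))
       = flat_poly (flat_deriv p) t"
      using 1 by (simp add: flat_poly_def flat_deriv_def power2_eq_square field_simps)
    finally show ?thesis
      by (rule has_field_derivative_transform_within_open[of _ _ _ "{0<..}"]) (use 1 in \<open>auto simp: flat_poly_def\<close>)
  next
    case 2
    have "((\<lambda>t. 0) has_real_derivative flat_poly (flat_deriv p) t) (at t)"
      using 2 by (simp add: flat_poly_def)
    then show ?thesis
      by (rule has_field_derivative_transform_within_open[of _ _ _ "{..<0}"]) (use 2 in \<open>auto simp: flat_poly_def\<close>)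
  next
    case 3
    \<comment> \<open>From the right the difference quotient at 0 is again of the flat form, for the
      polynomial \<open>[:0, 1:] * p\<close>, and hence tends to 0.\<close>
    have r: "((\<lambda>y. (flat_poly p y - flat_poly p 0) / (y - 0)) \<longlongrightarrow> 0) (at_right 0)"
      using flat_poly_tendsto_0[of "[:0, 1:] * p"]
    proof (rule Lim_transform_eventually)
      show "\<forall>\<^sub>F t in at_right 0. poly ([:0, 1:] * p) (1 / t) * exp (- (1 / t)) = (flat_poly p t - flat_poly p 0) / (t - 0)"
        by (simp add: eventually_at_filter flat_poly_def)
    qed
    have l: "((\<lambda>y. (flat_poly p y - flat_poly p 0) / (y - 0)) \<longlongrightarrow> 0) (at_left 0)"
      by (rule Lim_transform_eventually[OF tendsto_const]) (simp add: eventually_at_filter flat_poly_def)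
    have "(flat_poly p has_real_derivative 0) (at 0)"
      unfolding has_field_derivative_iff using filterlim_split_at_real[OF l r] by simp
    then show ?thesis using 3 by (simp add: flat_poly_def)
  qed
qed

definition flat :: "real \<Rightarrow> real" where
  "flat = flat_poly 1"

lemma flat_eq: "flat t = (if t > 0 then exp (- (1 / t)) else 0)"
  by (simp add: flat_def flat_poly_def)

lemma flat_simps: "t \<le> 0 \<Longrightarrow> flat t = 0" "0 \<le> flat t" "flat t > 0 \<longleftrightarrow> t > 0"
  by (auto simp: flat_eq)

lemma flat_mono: "s \<le> t \<Longrightarrow> flat s \<le> flat t"
  by (auto simp: flat_eq frac_le)

lemma smooth_flat:
  assumes "open S" "(\<lambda>x. complex_of_real (g x)) \<in> smooth_functions S"
  shows "(\<lambda>x. complex_of_real (flat (g x))) \<in> smooth_functions S"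
proof -
  have "((\<lambda>t. complex_of_real (flat_poly ((flat_deriv ^^ n) 1) t)) has_vector_derivative
      complex_of_real (flat_poly ((flat_deriv ^^ Suc n) 1) t)) (at t)" for n t
    using flat_poly_DERIV by (auto intro!: has_vector_derivative_of_real)
  from smooth_compose[OF assms, of "\<lambda>n t. complex_of_real (flat_poly ((flat_deriv ^^ n) 1) t)" 0, OF this]
  show ?thesis by (simp add: flat_def)
qed

section \<open>Test functions and smooth cutoffs\<close>

definition test_functions :: "(real ^ 'n::finite) set \<Rightarrow> (real ^ 'n \<Rightarrow> complex) set" where
  "test_functions V = {\<phi> \<in> smooth_functions UNIV. \<exists>C. compact C \<and> C \<subseteq> V \<and> (\<forall>x. x \<notin> C \<longrightarrow> \<phi> x = 0)}"

lemma test_smooth: "\<phi> \<in> test_functions V \<Longrightarrow> \<phi> \<in> smooth_functions S"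
  using smooth_subset[of S UNIV] by (auto simp: test_functions_def)

lemma test_mono: "\<phi> \<in> test_functions V \<Longrightarrow> V \<subseteq> W \<Longrightarrow> \<phi> \<in> test_functions W"
  by (auto simp: test_functions_def)

lemma test_zero: "\<phi> \<in> test_functions V \<Longrightarrow> x \<notin> V \<Longrightarrow> \<phi> x = 0"
  by (auto simp: test_functions_def)

lemma test_supportE:
  assumes "\<phi> \<in> test_functions V"
  obtains C where "compact C" "C \<subseteq> V" "\<And>x. x \<notin> C \<Longrightarrow> \<phi> x = 0"
  using assms by (auto simp: test_functions_def)

lemma D_op_zero_outside:
  assumes "closed C" "\<And>x. x \<notin> C \<Longrightarrow> \<phi> x = 0" "x \<notin> C"
  shows "D_op j \<phi> x = 0"
  using D_op_cong[of "- C" x \<phi> "\<lambda>x. 0" j] assms by auto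

lemma test_D_op:
  assumes "\<phi> \<in> test_functions V"
  shows "D_op j \<phi> \<in> test_functions V"
proof -
  obtain C where C: "compact C" "C \<subseteq> V" "\<And>x. x \<notin> C \<Longrightarrow> \<phi> x = 0" using test_supportE[OF assms] by blast
  have "D_op j \<phi> \<in> smooth_functions UNIV"
    by (rule smooth_D_op) (use test_smooth[OF assms] in auto)
  moreover have "D_op j \<phi> x = 0" if "x \<notin> C" for x
    using D_op_zero_outside[OF compact_imp_closed[OF C(1)] C(3) that] .
  ultimately show ?thesis using C by (auto simp: test_functions_def)
qed

lemma test_Dw: "\<phi> \<in> test_functions V \<Longrightarrow> Dw w \<phi> \<in> test_functions V"
  by (induction w) (simp_all add: test_D_op)

text \<open>\<open>u\<close> is smooth only on \<open>V\<close> and arbitrary elsewhere. The open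
  sets \<open>V\<close> and the complement of the compact set carrying \<phi> cover the space, and
  on the second one the product vanishes. This is why test functions are smooth everywhere and
  vanish off a compact subset of \<open>V\<close>.\<close>

lemma test_mult:
  assumes "\<phi> \<in> test_functions V" "open V" "u \<in> smooth_functions V"
  shows "(\<lambda>x. \<phi> x * u x) \<in> test_functions V"
proof -
  obtain C where C: "compact C" "C \<subseteq> V" "\<And>x. x \<notin> C \<Longrightarrow> \<phi> x = 0" using test_supportE[OF assms(1)] by blast
  have "(\<lambda>x. \<phi> x * u x) \<in> smooth_functions UNIV"
  proof (rule smooth_local)
    fix x :: "real ^ 'a"
    show "\<exists>T. open T \<and> x \<in> T \<and> (\<lambda>x. \<phi> x * u x) \<in> smooth_functions T"
    proof (cases "x \<in> C")
      case True
      have "(\<lambda>x. \<phi> x * u x) \<in> smooth_functions V"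
        by (rule smooth_mult[OF assms(2) test_smooth[OF assms(1)] assms(3)])
      then show ?thesis using True C assms by blast
    next
      case False
      have "(\<lambda>x. \<phi> x * u x) \<in> smooth_functions (- C)"
        by (rule smooth_cong[OF _ _ smooth_const[of 0]]) (use C in \<open>auto simp: compact_imp_closed\<close>)
      then show ?thesis using False C(1) by (intro exI[of _ "-C"]) (auto simp: compact_imp_closed)
    qed
  qed simp
  then show ?thesis using C by (auto simp: test_functions_def)
qed

lemma test_add:
  assumes "\<phi> \<in> test_functions V" "\<psi> \<in> test_functions V"
  shows "(\<lambda>x. \<phi> x + \<psi> x) \<in> test_functions V"
proof -
  obtain C where C: "compact C" "C \<subseteq> V" "\<And>x. x \<notin> C \<Longrightarrow> \<phi> x = 0" using test_supportE[OF assms(1)] by blast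
  obtain D where D: "compact D" "D \<subseteq> V" "\<And>x. x \<notin> D \<Longrightarrow> \<psi> x = 0" using test_supportE[OF assms(2)] by blast
  have "(\<lambda>x. \<phi> x + \<psi> x) \<in> smooth_functions UNIV"
    using assms by (intro smooth_add test_smooth) auto
  moreover have "\<phi> x + \<psi> x = 0" if "x \<notin> C \<union> D" for x using that C(3)[of x] D(3)[of x] by simp
  moreover have "compact (C \<union> D)" "C \<union> D \<subseteq> V" using C D by auto
  ultimately show ?thesis unfolding test_functions_def by blast
qed

lemma test_cmult:
  assumes "\<phi> \<in> test_functions V"
  shows "(\<lambda>x. c * \<phi> x) \<in> test_functions V"
  using assms smooth_cmult[OF open_UNIV, of \<phi> c] by (auto simp: test_functions_def)

lemma test_diff: "\<phi> \<in> test_functions V \<Longrightarrow> \<psi> \<in> test_functions V \<Longrightarrow> (\<lambda>x. \<phi> x - \<psi> x) \<in> test_functions V"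
  using test_add[of \<phi> V "\<lambda>x. (-1) * \<psi> x"] test_cmult[of \<psi> V "-1"] by simp

lemma test_const0: "(\<lambda>x. 0) \<in> test_functions V"
  using smooth_const by (auto simp: test_functions_def)

lemma test_sum: "(\<And>i. i \<in> I \<Longrightarrow> f i \<in> test_functions V) \<Longrightarrow> (\<lambda>x. \<Sum>i\<in>I. f i x) \<in> test_functions V"
  by (induction I rule: infinite_finite_induct) (auto intro: test_add test_const0)

lemma test_affine:
  assumes "\<phi> \<in> test_functions V" "t \<noteq> 0"
  shows "(\<lambda>x. \<phi> (a + t *\<^sub>R x)) \<in> test_functions {x. a + t *\<^sub>R x \<in> V}"
proof -
  obtain C where C: "compact C" "C \<subseteq> V" "\<And>x. x \<notin> C \<Longrightarrow> \<phi> x = 0" using test_supportE[OF assms(1)] by blast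
  have eq: "{x. a + t *\<^sub>R x \<in> C} = (\<lambda>y. (1/t) *\<^sub>R (y - a)) ` C"
    using assms(2) by (auto simp: image_iff intro!: bexI[of _ "a + t *\<^sub>R x" for x])
  have "compact {x. a + t *\<^sub>R x \<in> C}"
    unfolding eq by (intro compact_continuous_image C(1) continuous_intros)
  moreover have "(\<lambda>x. \<phi> (a + t *\<^sub>R x)) \<in> smooth_functions UNIV"
    using smooth_affine[of UNIV \<phi> a t] test_smooth[OF assms(1)] by simp
  ultimately show ?thesis using C
    by (auto simp: test_functions_def intro!: exI[of _ "{x. a + t *\<^sub>R x \<in> C}"])
qed

lemma smooth_norm_sq: "(\<lambda>x. complex_of_real ((norm (x - a))\<^sup>2)) \<in> smooth_functions S"
  for a :: "real ^ 'n::finite"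
proof -
  have "(\<lambda>x. complex_of_real (axis j 1 \<bullet> x) + (- of_real (a $ j))) \<in> smooth_functions UNIV" for j
    by (intro smooth_add smooth_linear_form smooth_const) auto
  then have "(\<lambda>x. complex_of_real (x $ j - a $ j)) \<in> smooth_functions UNIV" for j
    by (simp add: inner_axis' inner_axis)
  then have "(\<lambda>x. \<Sum>j\<in>UNIV. complex_of_real (x $ j - a $ j) * complex_of_real (x $ j - a $ j)) \<in> smooth_functions UNIV"
    by (intro smooth_sum smooth_mult) auto
  moreover have "(norm (x - a))\<^sup>2 = (\<Sum>j\<in>UNIV. (x $ j - a $ j) * (x $ j - a $ j))" for x
    by (simp only: power2_norm_eq_inner inner_vec_def) simp
  ultimately show ?thesis using smooth_subset[of S UNIV] by simp
qed

lemma smooth_bump: "(\<lambda>x. complex_of_real (flat (r\<^sup>2 - (norm (x - a))\<^sup>2))) \<in> smooth_functions UNIV"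
  for a :: "real ^ 'n::finite"
proof (rule smooth_flat[OF open_UNIV])
  have "(\<lambda>x. complex_of_real (r\<^sup>2) - complex_of_real ((norm (x - a))\<^sup>2)) \<in> smooth_functions UNIV"
    by (rule smooth_diff[OF open_UNIV smooth_const smooth_norm_sq])
  then show "(\<lambda>x. complex_of_real (r\<^sup>2 - (norm (x - a))\<^sup>2)) \<in> smooth_functions UNIV" by simp
qed

lemma test_bump:
  assumes "cball a r \<subseteq> V" "0 \<le> r"
  shows "(\<lambda>x. complex_of_real (flat (r\<^sup>2 - (norm (x - a))\<^sup>2))) \<in> test_functions V"
proof -
  have "r \<le> norm (x - a)" if "x \<notin> cball a r" for x
    using that by (simp add: dist_norm norm_minus_commute)
  then have "flat (r\<^sup>2 - (norm (x - a))\<^sup>2) = 0" if "x \<notin> cball a r" for x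
    using that assms(2) by (intro flat_simps) (simp add: power_mono)
  then show ?thesis using assms smooth_bump by (auto simp: test_functions_def intro!: exI[of _ "cball a r"])
qed

text \<open>Normalised bumps on finitely many balls sum to \<beta>, which is at least 1 on the balls
  of half radius. Applying \<open>1 - flat (1 - t) / flat 1\<close> to \<beta> sends every value
  from 1 on to exactly 1 and sends 0 to 0, without dividing by a sum of bumps.\<close>

lemma cutoff:
  fixes K V :: "(real ^ 'n::finite) set"
  assumes "compact K" "open V" "K \<subseteq> V"
  obtains \<zeta> U where "\<zeta> \<in> test_functions V" "open U" "K \<subseteq> U" "\<And>x. x \<in> U \<Longrightarrow> \<zeta> x = 1"
proof -
  have "\<exists>r>0. cball x r \<subseteq> V" if "x \<in> K" for x
    using assms that open_contains_cball by blast
  then obtain r where r: "\<And>x. x \<in> K \<Longrightarrow> r x > 0 \<and> cball x (r x) \<subseteq> V" by metis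
  have "K \<subseteq> (\<Union>x\<in>K. ball x (r x / 2))" using r by force
  then obtain A where A: "A \<subseteq> K" "finite A" "K \<subseteq> (\<Union>x\<in>A. ball x (r x / 2))"
    using compactE_image[OF assms(1), of K "\<lambda>x. ball x (r x / 2)"] by auto
  \<comment> \<open>The denominator is a lower bound for the bump on the ball of half radius, where
    the square of \<open>norm (x - a)\<close> is at most \<open>(r a)^2 / 2\<close>.\<close>
  define b where "b a x = flat ((r a)\<^sup>2 - (norm (x - a))\<^sup>2) / flat ((r a)\<^sup>2 / 2)" for a x :: "real ^ 'n"
  define \<beta> where "\<beta> x = (\<Sum>a\<in>A. b a x)" for x
  define \<zeta> where "\<zeta> x = 1 - complex_of_real (flat (1 - \<beta> x) / flat 1)" for x
  have b0: "0 \<le> b a x" for a x unfolding b_def by (intro divide_nonneg_nonneg flat_simps)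
  have sb: "(\<lambda>x. complex_of_real (b a x)) \<in> smooth_functions UNIV" for a
    using smooth_cmult[OF open_UNIV smooth_bump, of "1 / of_real (flat ((r a)\<^sup>2 / 2))" "r a" a]
    by (simp add: b_def)
  have "(\<lambda>x. complex_of_real (1 - \<beta> x)) \<in> smooth_functions UNIV"
    using smooth_diff[OF open_UNIV smooth_const smooth_sum[OF open_UNIV sb], of 1 "\<lambda>a. a" A] by (simp add: \<beta>_def)
  then have "(\<lambda>x. complex_of_real (flat (1 - \<beta> x))) \<in> smooth_functions UNIV" by (rule smooth_flat[OF open_UNIV])
  then have s\<zeta>: "\<zeta> \<in> smooth_functions UNIV"
    using smooth_diff[OF open_UNIV smooth_const smooth_cmult[OF open_UNIV, of "\<lambda>x. complex_of_real (flat (1 - \<beta> x))" "1 / of_real (flat 1)"], of 1]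
    by (simp add: \<zeta>_def[abs_def])
  have \<zeta>0: "\<zeta> x = 0" if "x \<notin> (\<Union>a\<in>A. cball a (r a))" for x
  proof -
    have "b a x = 0" if "a \<in> A" for a
    proof -
      have "r a \<le> norm (x - a)" "0 \<le> r a"
        using \<open>x \<notin> _\<close> that r[of a] A by (auto simp: dist_norm norm_minus_commute intro: less_imp_le)
      then show ?thesis using flat_simps(1)[of "(r a)\<^sup>2 - (norm (x - a))\<^sup>2"] power_mono[of "r a" "norm (x - a)" 2]
        by (simp add: b_def)
    qed
    then have "\<beta> x = 0" by (simp add: \<beta>_def)
    then show ?thesis by (simp add: \<zeta>_def flat_eq)
  qed
  have "compact (\<Union>a\<in>A. cball a (r a))" using A by (intro compact_UN) auto
  moreover have "(\<Union>a\<in>A. cball a (r a)) \<subseteq> V" using r A by blast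
  ultimately have t: "\<zeta> \<in> test_functions V"
    using s\<zeta> \<zeta>0 unfolding test_functions_def by blast
  have "\<zeta> x = 1" if "x \<in> (\<Union>x\<in>A. ball x (r x / 2))" for x
  proof -
    obtain a where a: "a \<in> A" "norm (x - a) < r a / 2"
      using \<open>x \<in> _\<close> by (auto simp: dist_norm norm_minus_commute)
    have ra: "r a > 0" using r a A by blast
    have "(norm (x - a))\<^sup>2 \<le> (r a / 2)\<^sup>2" using a by (intro power_mono) auto
    also have "\<dots> \<le> (r a)\<^sup>2 / 2" by (simp add: power_divide)
    finally have "flat ((r a)\<^sup>2 / 2) \<le> flat ((r a)\<^sup>2 - (norm (x - a))\<^sup>2)" by (intro flat_mono) simp
    moreover have "flat ((r a)\<^sup>2 / 2) > 0" using ra by (simp add: flat_simps(3))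
    ultimately have "1 \<le> b a x" by (simp add: b_def)
    also have "b a x \<le> \<beta> x" unfolding \<beta>_def using a A b0 by (intro member_le_sum) auto
    finally show ?thesis by (simp add: \<zeta>_def flat_simps(1))
  qed
  then show thesis using t A(3) that[of \<zeta> "\<Union>x\<in>A. ball x (r x / 2)"] by auto
qed

section \<open>Fourier coefficients and trigonometric series\<close>

lemma integrable_compact_support:
  fixes f :: "'a::euclidean_space \<Rightarrow> 'b::euclidean_space"
  assumes "compact C" "continuous_on C f" "\<And>x. x \<notin> C \<Longrightarrow> f x = 0"
  shows "integrable lborel f"
proof -
  have "(\<lambda>x. indicator C x *\<^sub>R f x) = f"
    using assms(3) by (auto simp: fun_eq_iff indicator_def)
  then show ?thesis using borel_integrable_compact[OF assms(1,2)] by simp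
qed

lemma test_integrable:
  assumes "\<phi> \<in> test_functions V" "continuous_on UNIV g"
  shows "integrable lborel (\<lambda>x. \<phi> x * g x)"
proof -
  obtain C where C: "compact C" "C \<subseteq> V" "\<And>x. x \<notin> C \<Longrightarrow> \<phi> x = 0"
    using test_supportE[OF assms(1)] by blast
  have "continuous_on C (\<lambda>x. \<phi> x * g x)"
    by (rule continuous_on_mult[OF smooth_continuous_on[OF test_smooth[OF assms(1)]] continuous_on_subset[OF assms(2)]]) simp
  then show ?thesis using C by (intro integrable_compact_support[of C]) auto
qed

lemma test_bounded:
  assumes "\<phi> \<in> test_functions V"
  obtains B where "0 \<le> B" "\<And>x. norm (\<phi> x) \<le> B"
proof -
  obtain C where C: "compact C" "C \<subseteq> V" "\<And>x. x \<notin> C \<Longrightarrow> \<phi> x = 0"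
    using test_supportE[OF assms(1)] by blast
  have "compact (\<phi> ` C)"
    using smooth_continuous_on[OF test_smooth[OF assms]] C(1) by (intro compact_continuous_image)
  then obtain B where "\<forall>y\<in>\<phi> ` C. norm y \<le> B" using compact_imp_bounded bounded_iff by blast
  then have "norm (\<phi> x) \<le> max B 0" for x using C(3)[of x] by (cases "x \<in> C") (auto simp: le_max_iff_disj)
  then show thesis using that[of "max B 0"] by auto
qed

lemma smooth_lipschitz:
  fixes u :: "real ^ 'n::finite \<Rightarrow> complex"
  assumes "convex S" "\<And>x. x \<in> S \<Longrightarrow> u differentiable (at x)"
    and B: "\<And>x j. x \<in> S \<Longrightarrow> norm (D_op j u x) \<le> B" and xy: "x \<in> S" "y \<in> S"
  shows "norm (u x - u y) \<le> real CARD('n) * B * norm (x - y)"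
proof (rule differentiable_bound[OF assms(1) _ _ xy])
  fix z assume z: "z \<in> S"
  show "(u has_derivative (\<lambda>h. \<Sum>j\<in>UNIV. \<i> * of_real (h $ j) * D_op j u z)) (at z within S)"
    using has_derivative_D_op[OF assms(2)[OF z]] by (rule has_derivative_at_withinI)
  show "onorm (\<lambda>h. \<Sum>j\<in>UNIV. \<i> * of_real (h $ j) * D_op j u z) \<le> real CARD('n) * B"
  proof (rule onorm_le)
    fix h :: "real ^ 'n"
    have "norm (\<Sum>j\<in>UNIV. \<i> * of_real (h $ j) * D_op j u z) \<le> (\<Sum>j\<in>(UNIV::'n set). norm h * B)"
    proof (rule sum_norm_le)
      fix j
      show "norm (\<i> * of_real (h $ j) * D_op j u z) \<le> norm h * B"
        unfolding norm_mult norm_of_real using B[OF z, of j] component_le_norm_cart[of h j]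
        by (auto intro!: mult_mono)
    qed
    then show "norm (\<Sum>j\<in>UNIV. \<i> * of_real (h $ j) * D_op j u z) \<le> real CARD('n) * B * norm h"
      by (simp add: mult_ac)
  qed
qed

lemma test_lipschitz:
  fixes \<phi> :: "real ^ 'n::finite \<Rightarrow> complex"
  assumes "\<phi> \<in> test_functions V"
  obtains L where "0 \<le> L" "\<And>x y. norm (\<phi> x - \<phi> y) \<le> L * norm (x - y)"
proof -
  have "\<exists>B\<ge>0. \<forall>x. norm (D_op j \<phi> x) \<le> B" for j
    using test_bounded[OF test_D_op[OF assms]] by metis
  then obtain B where B: "\<And>j x. 0 \<le> B j" "\<And>j x. norm (D_op j \<phi> x) \<le> B j" by metis
  have "norm (D_op j \<phi> x) \<le> (\<Sum>j\<in>UNIV. B j)" for j x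
    using B member_le_sum[of j UNIV B] by (auto intro: order_trans)
  from smooth_lipschitz[OF convex_UNIV smooth_differentiable[OF test_smooth[OF assms] UNIV_I] this UNIV_I UNIV_I]
  have "norm (\<phi> x - \<phi> y) \<le> real CARD('n) * (\<Sum>j\<in>UNIV. B j) * norm (x - y)" for x y by simp
  moreover have "0 \<le> real CARD('n) * (\<Sum>j\<in>UNIV. B j)"
    by (intro mult_nonneg_nonneg sum_nonneg B) auto
  ultimately show thesis using that by blast
qed

lemma integral_translation_lborel:
  fixes f :: "'a::euclidean_space \<Rightarrow> 'b::{banach, second_countable_topology}"
  assumes "f \<in> borel_measurable borel"
  shows "(\<integral>x. f (x + a) \<partial>lborel) = (\<integral>x. f x \<partial>lborel)"
proof -
  have "(\<integral>x. f x \<partial>lborel) = (\<integral>x. f x \<partial>distr lborel borel ((+) a))"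
    using lborel_distr_plus[of a] by simp
  also have "\<dots> = (\<integral>x. f (a + x) \<partial>lborel)"
    using assms by (intro integral_distr) auto
  finally show ?thesis by (simp add: add.commute)
qed

lemma integrable_translation_lborel:
  fixes f :: "'a::euclidean_space \<Rightarrow> 'b::{banach, second_countable_topology}"
  assumes "integrable lborel f"
  shows "integrable lborel (\<lambda>x. f (x + a))"
proof -
  have "integrable (distr lborel borel ((+) a)) f"
    using lborel_distr_plus[of a] assms by simp
  then show ?thesis
    using integrable_distr[of "(+) a" lborel borel f] by (simp add: add.commute)
qed

lemma has_vector_derivative_quotient:
  fixes f :: "real \<Rightarrow> 'a::real_normed_vector"
  assumes "(f has_vector_derivative D) (at 0)"
  shows "((\<lambda>s. (f s - f 0) /\<^sub>R s) \<longlongrightarrow> D) (at 0)"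
proof -
  have "((\<lambda>h. norm (f h - f 0 - h *\<^sub>R D) / norm h) \<longlongrightarrow> 0) (at 0)"
    using assms by (simp add: has_vector_derivative_def has_derivative_at)
  moreover have "\<forall>\<^sub>F h in at 0. norm (f h - f 0 - h *\<^sub>R D) / norm h = norm ((f h - f 0) /\<^sub>R h - D)"
  proof -
    have "norm (f h - f 0 - h *\<^sub>R D) / norm h = norm ((f h - f 0) /\<^sub>R h - D)" if "h \<noteq> 0" for h
    proof -
      have "(f h - f 0) /\<^sub>R h - D = (f h - f 0 - h *\<^sub>R D) /\<^sub>R h"
        using that by (simp add: scaleR_diff_right)
      then show ?thesis by (simp add: divide_inverse mult.commute)
    qed
    then show ?thesis by (auto simp: eventually_at_filter)
  qed
  ultimately have "((\<lambda>h. norm ((f h - f 0) /\<^sub>R h - D)) \<longlongrightarrow> 0) (at 0)"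
    by (rule Lim_transform_eventually)
  from LIM_zero_cancel[OF tendsto_norm_zero_cancel[OF this]] show ?thesis .
qed

text \<open>The difference quotients of \<psi> have integral 0 by translation invariance, so Fubini
  is avoided. They converge dominatedly: the Lipschitz constant bounds them, and steps of length at
  most 1 keep them inside the ball of radius \<open>R + 1\<close>.\<close>

lemma integral_D_op:
  assumes "\<psi> \<in> test_functions V"
  shows "(\<integral>x. D_op j \<psi> x \<partial>lborel) = 0"
proof -
  obtain L where L: "0 \<le> L" "\<And>x y. norm (\<psi> x - \<psi> y) \<le> L * norm (x - y)" using test_lipschitz[OF assms] by blast
  obtain C where C: "compact C" "C \<subseteq> V" "\<And>x. x \<notin> C \<Longrightarrow> \<psi> x = 0"
    using test_supportE[OF assms(1)] by blast
  obtain R where R: "C \<subseteq> ball 0 R" using compact_imp_bounded[OF C(1)] bounded_subset_ballD by blast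
  define t where "t n = 1 / real (Suc n)" for n
  have t: "t n > 0" "t n \<le> 1" for n by (auto simp: t_def)
  define q where "q n x = of_real (1 / t n) * (\<psi> (x + t n *\<^sub>R axis j 1) - \<psi> x)" for n x
  have int\<psi>: "integrable lborel \<psi>" using test_integrable[OF assms, of "\<lambda>x. 1"] by simp
  have m\<psi>: "\<psi> \<in> borel_measurable borel" using borel_measurable_integrable[OF int\<psi>] by simp
  have q0: "(\<integral>x. q n x \<partial>lborel) = 0" for n
    unfolding q_def using integrable_translation_lborel[OF int\<psi>] int\<psi> integral_translation_lborel[OF m\<psi>]
    by simp
  have "(\<lambda>n. \<integral>x. q n x \<partial>lborel) \<longlonglongrightarrow> (\<integral>x. \<i> * D_op j \<psi> x \<partial>lborel)"
  proof (rule integral_dominated_convergence[where w = "\<lambda>x. indicator (cball 0 (R + 1)) x *\<^sub>R L"])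
    show "(\<lambda>x. \<i> * D_op j \<psi> x) \<in> borel_measurable lborel"
      using test_integrable[OF test_D_op[OF assms], of "\<lambda>x. \<i>"] by (simp add: mult.commute)
    show "q n \<in> borel_measurable lborel" for n
      unfolding q_def using m\<psi> by measurable
    show "integrable lborel (\<lambda>x. indicator (cball 0 (R + 1)) x *\<^sub>R L)"
      by (intro borel_integrable_compact) auto
    show "AE x in lborel. (\<lambda>n. q n x) \<longlonglongrightarrow> \<i> * D_op j \<psi> x"
    proof (rule AE_I2)
      fix x :: "real ^ 'a"
      have "((\<lambda>s. \<psi> (x + s *\<^sub>R axis j 1)) has_vector_derivative \<i> * D_op j \<psi> x) (at 0)"
      proof -
        have 1: "((\<lambda>s::real. x + s *\<^sub>R axis j 1) has_derivative (\<lambda>s. s *\<^sub>R axis j 1)) (at 0)"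
          by (auto intro!: derivative_eq_intros)
        have 2: "(\<psi> has_derivative (\<lambda>h. \<Sum>i\<in>UNIV. \<i> * of_real (h $ i) * D_op i \<psi> x)) (at (x + 0 *\<^sub>R axis j 1))"
          using has_derivative_D_op[OF smooth_differentiable[OF test_smooth[OF assms] UNIV_I]] by simp
        have "(\<Sum>i\<in>UNIV. \<i> * complex_of_real (s * axis j 1 $ i) * D_op i \<psi> x) = s *\<^sub>R (\<i> * D_op j \<psi> x)" for s
          by (subst sum.remove[of _ j]) (auto simp: axis_def scaleR_conv_of_real intro!: sum.neutral)
        with diff_chain_at[OF 1 2] show ?thesis
          by (simp add: o_def has_vector_derivative_def)
      qed
      then have "(\<lambda>s. (\<psi> (x + s *\<^sub>R axis j 1) - \<psi> x) /\<^sub>R s) \<midarrow>0\<rightarrow> \<i> * D_op j \<psi> x"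
        using has_vector_derivative_quotient by fastforce
      moreover have "t \<longlonglongrightarrow> 0" unfolding t_def by (rule LIMSEQ_Suc[OF lim_1_over_n])
      moreover have "\<forall>\<^sub>F n in sequentially. t n \<noteq> 0" using t by (simp add: less_imp_neq[symmetric])
      ultimately have "(\<lambda>n. (\<psi> (x + t n *\<^sub>R axis j 1) - \<psi> x) /\<^sub>R t n) \<longlonglongrightarrow> \<i> * D_op j \<psi> x"
        by (rule tendsto_compose_eventually[where g = "\<lambda>s. (\<psi> (x + s *\<^sub>R axis j 1) - \<psi> x) /\<^sub>R s"])
      then show "(\<lambda>n. q n x) \<longlonglongrightarrow> \<i> * D_op j \<psi> x"
        by (simp add: q_def scaleR_conv_of_real inverse_eq_divide)
    qed
    show "AE x in lborel. norm (q n x) \<le> indicator (cball 0 (R + 1)) x *\<^sub>R L" for n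
    proof (rule AE_I2)
      fix x :: "real ^ 'a"
      show "norm (q n x) \<le> indicator (cball 0 (R + 1)) x *\<^sub>R L"
      proof (cases "x \<in> cball 0 (R + 1)")
        case True
        have "norm (q n x) = 1 / t n * norm (\<psi> (x + t n *\<^sub>R axis j 1) - \<psi> x)"
          using t[of n] by (simp add: q_def norm_mult norm_divide)
        also have "\<dots> \<le> 1 / t n * (L * norm (t n *\<^sub>R axis j 1 :: real ^ 'a))"
          using L(2)[of "x + t n *\<^sub>R axis j 1" x] t[of n] by (intro mult_left_mono) auto
        also have "\<dots> = L" using t[of n] by simp
        finally show ?thesis using True by simp
      next
        case False
        have "norm (x + t n *\<^sub>R axis j 1) \<ge> norm x - norm (t n *\<^sub>R axis j 1 :: real ^ 'a)"
          by (metis norm_diff_ineq)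
        then have "R \<le> norm (x + t n *\<^sub>R axis j 1)" "R \<le> norm x" using False t[of n] by auto
        then have "x + t n *\<^sub>R axis j 1 \<notin> C" "x \<notin> C"
          using subsetD[OF R, of x] subsetD[OF R, of "x + t n *\<^sub>R axis j 1"] by auto
        then have "\<psi> (x + t n *\<^sub>R axis j 1) = 0" "\<psi> x = 0" using C(3) by auto
        then show ?thesis using False by (simp add: q_def)
      qed
    qed
  qed
  then have "(\<integral>x. \<i> * D_op j \<psi> x \<partial>lborel) = 0"
    using q0 LIMSEQ_unique[OF tendsto_const] by fastforce
  then show ?thesis by simp
qed

section \<open>Plane waves and the Fourier transform of test functions\<close>

definition wave :: "real ^ 'n::finite \<Rightarrow> real ^ 'n \<Rightarrow> complex" where
  "wave \<xi> x = cis (\<xi> \<bullet> x)"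

lemma norm_wave [simp]: "norm (wave \<xi> x) = 1"
  by (simp add: wave_def)

lemma wave_add: "wave (\<xi> + \<eta>) x = wave \<xi> x * wave \<eta> x"
  by (simp add: wave_def cis_mult inner_add_left)

lemma wave_add_right: "wave \<xi> (x + y) = wave \<xi> x * wave \<xi> y"
  by (simp add: wave_def cis_mult inner_add_right)

lemma wave_0 [simp]: "wave \<xi> 0 = 1" "wave 0 x = 1"
  by (simp_all add: wave_def)

lemma wave_minus_cancel: "wave (- \<xi>) x * wave \<xi> x = 1" "wave \<xi> x * wave (- \<xi>) x = 1"
  by (simp_all add: wave_def cis_mult)

lemma wave_minus_right: "wave \<xi> (- x) = wave (- \<xi>) x"
  by (simp add: wave_def)

lemma cnj_wave: "cnj (wave \<xi> x) = wave (- \<xi>) x"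
  by (simp add: wave_def cis_cnj)

lemma smooth_wave: "wave \<xi> \<in> smooth_functions S"
proof -
  have "((\<lambda>t. \<i> ^ n * cis t) has_vector_derivative \<i> ^ Suc n * cis t) (at t)" for n t
  proof -
    have "(cis has_vector_derivative \<i> * cis t) (at t)"
      unfolding has_vector_derivative_def by (auto intro!: derivative_eq_intros)
    from has_vector_derivative_mult_right[OF this, of "\<i> ^ n"] show ?thesis by (simp add: mult_ac)
  qed
  from smooth_compose[OF open_UNIV smooth_linear_form[of \<xi>], of "\<lambda>n t. \<i> ^ n * cis t" 0, OF this]
  have "wave \<xi> \<in> smooth_functions UNIV" by (simp add: wave_def[abs_def])
  then show ?thesis using smooth_subset by blast
qed

lemma continuous_wave: "continuous_on S (wave \<xi>)"
  using smooth_continuous_on[OF smooth_wave] .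

lemma has_derivative_wave: "(wave \<xi> has_derivative (\<lambda>h. \<i> * of_real (\<xi> \<bullet> h) * wave \<xi> x)) (at x)"
  unfolding wave_def[abs_def] by (auto intro!: derivative_eq_intros simp: scaleR_conv_of_real)

lemma D_op_wave: "D_op j (wave \<xi>) x = of_real (\<xi> $ j) * wave \<xi> x"
  by (subst D_op_eq[OF has_derivative_wave]) (simp add: inner_axis mult.assoc)

text \<open>The factor is the volume of the period cell. For functions supported in the cell the
  values at the points of a shifted integer lattice are therefore the coefficients of the expansion
  into waves.\<close>

definition ft :: "(real ^ 'n::finite \<Rightarrow> complex) \<Rightarrow> real ^ 'n \<Rightarrow> complex" where
  "ft \<phi> \<xi> = (\<integral>x. \<phi> x * wave (- \<xi>) x \<partial>lborel) / of_real ((2 * pi) ^ CARD('n))"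

lemma ft_integrable: "\<phi> \<in> test_functions V \<Longrightarrow> integrable lborel (\<lambda>x. \<phi> x * wave \<xi> x)"
  using test_integrable continuous_wave by blast

lemma ft_add:
  "\<phi> \<in> test_functions V \<Longrightarrow> \<psi> \<in> test_functions V \<Longrightarrow> ft (\<lambda>x. \<phi> x + \<psi> x) \<xi> = ft \<phi> \<xi> + ft \<psi> \<xi>"
  by (simp add: ft_def algebra_simps ft_integrable add_divide_distrib)

lemma ft_diff:
  "\<phi> \<in> test_functions V \<Longrightarrow> \<psi> \<in> test_functions V \<Longrightarrow> ft (\<lambda>x. \<phi> x - \<psi> x) \<xi> = ft \<phi> \<xi> - ft \<psi> \<xi>"
  by (simp add: ft_def algebra_simps ft_integrable diff_divide_distrib)

lemma ft_cmult: "ft (\<lambda>x. c * \<phi> x) \<xi> = c * ft \<phi> \<xi>"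
  by (simp add: ft_def mult.assoc)

lemma ft_zero [simp]: "ft (\<lambda>x. 0) \<xi> = 0"
  by (simp add: ft_def)

lemma ft_sum:
  "(\<And>i. i \<in> I \<Longrightarrow> f i \<in> test_functions V) \<Longrightarrow> ft (\<lambda>x. \<Sum>i\<in>I. f i x) \<xi> = (\<Sum>i\<in>I. ft (f i) \<xi>)"
  proof (induction I rule: infinite_finite_induct)
  case (insert i I)
  then show ?case using ft_add[of "f i" V "\<lambda>x. \<Sum>i\<in>I. f i x"] test_sum[of I f V] by simp
qed simp_all

lemma ft_D_op:
  assumes "\<phi> \<in> test_functions V"
  shows "ft (D_op j \<phi>) \<xi> = of_real (\<xi> $ j) * ft \<phi> \<xi>"
proof -
  have "(\<lambda>x. \<phi> x * wave (- \<xi>) x) \<in> test_functions UNIV"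
    by (rule test_mult[OF test_mono[OF assms]]) (auto simp: smooth_wave)
  then have "(\<integral>x. D_op j (\<lambda>x. \<phi> x * wave (- \<xi>) x) x \<partial>lborel) = 0" by (rule integral_D_op)
  moreover have "D_op j (\<lambda>x. \<phi> x * wave (- \<xi>) x) x
      = D_op j \<phi> x * wave (- \<xi>) x - of_real (\<xi> $ j) * (\<phi> x * wave (- \<xi>) x)" for x
    by (subst D_op_mult) (auto simp: D_op_wave intro: smooth_differentiable[OF test_smooth[OF assms]]
        smooth_differentiable[OF smooth_wave])
  ultimately have "(\<integral>x. D_op j \<phi> x * wave (- \<xi>) x \<partial>lborel) = of_real (\<xi> $ j) * (\<integral>x. \<phi> x * wave (- \<xi>) x \<partial>lborel)"
    by (simp add: ft_integrable[OF assms] ft_integrable[OF test_D_op[OF assms]])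
  then show ?thesis by (simp add: ft_def)
qed

lemma ft_Dw:
  assumes "\<phi> \<in> test_functions V"
  shows "ft (Dw w \<phi>) \<xi> = (\<Prod>j\<leftarrow>w. of_real (\<xi> $ j)) * ft \<phi> \<xi>"
  by (induction w) (simp_all add: ft_D_op[OF test_Dw[OF assms]] mult.assoc)

lemma norm_word_prod_le: "norm (\<Prod>j\<leftarrow>w. complex_of_real (\<xi> $ j)) \<le> norm \<xi> ^ length w"
  by (induction w) (auto simp: norm_mult intro!: mult_mono component_le_norm_cart)

lemma one_plus_norm_le_sum: "1 + norm \<xi> \<le> 1 + (\<Sum>j\<in>UNIV. \<bar>\<xi> $ j\<bar>)" for \<xi> :: "real ^ 'n::finite"
  using norm_le_l1_cart[of \<xi>] by simp

text \<open>Each further power of \<open>1 + norm \<xi>\<close> costs one derivative: the norm is at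
  most the sum of the absolute coordinates, and multiplication by a coordinate is the transform of
  \<open>D_op j \<phi>\<close>.\<close>

lemma ft_decay:
  fixes \<phi> :: "real ^ 'n::finite \<Rightarrow> complex"
  assumes "\<phi> \<in> test_functions V"
  shows "\<exists>C\<ge>0. \<forall>\<xi>. (1 + norm \<xi>) ^ s * norm (ft \<phi> \<xi>) \<le> C"
  using assms
proof (induction s arbitrary: \<phi>)
  case 0
  have "norm (ft \<phi> \<xi>) \<le> (\<integral>x. norm (\<phi> x) \<partial>lborel) / (2 * pi) ^ CARD('n)" for \<xi>
  proof -
    have "norm (\<integral>x. \<phi> x * wave (- \<xi>) x \<partial>lborel) \<le> (\<integral>x. norm (\<phi> x) \<partial>lborel)"
      using integral_norm_bound[of lborel "\<lambda>x. \<phi> x * wave (- \<xi>) x"] by (simp add: norm_mult)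
    then show ?thesis unfolding ft_def
      by (simp add: norm_divide norm_power norm_mult divide_right_mono)
  qed
  then show ?case by (auto intro!: exI[of _ "(\<integral>x. norm (\<phi> x) \<partial>lborel) / (2 * pi) ^ CARD('n)"])
next
  case (Suc s)
  obtain C where C: "C \<ge> 0" "\<And>\<xi>. (1 + norm \<xi>) ^ s * norm (ft \<phi> \<xi>) \<le> C"
    using Suc.IH[OF Suc.prems] by blast
  have "\<forall>j. \<exists>C\<ge>0. \<forall>\<xi>. (1 + norm \<xi>) ^ s * norm (ft (D_op j \<phi>) \<xi>) \<le> C"
    using Suc.IH[OF test_D_op[OF Suc.prems]] by blast
  then obtain D where D: "\<And>j. D j \<ge> 0" "\<And>j \<xi>. (1 + norm \<xi>) ^ s * norm (ft (D_op j \<phi>) \<xi>) \<le> D j" by metis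
  have "(1 + norm \<xi>) ^ Suc s * norm (ft \<phi> \<xi>) \<le> C + (\<Sum>j\<in>UNIV. D j)" for \<xi>
  proof -
    have "(1 + norm \<xi>) ^ Suc s * norm (ft \<phi> \<xi>) = (1 + norm \<xi>) * ((1 + norm \<xi>) ^ s * norm (ft \<phi> \<xi>))"
      by simp
    also have "\<dots> \<le> (1 + (\<Sum>j\<in>UNIV. \<bar>\<xi> $ j\<bar>)) * ((1 + norm \<xi>) ^ s * norm (ft \<phi> \<xi>))"
      by (intro mult_right_mono one_plus_norm_le_sum) auto
    also have "\<dots> = (1 + norm \<xi>) ^ s * norm (ft \<phi> \<xi>) + (\<Sum>j\<in>UNIV. (1 + norm \<xi>) ^ s * norm (ft (D_op j \<phi>) \<xi>))"
      unfolding ft_D_op[OF Suc.prems] norm_mult norm_of_real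
      by (simp add: distrib_left sum_distrib_left sum_distrib_right mult_ac)
    also have "\<dots> \<le> C + (\<Sum>j\<in>UNIV. D j)" by (intro add_mono sum_mono C D)
    finally show ?thesis .
  qed
  moreover have "0 \<le> C + (\<Sum>j\<in>UNIV. D j)"
    by (intro add_nonneg_nonneg sum_nonneg C(1) D(1))
  ultimately show ?case by blast
qed

section \<open>Shifted integer lattices and rapidly decreasing coefficients\<close>

definition freq :: "real ^ 'n::finite \<Rightarrow> ('n \<Rightarrow> int) \<Rightarrow> real ^ 'n" where
  "freq \<theta> k = (\<chi> j. of_int (k j)) + \<theta>"

lemma freq_nth [simp]: "freq \<theta> k $ j = of_int (k j) + \<theta> $ j"
  by (simp add: freq_def)

lemma summable_on_int_inverse_square: "(\<lambda>n::int. 1 / (1 + \<bar>of_int n\<bar>) ^ 2 :: real) summable_on UNIV"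
proof -
  have s: "summable (\<lambda>n. 1 / (1 + real n) ^ 2)"
    using inverse_squares_sums by (auto simp: sums_iff)
  have 1: "(\<lambda>n::nat. 1 / (1 + real n) ^ 2) summable_on UNIV"
    by (rule summable_nonneg_imp_summable_on[OF s]) auto
  have "(\<lambda>n::int. 1 / (1 + \<bar>of_int n\<bar>) ^ 2 :: real) summable_on range int"
    using 1 by (subst summable_on_reindex) (auto simp: o_def)
  moreover have "(\<lambda>n::int. 1 / (1 + \<bar>of_int n\<bar>) ^ 2 :: real) summable_on range (\<lambda>n. - int n)"
    using 1 by (subst summable_on_reindex) (auto simp: o_def inj_on_def)
  ultimately have "(\<lambda>n::int. 1 / (1 + \<bar>of_int n\<bar>) ^ 2 :: real) summable_on (range int \<union> range (\<lambda>n. - int n))"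
    by (rule summable_on_union)
  moreover have "range int \<union> range (\<lambda>n. - int n) = UNIV"
    using int_cases2 by blast
  ultimately show ?thesis by simp
qed

lemma inverse_square_le:
  fixes a b c :: real
  shows "0 < a \<Longrightarrow> 0 < b \<Longrightarrow> a\<^sup>2 \<le> c * b\<^sup>2 \<Longrightarrow> 1 / b\<^sup>2 \<le> c * (1 / a\<^sup>2)"
  by (simp add: field_simps)

lemma summable_on_int_shift: "(\<lambda>n::int. 1 / (1 + \<bar>of_int n + t\<bar>) ^ 2 :: real) summable_on UNIV"
proof (rule summable_on_comparison_test)
  show "(\<lambda>n::int. (1 + \<bar>t\<bar>) ^ 2 * (1 / (1 + \<bar>of_int n\<bar>) ^ 2)) summable_on UNIV"
    by (rule summable_on_cmult_right[OF summable_on_int_inverse_square])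
  fix n :: int
  have "1 + \<bar>real_of_int n\<bar> \<le> (1 + \<bar>t\<bar>) * (1 + \<bar>of_int n + t\<bar>)"
  proof -
    have "\<bar>real_of_int n\<bar> \<le> \<bar>of_int n + t\<bar> + \<bar>t\<bar>" by linarith
    moreover have "0 \<le> \<bar>t\<bar> * \<bar>of_int n + t\<bar>" by simp
    ultimately show ?thesis unfolding distrib_left distrib_right by linarith
  qed
  then have "(1 + \<bar>real_of_int n\<bar>) ^ 2 \<le> ((1 + \<bar>t\<bar>) * (1 + \<bar>of_int n + t\<bar>)) ^ 2"
    by (intro power_mono) auto
  then show "1 / (1 + \<bar>of_int n + t\<bar>) ^ 2 \<le> (1 + \<bar>t\<bar>) ^ 2 * (1 / (1 + \<bar>real_of_int n\<bar>) ^ 2)"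
    using inverse_square_le[of "1 + \<bar>of_int n\<bar>" "1 + \<bar>of_int n + t\<bar>" "(1 + \<bar>t\<bar>) ^ 2"]
    by (simp add: power_mult_distrib)
qed auto

text \<open>The exponent \<open>2 * CARD('n)\<close> leaves an inverse square for every coordinate,
  as \<open>1 + \<bar>x $ j\<bar>\<close> never exceeds \<open>1 + norm x\<close>. The product of
  the one-dimensional sums converges.\<close>

lemma lattice_summable:
  fixes \<theta> :: "real ^ 'n::finite"
  shows "(\<lambda>k. 1 / (1 + norm (freq \<theta> k)) ^ (2 * CARD('n))) summable_on UNIV"
proof -
  have "Infinite_Set_Sum.abs_summable_on (\<lambda>n::int. 1 / (1 + \<bar>of_int n + \<theta> $ j\<bar>) ^ 2 :: real) UNIV" for j
    using summable_on_int_shift[of "\<theta> $ j"]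
    by (subst abs_summable_equivalent[symmetric]) simp
  then have "Infinite_Set_Sum.abs_summable_on (\<lambda>k. \<Prod>j\<in>UNIV. 1 / (1 + \<bar>of_int (k j) + \<theta> $ j\<bar>) ^ 2 :: real)
      (PiE (UNIV::'n set) (\<lambda>_. UNIV :: int set))"
    by (intro abs_summable_on_prod_PiE) auto
  then have *: "(\<lambda>k::'n \<Rightarrow> int. \<Prod>j\<in>UNIV. 1 / (1 + \<bar>of_int (k j) + \<theta> $ j\<bar>) ^ 2 :: real) summable_on UNIV"
    by (subst (asm) abs_summable_equivalent[symmetric]) (simp add: abs_prod PiE_UNIV_domain)
  show ?thesis
  proof (rule summable_on_comparison_test[OF *])
    fix k :: "'n \<Rightarrow> int"
    have "(\<Prod>j\<in>UNIV. (1 + \<bar>of_int (k j) + \<theta> $ j\<bar>) ^ 2) \<le> (\<Prod>j\<in>(UNIV::'n set). (1 + norm (freq \<theta> k)) ^ 2)"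
    proof (rule prod_mono)
      fix j
      show "0 \<le> (1 + \<bar>of_int (k j) + \<theta> $ j\<bar>) ^ 2 \<and> (1 + \<bar>of_int (k j) + \<theta> $ j\<bar>) ^ 2 \<le> (1 + norm (freq \<theta> k)) ^ 2"
        using component_le_norm_cart[of "freq \<theta> k" j] by (auto intro!: power_mono)
    qed
    also have "\<dots> = (1 + norm (freq \<theta> k)) ^ (2 * CARD('n))" by (simp add: power_mult)
    finally have "(\<Prod>j\<in>UNIV. (1 + \<bar>of_int (k j) + \<theta> $ j\<bar>) ^ 2) \<le> (1 + norm (freq \<theta> k)) ^ (2 * CARD('n))" .
    moreover have "(\<Prod>j\<in>UNIV. (1 + \<bar>of_int (k j) + \<theta> $ j\<bar>) ^ 2) > 0" by (intro prod_pos) (auto simp: add_pos_nonneg)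
    ultimately show "1 / (1 + norm (freq \<theta> k)) ^ (2 * CARD('n)) \<le> (\<Prod>j\<in>UNIV. 1 / (1 + \<bar>of_int (k j) + \<theta> $ j\<bar>) ^ 2)"
      by (simp add: prod_dividef divide_left_mono frac_le)
  qed auto
qed

definition rapid :: "real ^ 'n::finite \<Rightarrow> (('n \<Rightarrow> int) \<Rightarrow> complex) \<Rightarrow> bool" where
  "rapid \<theta> a \<longleftrightarrow> (\<forall>s. \<exists>C. \<forall>k. norm (a k) * (1 + norm (freq \<theta> k)) ^ s \<le> C)"

lemma rapid_ft:
  assumes "\<phi> \<in> test_functions V"
  shows "rapid \<theta> (\<lambda>k. ft \<phi> (freq \<theta> k))"
  unfolding rapid_def using ft_decay[OF assms] by (metis mult.commute)

lemma rapid_mult: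
  assumes "rapid \<theta> a" "\<And>k. norm (b k) \<le> C * (1 + norm (freq \<theta> k)) ^ r"
  shows "rapid \<theta> (\<lambda>k. b k * a k)"
  unfolding rapid_def
proof
  fix s
  obtain D where D: "\<And>k. norm (a k) * (1 + norm (freq \<theta> k)) ^ (r + s) \<le> D"
    using assms(1) unfolding rapid_def by blast
  have "norm (b k * a k) * (1 + norm (freq \<theta> k)) ^ s \<le> \<bar>C\<bar> * D" for k
  proof -
    have "norm (b k * a k) * (1 + norm (freq \<theta> k)) ^ s
        \<le> (\<bar>C\<bar> * (1 + norm (freq \<theta> k)) ^ r) * (norm (a k) * (1 + norm (freq \<theta> k)) ^ s)"
      unfolding norm_mult mult.assoc[of "norm (b k)"]
    proof (rule mult_right_mono)
      show "norm (b k) \<le> \<bar>C\<bar> * (1 + norm (freq \<theta> k)) ^ r"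
        by (rule order_trans[OF assms(2)]) (auto intro!: mult_right_mono)
    qed auto
    also have "\<dots> = \<bar>C\<bar> * (norm (a k) * (1 + norm (freq \<theta> k)) ^ (r + s))" by (simp add: power_add mult_ac)
    also have "\<dots> \<le> \<bar>C\<bar> * D" by (intro mult_left_mono D) auto
    finally show ?thesis .
  qed
  then show "\<exists>C. \<forall>k. norm (b k * a k) * (1 + norm (freq \<theta> k)) ^ s \<le> C" by blast
qed

lemma rapid_summable:
  fixes \<theta> :: "real ^ 'n::finite"
  assumes "rapid \<theta> a"
  shows "(\<lambda>k. norm (a k) * (1 + norm (freq \<theta> k)) ^ s) summable_on UNIV"
proof -
  obtain C where C: "\<And>k. norm (a k) * (1 + norm (freq \<theta> k)) ^ (s + 2 * CARD('n)) \<le> C"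
    using assms unfolding rapid_def by blast
  show ?thesis
  proof (rule summable_on_comparison_test)
    show "(\<lambda>k. C * (1 / (1 + norm (freq \<theta> k)) ^ (2 * CARD('n)))) summable_on UNIV"
      by (rule summable_on_cmult_right[OF lattice_summable])
    show "norm (a k) * (1 + norm (freq \<theta> k)) ^ s \<le> C * (1 / (1 + norm (freq \<theta> k)) ^ (2 * CARD('n)))" for k
      using C[of k] by (simp add: power_add divide_simps add_pos_nonneg mult_ac)
  qed auto
qed

lemma rapid_norm_summable: "rapid \<theta> a \<Longrightarrow> (\<lambda>k. norm (a k)) summable_on UNIV"
  using rapid_summable[of \<theta> a 0] by simp

section \<open>Trigonometric series and termwise calculus\<close>

definition trig :: "real ^ 'n::finite \<Rightarrow> (('n \<Rightarrow> int) \<Rightarrow> complex) \<Rightarrow> real ^ 'n \<Rightarrow> complex" where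
  "trig \<theta> a x = (\<Sum>\<^sub>\<infinity>k. a k * wave (freq \<theta> k) x)"

lemma summable_on_bounded_mult:
  fixes a w :: "'i \<Rightarrow> complex"
  assumes "(\<lambda>k. norm (a k)) summable_on UNIV" "\<And>k. norm (w k) \<le> C"
  shows "(\<lambda>k. a k * w k) summable_on UNIV"
proof -
  have "(\<lambda>k. norm (a k * w k)) summable_on UNIV"
  proof (rule summable_on_comparison_test)
    show "(\<lambda>k. norm (a k) * C) summable_on UNIV" by (rule summable_on_cmult_left[OF assms(1)])
    show "norm (a k * w k) \<le> norm (a k) * C" for k
      unfolding norm_mult by (intro mult_left_mono assms) auto
  qed auto
  then show ?thesis by (rule abs_summable_summable)
qed

text \<open>The bound does not involve the weights \<open>w k\<close>. If these depend on a point,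
  convergence is uniform in the point, which permits integration term by term.\<close>

lemma norm_infsum_tail_le:
  fixes a w :: "'i \<Rightarrow> complex"
  assumes "(\<lambda>k. norm (a k)) summable_on UNIV" "\<And>k. norm (w k) \<le> 1" "finite F"
  shows "norm ((\<Sum>\<^sub>\<infinity>k. a k * w k) - (\<Sum>k\<in>F. a k * w k)) \<le> (\<Sum>\<^sub>\<infinity>k. norm (a k)) - (\<Sum>k\<in>F. norm (a k))"
proof -
  have s: "(\<lambda>k. a k * w k) summable_on UNIV" by (rule summable_on_bounded_mult[OF assms(1,2)])
  have "(\<Sum>\<^sub>\<infinity>k. a k * w k) - (\<Sum>k\<in>F. a k * w k) = (\<Sum>\<^sub>\<infinity>k\<in>UNIV - F. a k * w k)"
    using infsum_Diff[OF s summable_on_finite[OF assms(3)]] assms(3) by simp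
  also have "norm \<dots> \<le> (\<Sum>\<^sub>\<infinity>k\<in>UNIV - F. norm (a k))"
  proof (rule norm_infsum_le)
    show "((\<lambda>k. a k * w k) has_sum (\<Sum>\<^sub>\<infinity>k\<in>UNIV - F. a k * w k)) (UNIV - F)"
      using summable_on_subset_banach[OF s] by auto
    show "((\<lambda>k. norm (a k)) has_sum (\<Sum>\<^sub>\<infinity>k\<in>UNIV - F. norm (a k))) (UNIV - F)"
      using summable_on_subset_banach[OF assms(1)] by auto
    show "norm (a k * w k) \<le> norm (a k)" for k
      using mult_left_mono[OF assms(2)[of k], of "norm (a k)"] by (simp add: norm_mult)
  qed
  also have "\<dots> = (\<Sum>\<^sub>\<infinity>k. norm (a k)) - (\<Sum>k\<in>F. norm (a k))"
    using infsum_Diff[OF assms(1) summable_on_finite[OF assms(3)]] assms(3) by simp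
  finally show ?thesis .
qed

lemma norm_infsum_mult_le:
  fixes a w :: "'i \<Rightarrow> complex"
  assumes "(\<lambda>k. norm (a k)) summable_on UNIV" "\<And>k. norm (w k) \<le> 1"
  shows "norm (\<Sum>\<^sub>\<infinity>k. a k * w k) \<le> (\<Sum>\<^sub>\<infinity>k. norm (a k))"
  using norm_infsum_tail_le[OF assms, of "{}"] by simp

lemma has_sum_finite_sum:
  fixes f :: "'j \<Rightarrow> 'i \<Rightarrow> complex"
  assumes "finite J" "\<And>j. j \<in> J \<Longrightarrow> (f j has_sum S j) A"
  shows "((\<lambda>k. \<Sum>j\<in>J. f j k) has_sum (\<Sum>j\<in>J. S j)) A"
  using assms by (induction J) (auto intro: has_sum_add)

lemma trig_has_sum:
  "(\<lambda>k. norm (a k)) summable_on UNIV \<Longrightarrow> ((\<lambda>k. a k * wave (freq \<theta> k) x) has_sum trig \<theta> a x) UNIV"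
  unfolding trig_def using summable_on_bounded_mult[of a "\<lambda>k. wave (freq \<theta> k) x" 1] by simp

lemma norm_cis_minus_1_le: "norm (cis t - 1) \<le> \<bar>t\<bar>"
proof -
  have "norm (cis t - cis 0) \<le> 1 * norm (t - 0)"
  proof (rule differentiable_bound[OF convex_UNIV])
    show "(cis has_derivative (\<lambda>h. h *\<^sub>R (\<i> * cis x))) (at x within (UNIV::real set))" for x
      by (auto intro!: derivative_eq_intros)
    show "onorm (\<lambda>h. h *\<^sub>R (\<i> * cis x)) \<le> 1" for x
      by (rule onorm_le) (simp add: norm_mult)
  qed auto
  then show ?thesis by simp
qed

lemma norm_cis_Taylor: "norm (cis t - 1 - \<i> * of_real t) \<le> t\<^sup>2"
proof -
  let ?f = "\<lambda>t. cis t - 1 - \<i> * of_real t"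
  have "norm (?f t - ?f 0) \<le> \<bar>t\<bar> * norm (t - 0)"
  proof (rule differentiable_bound[where S = "cball 0 \<bar>t\<bar>"])
    fix x :: real assume x: "x \<in> cball 0 \<bar>t\<bar>"
    show "(?f has_derivative (\<lambda>h. h *\<^sub>R (\<i> * (cis x - 1)))) (at x within cball 0 \<bar>t\<bar>)"
      by (auto intro!: derivative_eq_intros simp: algebra_simps scaleR_conv_of_real)
    show "onorm (\<lambda>h. h *\<^sub>R (\<i> * (cis x - 1))) \<le> \<bar>t\<bar>"
    proof (rule onorm_le)
      fix h
      have "norm (cis x - 1) \<le> \<bar>t\<bar>" using norm_cis_minus_1_le[of x] x by (auto simp: dist_norm)
      then show "norm (h *\<^sub>R (\<i> * (cis x - 1))) \<le> \<bar>t\<bar> * norm h"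
        by (simp add: norm_mult mult_left_mono mult.commute)
    qed
  qed auto
  then show ?thesis by (simp add: power2_eq_square)
qed

lemma has_derivative_quadratic:
  fixes f :: "'a::real_normed_vector \<Rightarrow> 'b::real_normed_vector"
  assumes "bounded_linear L" "\<And>h. norm (f (x + h) - f x - L h) \<le> M * (norm h)\<^sup>2"
  shows "(f has_derivative L) (at x)"
proof -
  have "((\<lambda>h. norm (f (x + h) - f x - L h) / norm h) \<longlongrightarrow> 0) (at 0)"
  proof (rule Lim_null_comparison)
    show "\<forall>\<^sub>F h in at 0. norm (norm (f (x + h) - f x - L h) / norm h) \<le> M * norm h"
    proof -
      have "norm (norm (f (x + h) - f x - L h) / norm h) \<le> M * norm h" if "h \<noteq> 0" for h
        using assms(2)[of h] that by (simp add: divide_simps power2_eq_square mult_ac)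
      then show ?thesis by (auto simp: eventually_at_filter)
    qed
    show "((\<lambda>h::'a. M * norm h) \<longlongrightarrow> 0) (at 0)"
      by (intro tendsto_mult_right_zero tendsto_norm_zero tendsto_ident_at)
  qed
  then show ?thesis using assms(1) by (simp add: has_derivative_at)
qed

lemma rapid_component:
  assumes "rapid \<theta> a"
  shows "rapid \<theta> (\<lambda>k. of_real (freq \<theta> k $ j) * a k)"
proof (rule rapid_mult[OF assms, where C = 1 and r = 1])
  show "norm (complex_of_real (freq \<theta> k $ j)) \<le> 1 * (1 + norm (freq \<theta> k)) ^ 1" for k
    using component_le_norm_cart[of "freq \<theta> k" j] unfolding norm_of_real power_one_right mult_1 by linarith
qed

lemma has_sum_diff:
  fixes f g :: "'i \<Rightarrow> complex"
  assumes "(f has_sum a) A" "(g has_sum b) A"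
  shows "((\<lambda>x. f x - g x) has_sum (a - b)) A"
  using has_sum_add[OF assms(1) has_sum_uminus[THEN iffD2, of g A "- b"]] assms(2) by simp

text \<open>Termwise the remainder of \<open>cis\<close> after the linear part is at most quadratic,
  and the resulting constants \<open>norm (a k) * (1 + norm (freq \<theta> k)) ^ 2\<close> are
  summable. The whole series thus has a quadratic remainder, which gives the derivative
  directly.\<close>

lemma trig_has_derivative:
  assumes "rapid \<theta> a"
  shows "(trig \<theta> a has_derivative
    (\<lambda>h. \<Sum>j\<in>UNIV. \<i> * of_real (h $ j) * trig \<theta> (\<lambda>k. of_real (freq \<theta> k $ j) * a k) x)) (at x)"
proof (rule has_derivative_quadratic)
  let ?L = "\<lambda>h. \<Sum>j\<in>UNIV. \<i> * of_real (h $ j) * trig \<theta> (\<lambda>k. of_real (freq \<theta> k $ j) * a k) x"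
  show "bounded_linear ?L"
    by (intro bounded_linear_sum bounded_linear_mult_const bounded_linear_compose[OF bounded_linear_mult_right]
        bounded_linear_compose[OF bounded_linear_of_real] bounded_linear_vec_nth)
  let ?M = "\<Sum>\<^sub>\<infinity>k. norm (a k) * (1 + norm (freq \<theta> k)) ^ 2"
  have s: "(\<lambda>k. norm (a k)) summable_on UNIV" by (rule rapid_norm_summable[OF assms])
  show "norm (trig \<theta> a (x + h) - trig \<theta> a x - ?L h) \<le> ?M * (norm h)\<^sup>2" for h
  proof (rule norm_infsum_le)
    let ?g = "\<lambda>k. a k * wave (freq \<theta> k) (x + h) - a k * wave (freq \<theta> k) x -
      (\<Sum>j\<in>UNIV. \<i> * of_real (h $ j) * (of_real (freq \<theta> k $ j) * a k * wave (freq \<theta> k) x))"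
    show "(?g has_sum (trig \<theta> a (x + h) - trig \<theta> a x - ?L h)) UNIV"
      by (intro has_sum_diff trig_has_sum s has_sum_finite_sum has_sum_cmult_right
          rapid_norm_summable[OF rapid_component[OF assms]]) auto
    have "((\<lambda>k. norm (a k) * (1 + norm (freq \<theta> k)) ^ 2) has_sum ?M) UNIV"
      using rapid_summable[OF assms] by auto
    then show "((\<lambda>k. norm (a k) * (1 + norm (freq \<theta> k)) ^ 2 * (norm h)\<^sup>2) has_sum ?M * (norm h)\<^sup>2) UNIV"
      by (rule has_sum_cmult_left)
    fix k :: "'a \<Rightarrow> int"
    let ?x = "freq \<theta> k"
    have "(\<Sum>j\<in>UNIV. \<i> * of_real (h $ j) * (of_real (?x $ j) * a k * wave ?x x))
        = a k * wave ?x x * (\<i> * of_real (?x \<bullet> h))"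
      by (simp add: inner_vec_def sum_distrib_left mult_ac)
    then have "?g k = a k * wave ?x x * (cis (?x \<bullet> h) - 1 - \<i> * of_real (?x \<bullet> h))"
      by (simp add: wave_add_right wave_def[of ?x h] algebra_simps)
    also have "norm \<dots> \<le> norm (a k) * (?x \<bullet> h)\<^sup>2"
      using norm_cis_Taylor[of "?x \<bullet> h"] by (simp add: norm_mult mult_left_mono)
    also have "\<dots> \<le> norm (a k) * ((1 + norm ?x) ^ 2 * (norm h)\<^sup>2)"
    proof (rule mult_left_mono)
      have "\<bar>?x \<bullet> h\<bar> \<le> norm ?x * norm h" by (rule Cauchy_Schwarz_ineq2)
      also have "\<dots> \<le> (1 + norm ?x) * norm h" by (intro mult_right_mono) auto
      finally have "\<bar>?x \<bullet> h\<bar>\<^sup>2 \<le> ((1 + norm ?x) * norm h)\<^sup>2" by (rule power_mono) auto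
      then show "(?x \<bullet> h)\<^sup>2 \<le> (1 + norm ?x) ^ 2 * (norm h)\<^sup>2" by (simp add: power_mult_distrib)
    qed auto
    finally show "norm (?g k) \<le> norm (a k) * (1 + norm ?x) ^ 2 * (norm h)\<^sup>2" by (simp add: mult.assoc)
  qed
qed

lemma D_op_trig: "rapid \<theta> a \<Longrightarrow> D_op j (trig \<theta> a) = trig \<theta> (\<lambda>k. of_real (freq \<theta> k $ j) * a k)"
proof
  fix x assume a: "rapid \<theta> a"
  let ?T = "\<lambda>i. trig \<theta> (\<lambda>k. of_real (freq \<theta> k $ i) * a k) x"
  have "(\<Sum>i\<in>UNIV. \<i> * complex_of_real (axis j 1 $ i) * ?T i) = \<i> * ?T j"
    by (subst sum.remove[of _ j]) (auto simp: axis_def intro!: sum.neutral)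
  then show "D_op j (trig \<theta> a) x = ?T j"
    by (subst D_op_eq[OF trig_has_derivative[OF a]]) simp
qed

lemma smooth_trig:
  assumes "rapid \<theta> a"
  shows "trig \<theta> a \<in> smooth_functions S"
proof -
  have "trig \<theta> a \<in> smooth_functions UNIV"
  proof (rule smooth_coinduct[where F = "{trig \<theta> a |a. rapid \<theta> a}"])
    show "g differentiable at x" if "g \<in> {trig \<theta> a |a. rapid \<theta> a}" for g x
      using that trig_has_derivative by (auto intro: differentiableI)
    show "\<exists>g'\<in>{trig \<theta> a |a. rapid \<theta> a}. \<forall>x\<in>UNIV. partial_deriv j g x = g' x"
      if gF: "g \<in> {trig \<theta> a |a. rapid \<theta> a}" for g j
    proof -
      obtain b where b: "g = trig \<theta> b" "rapid \<theta> b" using gF by auto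
      let ?c = "\<lambda>k. \<i> * (of_real (freq \<theta> k $ j) * b k)"
      have "rapid \<theta> ?c"
        by (rule rapid_mult[OF rapid_component[OF b(2)], where C = 1 and r = 0]) simp
      moreover have "partial_deriv j g x = trig \<theta> ?c x" for x
      proof -
        have "partial_deriv j g x = \<i> * D_op j g x" by (simp add: D_op_def)
        also have "\<dots> = \<i> * trig \<theta> (\<lambda>k. of_real (freq \<theta> k $ j) * b k) x" using D_op_trig b by metis
        also have "\<dots> = trig \<theta> ?c x" by (simp add: trig_def infsum_cmult_right' mult.assoc)
        finally show ?thesis .
      qed
      ultimately show ?thesis by blast
    qed
  qed (use assms in auto)
  then show ?thesis using smooth_subset by blast
qed

lemma rapid_word: "rapid \<theta> a \<Longrightarrow> rapid \<theta> (\<lambda>k. (\<Prod>j\<leftarrow>w. of_real (freq \<theta> k $ j)) * a k)"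
proof (induction w)
  case (Cons j w)
  then show ?case using rapid_component[of \<theta> "\<lambda>k. (\<Prod>j\<leftarrow>w. of_real (freq \<theta> k $ j)) * a k" j]
    by (simp add: mult.assoc del: freq_nth)
qed simp

lemma Dw_trig:
  "rapid \<theta> a \<Longrightarrow> Dw w (trig \<theta> a) = trig \<theta> (\<lambda>k. (\<Prod>j\<leftarrow>w. of_real (freq \<theta> k $ j)) * a k)"
  by (induction w) (simp_all add: D_op_trig rapid_word mult.assoc del: freq_nth)

lemma norm_trig_le: "(\<lambda>k. norm (a k)) summable_on UNIV \<Longrightarrow> norm (trig \<theta> a x) \<le> (\<Sum>\<^sub>\<infinity>k. norm (a k))"
  unfolding trig_def by (rule norm_infsum_mult_le) auto

text \<open>The partial sums are uniformly close to the series, so the error is the remaining tail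
  of \<open>norm (a k)\<close> times the integral of \<open>norm (g x)\<close>. The functions
  \<open>w k\<close> are kept general because they are later waves in \<open>x - y\<close>.\<close>

lemma integral_infsum_mult:
  fixes a :: "'i \<Rightarrow> complex" and w :: "'i \<Rightarrow> 'a::euclidean_space \<Rightarrow> complex"
  assumes s: "(\<lambda>k. norm (a k)) summable_on UNIV"
    and w: "\<And>k. continuous_on UNIV (w k)" "\<And>k x. norm (w k x) \<le> 1"
    and t: "continuous_on UNIV (\<lambda>x. \<Sum>\<^sub>\<infinity>k. a k * w k x)"
    and g: "integrable lborel g"
  shows "((\<lambda>k. a k * (\<integral>x. w k x * g x \<partial>lborel)) has_sum (\<integral>x. (\<Sum>\<^sub>\<infinity>k. a k * w k x) * g x \<partial>lborel)) UNIV"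
proof -
  let ?A = "\<Sum>\<^sub>\<infinity>k. norm (a k)" and ?t = "\<lambda>x. \<Sum>\<^sub>\<infinity>k. a k * w k x"
  have mg: "g \<in> borel_measurable lborel" using g by auto
  have bi: "integrable lborel (\<lambda>x. h x * g x)" if "continuous_on UNIV h" "\<And>x. norm (h x) \<le> B" for h B
  proof (rule Bochner_Integration.integrable_bound[of lborel "\<lambda>x. B * norm (g x)"])
    show "integrable lborel (\<lambda>x. B * norm (g x))" using g by simp
    show "(\<lambda>x. h x * g x) \<in> borel_measurable lborel"
      using borel_measurable_continuous_onI[OF that(1)] mg by measurable
    have "norm (h x * g x) \<le> norm (B * norm (g x))" for x
      using that(2)[of x] norm_ge_zero[of "h x"] by (simp add: norm_mult abs_mult mult_right_mono)
    then show "AE x in lborel. norm (h x * g x) \<le> norm (B * norm (g x))" by simp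
  qed
  have iw: "integrable lborel (\<lambda>x. w k x * g x)" for k
    by (rule bi[where B = 1]) (auto simp: w)
  have it: "integrable lborel (\<lambda>x. ?t x * g x)"
    by (rule bi[OF t norm_infsum_mult_le[OF s w(2)]])
  have bound: "norm ((\<Sum>k\<in>F. a k * (\<integral>x. w k x * g x \<partial>lborel)) - (\<integral>x. ?t x * g x \<partial>lborel))
      \<le> (?A - (\<Sum>k\<in>F. norm (a k))) * (\<integral>x. norm (g x) \<partial>lborel)" if F: "finite F" for F
  proof -
    have 1: "(\<integral>x. ?t x * g x \<partial>lborel) - (\<Sum>k\<in>F. a k * (\<integral>x. w k x * g x \<partial>lborel))
        = (\<integral>x. ?t x * g x - (\<Sum>k\<in>F. a k * (w k x * g x)) \<partial>lborel)"
      using it iw by simp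
    also have "norm \<dots> \<le> (\<integral>x. (?A - (\<Sum>k\<in>F. norm (a k))) * norm (g x) \<partial>lborel)"
    proof (rule Bochner_Integration.integral_norm_bound_integral)
      show "integrable lborel (\<lambda>x. ?t x * g x - (\<Sum>k\<in>F. a k * (w k x * g x)))"
        using it iw by simp
      show "integrable lborel (\<lambda>x. (?A - (\<Sum>k\<in>F. norm (a k))) * norm (g x))"
        using g by simp
      fix x
      have "?t x * g x - (\<Sum>k\<in>F. a k * (w k x * g x))
          = (?t x - (\<Sum>k\<in>F. a k * w k x)) * g x"
        by (simp add: sum_distrib_right left_diff_distrib mult.assoc)
      then show "norm (?t x * g x - (\<Sum>k\<in>F. a k * (w k x * g x)))
          \<le> (?A - (\<Sum>k\<in>F. norm (a k))) * norm (g x)"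
        using norm_infsum_tail_le[OF s, of "\<lambda>k. w k x" F] F w(2)
        by (simp add: norm_mult mult_right_mono)
    qed
    finally show ?thesis by (simp add: norm_minus_commute)
  qed
  have "((\<lambda>F. (?A - (\<Sum>k\<in>F. norm (a k))) * (\<integral>x. norm (g x) \<partial>lborel)) \<longlongrightarrow> (?A - ?A) * (\<integral>x. norm (g x) \<partial>lborel))
      (finite_subsets_at_top UNIV)"
    using has_sum_infsum[OF s] unfolding has_sum_def by (intro tendsto_intros)
  then have lim: "((\<lambda>F. (?A - (\<Sum>k\<in>F. norm (a k))) * (\<integral>x. norm (g x) \<partial>lborel)) \<longlongrightarrow> 0)
      (finite_subsets_at_top UNIV)" by simp
  have "((\<lambda>F. (\<Sum>k\<in>F. a k * (\<integral>x. w k x * g x \<partial>lborel)) - (\<integral>x. ?t x * g x \<partial>lborel)) \<longlongrightarrow> 0)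
      (finite_subsets_at_top UNIV)"
    by (rule Lim_null_comparison[OF eventually_finite_subsets_at_top_weakI lim]) (rule bound)
  then show ?thesis unfolding has_sum_def by (rule LIM_zero_cancel)
qed

lemma integral_trig:
  assumes "rapid \<theta> a" "integrable lborel g"
  shows "((\<lambda>k. a k * (\<integral>x. wave (freq \<theta> k) x * g x \<partial>lborel)) has_sum (\<integral>x. trig \<theta> a x * g x \<partial>lborel)) UNIV"
  using integral_infsum_mult[OF rapid_norm_summable[OF assms(1)] continuous_wave _ smooth_continuous_on[OF smooth_trig[OF assms(1), unfolded trig_def[abs_def]]] assms(2)]
  by (simp add: trig_def)

section \<open>Fourier inversion\<close>

lemma integral_prod_components:
  fixes f :: "'n::finite \<Rightarrow> real \<Rightarrow> complex"
  assumes "\<And>j. integrable lborel (f j)"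
  shows "(\<integral>x. (\<Prod>j\<in>UNIV. f j (x $ j)) \<partial>(lborel :: (real ^ 'n) measure)) = (\<Prod>j\<in>UNIV. \<integral>t. f j t \<partial>lborel)"
proof -
  let ?ax = "\<lambda>i. axis i 1 :: real ^ 'n"
  have inj: "inj ?ax" by (auto simp: inj_def axis_eq_axis)
  have B: "(Basis :: (real ^ 'n) set) = range ?ax" by (auto simp: Basis_vec_def)
  define ix where "ix = inv ?ax"
  have ix: "ix (?ax i) = i" for i unfolding ix_def using inj by (rule inv_f_f)
  interpret product_sigma_finite "\<lambda>_::real ^ 'n. lborel :: real measure" ..
  have mf: "f j \<in> borel_measurable borel" for j using borel_measurable_integrable[OF assms] by simp
  have mc: "(\<lambda>x::real ^ 'n. x $ j) \<in> borel_measurable borel" for j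
    by (intro borel_measurable_continuous_onI continuous_intros)
  have m: "(\<lambda>x::real ^ 'n. \<Prod>j\<in>UNIV. f j (x $ j)) \<in> borel_measurable borel"
    by (intro borel_measurable_prod measurable_compose[OF mc mf])
  have nth: "(\<Sum>b\<in>Basis. g b *\<^sub>R b) $ j = g (?ax j)" for g :: "real ^ 'n \<Rightarrow> real" and j
  proof -
    have "(\<Sum>b\<in>Basis. g b *\<^sub>R b) $ j = (\<Sum>b\<in>Basis. g b *\<^sub>R b) \<bullet> ?ax j" by (simp add: inner_axis)
    also have "\<dots> = g (?ax j)" using B by (subst inner_sum_left_Basis) auto
    finally show ?thesis .
  qed
  have "(\<integral>x. (\<Prod>j\<in>UNIV. f j (x $ j)) \<partial>(lborel :: (real ^ 'n) measure))
    = (\<integral>g. (\<Prod>j\<in>UNIV. f j ((\<Sum>b\<in>Basis. g b *\<^sub>R b) $ j)) \<partial>(\<Pi>\<^sub>M b\<in>(Basis :: (real ^ 'n) set). lborel))"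
    by (subst lborel_eq) (intro integral_distr m, measurable)
  also have "\<dots> = (\<integral>g. (\<Prod>b\<in>Basis. f (ix b) (g b)) \<partial>(\<Pi>\<^sub>M b\<in>(Basis :: (real ^ 'n) set). lborel))"
    unfolding nth unfolding B using inj by (subst prod.reindex) (auto simp: ix)
  also have "\<dots> = (\<Prod>b\<in>(Basis :: (real ^ 'n) set). \<integral>t. f (ix b) t \<partial>lborel)"
    by (rule product_integral_prod) (auto simp: assms)
  also have "\<dots> = (\<Prod>j\<in>UNIV. \<integral>t. f j t \<partial>lborel)"
    unfolding B using inj by (subst prod.reindex) (auto simp: ix)
  finally show ?thesis .
qed

lemma integral_cis_period:
  "(\<integral>t. indicator {-pi..pi} t *\<^sub>R cis (of_int n * t) \<partial>lborel) = (if n = 0 then of_real (2 * pi) else 0)"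
proof (cases "n = 0")
  case True
  have "(\<integral>t. indicator {-pi..pi} t *\<^sub>R (1::complex) \<partial>lborel) = of_real pi - of_real (- pi)"
    by (rule integral_FTC_atLeastAtMost) (auto intro!: derivative_eq_intros simp: has_vector_derivative_def scaleR_conv_of_real)
  then show ?thesis using True by simp
next
  case False
  let ?F = "\<lambda>t. cis (of_int n * t) / (\<i> * of_int n)"
  have "(\<integral>t. indicator {-pi..pi} t *\<^sub>R cis (of_int n * t) \<partial>lborel) = ?F pi - ?F (- pi)"
  proof (rule integral_FTC_atLeastAtMost)
    show "(?F has_vector_derivative cis (of_int n * x)) (at x within {-pi..pi})" for x
      using False unfolding has_vector_derivative_def
      by (auto intro!: derivative_eq_intros simp: scaleR_conv_of_real fun_eq_iff algebra_simps)
    show "continuous_on {-pi..pi} (\<lambda>t. cis (of_int n * t))" by (intro continuous_intros)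
  qed simp
  also have "cis (of_int n * pi) = cis (of_int n * (- pi))"
    using sin_npi_int[of n] by (simp add: complex_eq_iff mult.commute)
  finally show ?thesis using False by simp
qed

definition cell :: "(real ^ 'n::finite) set" where
  "cell = {x. \<forall>j. x $ j \<in> {-pi..pi}}"

lemma cell_cbox: "cell = cbox (\<chi> j. - pi) (\<chi> j. pi)"
  by (auto simp: cell_def mem_box_cart)

lemma cis_sum: "cis (\<Sum>j\<in>A. f j) = (\<Prod>j\<in>A. cis (f j))"
  by (induction A rule: infinite_finite_induct) (auto simp: cis_mult[symmetric])

lemma integral_cell_wave:
  fixes k :: "'n::finite \<Rightarrow> int"
  shows "(\<integral>x. indicator cell x *\<^sub>R wave (freq 0 k) x \<partial>lborel) = (if k = (\<lambda>_. 0) then of_real ((2 * pi) ^ CARD('n)) else 0)"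
proof -
  have "indicator cell x *\<^sub>R wave (freq 0 k) x = (\<Prod>j\<in>UNIV. indicator {-pi..pi} (x $ j) *\<^sub>R cis (of_int (k j) * x $ j))" for x :: "real ^ 'n"
  proof (cases "x \<in> cell")
    case True
    then have "\<forall>j. indicator {-pi..pi} (x $ j) = (1::real)" by (auto simp: cell_def indicator_def)
    then show ?thesis using True by (simp add: wave_def inner_vec_def cis_sum)
  next
    case False
    then obtain j where "x $ j \<notin> {-pi..pi}" by (auto simp: cell_def)
    then have "(\<Prod>j\<in>UNIV. indicator {-pi..pi} (x $ j) *\<^sub>R cis (of_int (k j) * x $ j)) = 0"
      by (intro prod_zero) (auto simp: indicator_def intro!: exI[of _ j])
    then show ?thesis using False by simp
  qed
  then have "(\<integral>x. indicator cell x *\<^sub>R wave (freq 0 k) x \<partial>lborel)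
      = (\<Prod>j\<in>UNIV. \<integral>t. indicator {-pi..pi} t *\<^sub>R cis (of_int (k j) * t) \<partial>lborel)"
    by (simp add: integral_prod_components[of "\<lambda>j t. indicator {-pi..pi} t *\<^sub>R cis (of_int (k j) * t)"]
        borel_integrable_compact continuous_intros)
  also have "\<dots> = (\<Prod>j\<in>UNIV. if k j = 0 then of_real (2 * pi) else 0)"
    by (simp only: integral_cis_period)
  also have "\<dots> = (if k = (\<lambda>_. 0) then of_real ((2 * pi) ^ CARD('n)) else 0)"
  proof (cases "k = (\<lambda>_. 0)")
    case False
    then obtain j where "k j \<noteq> 0" by auto
    then show ?thesis using False by (auto intro!: prod_zero)
  qed (simp add: prod_constant)
  finally show ?thesis .
qed

lemma integrable_cell:
  fixes f :: "real ^ 'n::finite \<Rightarrow> complex"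
  shows "continuous_on UNIV f \<Longrightarrow> integrable lborel (\<lambda>x. indicator cell x *\<^sub>R f x)"
  unfolding cell_cbox by (intro borel_integrable_compact compact_cbox) (rule continuous_on_subset, auto)

section \<open>Fejer kernels and completeness of the waves\<close>

definition cube :: "nat \<Rightarrow> ('n::finite \<Rightarrow> int) set" where
  "cube n = (\<Pi>\<^sub>E j\<in>UNIV. {0..<int n})"

lemma finite_cube [simp]: "finite (cube n)"
  by (simp add: cube_def finite_PiE)

lemma card_cube: "card (cube n :: ('n::finite \<Rightarrow> int) set) = n ^ CARD('n)"
  by (simp add: cube_def card_PiE)

text \<open>A unit step in direction \<open>j\<close> moves the fraction \<open>1 / n\<close> of the
  cube out of it. This is the relative defect of the corresponding coefficient of the Fejer kernel,
  and its smallness is what concentrates the kernel at 0.\<close>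

lemma card_cube_shift:
  assumes "n > 0"
  shows "real n * (real (card (cube n :: ('n::finite \<Rightarrow> int) set)) - real (card {a \<in> (cube n :: ('n \<Rightarrow> int) set). a(j := a j + 1) \<in> cube n}))
    = real (card (cube n :: ('n \<Rightarrow> int) set))"
proof -
  have eq: "{a \<in> (cube n :: ('n \<Rightarrow> int) set). a(j := a j + 1) \<in> cube n} = (\<Pi>\<^sub>E i\<in>UNIV. if i = j then {0..<int n - 1} else {0..<int n})"
  proof (intro set_eqI iffI)
    fix a :: "'n \<Rightarrow> int"
    assume a: "a \<in> {a \<in> cube n. a(j := a j + 1) \<in> cube n}"
    then have "0 \<le> a i \<and> a i < int n" "0 \<le> (a(j := a j + 1)) i \<and> (a(j := a j + 1)) i < int n" for i
      by (auto simp: cube_def PiE_iff)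
    then have "a i \<in> (if i = j then {0..<int n - 1} else {0..<int n})" for i
      by (metis (mono_tags, lifting) atLeastLessThan_iff fun_upd_same less_diff_eq)
    then show "a \<in> (\<Pi>\<^sub>E i\<in>UNIV. if i = j then {0..<int n - 1} else {0..<int n})"
      by (auto simp: PiE_iff)
  next
    fix a :: "'n \<Rightarrow> int"
    assume "a \<in> (\<Pi>\<^sub>E i\<in>UNIV. if i = j then {0..<int n - 1} else {0..<int n})"
    then have *: "a i \<in> (if i = j then {0..<int n - 1} else {0..<int n})" for i by (auto simp: PiE_iff)
    have "0 \<le> a i \<and> a i < int n" for i using *[of i] by (auto split: if_splits)
    moreover have "0 \<le> (a(j := a j + 1)) i \<and> (a(j := a j + 1)) i < int n" for i
      using *[of i] by (auto split: if_splits)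
    ultimately show "a \<in> {a \<in> cube n. a(j := a j + 1) \<in> cube n}"
      by (simp add: cube_def PiE_iff)
  qed
  have "card {a \<in> (cube n :: ('n \<Rightarrow> int) set). a(j := a j + 1) \<in> cube n} = (\<Prod>i\<in>UNIV. card (if i = j then {0..<int n - 1} else {0..<int n}))"
    unfolding eq by (simp add: card_PiE)
  also have "\<dots> = (n - 1) * n ^ (CARD('n) - 1)"
    by (subst prod.remove[of _ j]) (auto simp: prod_constant card_Diff_singleton nat_diff_distrib)
  finally have c: "card {a \<in> (cube n :: ('n \<Rightarrow> int) set). a(j := a j + 1) \<in> cube n} = (n - 1) * n ^ (CARD('n) - 1)" .
  have "CARD('n) = Suc (CARD('n) - 1)" by simp
  then have "card (cube n :: ('n \<Rightarrow> int) set) = n * n ^ (CARD('n) - 1)"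
    unfolding card_cube by (metis power_Suc)
  then show ?thesis unfolding c using assms by (simp add: of_nat_diff algebra_simps)
qed

text \<open>A Dirichlet sum, whose squared modulus is the Fejer kernel up to a factor. As a square
  it is nonnegative, and its coefficients count the pairs of points of the cube with a given
  difference.\<close>

definition fejer :: "nat \<Rightarrow> real ^ 'n::finite \<Rightarrow> complex" where
  "fejer n y = (\<Sum>a\<in>cube n. wave (freq 0 a) y)"

lemma freq_diff: "freq 0 (\<lambda>j. a j - b j) = freq 0 a - freq 0 b"
  by (simp add: vec_eq_iff)

lemma wave_diff: "wave (\<xi> - \<eta>) x = wave \<xi> x * wave (- \<eta>) x"
  by (simp add: wave_def cis_mult inner_diff_left)

lemma fejer_sq: "of_real ((norm (fejer n y))\<^sup>2) = (\<Sum>a\<in>cube n. \<Sum>b\<in>cube n. wave (freq 0 (\<lambda>j. a j - b j)) y)"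
  unfolding complex_norm_square fejer_def cnj_sum cnj_wave sum_product freq_diff wave_diff ..

lemma continuous_fejer: "continuous_on S (fejer n)"
  unfolding fejer_def[abs_def] by (intro continuous_on_sum continuous_wave)

lemma integral_fejer_wave:
  assumes "continuous_on UNIV (w :: real ^ 'n::finite \<Rightarrow> complex)"
  shows "(\<integral>y. indicator cell y *\<^sub>R (w y * of_real ((norm (fejer n y))\<^sup>2)) \<partial>lborel)
     = (\<Sum>a\<in>cube n. \<Sum>b\<in>cube n. \<integral>y. indicator cell y *\<^sub>R (w y * wave (freq 0 (\<lambda>j. a j - b j)) y) \<partial>lborel)"
proof -
  have i: "integrable lborel (\<lambda>y. indicator cell y *\<^sub>R (w y * wave \<xi> y))" for \<xi>
    by (intro integrable_cell continuous_on_mult assms continuous_wave)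
  have eq: "indicator cell y *\<^sub>R (w y * of_real ((norm (fejer n y))\<^sup>2))
     = (\<Sum>a\<in>cube n. \<Sum>b\<in>cube n. indicator cell y *\<^sub>R (w y * wave (freq 0 (\<lambda>j. a j - b j)) y))" for y
    unfolding fejer_sq by (simp add: sum_distrib_left scaleR_sum_right)
  show ?thesis unfolding eq
    by (subst Bochner_Integration.integral_sum, rule Bochner_Integration.integrable_sum, rule i)
      (intro sum.cong refl Bochner_Integration.integral_sum i)
qed

lemma integral_fejer: "(\<integral>y. indicator cell y *\<^sub>R of_real ((norm (fejer n y))\<^sup>2) \<partial>(lborel :: (real ^ 'n::finite) measure))
    = complex_of_real ((2 * pi) ^ CARD('n) * card (cube n :: ('n \<Rightarrow> int) set))"
proof -
  have "(\<integral>y. indicator cell y *\<^sub>R (1 * complex_of_real ((norm (fejer n y))\<^sup>2)) \<partial>(lborel :: (real ^ 'n) measure))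
    = (\<Sum>a\<in>cube n. \<Sum>b\<in>(cube n :: ('n \<Rightarrow> int) set). if b = a then of_real ((2 * pi) ^ CARD('n)) else 0)"
  proof -
    have "(\<lambda>j. a j - b j) = (\<lambda>_. 0) \<longleftrightarrow> b = a" for a b :: "'n \<Rightarrow> int" by (auto simp: fun_eq_iff)
    then show ?thesis
      by (subst integral_fejer_wave) (simp_all add: integral_cell_wave)
  qed
  then show ?thesis by (simp add: mult.commute)
qed

lemma integral_fejer_axis: "(\<integral>y. indicator cell y *\<^sub>R (wave (axis i 1) y * of_real ((norm (fejer n y))\<^sup>2)) \<partial>(lborel :: (real ^ 'n::finite) measure))
    = complex_of_real ((2 * pi) ^ CARD('n) * card {a \<in> (cube n :: ('n \<Rightarrow> int) set). a(i := a i + 1) \<in> cube n})"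
proof -
  have ww: "wave (axis i 1) y * wave (freq 0 (\<lambda>j. a j - b j)) y = wave (freq 0 (\<lambda>j. (a(i := a i + 1)) j - b j)) y"
    for a b :: "'n \<Rightarrow> int" and y
  proof -
    have "freq 0 (\<lambda>j. (a(i := a i + 1)) j - b j) = axis i 1 + freq 0 (\<lambda>j. a j - b j)"
      by (auto simp: vec_eq_iff axis_def)
    then show ?thesis by (simp add: wave_add)
  qed
  have "(\<integral>y. indicator cell y *\<^sub>R (wave (axis i 1) y * of_real ((norm (fejer n y))\<^sup>2)) \<partial>(lborel :: (real ^ 'n::finite) measure))
    = (\<Sum>a\<in>cube n. \<Sum>b\<in>(cube n :: ('n \<Rightarrow> int) set). if b = a(i := a i + 1) then of_real ((2 * pi) ^ CARD('n)) else 0)"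
  proof -
    have "(\<lambda>j. (a(i := a i + 1)) j - b j) = (\<lambda>_. 0) \<longleftrightarrow> b = a(i := a i + 1)" for a b :: "'n \<Rightarrow> int"
      by (auto simp: fun_eq_iff)
    then show ?thesis
      by (subst integral_fejer_wave[OF continuous_wave]) (simp_all only: ww integral_cell_wave)
  qed
  also have "\<dots> = (\<Sum>a\<in>(cube n :: ('n \<Rightarrow> int) set). if a(i := a i + 1) \<in> cube n then of_real ((2 * pi) ^ CARD('n)) else 0)"
    by (intro sum.cong refl) simp
  also have "\<dots> = complex_of_real ((2 * pi) ^ CARD('n) * card {a \<in> (cube n :: ('n \<Rightarrow> int) set). a(i := a i + 1) \<in> cube n})"
    by (subst sum.inter_filter[symmetric]) (simp_all add: mult.commute)
  finally show ?thesis .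
qed

text \<open>A majorant in the style of Korovkin. Near 0 continuity gives the bound \<open>e\<close>;
  elsewhere in the cell some \<open>1 - cos (y $ j)\<close> is at least a fixed
  \<open>c > 0\<close>, so a large multiple dominates the supremum of \<open>w\<close>. The majorant
  is a trigonometric polynomial of degree one and is integrated exactly against the Fejer
  kernel.\<close>

lemma fejer_concentration:
  fixes w :: "real ^ 'n::finite \<Rightarrow> complex"
  assumes "continuous_on UNIV w" "w 0 = 0" "e > 0"
  obtains M where "0 \<le> M" "\<And>y. y \<in> cell \<Longrightarrow> norm (w y) \<le> e + M * (\<Sum>j\<in>UNIV. 1 - cos (y $ j))"
proof -
  have c: "compact (cell :: (real ^ 'n) set)" unfolding cell_cbox by (rule compact_cbox)
  have "compact (w ` cell)"
    using continuous_on_subset[OF assms(1)] by (intro compact_continuous_image c) auto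
  then obtain W where "\<forall>z\<in>w ` cell. norm z \<le> W" using compact_imp_bounded bounded_iff by blast
  then have W: "\<And>y. y \<in> cell \<Longrightarrow> norm (w y) \<le> W" by blast
  obtain d where d: "d > 0" "\<And>y. norm y < d \<Longrightarrow> norm (w y) < e"
  proof -
    have "\<exists>d>0. \<forall>y. dist y 0 < d \<longrightarrow> dist (w y) (w 0) < e"
      using assms(1,3) unfolding continuous_on_iff by blast
    then show thesis using that assms(2) by auto
  qed
  \<comment> \<open>Coordinates of size at most \<open>t\<close> add up to less than
    \<open>d\<close>, and \<open>t \<le> 1\<close> keeps \<open>t\<close> below pi, where the cosine
    is monotone.\<close>
  define t where "t = min 1 (d / (2 * CARD('n)))"
  have "t \<le> 1" by (simp add: t_def)
  then have t: "t \<le> pi" using pi_gt3 by linarith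
  have t': "0 < t" "t * CARD('n) < d"
    using d(1) by (auto simp: t_def min_def field_simps)
  define c where "c = 1 - cos t"
  have c0: "c > 0" using cos_monotone_0_pi[of 0 t] t t' by (simp add: c_def)
  have bound: "norm (w y) \<le> e + \<bar>W\<bar> / c * (\<Sum>j\<in>UNIV. 1 - cos (y $ j))" if y: "y \<in> cell" for y
  proof (cases "\<forall>j. \<bar>y $ j\<bar> \<le> t")
    case True
    have "norm y \<le> (\<Sum>j\<in>UNIV. \<bar>y $ j\<bar>)" by (rule norm_le_l1_cart)
    also have "\<dots> \<le> (\<Sum>j\<in>(UNIV::'n set). t)" using True by (intro sum_mono) auto
    also have "\<dots> < d" using t' by (simp add: mult.commute)
    finally have "norm (w y) \<le> e" using d(2) by force
    moreover have "0 \<le> \<bar>W\<bar> / c * (\<Sum>j\<in>UNIV. 1 - cos (y $ j))"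
      using c0 by (intro mult_nonneg_nonneg sum_nonneg) auto
    ultimately show ?thesis by linarith
  next
    case False
    then obtain i where i: "t < \<bar>y $ i\<bar>" by (auto simp: not_le)
    have "\<bar>y $ i\<bar> \<le> pi" using y by (auto simp: cell_def abs_le_iff minus_le_iff)
    then have "cos \<bar>y $ i\<bar> \<le> cos t" using i t t' by (intro cos_monotone_0_pi_le) auto
    then have "c \<le> 1 - cos (y $ i)" by (simp add: c_def)
    also have "\<dots> \<le> (\<Sum>j\<in>UNIV. 1 - cos (y $ j))" by (rule member_le_sum) auto
    finally have "\<bar>W\<bar> / c * c \<le> \<bar>W\<bar> / c * (\<Sum>j\<in>UNIV. 1 - cos (y $ j))"
      using c0 by (intro mult_left_mono) auto
    then show ?thesis using W[OF y] c0 assms(3) by simp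
  qed
  show thesis by (rule that[of "\<bar>W\<bar> / c"]) (use bound c0 in auto)
qed

text \<open>Orthogonality kills the integral of \<open>w\<close> against the Fejer kernel, so
  \<open>w 0\<close> times the mass of the kernel is the integral of \<open>w 0 - w\<close> against
  it. By \<open>fejer_concentration\<close> this is at most \<open>e2\<close> times the mass plus
  multiples of the integrals of \<open>1 - cos (y $ j)\<close>, each of which is
  \<open>1 / n\<close> of the mass.\<close>

lemma zero_if_orthogonal:
  fixes w :: "real ^ 'n::finite \<Rightarrow> complex"
  assumes "continuous_on UNIV w"
    and orth: "\<And>l. (\<integral>y. indicator cell y *\<^sub>R (w y * wave (freq 0 l) y) \<partial>lborel) = 0"
  shows "w 0 = 0"
proof -
  let ?d = "(2 * pi) ^ CARD('n)"
  have d0: "?d > 0" by simp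
  have "norm (w 0) \<le> e" if e: "e > 0" for e
  proof -
    define e2 where "e2 = e / 2"
    have e2: "e2 > 0" using e by (simp add: e2_def)
    have "continuous_on UNIV (\<lambda>y. w 0 - w y)" by (intro continuous_intros assms(1))
    then obtain M where M: "0 \<le> M" "\<And>y. y \<in> cell \<Longrightarrow> norm (w 0 - w y) \<le> e2 + M * (\<Sum>j\<in>UNIV. 1 - cos (y $ j))"
      using fejer_concentration[of "\<lambda>y. w 0 - w y" e2] e2 by auto
    have key: "norm (w 0) * n \<le> e2 * n + M * CARD('n)" if n: "n > 0" for n :: nat
    proof -
      let ?N = "real (card (cube n :: ('n \<Rightarrow> int) set))"
      let ?F = "\<lambda>y::real ^ 'n. (norm (fejer n y))\<^sup>2"
      have N0: "?N > 0" using n by (simp add: card_cube)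
      have cF: "continuous_on UNIV ?F"
        by (intro continuous_intros continuous_fejer)
      have cFc: "continuous_on UNIV (\<lambda>y. of_real (?F y) :: complex)"
        by (intro continuous_intros continuous_fejer)
      have "(\<integral>y. indicator cell y *\<^sub>R ((w 0 - w y) * of_real (?F y)) \<partial>lborel)
          = (\<integral>y. indicator cell y *\<^sub>R (w 0 * of_real (?F y)) \<partial>lborel) - (\<integral>y. indicator cell y *\<^sub>R (w y * of_real (?F y)) \<partial>lborel)"
        unfolding left_diff_distrib scaleR_diff_right
        by (intro Bochner_Integration.integral_diff integrable_cell continuous_on_mult assms(1) cFc continuous_on_const)
      also have "(\<integral>y. indicator cell y *\<^sub>R (w y * of_real (?F y)) \<partial>lborel) = 0"
        using orth by (subst integral_fejer_wave[OF assms(1)]) simp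
      also have "(\<integral>y. indicator cell y *\<^sub>R (w 0 * of_real (?F y)) \<partial>lborel) = w 0 * (\<integral>y. indicator cell y *\<^sub>R of_real (?F y) \<partial>lborel)"
        by (subst integral_mult_right_zero[symmetric]) (simp add: mult.left_commute scaleR_conv_of_real)
      also have "\<dots> = w 0 * of_real (?d * ?N)" by (subst integral_fejer) simp
      finally have eq: "w 0 * of_real (?d * ?N) = (\<integral>y. indicator cell y *\<^sub>R ((w 0 - w y) * of_real (?F y)) \<partial>lborel)" by simp
      have ib: "integrable lborel (\<lambda>y::real ^ 'n. indicator cell y *\<^sub>R (g y :: real))" if "continuous_on UNIV g" for g
        unfolding cell_cbox by (intro borel_integrable_compact compact_cbox continuous_on_subset[OF that]) auto
      have "norm (w 0) * (?d * ?N) = norm (w 0 * of_real (?d * ?N))"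
        using N0 d0 by (simp add: norm_mult norm_power)
      also have "\<dots> \<le> (\<integral>y. indicator cell y *\<^sub>R ((e2 + M * (\<Sum>j\<in>UNIV. 1 - cos (y $ j))) * ?F y) \<partial>lborel)"
        unfolding eq
      proof (rule Bochner_Integration.integral_norm_bound_integral)
        show "integrable lborel (\<lambda>y. indicator cell y *\<^sub>R ((w 0 - w y) * of_real (?F y)))"
          by (intro integrable_cell continuous_intros assms(1) cFc)
        show "integrable lborel (\<lambda>y. indicator cell y *\<^sub>R ((e2 + M * (\<Sum>j\<in>UNIV. 1 - cos (y $ j))) * ?F y))"
          by (intro ib continuous_intros cF)
        show "norm (indicator cell y *\<^sub>R ((w 0 - w y) * of_real (?F y)))
            \<le> indicator cell y *\<^sub>R ((e2 + M * (\<Sum>j\<in>UNIV. 1 - cos (y $ j))) * ?F y)" for y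
          using M(2)[of y] by (auto simp: indicator_def norm_mult norm_power intro!: mult_right_mono)
      qed
      also have "\<dots> = Re (\<integral>y. indicator cell y *\<^sub>R (of_real (e2 + M * CARD('n)) * of_real (?F y)) \<partial>lborel)
          - (\<Sum>j\<in>UNIV. M * Re (\<integral>y. indicator cell y *\<^sub>R (wave (axis j 1) y * of_real (?F y)) \<partial>lborel))"
      proof -
        have i1: "integrable lborel (\<lambda>y. indicator cell y *\<^sub>R (of_real (e2 + M * CARD('n)) * of_real (?F y) :: complex))"
          by (intro integrable_cell continuous_intros cFc)
        have i2: "integrable lborel (\<lambda>y. indicator cell y *\<^sub>R (wave (axis j 1) y * of_real (?F y)))" for j
          by (intro integrable_cell continuous_intros continuous_wave cFc)
        have e: "indicator cell y *\<^sub>R ((e2 + M * (\<Sum>j\<in>UNIV. 1 - cos (y $ j))) * ?F y)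
          = Re (indicator cell y *\<^sub>R (of_real (e2 + M * CARD('n)) * of_real (?F y)))
          - (\<Sum>j\<in>UNIV. M * Re (indicator cell y *\<^sub>R (wave (axis j 1) y * of_real (?F y))))" for y
          by (simp add: wave_def inner_axis' sum_subtractf sum_distrib_left[symmetric] sum_distrib_right[symmetric] algebra_simps)
        have gen: "(\<integral>y. Re (A y) - (\<Sum>j\<in>UNIV. M * Re (B j y)) \<partial>lborel)
            = Re (\<integral>y. A y \<partial>lborel) - (\<Sum>j\<in>(UNIV :: 'n set). M * Re (\<integral>y. B j y \<partial>lborel))"
          if "integrable lborel A" "\<And>j. integrable lborel (B j)" for A and B :: "'n \<Rightarrow> real ^ 'n \<Rightarrow> complex"
          using that by simp
        show ?thesis unfolding e by (rule gen[OF i1 i2])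
      qed
      also have "\<dots> = (e2 + M * CARD('n)) * (?d * ?N)
          - (\<Sum>j\<in>(UNIV :: 'n set). M * (?d * card {a \<in> (cube n :: ('n \<Rightarrow> int) set). a(j := a j + 1) \<in> cube n}))"
      proof -
        have "(\<integral>y. indicator cell y *\<^sub>R (complex_of_real (e2 + M * CARD('n)) * of_real (?F y)) \<partial>lborel)
          = complex_of_real (e2 + M * CARD('n)) * (\<integral>y. indicator cell y *\<^sub>R of_real (?F y) \<partial>lborel)"
          by (subst integral_mult_right_zero[symmetric]) (simp add: mult.left_commute scaleR_conv_of_real)
        also have "\<dots> = complex_of_real ((e2 + M * CARD('n)) * (?d * ?N))"
          by (subst integral_fejer) simp
        finally show ?thesis unfolding integral_fejer_axis by (simp only: Re_complex_of_real)
      qed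
      also have "\<dots> = ?d * (e2 * ?N + (\<Sum>j\<in>(UNIV :: 'n set). M * (?N - card {a \<in> (cube n :: ('n \<Rightarrow> int) set). a(j := a j + 1) \<in> cube n})))"
        by (simp add: sum_subtractf sum_distrib_left[symmetric] algebra_simps)
      finally have "norm (w 0) * ?N \<le> e2 * ?N + (\<Sum>j\<in>(UNIV :: 'n set). M * (?N - card {a \<in> (cube n :: ('n \<Rightarrow> int) set). a(j := a j + 1) \<in> cube n}))"
        using d0 by (simp add: mult.left_commute)
      \<comment> \<open>Multiplication by \<open>n\<close> turns the defect of each shifted cube
        into the cardinality of the cube itself, which then cancels.\<close>
      then have "n * (norm (w 0) * ?N) \<le> n * (e2 * ?N + (\<Sum>j\<in>(UNIV :: 'n set). M * (?N - card {a \<in> (cube n :: ('n \<Rightarrow> int) set). a(j := a j + 1) \<in> cube n})))"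
        by (intro mult_left_mono) auto
      also have "\<dots> = n * (e2 * ?N) + (\<Sum>j\<in>(UNIV :: 'n set). M * (n * (?N - card {a \<in> (cube n :: ('n \<Rightarrow> int) set). a(j := a j + 1) \<in> cube n})))"
        by (simp add: distrib_left sum_distrib_left mult.left_commute)
      also have "\<dots> = n * (e2 * ?N) + CARD('n) * (M * ?N)"
        by (simp only: card_cube_shift[OF n]) simp
      finally have "?N * (norm (w 0) * n) \<le> ?N * (e2 * n + M * CARD('n))" by (simp add: algebra_simps)
      then show ?thesis using N0 by simp
    qed
    obtain n :: nat where n': "M * CARD('n) / e2 < n" using reals_Archimedean2 by blast
    have "0 \<le> M * CARD('n) / e2" using M(1) e2 by simp
    then have "0 < real n" using n' by linarith
    then have n: "n > 0" "M * CARD('n) \<le> e2 * n"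
      using n' e2 by (simp_all add: pos_divide_less_eq mult.commute)
    have "norm (w 0) * n \<le> e * n" using key[OF n(1)] n(2) by (simp add: e2_def field_simps)
    then show ?thesis using n(1) by simp
  qed
  \<comment> \<open>A nonzero value would be bounded by half of itself.\<close>
  from this[of "norm (w 0) / 2"] show ?thesis by (cases "w 0 = 0") auto
qed

section \<open>Inversion on a ball inside the cell\<close>

lemma ball_subset_cell: "ball 0 3 \<subseteq> cell"
proof
  fix x :: "real ^ 'n" assume x: "x \<in> ball 0 3"
  have "x $ j \<in> {-pi..pi}" for j
    using component_le_norm_cart[of x j] x pi_gt3 by (auto simp: abs_le_iff)
  then show "x \<in> cell" by (simp add: cell_def)
qed

lemma freq_uminus: "freq 0 (\<lambda>j. - l j) = - freq 0 l"
  by (simp add: vec_eq_iff)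

text \<open>As 3 is less than pi, the support lies inside the period cell, so \<phi> minus its
  series is orthogonal to all waves of the unshifted lattice and vanishes at 0. The point 0 is
  enough, since other points are reached by translation.\<close>

lemma ft_inversion_0:
  fixes \<phi> :: "real ^ 'n::finite \<Rightarrow> complex"
  assumes "\<phi> \<in> test_functions (ball 0 3)"
  shows "trig \<theta> (\<lambda>k. ft \<phi> (freq \<theta> k)) 0 = \<phi> 0"
proof -
  have base: "trig 0 (\<lambda>k. ft \<phi> (freq 0 k)) 0 = \<phi> 0" if \<phi>: "\<phi> \<in> test_functions (ball 0 3)" for \<phi> :: "real ^ 'n \<Rightarrow> complex"
  proof -
    let ?d = "complex_of_real ((2 * pi) ^ CARD('n))"
    define c where "c k = ft \<phi> (freq 0 k)" for k
    have rc: "rapid 0 c" unfolding c_def by (rule rapid_ft[OF \<phi>])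
    define w where "w x = \<phi> x - trig 0 c x" for x
    have cw: "continuous_on UNIV w"
      unfolding w_def by (intro continuous_on_diff smooth_continuous_on[OF test_smooth[OF \<phi>]] smooth_continuous_on[OF smooth_trig[OF rc]])
    have "(\<integral>y. indicator cell y *\<^sub>R (w y * wave (freq 0 l) y) \<partial>lborel) = 0" for l
    proof -
      let ?g = "\<lambda>y. indicator cell y *\<^sub>R wave (freq 0 l) y"
      have ig: "integrable lborel ?g" by (rule integrable_cell[OF continuous_wave])
      have i1: "integrable lborel (\<lambda>y. \<phi> y * wave (freq 0 l) y)" by (rule ft_integrable[OF \<phi>])
      have eq: "indicator cell y *\<^sub>R (w y * wave (freq 0 l) y) = \<phi> y * wave (freq 0 l) y - trig 0 c y * ?g y" for y
      proof (cases "y \<in> cell")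
        case False
        then have "\<phi> y = 0" using test_zero[OF \<phi>, of y] ball_subset_cell by blast
        then show ?thesis using False by simp
      qed (simp add: w_def algebra_simps)
      have i2: "integrable lborel (\<lambda>y. trig 0 c y * ?g y)"
      proof -
        have "integrable lborel (\<lambda>y. indicator cell y *\<^sub>R (trig 0 c y * wave (freq 0 l) y))"
          by (intro integrable_cell continuous_on_mult smooth_continuous_on[OF smooth_trig[OF rc]] continuous_wave)
        then show ?thesis by simp
      qed
      let ?m = "\<lambda>j. - l j"
      have "((\<lambda>k. c k * (\<integral>x. wave (freq 0 k) x * ?g x \<partial>lborel)) has_sum (\<integral>x. trig 0 c x * ?g x \<partial>lborel)) UNIV"
        by (rule integral_trig[OF rc ig])
      moreover have "(\<integral>x. wave (freq 0 k) x * ?g x \<partial>lborel) = (if k = ?m then ?d else 0)" for k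
      proof -
        have "wave (freq 0 k) x * ?g x = indicator cell x *\<^sub>R wave (freq 0 (\<lambda>j. k j + l j)) x" for x
        proof -
          have "freq 0 (\<lambda>j. k j + l j) = freq 0 k + freq 0 l" by (simp add: vec_eq_iff)
          then show ?thesis by (simp add: wave_add)
        qed
        moreover have "(\<lambda>j. k j + l j) = (\<lambda>_. 0) \<longleftrightarrow> k = ?m" by (simp add: fun_eq_iff eq_neg_iff_add_eq_0)
        ultimately show ?thesis by (simp only: integral_cell_wave)
      qed
      ultimately have "((\<lambda>k. c k * (if k = ?m then ?d else 0)) has_sum (\<integral>x. trig 0 c x * ?g x \<partial>lborel)) UNIV"
        by simp
      moreover have "((\<lambda>k. c k * (if k = ?m then ?d else 0)) has_sum (\<Sum>k\<in>{?m}. c k * (if k = ?m then ?d else 0))) {?m}"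
        by (rule has_sum_finite) simp
      then have "((\<lambda>k. c k * (if k = ?m then ?d else 0)) has_sum (\<Sum>k\<in>{?m}. c k * (if k = ?m then ?d else 0))) UNIV"
        by (rule has_sum_cong_neutral[THEN iffD1, rotated -1]) auto
      ultimately have "(\<integral>x. trig 0 c x * ?g x \<partial>lborel) = c ?m * ?d"
        using has_sum_unique by fastforce
      moreover have "(\<integral>y. \<phi> y * wave (freq 0 l) y \<partial>lborel) = c ?m * ?d"
        by (simp add: c_def ft_def freq_uminus)
      ultimately show ?thesis unfolding eq using i1 i2 by simp
    qed
    from zero_if_orthogonal[OF cw this] show ?thesis by (simp add: w_def c_def[abs_def])
  qed
  \<comment> \<open>Multiplication by \<open>wave (- \<theta>)\<close> moves the shifted lattice to
    the integer lattice and does not change the value at 0.\<close>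
  let ?\<psi> = "\<lambda>x. \<phi> x * wave (- \<theta>) x"
  have "trig 0 (\<lambda>k. ft ?\<psi> (freq 0 k)) 0 = ?\<psi> 0"
    by (rule base[OF test_mult[OF assms open_ball smooth_wave]])
  moreover have "ft ?\<psi> (freq 0 k) = ft \<phi> (freq \<theta> k)" for k
  proof -
    have "- freq \<theta> k = - \<theta> + - freq 0 k" by (simp add: vec_eq_iff)
    then have w: "wave (- freq \<theta> k) x = wave (- \<theta>) x * wave (- freq 0 k) x" for x
      using wave_add[of "- \<theta>" "- freq 0 k" x] by simp
    show ?thesis unfolding ft_def w mult.assoc ..
  qed
  ultimately show ?thesis by (simp add: trig_def)
qed

lemma ft_translate:
  assumes "\<phi> \<in> test_functions V"
  shows "ft (\<lambda>x. \<phi> (x + a)) \<xi> = wave \<xi> a * ft \<phi> \<xi>"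
proof -
  have "(\<integral>x. \<phi> (x + a) * wave (- \<xi>) (x + a) \<partial>lborel) = (\<integral>x. \<phi> x * wave (- \<xi>) x \<partial>lborel)"
    using integral_translation_lborel[of "\<lambda>x. \<phi> x * wave (- \<xi>) x"] borel_measurable_integrable[OF ft_integrable[OF assms]]
    by simp
  then have e1: "(\<integral>x. wave \<xi> a * (\<phi> (x + a) * wave (- \<xi>) (x + a)) \<partial>lborel) = wave \<xi> a * (\<integral>x. \<phi> x * wave (- \<xi>) x \<partial>lborel)"
    by simp
  have e2: "\<phi> (x + a) * wave (- \<xi>) x = wave \<xi> a * (\<phi> (x + a) * wave (- \<xi>) (x + a))" for x
    using wave_minus_cancel(2)[of \<xi> a] unfolding wave_add_right by algebra
  show ?thesis unfolding ft_def e2 e1 by simp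
qed

text \<open>Translating by \<open>x\<close> moves the support into a ball of radius
  \<open>norm x + r\<close>, where the inversion at 0 applies. The condition on \<open>x\<close>
  thus keeps away the periodic copies of the support.\<close>

lemma ft_inversion:
  fixes \<phi> :: "real ^ 'n::finite \<Rightarrow> complex"
  assumes "\<phi> \<in> test_functions (ball 0 r)" "norm x + r \<le> 3"
  shows "trig \<theta> (\<lambda>k. ft \<phi> (freq \<theta> k)) x = \<phi> x"
proof -
  have "(\<lambda>y. \<phi> (x + 1 *\<^sub>R y)) \<in> test_functions {y. x + 1 *\<^sub>R y \<in> ball 0 r}"
    by (rule test_affine[OF assms(1)]) simp
  then have "(\<lambda>y. \<phi> (y + x)) \<in> test_functions {y. x + y \<in> ball 0 r}" by (simp add: add.commute)
  moreover have "{y. x + y \<in> ball 0 r} \<subseteq> ball 0 3"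
  proof
    fix y assume "y \<in> {y. x + y \<in> ball 0 r}"
    then have "norm (x + y) < r" by simp
    moreover have "norm y \<le> norm (x + y) + norm x" by (metis add_diff_cancel_left' norm_triangle_ineq4)
    ultimately show "y \<in> ball 0 3" using assms(2) by simp
  qed
  ultimately have "(\<lambda>y. \<phi> (y + x)) \<in> test_functions (ball 0 3)"
    by (rule test_mono)
  from ft_inversion_0[OF this, of \<theta>]
  have "trig \<theta> (\<lambda>k. ft (\<lambda>y. \<phi> (y + x)) (freq \<theta> k)) 0 = \<phi> (0 + x)" .
  then show ?thesis by (simp add: trig_def ft_translate[OF assms(1)] mult.commute)
qed

section \<open>Fourier coefficients of products\<close>

lemma ft_trig_mult:
  assumes "rapid \<theta> a" "\<zeta> \<in> test_functions V"
  shows "((\<lambda>k. a k * ft \<zeta> (\<xi> - freq \<theta> k)) has_sum ft (\<lambda>x. \<zeta> x * trig \<theta> a x) \<xi>) UNIV"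
proof -
  have w: "wave (freq \<theta> k) x * (\<zeta> x * wave (- \<xi>) x) = \<zeta> x * wave (- (\<xi> - freq \<theta> k)) x" for k x
    using wave_add[of "freq \<theta> k" "- \<xi>" x] by simp
  have "((\<lambda>k. a k * (\<integral>x. wave (freq \<theta> k) x * (\<zeta> x * wave (- \<xi>) x) \<partial>lborel)) has_sum
      (\<integral>x. trig \<theta> a x * (\<zeta> x * wave (- \<xi>) x) \<partial>lborel)) UNIV"
    by (rule integral_trig[OF assms(1) ft_integrable[OF assms(2)]])
  from has_sum_cmult_left[OF this, of "1 / of_real ((2 * pi) ^ CARD('a))"]
  show ?thesis unfolding w by (simp add: ft_def mult_ac)
qed

text \<open>The coefficients of the product arise by convolution with the summable coefficients of
  \<zeta>, so bounded coefficients stay bounded, with a constant that depends on \<zeta> alone. This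
  is how a bounded but not summable sequence such as \<open>1 / P(k)\<close> still yields an
  estimate that is uniform in the regularisation.\<close>

lemma ft_trig_mult_bound:
  assumes "\<zeta> \<in> test_functions V"
  obtains C where "0 \<le> C" "\<And>\<theta> a B k. rapid \<theta> a \<Longrightarrow> (\<And>k. norm (a k) \<le> B) \<Longrightarrow> norm (ft (\<lambda>x. \<zeta> x * trig \<theta> a x) (freq \<theta> k)) \<le> C * B"
proof
  let ?f = "\<lambda>l. norm (ft \<zeta> (freq 0 l))"
  let ?C = "\<Sum>\<^sub>\<infinity>l. ?f l"
  have s: "?f summable_on UNIV" by (rule rapid_norm_summable[OF rapid_ft[OF assms]])
  show "0 \<le> ?C" by (intro infsum_nonneg) auto
  fix \<theta> :: "real ^ 'a" and a B and k :: "'a \<Rightarrow> int"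
  assume a: "rapid \<theta> a" and B: "\<And>k. norm (a k) \<le> B"
  \<comment> \<open>For fixed \<open>k\<close> the differences \<open>k - l\<close> run exactly once
    through the integer lattice, and the shift \<theta> cancels in them.\<close>
  have bij: "bij_betw (\<lambda>l j. k j - l j) UNIV UNIV"
    by (rule bij_betwI[where g = "\<lambda>l j. k j - l j"]) (auto simp: fun_eq_iff)
  have "((\<lambda>l. ?f (\<lambda>j. k j - l j)) has_sum ?C) UNIV"
    using has_sum_reindex_bij_betw[OF bij, of ?f ?C] has_sum_infsum[OF s] by simp
  then have 2: "((\<lambda>l. ?f (\<lambda>j. k j - l j) * B) has_sum (?C * B)) UNIV" by (rule has_sum_cmult_left)
  have fr: "freq \<theta> k - freq \<theta> l = freq 0 (\<lambda>j. k j - l j)" for l by (simp add: vec_eq_iff)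
  show "norm (ft (\<lambda>x. \<zeta> x * trig \<theta> a x) (freq \<theta> k)) \<le> ?C * B"
  proof (rule norm_infsum_le[OF ft_trig_mult[OF a assms] 2])
    fix l
    show "norm (a l * ft \<zeta> (freq \<theta> k - freq \<theta> l)) \<le> ?f (\<lambda>j. k j - l j) * B"
      unfolding fr norm_mult using B[of l] by (subst mult.commute) (intro mult_left_mono, auto)
  qed
qed

text \<open>A weighted convolution bound, by Peetre's inequality
  \<open>1 + norm (y + z) \<le> (1 + norm y) * (1 + norm z)\<close>. The radius 3/2 lets the series
  of \<psi> represent \<psi> on the whole support of \<phi>: a point of norm below 3/2 and a support
  of radius 3/2 meet the condition of \<open>ft_inversion\<close>.\<close>

lemma ft_mult_bound:
  fixes \<psi> :: "real ^ 'n::finite \<Rightarrow> complex"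
  assumes "\<psi> \<in> test_functions (ball 0 (3/2))"
  shows "\<exists>C\<ge>0. \<forall>\<theta> (\<phi> :: real ^ 'n \<Rightarrow> complex) B. \<phi> \<in> test_functions (ball 0 (3/2)) \<longrightarrow>
      (\<forall>k. (1 + norm (freq \<theta> k)) ^ s * norm (ft \<phi> (freq \<theta> k)) \<le> B) \<longrightarrow>
      (\<forall>k. (1 + norm (freq \<theta> k)) ^ s * norm (ft (\<lambda>x. \<psi> x * \<phi> x) (freq \<theta> k)) \<le> C * B)"
proof (intro exI conjI allI impI)
  let ?a = "\<lambda>l. ft \<psi> (freq 0 l)"
  let ?C = "\<Sum>\<^sub>\<infinity>l. norm (?a l) * (1 + norm (freq 0 l)) ^ s"
  have r: "rapid 0 ?a" by (rule rapid_ft[OF assms])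
  have s: "(\<lambda>l. norm (?a l) * (1 + norm (freq 0 l)) ^ s) summable_on UNIV" by (rule rapid_summable[OF r])
  show "0 \<le> ?C" by (intro infsum_nonneg) auto
  fix \<theta> :: "real ^ 'n" and \<phi> :: "real ^ 'n \<Rightarrow> complex" and B k
  assume \<phi>: "\<phi> \<in> test_functions (ball 0 (3/2))"
    and B: "\<forall>k. (1 + norm (freq \<theta> k)) ^ s * norm (ft \<phi> (freq \<theta> k)) \<le> B"
  have "\<psi> x * \<phi> x = \<phi> x * trig 0 ?a x" for x
  proof (cases "x \<in> ball 0 (3/2)")
    case True
    then show ?thesis using ft_inversion[OF assms, of x 0] by simp
  qed (use test_zero[OF \<phi>] in auto)
  then have eq: "(\<lambda>x. \<psi> x * \<phi> x) = (\<lambda>x. \<phi> x * trig 0 ?a x)" by (rule ext)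
  let ?x = "freq \<theta> k"
  have "norm (ft (\<lambda>x. \<psi> x * \<phi> x) ?x) \<le> (?C * B) / (1 + norm ?x) ^ s"
    unfolding eq
  proof (rule norm_infsum_le[OF ft_trig_mult[OF r \<phi>, of ?x]])
    show "((\<lambda>l. norm (?a l) * (1 + norm (freq 0 l)) ^ s * (B / (1 + norm ?x) ^ s)) has_sum (?C * B) / (1 + norm ?x) ^ s) UNIV"
      using has_sum_cmult_left[OF has_sum_infsum[OF s], of "B / (1 + norm ?x) ^ s"] by simp
    fix l :: "'n \<Rightarrow> int"
    let ?y = "freq \<theta> (\<lambda>j. k j - l j)" and ?z = "freq (0 :: real ^ 'n) l"
    have xyz: "?x = ?z + ?y" and yxz: "?x - ?z = ?y" by (simp_all add: vec_eq_iff)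
    have "1 + norm ?x \<le> (1 + norm ?z) * (1 + norm ?y)"
      unfolding xyz using norm_triangle_ineq[of ?z ?y] mult_nonneg_nonneg[OF norm_ge_zero norm_ge_zero, of ?z ?y]
      unfolding distrib_left distrib_right mult_1_left mult_1_right by linarith
    then have "(1 + norm ?x) ^ s \<le> ((1 + norm ?z) * (1 + norm ?y)) ^ s" by (intro power_mono) auto
    then have "norm (ft \<phi> ?y) * (1 + norm ?x) ^ s \<le> norm (ft \<phi> ?y) * ((1 + norm ?z) ^ s * (1 + norm ?y) ^ s)"
      by (intro mult_left_mono) (auto simp: power_mult_distrib)
    also have "\<dots> = (1 + norm ?z) ^ s * ((1 + norm ?y) ^ s * norm (ft \<phi> ?y))" by (simp add: mult_ac)
    also have "\<dots> \<le> (1 + norm ?z) ^ s * B" using B by (intro mult_left_mono) auto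
    finally have "norm (ft \<phi> ?y) \<le> (1 + norm ?z) ^ s * (B / (1 + norm ?x) ^ s)"
      by (simp add: pos_le_divide_eq add_pos_nonneg)
    then show "norm (?a l * ft \<phi> (?x - ?z)) \<le> norm (?a l) * (1 + norm ?z) ^ s * (B / (1 + norm ?x) ^ s)"
      unfolding yxz norm_mult mult.assoc by (intro mult_left_mono) auto
  qed
  then show "(1 + norm ?x) ^ s * norm (ft (\<lambda>x. \<psi> x * \<phi> x) ?x) \<le> ?C * B"
    by (simp add: pos_le_divide_eq add_pos_nonneg mult.commute)
qed

text \<open>Symmetry of second derivatives by Fourier inversion: after localisation near
  \<open>x\<close> through a rescaling and a cutoff, both orders multiply the Fourier coefficients
  by the same product of coordinates.\<close>

lemma D_op_commute:
  assumes "open S" "u \<in> smooth_functions S" "x \<in> S"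
  shows "D_op i (D_op j u) x = D_op j (D_op i u) x"
proof -
  obtain t where t: "t > 0" "ball x t \<subseteq> S" using assms open_contains_ball by blast
  let ?v = "\<lambda>y. u (x + t *\<^sub>R y)"
  have sub: "ball 0 1 \<subseteq> {y. x + t *\<^sub>R y \<in> S}"
    using t by (auto simp: subset_iff dist_norm)
  have v: "?v \<in> smooth_functions (ball 0 1)" by (rule smooth_subset[OF sub smooth_affine[OF assms(1,2)]])
  obtain \<zeta> :: "real ^ 'a \<Rightarrow> complex" and U where \<zeta>: "\<zeta> \<in> test_functions (ball 0 1)" "open U" "{0} \<subseteq> U" "\<And>x. x \<in> U \<Longrightarrow> \<zeta> x = 1"
    using cutoff[of "{0}" "ball 0 1"] by auto
  let ?\<phi> = "\<lambda>y. \<zeta> y * ?v y"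
  have \<phi>: "?\<phi> \<in> test_functions (ball 0 1)" by (rule test_mult[OF \<zeta>(1) open_ball v])
  have "ft (Dw [i, j] ?\<phi>) \<xi> = ft (Dw [j, i] ?\<phi>) \<xi>" for \<xi>
    by (simp only: ft_Dw[OF \<phi>]) (simp add: mult_ac)
  then have "Dw [i, j] ?\<phi> 0 = Dw [j, i] ?\<phi> 0"
    using ft_inversion[OF test_Dw[OF \<phi>], of 0 0 "[i, j]"] ft_inversion[OF test_Dw[OF \<phi>], of 0 0 "[j, i]"] by simp
  moreover have Dwt: "Dw w ?\<phi> 0 = of_real t ^ length w * Dw w u x" for w
  proof -
    have "Dw w ?\<phi> 0 = Dw w ?v 0"
      by (rule Dw_cong[OF \<zeta>(2)]) (use \<zeta> in auto)
    also have "\<dots> = of_real t ^ length w * Dw w u x"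
      using Dw_affine[OF assms(1,2), of x t 0 w] assms(3) by simp
    finally show ?thesis .
  qed
  ultimately show ?thesis using t Dwt[of "[i, j]"] Dwt[of "[j, i]"] by simp
qed

section \<open>Interior estimates for solutions of elliptic equations\<close>

definition Lop :: "'n list set \<Rightarrow> ('n list \<Rightarrow> complex) \<Rightarrow> (real ^ 'n::finite \<Rightarrow> complex) \<Rightarrow> real ^ 'n \<Rightarrow> complex" where
  "Lop W c u x = (\<Sum>w\<in>W. c w * Dw w u x)"

definition symb :: "'n list set \<Rightarrow> ('n list \<Rightarrow> complex) \<Rightarrow> real ^ 'n::finite \<Rightarrow> complex" where
  "symb W c \<xi> = (\<Sum>w\<in>W. c w * (\<Prod>j\<leftarrow>w. of_real (\<xi> $ j)))"

definition Ker :: "'n list set \<Rightarrow> ('n list \<Rightarrow> complex) \<Rightarrow> (real ^ 'n::finite) set \<Rightarrow> (real ^ 'n \<Rightarrow> complex) set" where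
  "Ker W c V = {u \<in> smooth_functions V. \<forall>x\<in>V. Lop W c u x = 0}"

lemma Ker_smooth: "u \<in> Ker W c V \<Longrightarrow> u \<in> smooth_functions V"
  by (simp add: Ker_def)

lemma Ker_subset: "u \<in> Ker W c V \<Longrightarrow> U \<subseteq> V \<Longrightarrow> u \<in> Ker W c U"
  by (auto simp: Ker_def intro: smooth_subset)

lemma Ker_cong:
  assumes "open V" "\<And>x. x \<in> V \<Longrightarrow> u x = v x" "u \<in> Ker W c V"
  shows "v \<in> Ker W c V"
proof -
  have "Dw w v x = Dw w u x" if "x \<in> V" for w x
    using Dw_cong[OF assms(1), of v u x w] assms(2) that by simp
  then show ?thesis using assms(3) smooth_cong[OF assms(1,2)]
    by (auto simp: Ker_def Lop_def)
qed

lemma Ker_cmult: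
  assumes "open V" "u \<in> Ker W c V"
  shows "(\<lambda>x. a * u x) \<in> Ker W c V"
proof -
  have "Lop W c (\<lambda>x. a * u x) x = a * Lop W c u x" if "x \<in> V" for x
    using that by (simp add: Lop_def Dw_cmult[OF assms(1) Ker_smooth[OF assms(2)]] sum_distrib_left mult_ac)
  then show ?thesis using assms by (auto simp: Ker_def smooth_cmult)
qed

lemma Ker_add:
  assumes "open V" "u \<in> Ker W c V" "v \<in> Ker W c V"
  shows "(\<lambda>x. u x + v x) \<in> Ker W c V"
proof -
  have "Lop W c (\<lambda>x. u x + v x) x = Lop W c u x + Lop W c v x" if "x \<in> V" for x
    using that by (simp add: Lop_def Dw_add[OF assms(1) Ker_smooth[OF assms(2)] Ker_smooth[OF assms(3)]] sum.distrib distrib_left)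
  then show ?thesis using assms by (auto simp: Ker_def smooth_add)
qed

lemma Ker_zero: "(\<lambda>x. 0) \<in> Ker W c V"
  by (simp add: Ker_def Lop_def smooth_const)

lemma Ker_sum:
  "open V \<Longrightarrow> (\<And>i. i \<in> I \<Longrightarrow> f i \<in> Ker W c V) \<Longrightarrow> (\<lambda>x. \<Sum>i\<in>I. f i x) \<in> Ker W c V"
  by (induction I rule: infinite_finite_induct) (simp_all add: Ker_zero Ker_add)

lemma Ker_diff: "open V \<Longrightarrow> u \<in> Ker W c V \<Longrightarrow> v \<in> Ker W c V \<Longrightarrow> (\<lambda>x. u x - v x) \<in> Ker W c V"
  using Ker_add[of V u W c "\<lambda>x. (-1) * v x"] Ker_cmult[of V v W c "-1"] by simp

lemma Dw_D_op:
  assumes "open S" "u \<in> smooth_functions S" "x \<in> S"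
  shows "Dw w (D_op j u) x = D_op j (Dw w u) x"
  using assms(3)
proof (induction w arbitrary: x)
  case (Cons i w)
  have "D_op i (Dw w (D_op j u)) x = D_op i (D_op j (Dw w u)) x"
    by (rule D_op_cong[OF assms(1) Cons.prems Cons.IH])
  also have "\<dots> = D_op j (D_op i (Dw w u)) x"
    by (rule D_op_commute[OF assms(1) smooth_Dw[OF assms(1,2)] Cons.prems])
  finally show ?case by simp
qed simp

lemma D_op_sum:
  "(\<And>i. i \<in> I \<Longrightarrow> f i differentiable (at x)) \<Longrightarrow> D_op j (\<lambda>x. \<Sum>i\<in>I. f i x) x = (\<Sum>i\<in>I. D_op j (f i) x)"
proof (induction I rule: infinite_finite_induct)
  case (insert i I)
  have "(\<lambda>x. \<Sum>i\<in>I. f i x) differentiable (at x)"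
    using insert by (intro differentiable_sum) auto
  then show ?case using insert D_op_add[of "f i" x "\<lambda>x. \<Sum>i\<in>I. f i x" j] by simp
qed simp_all

lemma Ker_D_op:
  assumes "open V" "u \<in> Ker W c V"
  shows "D_op j u \<in> Ker W c V"
proof -
  have su: "u \<in> smooth_functions V" by (rule Ker_smooth[OF assms(2)])
  have "Lop W c (D_op j u) x = 0" if x: "x \<in> V" for x
  proof -
    have d: "Dw w u differentiable (at x)" for w
      by (rule smooth_differentiable[OF smooth_Dw[OF assms(1) su] x])
    have "Lop W c (D_op j u) x = (\<Sum>w\<in>W. D_op j (\<lambda>x. c w * Dw w u x) x)"
      by (simp add: Lop_def Dw_D_op[OF assms(1) su x] D_op_cmult[OF d])
    also have "\<dots> = D_op j (\<lambda>x. Lop W c u x) x"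
      unfolding Lop_def by (rule D_op_sum[symmetric]) (intro differentiable_mult differentiable_const d)
    also have "\<dots> = D_op j (\<lambda>x. 0) x"
      by (rule D_op_cong[OF assms(1) x]) (use assms in \<open>auto simp: Ker_def\<close>)
    finally show ?thesis by simp
  qed
  then show ?thesis using smooth_D_op[OF assms(1) su] by (simp add: Ker_def)
qed

lemma Ker_Dw: "open V \<Longrightarrow> u \<in> Ker W c V \<Longrightarrow> Dw w u \<in> Ker W c V"
  by (induction w) (simp_all add: Ker_D_op)

text \<open>The coefficients of the rescaled operator are fixed only up to a common factor
  \<open>b\<close>. With \<open>b\<close> equal to the power \<open>m\<close> of the scale,
  coefficients of order \<open>m\<close> stay as they are and those of lower order become small;
  with \<open>b = 1\<close> the operator is transported exactly.\<close>

lemma Ker_affine: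
  assumes "open V" "u \<in> Ker W c V" and c': "\<And>w. w \<in> W \<Longrightarrow> c' w * of_real t ^ length w = b * c w"
  shows "(\<lambda>x. u (a + t *\<^sub>R x)) \<in> Ker W c' {x. a + t *\<^sub>R x \<in> V}"
proof -
  have "Lop W c' (\<lambda>x. u (a + t *\<^sub>R x)) x = b * Lop W c u (a + t *\<^sub>R x)" if x: "a + t *\<^sub>R x \<in> V" for x
    unfolding Lop_def sum_distrib_left
    by (intro sum.cong refl)
      (simp add: Dw_affine[OF assms(1) Ker_smooth[OF assms(2)] x] mult.assoc[symmetric] c')
  then show ?thesis
    using assms smooth_affine[OF assms(1) Ker_smooth[OF assms(2)]] by (auto simp: Ker_def)
qed

section \<open>Commutators with cutoffs and the elliptic bootstrap\<close>

lemma D_op_test_mult: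
  assumes "\<zeta> \<in> test_functions V" "open V" "v \<in> smooth_functions V"
  shows "D_op j (\<lambda>x. \<zeta> x * v x) x = D_op j \<zeta> x * v x + \<zeta> x * D_op j v x"
proof (cases "x \<in> V")
  case True
  then show ?thesis
    by (intro D_op_mult smooth_differentiable[OF test_smooth[OF assms(1)] True] smooth_differentiable[OF assms(3)])
next
  case False
  then show ?thesis
    using test_zero[OF assms(1) False] test_zero[OF test_D_op[OF assms(1)] False]
      test_zero[OF test_D_op[OF test_mult[OF assms]] False] by simp
qed

lemma norm_add_diff_le: "norm (a + b - c) \<le> norm a + norm b + norm c" for a b c :: "'a::real_normed_vector"
  using norm_triangle_ineq4[of "a + b" c] norm_triangle_ineq[of a b] by linarith

text \<open>Each derivative that falls on the cutoff gains a factor \<open>1 + |\<xi>|\<close>.\<close>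

lemma commutator_bound:
  assumes "open V" "u \<in> smooth_functions V"
  shows "\<zeta> \<in> test_functions V \<Longrightarrow> (\<And>\<gamma>. length \<gamma> \<le> length w \<Longrightarrow> norm (ft (\<lambda>x. Dw \<gamma> \<zeta> x * u x) \<xi>) \<le> B) \<Longrightarrow>
    (1 + norm \<xi>) * norm (ft (\<lambda>x. Dw w (\<lambda>y. \<zeta> y * u y) x - \<zeta> x * Dw w u x) \<xi>)
      \<le> (2 ^ length w - 1) * B * (1 + norm \<xi>) ^ length w"
proof (induction w arbitrary: \<zeta>)
  case (Cons j w)
  let ?R = "\<lambda>\<zeta> x. Dw w (\<lambda>y. \<zeta> y * u y) x - \<zeta> x * Dw w u x"
  let ?n = "length w" and ?X = "1 + norm \<xi>" and ?C = "2 ^ length w - 1 :: real"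
  have X: "?X \<ge> 1" "norm \<xi> \<le> ?X" by auto
  have tu: "(\<lambda>y. \<eta> y * u y) \<in> test_functions V" if "\<eta> \<in> test_functions V" for \<eta>
    by (rule test_mult[OF that assms])
  have tQ: "(\<lambda>y. \<eta> y * Dw w u y) \<in> test_functions V" if "\<eta> \<in> test_functions V" for \<eta>
    by (rule test_mult[OF that assms(1) smooth_Dw[OF assms]])
  have tR: "?R \<eta> \<in> test_functions V" if "\<eta> \<in> test_functions V" for \<eta>
    by (intro test_diff test_Dw tu tQ that)
  have B: "0 \<le> B" using order_trans[OF norm_ge_zero Cons.prems(2)[of "[]"]] by simp
  have dz: "D_op j \<zeta> \<in> test_functions V" by (rule test_D_op[OF Cons.prems(1)])
  \<comment> \<open>The term in which \<open>D_op j\<close> hits the cutoff is rewritten by the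
    commutator for \<open>D_op j \<zeta>\<close>, to which the induction hypothesis applies again.
    Two commutators and one direct term turn a constant \<open>a\<close> into
    \<open>2 * a + 1\<close>, whence \<open>2 ^ length w - 1\<close>.\<close>
  have eq: "Dw (j # w) (\<lambda>y. \<zeta> y * u y) x - \<zeta> x * Dw (j # w) u x
      = (D_op j (?R \<zeta>) x + Dw w (\<lambda>y. D_op j \<zeta> y * u y) x) - ?R (D_op j \<zeta>) x" for x
  proof -
    have "D_op j (?R \<zeta>) x = D_op j (Dw w (\<lambda>y. \<zeta> y * u y)) x - D_op j (\<lambda>y. \<zeta> y * Dw w u y) x"
      by (intro D_op_diff smooth_differentiable[OF test_smooth, of _ V x UNIV] test_Dw tu tQ Cons.prems) auto
    then show ?thesis
      using D_op_test_mult[OF Cons.prems(1) assms(1) smooth_Dw[OF assms], of j w x] by simp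
  qed
  have "ft (\<lambda>x. Dw (j # w) (\<lambda>y. \<zeta> y * u y) x - \<zeta> x * Dw (j # w) u x) \<xi>
      = of_real (\<xi> $ j) * ft (?R \<zeta>) \<xi> + (\<Prod>j\<leftarrow>w. of_real (\<xi> $ j)) * ft (\<lambda>y. D_op j \<zeta> y * u y) \<xi> - ft (?R (D_op j \<zeta>)) \<xi>"
    unfolding eq
    by (subst ft_diff[OF test_add[OF test_D_op[OF tR[OF Cons.prems(1)]] test_Dw[OF tu[OF dz]]] tR[OF dz]],
        subst ft_add[OF test_D_op[OF tR[OF Cons.prems(1)]] test_Dw[OF tu[OF dz]]])
      (simp only: ft_D_op[OF tR[OF Cons.prems(1)]] ft_Dw[OF tu[OF dz]])
  then have "?X * norm (ft (\<lambda>x. Dw (j # w) (\<lambda>y. \<zeta> y * u y) x - \<zeta> x * Dw (j # w) u x) \<xi>)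
    \<le> ?X * (norm (of_real (\<xi> $ j) * ft (?R \<zeta>) \<xi>) + norm ((\<Prod>j\<leftarrow>w. of_real (\<xi> $ j)) * ft (\<lambda>y. D_op j \<zeta> y * u y) \<xi>)
      + norm (ft (?R (D_op j \<zeta>)) \<xi>))"
    using X by (simp only:) (intro mult_left_mono norm_add_diff_le, simp)
  also have "\<dots> \<le> norm \<xi> * (?X * norm (ft (?R \<zeta>) \<xi>)) + ?X * (norm \<xi> ^ ?n * norm (ft (\<lambda>y. D_op j \<zeta> y * u y) \<xi>))
      + ?X * norm (ft (?R (D_op j \<zeta>)) \<xi>)"
  proof -
    have "norm (of_real (\<xi> $ j) * ft (?R \<zeta>) \<xi>) \<le> norm \<xi> * norm (ft (?R \<zeta>) \<xi>)"
      unfolding norm_mult norm_of_real by (intro mult_right_mono component_le_norm_cart) auto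
    moreover have "norm ((\<Prod>j\<leftarrow>w. of_real (\<xi> $ j)) * ft (\<lambda>y. D_op j \<zeta> y * u y) \<xi>)
        \<le> norm \<xi> ^ ?n * norm (ft (\<lambda>y. D_op j \<zeta> y * u y) \<xi>)"
      unfolding norm_mult by (intro mult_right_mono norm_word_prod_le) auto
    ultimately have "?X * (norm (of_real (\<xi> $ j) * ft (?R \<zeta>) \<xi>) + norm ((\<Prod>j\<leftarrow>w. of_real (\<xi> $ j)) * ft (\<lambda>y. D_op j \<zeta> y * u y) \<xi>)
      + norm (ft (?R (D_op j \<zeta>)) \<xi>)) \<le> ?X * (norm \<xi> * norm (ft (?R \<zeta>) \<xi>) + norm \<xi> ^ ?n * norm (ft (\<lambda>y. D_op j \<zeta> y * u y) \<xi>)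
      + norm (ft (?R (D_op j \<zeta>)) \<xi>))"
      using X by (intro mult_left_mono add_mono) auto
    then show ?thesis by (simp add: algebra_simps)
  qed
  also have "\<dots> \<le> ?X * (?C * B * ?X ^ ?n) + ?X * (?X ^ ?n * B) + ?X * (?C * B * ?X ^ ?n)"
  proof (intro add_mono)
    have "?X * norm (ft (?R \<zeta>) \<xi>) \<le> ?C * B * ?X ^ ?n"
      by (rule Cons.IH[OF Cons.prems(1)]) (use Cons.prems(2) in auto)
    then show "norm \<xi> * (?X * norm (ft (?R \<zeta>) \<xi>)) \<le> ?X * (?C * B * ?X ^ ?n)"
      by (rule mult_mono[OF X(2)]) auto
    have "norm (ft (\<lambda>y. D_op j \<zeta> y * u y) \<xi>) \<le> B" using Cons.prems(2)[of "[j]"] by simp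
    then show "?X * (norm \<xi> ^ ?n * norm (ft (\<lambda>y. D_op j \<zeta> y * u y) \<xi>)) \<le> ?X * (?X ^ ?n * B)"
      using mult_mono[OF power_mono[OF X(2), of ?n], of "norm (ft (\<lambda>y. D_op j \<zeta> y * u y) \<xi>)" B]
      by (intro mult_left_mono) auto
    have "?X * norm (ft (?R (D_op j \<zeta>)) \<xi>) \<le> ?C * B * ?X ^ ?n"
    proof (rule Cons.IH[OF dz])
      fix \<gamma> :: "'a list" assume "length \<gamma> \<le> length w"
      then show "norm (ft (\<lambda>x. Dw \<gamma> (D_op j \<zeta>) x * u x) \<xi>) \<le> B" using Cons.prems(2)[of "\<gamma> @ [j]"] by simp
    qed
    also have "\<dots> \<le> ?X * (?C * B * ?X ^ ?n)"
    proof -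
      have "0 \<le> ?C * B * ?X ^ ?n" using B X by (intro mult_nonneg_nonneg) auto
      from mult_right_mono[OF X(1) this] show ?thesis by simp
    qed
    finally show "?X * norm (ft (?R (D_op j \<zeta>)) \<xi>) \<le> ?X * (?C * B * ?X ^ ?n)" .
  qed
  also have "\<dots> = (2 ^ length (j # w) - 1) * B * ?X ^ length (j # w)" by (simp add: algebra_simps)
  finally show ?case .
qed simp

text \<open>Since \<open>u\<close> is a solution, \<open>symb W c \<xi>\<close> times the transform
  of \<open>\<zeta> u\<close> consists of commutators only. These are smaller by one power of
  \<open>1 + norm \<xi>\<close>, and the lower bound of order \<open>m\<close> for the symbol turns
  this into a gain of one power.\<close>

lemma bootstrap_at:
  fixes \<xi> :: "real ^ 'n::finite" and A B \<kappa> :: real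
  assumes V: "open V" and u: "u \<in> Ker W c V" and \<zeta>: "\<zeta> \<in> test_functions V" and W: "finite W"
    and c: "\<And>w. w \<in> W \<Longrightarrow> length w \<le> m \<and> norm (c w) \<le> A"
    and \<kappa>: "\<kappa> > 0" "\<kappa> * (1 + norm \<xi>) ^ m \<le> norm (symb W c \<xi>)"
    and B: "\<And>\<gamma>. length \<gamma> \<le> m \<Longrightarrow> norm (ft (\<lambda>x. Dw \<gamma> \<zeta> x * u x) \<xi>) \<le> B"
  shows "(1 + norm \<xi>) * norm (ft (\<lambda>x. \<zeta> x * u x) \<xi>) \<le> real (card W) * (A * 2 ^ m) / \<kappa> * B"
proof -
  let ?X = "1 + norm \<xi>"
  have X: "?X \<ge> 1" by simp
  have B0: "0 \<le> B" using order_trans[OF norm_ge_zero B[of "[]"]] by simp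
  have su: "u \<in> smooth_functions V" by (rule Ker_smooth[OF u])
  have tu: "(\<lambda>y. \<zeta> y * u y) \<in> test_functions V" by (rule test_mult[OF \<zeta> V su])
  let ?R = "\<lambda>w x. Dw w (\<lambda>y. \<zeta> y * u y) x - \<zeta> x * Dw w u x"
  have tR: "?R w \<in> test_functions V" for w
    by (intro test_diff test_Dw tu test_mult[OF \<zeta> V smooth_Dw[OF V su]])
  have z: "(\<Sum>w\<in>W. c w * (\<zeta> x * Dw w u x)) = 0" for x
  proof -
    have "(\<Sum>w\<in>W. c w * (\<zeta> x * Dw w u x)) = \<zeta> x * Lop W c u x"
      by (simp add: Lop_def sum_distrib_left mult_ac)
    also have "\<dots> = 0" using u test_zero[OF \<zeta>, of x] by (cases "x \<in> V") (auto simp: Ker_def)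
    finally show ?thesis .
  qed
  have eq: "(\<Sum>w\<in>W. c w * Dw w (\<lambda>y. \<zeta> y * u y) x) = (\<Sum>w\<in>W. c w * ?R w x)" for x
    using z[of x] by (simp add: right_diff_distrib sum_subtractf)
  have "symb W c \<xi> * ft (\<lambda>x. \<zeta> x * u x) \<xi> = (\<Sum>w\<in>W. ft (\<lambda>x. c w * Dw w (\<lambda>y. \<zeta> y * u y) x) \<xi>)"
    by (simp add: symb_def ft_cmult ft_Dw[OF tu] sum_distrib_right mult.assoc)
  also have "\<dots> = ft (\<lambda>x. \<Sum>w\<in>W. c w * Dw w (\<lambda>y. \<zeta> y * u y) x) \<xi>"
    by (rule ft_sum[where V = V, symmetric]) (intro test_cmult test_Dw tu)
  also have "\<dots> = (\<Sum>w\<in>W. c w * ft (?R w) \<xi>)"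
    unfolding eq by (subst ft_sum[where V = V, OF test_cmult[OF tR]]) (simp add: ft_cmult)
  finally have eq2: "symb W c \<xi> * ft (\<lambda>x. \<zeta> x * u x) \<xi> = (\<Sum>w\<in>W. c w * ft (?R w) \<xi>)" .
  have "?X * norm (\<Sum>w\<in>W. c w * ft (?R w) \<xi>) \<le> ?X * (\<Sum>w\<in>W. norm (c w * ft (?R w) \<xi>))"
    using X by (intro mult_left_mono norm_sum) auto
  also have "\<dots> = (\<Sum>w\<in>W. norm (c w) * (?X * norm (ft (?R w) \<xi>)))"
    by (simp add: sum_distrib_left norm_mult mult_ac)
  also have "\<dots> \<le> (\<Sum>w\<in>W. A * (2 ^ m * B * ?X ^ m))"
  proof (rule sum_mono, rule mult_mono)
    fix w assume w: "w \<in> W"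
    show "norm (c w) \<le> A" using c[OF w] by simp
    then show "0 \<le> A" by (rule order_trans[OF norm_ge_zero])
    have "?X * norm (ft (?R w) \<xi>) \<le> (2 ^ length w - 1) * B * ?X ^ length w"
      by (rule commutator_bound[OF V su \<zeta>]) (use c[OF w] B in auto)
    also have "\<dots> \<le> 2 ^ m * B * ?X ^ m"
    proof (rule mult_mono)
      have "(2::real) ^ length w \<le> 2 ^ m" using c[OF w] by (intro power_increasing) auto
      then have "(2::real) ^ length w - 1 \<le> 2 ^ m" by linarith
      then show "(2 ^ length w - 1) * B \<le> 2 ^ m * B" using B0 by (rule mult_right_mono)
      show "?X ^ length w \<le> ?X ^ m" using c[OF w] by (intro power_increasing) auto
    qed (use B0 in auto)
    finally show "?X * norm (ft (?R w) \<xi>) \<le> 2 ^ m * B * ?X ^ m" .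
  qed auto
  also have "\<dots> = real (card W) * (A * 2 ^ m) * B * ?X ^ m" by (simp add: mult_ac)
  finally have *: "?X * (norm (symb W c \<xi>) * norm (ft (\<lambda>x. \<zeta> x * u x) \<xi>)) \<le> real (card W) * (A * 2 ^ m) * B * ?X ^ m"
    unfolding eq2[symmetric] norm_mult .
  have "?X ^ m * (\<kappa> * (?X * norm (ft (\<lambda>x. \<zeta> x * u x) \<xi>))) = ?X * ((\<kappa> * ?X ^ m) * norm (ft (\<lambda>x. \<zeta> x * u x) \<xi>))"
    by (simp add: mult_ac)
  also have "\<dots> \<le> ?X * (norm (symb W c \<xi>) * norm (ft (\<lambda>x. \<zeta> x * u x) \<xi>))"
    using \<kappa> X by (intro mult_left_mono mult_right_mono) auto
  also note *
  finally have "?X ^ m * (\<kappa> * (?X * norm (ft (\<lambda>x. \<zeta> x * u x) \<xi>))) \<le> ?X ^ m * (real (card W) * (A * 2 ^ m) * B)"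
    by (simp add: mult_ac)
  then have "\<kappa> * (?X * norm (ft (\<lambda>x. \<zeta> x * u x) \<xi>)) \<le> real (card W) * (A * 2 ^ m) * B"
    by (subst (asm) mult_le_cancel_left_pos) (auto intro!: zero_less_power add_pos_nonneg)
  then show ?thesis using \<kappa>(1) by (simp add: field_simps)
qed

text \<open>A class of operators with common bounds on one lattice. Estimates are proved for the
  whole class, because rescaling to small balls produces a family of operators.\<close>

definition symb_bounds :: "'n list set \<Rightarrow> nat \<Rightarrow> real \<Rightarrow> real \<Rightarrow> real ^ 'n \<Rightarrow> ('n::finite list \<Rightarrow> complex) \<Rightarrow> bool" where
  "symb_bounds W m A \<kappa> \<theta> c \<longleftrightarrow> (\<forall>w\<in>W. length w \<le> m \<and> norm (c w) \<le> A) \<and>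
     (\<forall>k. \<kappa> * (1 + norm (freq \<theta> k)) ^ m \<le> norm (symb W c (freq \<theta> k)))"

text \<open>The cutoffs and the constant come before the operator \<open>c\<close> and the solution
  \<open>u\<close>: the estimate is uniform in both.\<close>

definition gains :: "(real ^ 'n::finite) set \<Rightarrow> 'n list set \<Rightarrow> nat \<Rightarrow> real \<Rightarrow> real \<Rightarrow> real ^ 'n \<Rightarrow> nat \<Rightarrow>
    (real ^ 'n \<Rightarrow> complex) \<Rightarrow> (real ^ 'n \<Rightarrow> complex) \<Rightarrow> real \<Rightarrow> bool" where
  "gains V W m A \<kappa> \<theta> s \<zeta>0 \<zeta> C \<longleftrightarrow> (\<forall>c u B. symb_bounds W m A \<kappa> \<theta> c \<longrightarrow> u \<in> Ker W c V \<longrightarrow>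
      (\<forall>k. norm (ft (\<lambda>x. \<zeta>0 x * u x) (freq \<theta> k)) \<le> B) \<longrightarrow>
      (\<forall>k. (1 + norm (freq \<theta> k)) ^ s * norm (ft (\<lambda>x. \<zeta> x * u x) (freq \<theta> k)) \<le> C * B))"

text \<open>Nested cutoffs: on the support of the new \<zeta> an earlier \<zeta>' equals 1, so a
  derivative of \<zeta> times \<open>u\<close> is that derivative times \<open>\<zeta>' u\<close>,
  whose \<open>s\<close> orders of decay survive the multiplication by \<open>ft_mult_bound\<close>.
  The commutator argument adds one order. The supports grow inside \<open>V\<close>, so the
  induction needs the claim for every compact \<open>Z\<close>.\<close>

lemma bootstrap:
  fixes V :: "(real ^ 'n::finite) set"
  assumes V: "open V" "V \<subseteq> ball 0 (3/2)" and W: "finite W" and \<kappa>: "\<kappa> > 0"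
  shows "compact Z \<Longrightarrow> Z \<subseteq> V \<Longrightarrow> \<exists>\<zeta>0\<in>test_functions V. \<exists>\<zeta>\<in>test_functions V. \<exists>U C.
    open U \<and> Z \<subseteq> U \<and> (\<forall>x\<in>U. \<zeta> x = 1) \<and> 0 \<le> C \<and> gains V W m A \<kappa> \<theta> s \<zeta>0 \<zeta> C"
proof (induction s arbitrary: Z)
  case 0
  obtain \<zeta> U where "\<zeta> \<in> test_functions V" "open U" "Z \<subseteq> U" "\<And>x. x \<in> U \<Longrightarrow> \<zeta> x = 1"
    using cutoff[OF 0(1) V(1) 0(2)] by blast
  then show ?case by (intro bexI[of _ \<zeta>] exI[of _ U] exI[of _ 1]) (auto simp: gains_def)
next
  case (Suc s)
  obtain \<zeta> U where \<zeta>: "\<zeta> \<in> test_functions V" and U: "open U" "Z \<subseteq> U" "\<And>x. x \<in> U \<Longrightarrow> \<zeta> x = 1"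
    using cutoff[OF Suc(2) V(1) Suc(3)] by blast
  obtain Z' where Z': "compact Z'" "Z' \<subseteq> V" "\<And>x. x \<notin> Z' \<Longrightarrow> \<zeta> x = 0" using test_supportE[OF \<zeta>] by blast
  obtain \<zeta>0 \<zeta>' U' C where \<zeta>0: "\<zeta>0 \<in> test_functions V" and \<zeta>': "\<zeta>' \<in> test_functions V"
    and U': "Z' \<subseteq> U'" "\<forall>x\<in>U'. \<zeta>' x = 1" and C: "0 \<le> C"
    and IH0: "gains V W m A \<kappa> \<theta> s \<zeta>0 \<zeta>' C"
    using Suc.IH[OF Z'(1,2)] by blast
  have IH: "(1 + norm (freq \<theta> k)) ^ s * norm (ft (\<lambda>x. \<zeta>' x * u x) (freq \<theta> k)) \<le> C * B"
    if "symb_bounds W m A \<kappa> \<theta> c" "u \<in> Ker W c V" "\<forall>k. norm (ft (\<lambda>x. \<zeta>0 x * u x) (freq \<theta> k)) \<le> B" for c u B k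
    using IH0[unfolded gains_def, rule_format, OF that(1,2)] that(3) by blast
  have z: "Dw \<gamma> \<zeta> x = 0" if "x \<notin> Z'" for \<gamma> x
  proof -
    have "Dw \<gamma> \<zeta> x = Dw \<gamma> (\<lambda>x. 0) x"
      by (rule Dw_cong[of "- Z'"]) (use that Z' in \<open>auto simp: compact_imp_closed\<close>)
    then show ?thesis by simp
  qed
  have "\<exists>D\<ge>0. \<forall>\<phi> B. \<phi> \<in> test_functions (ball 0 (3/2)) \<longrightarrow>
      (\<forall>k. (1 + norm (freq \<theta> k)) ^ s * norm (ft \<phi> (freq \<theta> k)) \<le> B) \<longrightarrow>
      (\<forall>k. (1 + norm (freq \<theta> k)) ^ s * norm (ft (\<lambda>x. Dw \<gamma> \<zeta> x * \<phi> x) (freq \<theta> k)) \<le> D * B)" for \<gamma>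
  proof -
    obtain D0 where D0: "0 \<le> D0" "\<forall>(\<theta> :: real ^ 'n) (\<phi> :: real ^ 'n \<Rightarrow> complex) B. \<phi> \<in> test_functions (ball 0 (3/2)) \<longrightarrow>
      (\<forall>k. (1 + norm (freq \<theta> k)) ^ s * norm (ft \<phi> (freq \<theta> k)) \<le> B) \<longrightarrow>
      (\<forall>k. (1 + norm (freq \<theta> k)) ^ s * norm (ft (\<lambda>x. Dw \<gamma> \<zeta> x * \<phi> x) (freq \<theta> k)) \<le> D0 * B)"
      using ft_mult_bound[OF test_mono[OF test_Dw[OF \<zeta>] V(2)], of s \<gamma>] by (elim exE conjE) (rule that)
    show ?thesis by (rule exI[of _ D0], rule conjI[OF D0(1)], rule D0(2)[THEN spec])
  qed
  from choice[OF allI[OF this]] obtain D where D': "\<forall>\<gamma>. 0 \<le> D \<gamma> \<and> (\<forall>\<phi> B. \<phi> \<in> test_functions (ball 0 (3/2)) \<longrightarrow>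
      (\<forall>k. (1 + norm (freq \<theta> k)) ^ s * norm (ft \<phi> (freq \<theta> k)) \<le> B) \<longrightarrow>
      (\<forall>k. (1 + norm (freq \<theta> k)) ^ s * norm (ft (\<lambda>x. Dw \<gamma> \<zeta> x * \<phi> x) (freq \<theta> k)) \<le> D \<gamma> * B))" ..
  have D: "0 \<le> D \<gamma>" "(1 + norm (freq \<theta> k)) ^ s * norm (ft (\<lambda>x. Dw \<gamma> \<zeta> x * \<phi> x) (freq \<theta> k)) \<le> D \<gamma> * B"
    if "\<phi> \<in> test_functions (ball 0 (3/2))" "\<forall>k. (1 + norm (freq \<theta> k)) ^ s * norm (ft \<phi> (freq \<theta> k)) \<le> B" for \<gamma> \<phi> B k
    using D'[rule_format, of \<gamma>, THEN conjunct2, rule_format, OF that(1)] that(2) D' by blast+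
  have D0: "0 \<le> D \<gamma>" for \<gamma> using D' by blast
  let ?G = "{\<gamma> :: 'n list. length \<gamma> \<le> m}"
  have fG: "finite ?G" using finite_lists_length_le[of "UNIV :: 'n set" m] by simp
  define E where "E = (\<Sum>\<gamma>\<in>?G. D \<gamma>)"
  have E: "D \<gamma> \<le> E" if "length \<gamma> \<le> m" for \<gamma>
    unfolding E_def using that D0 fG by (intro member_le_sum) auto
  have E0: "0 \<le> E" unfolding E_def by (intro sum_nonneg D0)
  have A0: "0 \<le> real (card W) * (\<bar>A\<bar> * 2 ^ m) / \<kappa>" using \<kappa> by simp
  have main: "(1 + norm (freq \<theta> k)) ^ Suc s * norm (ft (\<lambda>x. \<zeta> x * u x) (freq \<theta> k)) \<le> (real (card W) * (\<bar>A\<bar> * 2 ^ m) / \<kappa> * (E * C)) * B"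
    if sb: "symb_bounds W m A \<kappa> \<theta> c" and u: "u \<in> Ker W c V" and B: "\<forall>k. norm (ft (\<lambda>x. \<zeta>0 x * u x) (freq \<theta> k)) \<le> B" for c u B k
  proof -
    let ?X = "1 + norm (freq \<theta> k)"
    have X: "?X ^ s > 0" by (intro zero_less_power) (auto intro: add_pos_nonneg)
    have B0: "0 \<le> B" using B norm_ge_zero order_trans by blast
    have tu: "(\<lambda>x. \<zeta>' x * u x) \<in> test_functions (ball 0 (3/2))"
      by (rule test_mono[OF test_mult[OF \<zeta>' V(1) Ker_smooth[OF u]] V(2)])
    have "norm (ft (\<lambda>x. Dw \<gamma> \<zeta> x * u x) (freq \<theta> k)) \<le> E * (C * B) / ?X ^ s" if \<gamma>: "length \<gamma> \<le> m" for \<gamma>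
    proof -
      have eq: "Dw \<gamma> \<zeta> x * u x = Dw \<gamma> \<zeta> x * (\<zeta>' x * u x)" for x
        using z[of x \<gamma>] U' by (cases "x \<in> Z'") auto
      have "?X ^ s * norm (ft (\<lambda>x. Dw \<gamma> \<zeta> x * u x) (freq \<theta> k)) \<le> D \<gamma> * (C * B)"
        unfolding eq using D(2)[OF tu, of "C * B" k \<gamma>] IH[OF sb u B] by simp
      also have "\<dots> \<le> E * (C * B)" using E[OF \<gamma>] B0 C by (intro mult_right_mono) auto
      finally show ?thesis using X by (simp add: pos_le_divide_eq mult.commute)
    qed
    from bootstrap_at[where A = "\<bar>A\<bar>", OF V(1) u \<zeta> W _ \<kappa> _ this]
    have "?X * norm (ft (\<lambda>x. \<zeta> x * u x) (freq \<theta> k)) \<le> real (card W) * (\<bar>A\<bar> * 2 ^ m) / \<kappa> * (E * (C * B) / ?X ^ s)"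
      using sb by (force simp: symb_bounds_def)
    then have "?X ^ s * (?X * norm (ft (\<lambda>x. \<zeta> x * u x) (freq \<theta> k))) \<le> ?X ^ s * (real (card W) * (\<bar>A\<bar> * 2 ^ m) / \<kappa> * (E * (C * B) / ?X ^ s))"
      using X by (intro mult_left_mono) auto
    moreover have "?X \<noteq> 0" using norm_ge_zero[of "freq \<theta> k"] by linarith
    ultimately show ?thesis using X by (simp add: mult_ac)
  qed
  have nn: "0 \<le> real (card W) * (\<bar>A\<bar> * 2 ^ m) / \<kappa> * (E * C)" using A0 E0 C by (intro mult_nonneg_nonneg) auto
  have "gains V W m A \<kappa> \<theta> (Suc s) \<zeta>0 \<zeta> (real (card W) * (\<bar>A\<bar> * 2 ^ m) / \<kappa> * (E * C))"
    unfolding gains_def using main by blast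
  then show ?case using \<zeta>0 \<zeta> U nn by blast
qed

text \<open>Of the \<open>2 * CARD('n) + 1\<close> orders gained, \<open>2 * CARD('n)\<close> make
  the Fourier series summable and one pays for the derivative. On the right only Fourier
  coefficients of \<open>\<zeta>0 u\<close> enter, no bound on \<open>u\<close> itself; this is the
  form that the fundamental solution requires.\<close>

lemma interior_estimate:
  fixes V :: "(real ^ 'n::finite) set"
  assumes V: "open V" "V \<subseteq> ball 0 (3/2)" and W: "finite W" and \<kappa>: "\<kappa> > 0" and Z: "compact Z" "Z \<subseteq> V"
  obtains \<zeta>0 C where "\<zeta>0 \<in> test_functions V" "0 \<le> C"
    "\<And>c u B x j. symb_bounds W m A \<kappa> \<theta> c \<Longrightarrow> u \<in> Ker W c V \<Longrightarrow> (\<And>k. norm (ft (\<lambda>x. \<zeta>0 x * u x) (freq \<theta> k)) \<le> B) \<Longrightarrow>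
      x \<in> Z \<Longrightarrow> norm (u x) \<le> C * B \<and> norm (D_op j u x) \<le> C * B"
proof -
  let ?r = "2 * CARD('n)"
  obtain \<zeta>0 \<zeta> U C where \<zeta>0: "\<zeta>0 \<in> test_functions V" and \<zeta>: "\<zeta> \<in> test_functions V"
    and U: "open U" "Z \<subseteq> U" "\<forall>x\<in>U. \<zeta> x = 1" and C: "0 \<le> C" and g: "gains V W m A \<kappa> \<theta> (Suc ?r) \<zeta>0 \<zeta> C"
    using bootstrap[OF V W \<kappa> Z] by blast
  let ?S = "\<Sum>\<^sub>\<infinity>k. 1 / (1 + norm (freq \<theta> k)) ^ ?r"
  have S0: "0 \<le> ?S" by (intro infsum_nonneg) auto
  have main: "norm (u x) \<le> (C * ?S) * B \<and> norm (D_op j u x) \<le> (C * ?S) * B"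
    if sb: "symb_bounds W m A \<kappa> \<theta> c" and u: "u \<in> Ker W c V" and B: "\<And>k. norm (ft (\<lambda>x. \<zeta>0 x * u x) (freq \<theta> k)) \<le> B"
      and x: "x \<in> Z" for c u B x j
  proof -
    let ?\<psi> = "\<lambda>x. \<zeta> x * u x"
    have t: "?\<psi> \<in> test_functions (ball 0 (3/2))"
      by (rule test_mono[OF test_mult[OF \<zeta> V(1) Ker_smooth[OF u]] V(2)])
    have nx: "norm x + 3/2 \<le> 3" using x Z V by force
    have bound: "norm (v x) \<le> (C * ?S) * B"
      if v: "v \<in> test_functions (ball 0 (3/2))" and le: "\<And>k. norm (ft v (freq \<theta> k)) \<le> (1 + norm (freq \<theta> k)) * norm (ft ?\<psi> (freq \<theta> k))" for v
    proof -
      have "norm (trig \<theta> (\<lambda>k. ft v (freq \<theta> k)) x) \<le> C * B * ?S"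
      proof (rule norm_infsum_le[OF trig_has_sum has_sum_cmult_right[OF has_sum_infsum[OF lattice_summable]]])
        show "(\<lambda>k. norm (ft v (freq \<theta> k))) summable_on UNIV"
          by (rule rapid_norm_summable[OF rapid_ft[OF v]])
        fix k
        let ?X = "1 + norm (freq \<theta> k)"
        have X: "?X ^ ?r > 0" by (intro zero_less_power add_pos_nonneg) auto
        have "?X ^ Suc ?r * norm (ft ?\<psi> (freq \<theta> k)) \<le> C * B"
          using g sb u B unfolding gains_def by blast
        moreover have "?X ^ ?r * norm (ft v (freq \<theta> k)) \<le> ?X ^ ?r * (?X * norm (ft ?\<psi> (freq \<theta> k)))"
          using X by (intro mult_left_mono le) simp
        moreover have "?X ^ ?r * (?X * norm (ft ?\<psi> (freq \<theta> k))) = ?X ^ Suc ?r * norm (ft ?\<psi> (freq \<theta> k))"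
          unfolding power_Suc by (simp only: mult.assoc mult.left_commute)
        ultimately have "?X ^ ?r * norm (ft v (freq \<theta> k)) \<le> C * B" by linarith
        then show "norm (ft v (freq \<theta> k) * wave (freq \<theta> k) x) \<le> C * B * (1 / ?X ^ ?r)"
          using X by (simp add: norm_mult pos_le_divide_eq mult.commute)
      qed
      then show ?thesis using ft_inversion[OF v nx, of \<theta>] by (simp add: mult_ac)
    qed
    have "norm (?\<psi> x) \<le> (C * ?S) * B"
    proof (rule bound[OF t])
      show "norm (ft ?\<psi> (freq \<theta> k)) \<le> (1 + norm (freq \<theta> k)) * norm (ft ?\<psi> (freq \<theta> k))" for k
        using mult_right_mono[of 1 "1 + norm (freq \<theta> k)" "norm (ft ?\<psi> (freq \<theta> k))"] by simp
    qed
    moreover have "norm (D_op j ?\<psi> x) \<le> (C * ?S) * B"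
    proof (rule bound[OF test_D_op[OF t]])
      fix k
      have "\<bar>freq \<theta> k $ j\<bar> \<le> 1 + norm (freq \<theta> k)"
        using component_le_norm_cart[of "freq \<theta> k" j] by linarith
      then show "norm (ft (D_op j ?\<psi>) (freq \<theta> k)) \<le> (1 + norm (freq \<theta> k)) * norm (ft ?\<psi> (freq \<theta> k))"
        unfolding ft_D_op[OF t] norm_mult norm_of_real by (intro mult_right_mono) auto
    qed
    moreover have "D_op j ?\<psi> x = D_op j u x"
      by (rule D_op_cong[OF U(1)]) (use U x in auto)
    ultimately show ?thesis using U x by auto
  qed
  show thesis by (rule that[of \<zeta>0 "C * ?S"]) (use \<zeta>0 C S0 main in auto)
qed

text \<open>Estimating the integral directly feeds \<open>interior_estimate\<close> when the values
  of \<open>u\<close> are controlled instead of its coefficients.\<close>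

lemma ft_test_bound:
  fixes \<zeta> :: "real ^ 'n::finite \<Rightarrow> complex"
  assumes "\<zeta> \<in> test_functions V" "open V"
  obtains C where "0 \<le> C" "\<And>u B \<xi>. u \<in> smooth_functions V \<Longrightarrow> (\<And>x. x \<in> V \<Longrightarrow> norm (u x) \<le> B) \<Longrightarrow> 0 \<le> B \<Longrightarrow>
    norm (ft (\<lambda>x. \<zeta> x * u x) \<xi>) \<le> C * B"
proof
  let ?C = "(\<integral>x. norm (\<zeta> x) \<partial>lborel) / (2 * pi) ^ CARD('n)"
  show "0 \<le> ?C" by simp
  fix u B \<xi> assume u: "u \<in> smooth_functions V" and B: "\<And>x. x \<in> V \<Longrightarrow> norm (u x) \<le> B" "0 \<le> B"
  have i: "integrable lborel (\<lambda>x. norm (\<zeta> x) * B)"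
    using test_integrable[OF assms(1), of "\<lambda>_. 1"] by (intro integrable_mult_left integrable_norm) simp
  have "norm (\<integral>x. \<zeta> x * u x * wave (- \<xi>) x \<partial>lborel) \<le> (\<integral>x. norm (\<zeta> x) * B \<partial>lborel)"
  proof (rule Bochner_Integration.integral_norm_bound_integral[OF ft_integrable[OF test_mult[OF assms u]] i])
    fix x
    show "norm (\<zeta> x * u x * wave (- \<xi>) x) \<le> norm (\<zeta> x) * B"
      using B(1)[of x] test_zero[OF assms(1), of x] by (cases "x \<in> V") (auto simp: norm_mult mult_left_mono)
  qed
  then show "norm (ft (\<lambda>x. \<zeta> x * u x) \<xi>) \<le> ?C * B"
    unfolding ft_def by (simp add: norm_divide norm_power norm_mult divide_right_mono)
qed

lemma gradient_unit:
  assumes W: "finite W" and \<kappa>: "\<kappa> > 0"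
  obtains C where "0 \<le> C" "\<And>c u B j. symb_bounds W m A \<kappa> \<theta> c \<Longrightarrow> u \<in> Ker W c (ball (0 :: real ^ 'n::finite) 1) \<Longrightarrow>
     (\<And>x. x \<in> ball 0 1 \<Longrightarrow> norm (u x) \<le> B) \<Longrightarrow> norm (D_op j u 0) \<le> C * B"
proof -
  have V: "open (ball (0 :: real ^ 'n) 1)" "ball (0 :: real ^ 'n) 1 \<subseteq> ball 0 (3/2)" by auto
  have Z: "compact {0 :: real ^ 'n}" "{0 :: real ^ 'n} \<subseteq> ball 0 1" by auto
  obtain \<zeta>0 C where \<zeta>0: "\<zeta>0 \<in> test_functions (ball (0 :: real ^ 'n) 1)" and C: "0 \<le> C"
    "\<And>c u B x j. symb_bounds W m A \<kappa> \<theta> c \<Longrightarrow> u \<in> Ker W c (ball 0 1) \<Longrightarrow> (\<And>k. norm (ft (\<lambda>x. \<zeta>0 x * u x) (freq \<theta> k)) \<le> B) \<Longrightarrow>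
      x \<in> {0} \<Longrightarrow> norm (u x) \<le> C * B \<and> norm (D_op j u x) \<le> C * B"
    using interior_estimate[OF V W \<kappa> Z, of m A \<theta>] by blast
  obtain D where D: "0 \<le> D" "\<And>u B \<xi>. u \<in> smooth_functions (ball 0 1) \<Longrightarrow> (\<And>x. x \<in> ball 0 1 \<Longrightarrow> norm (u x) \<le> B) \<Longrightarrow> 0 \<le> B \<Longrightarrow>
    norm (ft (\<lambda>x. \<zeta>0 x * u x) \<xi>) \<le> D * B"
    using ft_test_bound[OF \<zeta>0 V(1)] by blast
  show thesis
  proof (rule that[of "C * D"])
    show "0 \<le> C * D" using C(1) D(1) by simp
    fix c u B j assume sb: "symb_bounds W m A \<kappa> \<theta> c" and u: "u \<in> Ker W c (ball (0 :: real ^ 'n) 1)"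
      and B: "\<And>x. x \<in> ball 0 1 \<Longrightarrow> norm (u x) \<le> B"
    have "0 \<le> B" using order_trans[OF norm_ge_zero B[of 0]] by simp
    then have "norm (ft (\<lambda>x. \<zeta>0 x * u x) (freq \<theta> k)) \<le> D * B" for k
      by (intro D(2) Ker_smooth[OF u] B)
    from C(2)[OF sb u this, of 0] show "norm (D_op j u 0) \<le> C * D * B" by (simp add: mult.assoc)
  qed
qed

section \<open>Ellipticity, small scales and Cauchy estimates\<close>

definition ell :: "'n list set \<Rightarrow> ('n::finite list \<Rightarrow> complex) \<Rightarrow> nat \<Rightarrow> bool" where
  "ell W c m \<longleftrightarrow> finite W \<and> (\<forall>w\<in>W. length w \<le> m) \<and>
     (\<exists>\<kappa>>0. \<forall>\<xi>. \<kappa> * norm \<xi> ^ m \<le> norm (symb {w\<in>W. length w = m} c \<xi>))"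

lemma norm_symb_le:
  "finite W \<Longrightarrow> (\<And>w. w \<in> W \<Longrightarrow> norm (c w) * norm \<xi> ^ length w \<le> b w) \<Longrightarrow> norm (symb W c \<xi>) \<le> (\<Sum>w\<in>W. b w)"
  unfolding symb_def by (rule sum_norm_le) (auto simp: norm_mult intro: order_trans[OF mult_left_mono[OF norm_word_prod_le]])

lemma symb_split:
  "finite W \<Longrightarrow> symb W c \<xi> = symb {w\<in>W. length w = m} c \<xi> + symb {w\<in>W. length w \<noteq> m} c \<xi>"
proof -
  assume "finite W"
  moreover have "W = {w\<in>W. length w = m} \<union> {w\<in>W. length w \<noteq> m}" by auto
  ultimately show ?thesis unfolding symb_def by (subst (1) \<open>W = _\<close>, subst sum.union_disjoint) auto
qed

text \<open>The shift by 1/2 keeps all lattice points at norm at least 1/2, so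
  \<open>1 + norm \<xi>\<close> is at most three times the norm and the leading part dominates the
  weight. The lower-order terms carry a factor \<open>t\<close> and are absorbed for small
  \<open>t\<close>, with the same constants for all such \<open>t\<close>.\<close>

lemma ell_scaled_bound:
  fixes c :: "'n::finite list \<Rightarrow> complex"
  assumes "ell W c m"
  shows "\<exists>\<delta>0 A \<kappa>. 0 < \<delta>0 \<and> \<delta>0 \<le> 1 \<and> 0 < \<kappa> \<and>
    (\<forall>t. 0 < t \<longrightarrow> t \<le> \<delta>0 \<longrightarrow> symb_bounds W m A \<kappa> (\<chi> j. 1/2) (\<lambda>w. c w * of_real (t ^ (m - length w))))"
proof -
  obtain \<kappa> where W: "finite W" "\<And>w. w \<in> W \<Longrightarrow> length w \<le> m" and \<kappa>: "\<kappa> > 0"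
    "\<And>\<xi>. \<kappa> * norm \<xi> ^ m \<le> norm (symb {w\<in>W. length w = m} c \<xi>)" using assms by (auto simp: ell_def)
  define A where "A = (\<Sum>w\<in>W. norm (c w))"
  have A: "norm (c w) \<le> A" if "w \<in> W" for w
    unfolding A_def using W that by (intro member_le_sum) auto
  have A0: "0 \<le> A" unfolding A_def by (intro sum_nonneg) auto
  \<comment> \<open>Small enough that the lower-order terms take away at most half of the lower
    bound \<open>\<kappa> / 3 ^ m\<close>; the denominator \<open>A + 1\<close> is positive even
    when \<open>A\<close> is 0.\<close>
  define \<delta>0 where "\<delta>0 = min 1 (\<kappa> / 3 ^ m / 2 / (A + 1))"
  have \<delta>0: "0 < \<delta>0" "\<delta>0 \<le> 1" "\<delta>0 * A \<le> \<kappa> / 3 ^ m / 2"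
  proof -
    show "0 < \<delta>0" "\<delta>0 \<le> 1" using \<kappa> A0 by (auto simp: \<delta>0_def)
    have "\<delta>0 * A \<le> \<kappa> / 3 ^ m / 2 / (A + 1) * (A + 1)"
      using \<kappa> A0 by (intro mult_mono) (auto simp: \<delta>0_def)
    then show "\<delta>0 * A \<le> \<kappa> / 3 ^ m / 2" using A0 by simp
  qed
  let ?\<theta> = "\<chi> j. 1/2 :: real ^ 'n"
  have "symb_bounds W m A (\<kappa> / 3 ^ m / 2) (\<chi> j. 1/2) (\<lambda>w. c w * of_real (t ^ (m - length w)))"
    if t: "0 < t" "t \<le> \<delta>0" for t
    unfolding symb_bounds_def
  proof (intro conjI allI ballI)
    let ?c = "\<lambda>w. c w * complex_of_real (t ^ (m - length w))"
    have t1: "t \<le> 1" using t \<delta>0 by linarith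
    fix w assume w: "w \<in> W"
    show "length w \<le> m" by (rule W(2)[OF w])
    have "norm (?c w) \<le> norm (c w) * 1"
      unfolding norm_mult norm_of_real using t t1 by (intro mult_left_mono) (auto simp: power_le_one abs_mult)
    then show "norm (?c w) \<le> A" using A[OF w] by simp
  next
    let ?c = "\<lambda>w. c w * complex_of_real (t ^ (m - length w))"
    have t1: "t \<le> 1" using t \<delta>0 by linarith
    fix k :: "'n \<Rightarrow> int"
    let ?\<xi> = "freq (\<chi> j. 1/2) k"
    have "1/2 \<le> norm ?\<xi>"
    proof -
      obtain j :: 'n where True by blast
      have "k j \<ge> 0 \<or> k j \<le> - 1" by linarith
      then have "real_of_int (k j) \<ge> 0 \<or> real_of_int (k j) \<le> - 1" by linarith
      then have "1/2 \<le> \<bar>?\<xi> $ j\<bar>" by auto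
      then show ?thesis using component_le_norm_cart[of ?\<xi> j] by linarith
    qed
    then have "1 + norm ?\<xi> \<le> 3 * norm ?\<xi>" by simp
    then have p: "(1 + norm ?\<xi>) ^ m \<le> 3 ^ m * norm ?\<xi> ^ m"
      using power_mono[of "1 + norm ?\<xi>" "3 * norm ?\<xi>" m] by (simp add: power_mult_distrib)
    have "symb {w\<in>W. length w = m} ?c ?\<xi> = symb {w\<in>W. length w = m} c ?\<xi>"
      unfolding symb_def by (intro sum.cong) auto
    then have 1: "\<kappa> / 3 ^ m * (1 + norm ?\<xi>) ^ m \<le> norm (symb {w\<in>W. length w = m} ?c ?\<xi>)"
      using \<kappa>(2)[of ?\<xi>] mult_left_mono[OF p, of "\<kappa> / 3 ^ m"] \<kappa>(1) by simp
    have "norm (symb {w\<in>W. length w \<noteq> m} ?c ?\<xi>) \<le> (\<Sum>w\<in>{w\<in>W. length w \<noteq> m}. t * (1 + norm ?\<xi>) ^ m * norm (c w))"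
    proof (rule norm_symb_le)
      fix w assume w: "w \<in> {w\<in>W. length w \<noteq> m}"
      then have lw: "length w < m" using W(2) by force
      have "t ^ (m - length w) \<le> t ^ 1" using t t1 lw by (intro power_decreasing) auto
      moreover have "norm ?\<xi> ^ length w \<le> (1 + norm ?\<xi>) ^ m"
        using power_mono[of "norm ?\<xi>" "1 + norm ?\<xi>" "length w"] power_increasing[of "length w" m "1 + norm ?\<xi>"] lw by simp
      ultimately have "norm (c w) * (t ^ (m - length w) * norm ?\<xi> ^ length w) \<le> norm (c w) * (t * (1 + norm ?\<xi>) ^ m)"
        using t by (intro mult_left_mono mult_mono) auto
      then show "norm (?c w) * norm ?\<xi> ^ length w \<le> t * (1 + norm ?\<xi>) ^ m * norm (c w)"
        using t by (simp add: norm_mult norm_power mult_ac)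
    qed (use W in auto)
    also have "\<dots> = t * (1 + norm ?\<xi>) ^ m * (\<Sum>w\<in>{w\<in>W. length w \<noteq> m}. norm (c w))"
      by (simp add: sum_distrib_left)
    also have "\<dots> \<le> t * (1 + norm ?\<xi>) ^ m * A"
      unfolding A_def using t W by (intro mult_left_mono sum_mono2) auto
    also have "\<dots> \<le> (1 + norm ?\<xi>) ^ m * (\<delta>0 * A)"
      using mult_left_mono[OF mult_right_mono[OF t(2) A0], of "(1 + norm ?\<xi>) ^ m"] by (simp add: mult_ac)
    also have "\<dots> \<le> (1 + norm ?\<xi>) ^ m * (\<kappa> / 3 ^ m / 2)" using \<delta>0(3) by (intro mult_left_mono) auto
    finally have 2: "norm (symb {w\<in>W. length w \<noteq> m} ?c ?\<xi>) \<le> \<kappa> / 3 ^ m / 2 * (1 + norm ?\<xi>) ^ m" by (simp add: mult.commute)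
    have "norm (symb {w\<in>W. length w = m} ?c ?\<xi>) \<le> norm (symb W ?c ?\<xi>) + norm (symb {w\<in>W. length w \<noteq> m} ?c ?\<xi>)"
      using symb_split[OF W(1), of ?c ?\<xi> m] norm_triangle_ineq4[of "symb W ?c ?\<xi>" "symb {w\<in>W. length w \<noteq> m} ?c ?\<xi>"] by simp
    then show "\<kappa> / 3 ^ m / 2 * (1 + norm ?\<xi>) ^ m \<le> norm (symb W ?c ?\<xi>)"
      using 1 2 by linarith
  qed
  then show ?thesis using \<delta>0 \<kappa>(1)
    by (intro exI[of _ \<delta>0] exI[of _ A] exI[of _ "\<kappa> / 3 ^ m / 2"]) auto
qed

text \<open>On the unit ball the rescaled operators lie in one class for all
  \<open>\<delta> \<le> \<delta>0\<close>, so \<open>gradient_unit\<close> gives one constant;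
  scaling back produces the factor \<open>1 / \<delta>\<close>.\<close>

lemma gradient_estimate:
  fixes c :: "'n::finite list \<Rightarrow> complex"
  assumes "ell W c m"
  obtains \<delta>0 C where "0 < \<delta>0" "1 \<le> C"
    "\<And>\<delta> x u B j. 0 < \<delta> \<Longrightarrow> \<delta> \<le> \<delta>0 \<Longrightarrow> u \<in> Ker W c (ball x \<delta>) \<Longrightarrow> (\<And>y. y \<in> ball x \<delta> \<Longrightarrow> norm (u y) \<le> B) \<Longrightarrow>
      norm (D_op j u x) \<le> C / \<delta> * B"
proof -
  have W: "finite W" "\<And>w. w \<in> W \<Longrightarrow> length w \<le> m" using assms by (auto simp: ell_def)
  obtain \<delta>0 A \<kappa> where \<delta>0: "0 < \<delta>0" "\<delta>0 \<le> 1" and \<kappa>: "0 < \<kappa>"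
    and sb0: "\<forall>t. 0 < t \<longrightarrow> t \<le> \<delta>0 \<longrightarrow> symb_bounds W m A \<kappa> (\<chi> j. 1/2) (\<lambda>w. c w * of_real (t ^ (m - length w)))"
    using ell_scaled_bound[OF assms] by (elim exE conjE) (rule that)
  note sb = sb0[rule_format]
  obtain C where C: "0 \<le> C" "\<And>c u B j. symb_bounds W m A \<kappa> (\<chi> j. 1/2) c \<Longrightarrow> u \<in> Ker W c (ball (0 :: real ^ 'n) 1) \<Longrightarrow>
     (\<And>x. x \<in> ball 0 1 \<Longrightarrow> norm (u x) \<le> B) \<Longrightarrow> norm (D_op j u 0) \<le> C * B"
    using gradient_unit[OF W(1) \<kappa>, of m A "\<chi> j. 1/2"] by blast
  show thesis
  proof (rule that[of \<delta>0 "max C 1"])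
    fix \<delta> x u B j
    assume \<delta>: "0 < \<delta>" "\<delta> \<le> \<delta>0" and u: "u \<in> Ker W c (ball x \<delta>)" and B: "\<And>y. y \<in> ball x \<delta> \<Longrightarrow> norm (u y) \<le> B"
    have B0: "0 \<le> B" using order_trans[OF norm_ge_zero B[of x]] \<delta> by simp
    let ?v = "\<lambda>y. u (x + \<delta> *\<^sub>R y)"
    have sub: "ball 0 1 \<subseteq> {y. x + \<delta> *\<^sub>R y \<in> ball x \<delta>}" using \<delta> by (auto simp: dist_norm)
    have "?v \<in> Ker W (\<lambda>w. c w * of_real (\<delta> ^ (m - length w))) {y. x + \<delta> *\<^sub>R y \<in> ball x \<delta>}"
    proof (rule Ker_affine[OF open_ball u, where b = "of_real (\<delta> ^ m)"])
      fix w assume "w \<in> W"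
      then have "\<delta> ^ (m - length w) * \<delta> ^ length w = \<delta> ^ m" using W(2) by (simp add: power_add[symmetric])
      then show "c w * of_real (\<delta> ^ (m - length w)) * of_real \<delta> ^ length w = of_real (\<delta> ^ m) * c w"
        by (simp add: mult_ac flip: of_real_mult of_real_power)
    qed
    then have "?v \<in> Ker W (\<lambda>w. c w * of_real (\<delta> ^ (m - length w))) (ball 0 1)" by (rule Ker_subset[OF _ sub])
    from C(2)[OF sb[OF \<delta>] this, of B j] have "norm (D_op j ?v 0) \<le> C * B" using B sub by blast
    moreover have "D_op j ?v 0 = of_real \<delta> * D_op j u x"
      using D_op_affine[of u x \<delta> 0 j] smooth_differentiable[OF Ker_smooth[OF u]] \<delta> by simp
    ultimately have "\<delta> * norm (D_op j u x) \<le> C * B" using \<delta> by (simp add: norm_mult)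
    then have "norm (D_op j u x) \<le> C / \<delta> * B" using \<delta> by (simp add: field_simps)
    also have "\<dots> \<le> max C 1 / \<delta> * B" using \<delta> B0 by (intro mult_right_mono divide_right_mono) auto
    finally show "norm (D_op j u x) \<le> max C 1 / \<delta> * B" .
  qed (use \<delta>0 in auto)
qed

text \<open>One term of the exponential series. It takes the place of Stirling's formula in bounding
  \<open>(n + 1) ^ n\<close> by \<open>fact n\<close> times an exponential.\<close>

lemma power_le_fact_exp: "x ^ n \<le> fact n * exp x" if "0 \<le> x" for x :: real
proof -
  have "x ^ n /\<^sub>R fact n \<le> suminf (\<lambda>k. x ^ k /\<^sub>R fact k)"
    using sum_le_suminf[OF summable_exp_generic[of x], of "{n}"] that by simp
  then show ?thesis by (simp add: exp_def field_simps)
qed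

text \<open>The gradient estimate is applied \<open>n\<close> times, each time on a ball of radius \<open>\<rho> / (n + 1)\<close>.\<close>

lemma Cauchy_estimate:
  fixes c :: "'n::finite list \<Rightarrow> complex"
  assumes "ell W c m"
  obtains \<delta>0 A where "0 < \<delta>0" "1 \<le> A"
    "\<And>\<rho> x u B w. 0 < \<rho> \<Longrightarrow> \<rho> \<le> \<delta>0 \<Longrightarrow> u \<in> Ker W c (ball x \<rho>) \<Longrightarrow> (\<And>y. y \<in> ball x \<rho> \<Longrightarrow> norm (u y) \<le> B) \<Longrightarrow>
      norm (Dw w u x) \<le> A * (A / \<rho>) ^ length w * fact (length w) * B"
proof -
  obtain \<delta>0 C where \<delta>0: "0 < \<delta>0" and C: "1 \<le> C"
    and grad: "\<And>\<delta> x u B j. 0 < \<delta> \<Longrightarrow> \<delta> \<le> \<delta>0 \<Longrightarrow> u \<in> Ker W c (ball x \<delta>) \<Longrightarrow> (\<And>y. y \<in> ball x \<delta> \<Longrightarrow> norm (u y) \<le> B) \<Longrightarrow>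
      norm (D_op j u x) \<le> C / \<delta> * B"
    using gradient_estimate[OF assms] by blast
  let ?A = "C * exp 1"
  have A: "1 \<le> ?A" using mult_mono[of 1 C 1 "exp 1"] C by simp
  show thesis
  proof (rule that[of \<delta>0 ?A])
    fix \<rho> B :: real and x :: "real ^ 'n" and u :: "real ^ 'n \<Rightarrow> complex" and w :: "'n list"
    assume \<rho>: "0 < \<rho>" "\<rho> \<le> \<delta>0" and u: "u \<in> Ker W c (ball x \<rho>)" and B: "\<And>y. y \<in> ball x \<rho> \<Longrightarrow> norm (u y) \<le> B"
    have B0: "0 \<le> B" using order_trans[OF norm_ge_zero B[of x]] \<rho> by simp
    let ?n = "length w"
    define d where "d = \<rho> / (real ?n + 1)"
    have d: "0 < d" "d \<le> \<rho>" using \<rho> by (auto simp: d_def field_simps)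
    \<comment> \<open>Each derivative uses up a distance \<open>d\<close>. As \<open>d\<close> is
      \<rho> divided by one more than the number of derivatives, all of them can be taken at the
      centre.\<close>
    have step: "norm (Dw v u y) \<le> (C / d) ^ length v * B" if "norm (y - x) + real (length v) * d < \<rho>" for v y
      using that
    proof (induction v arbitrary: y)
      case Nil
      then show ?case using B[of y] by (simp add: dist_norm norm_minus_commute)
    next
      case (Cons j v)
      have b: "norm (z - x) + real (length v) * d < \<rho>" if z: "z \<in> ball y d" for z
      proof -
        have "norm (z - x) \<le> norm (z - y) + norm (y - x)" using norm_triangle_ineq[of "z - y" "y - x"] by simp
        moreover have "norm (z - y) < d" using z by (simp add: dist_norm norm_minus_commute)
        ultimately have "norm (z - x) < d + norm (y - x)" by linarith
        moreover have "real (length (j # v)) * d = real (length v) * d + d" by (simp add: distrib_right)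
        ultimately show ?thesis using Cons.prems by linarith
      qed
      have sub: "ball y d \<subseteq> ball x \<rho>"
      proof
        fix z assume "z \<in> ball y d"
        from b[OF this] d(1) have "norm (z - x) < \<rho>" by (smt (verit) mult_nonneg_nonneg of_nat_0_le_iff)
        then show "z \<in> ball x \<rho>" by (simp add: dist_norm norm_minus_commute)
      qed
      have "norm (D_op j (Dw v u) y) \<le> C / d * ((C / d) ^ length v * B)"
        by (rule grad[OF d(1) _ Ker_subset[OF Ker_Dw[OF open_ball u] sub] Cons.IH[OF b]]) (use d \<rho> in auto)
      then show ?case by (simp add: mult.assoc)
    qed
    have "real ?n * d < \<rho>" using \<rho> by (simp add: d_def field_simps)
    then have "norm (Dw w u x) \<le> (C / d) ^ ?n * B" using step[of x w] by simp
    \<comment> \<open>The price of the small balls is \<open>(n + 1) ^ n\<close>, which is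
      \<open>fact n\<close> up to an exponential: the growth of derivatives of an analytic
      function.\<close>
    also have "(C / d) ^ ?n = (C / \<rho>) ^ ?n * (real ?n + 1) ^ ?n"
      using \<rho> by (simp add: d_def power_mult_distrib[symmetric])
    also have "\<dots> \<le> (C / \<rho>) ^ ?n * (fact ?n * exp (real ?n + 1))"
      using C \<rho> by (intro mult_left_mono power_le_fact_exp) auto
    also have "\<dots> = exp 1 * (?A / \<rho>) ^ ?n * fact ?n"
      by (simp add: exp_add exp_of_nat_mult[of ?n 1, simplified] power_divide power_mult_distrib)
    also have "\<dots> * B \<le> ?A * (?A / \<rho>) ^ ?n * fact ?n * B"
      using C \<rho> B0 by (intro mult_right_mono) auto
    finally show "norm (Dw w u x) \<le> ?A * (?A / \<rho>) ^ ?n * fact ?n * B" using B0 by (simp add: mult_right_mono)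
  qed (use \<delta>0 A in auto)
qed

section \<open>Approximate fundamental solutions\<close>

lemma finite_freq_bounded:
  fixes \<theta> :: "real ^ 'n::finite"
  shows "finite {k. norm (freq \<theta> k) < R}"
proof (rule finite_subset)
  let ?B = "\<lambda>j. {\<lfloor>- R - \<theta> $ j\<rfloor>..\<lceil>R - \<theta> $ j\<rceil>}"
  show "{k. norm (freq \<theta> k) < R} \<subseteq> (\<Pi>\<^sub>E j\<in>UNIV. ?B j)"
  proof
    fix k assume k: "k \<in> {k. norm (freq \<theta> k) < R}"
    have "k j \<in> ?B j" for j
    proof -
      have "\<bar>of_int (k j) + \<theta> $ j\<bar> < R" using component_le_norm_cart[of "freq \<theta> k" j] k by simp
      then have "- R - \<theta> $ j \<le> of_int (k j)" "of_int (k j) \<le> R - \<theta> $ j" by linarith+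
      then show ?thesis by (auto simp: floor_le_iff le_ceiling_iff)
    qed
    then show "k \<in> (\<Pi>\<^sub>E j\<in>UNIV. ?B j)" by (auto simp: PiE_iff)
  qed
  show "finite (\<Pi>\<^sub>E j\<in>(UNIV :: 'n set). ?B j)" by (intro finite_PiE) auto
qed

text \<open>For norm at least 1 the lower-order terms are at most
  \<open>A * norm \<xi> ^ m / norm \<xi>\<close>, which is half of the leading lower bound as soon
  as \<open>norm \<xi>\<close> reaches \<open>2 * A / \<kappa>\<close>.\<close>

lemma ell_lower_bound_large:
  fixes c :: "'n::finite list \<Rightarrow> complex"
  assumes "ell W c m"
  obtains R \<kappa> where "1 \<le> R" "0 < \<kappa>" "\<And>\<xi>. R \<le> norm \<xi> \<Longrightarrow> \<kappa> * (1 + norm \<xi>) ^ m \<le> norm (symb W c \<xi>)"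
proof -
  obtain \<kappa> where W: "finite W" "\<And>w. w \<in> W \<Longrightarrow> length w \<le> m" and \<kappa>: "\<kappa> > 0"
    "\<And>\<xi>. \<kappa> * norm \<xi> ^ m \<le> norm (symb {w\<in>W. length w = m} c \<xi>)" using assms by (auto simp: ell_def)
  define A where "A = (\<Sum>w\<in>W. norm (c w))"
  define R where "R = max 1 (2 * A / \<kappa>)"
  have "\<kappa> / 2 / 2 ^ m * (1 + norm \<xi>) ^ m \<le> norm (symb W c \<xi>)" if \<xi>: "R \<le> norm \<xi>" for \<xi>
  proof -
    let ?x = "norm \<xi>"
    have x1: "1 \<le> ?x" and xA: "2 * A \<le> \<kappa> * ?x"
    proof -
      show "1 \<le> ?x" using \<xi> by (simp add: R_def)
      have "2 * A / \<kappa> \<le> ?x" using \<xi> by (simp add: R_def)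
      then show "2 * A \<le> \<kappa> * ?x" using \<kappa>(1) by (simp add: pos_divide_le_eq mult.commute)
    qed
    have "norm (symb {w\<in>W. length w \<noteq> m} c \<xi>) \<le> (\<Sum>w\<in>{w\<in>W. length w \<noteq> m}. norm (c w) * (?x ^ m / ?x))"
    proof (rule norm_symb_le)
      fix w assume w: "w \<in> {w\<in>W. length w \<noteq> m}"
      then have "Suc (length w) \<le> m" using W(2) by force
      then have "?x ^ Suc (length w) \<le> ?x ^ m" using x1 by (intro power_increasing) auto
      moreover have "?x > 0" using x1 by linarith
      ultimately have "?x ^ length w \<le> ?x ^ m / ?x" by (simp add: pos_le_divide_eq mult.commute)
      then show "norm (c w) * ?x ^ length w \<le> norm (c w) * (?x ^ m / ?x)" by (intro mult_left_mono) auto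
    qed (use W in auto)
    also have "\<dots> = (\<Sum>w\<in>{w\<in>W. length w \<noteq> m}. norm (c w)) * (?x ^ m / ?x)" by (simp only: sum_distrib_right)
    also have "\<dots> \<le> A * (?x ^ m / ?x)"
      unfolding A_def using W x1 by (intro mult_right_mono sum_mono2) auto
    also have "\<dots> = A / ?x * ?x ^ m" by simp
    also have "\<dots> \<le> \<kappa> / 2 * ?x ^ m"
    proof -
      have "?x > 0" using x1 by linarith
      then have "A / ?x \<le> \<kappa> / 2" using xA by (simp add: pos_divide_le_eq)
      then show ?thesis using x1 by (intro mult_right_mono) auto
    qed
    finally have 2: "norm (symb {w\<in>W. length w \<noteq> m} c \<xi>) \<le> \<kappa> / 2 * ?x ^ m" .
    have "norm (symb {w\<in>W. length w = m} c \<xi>) \<le> norm (symb W c \<xi>) + norm (symb {w\<in>W. length w \<noteq> m} c \<xi>)"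
      using symb_split[OF W(1), of c \<xi> m] norm_triangle_ineq4[of "symb W c \<xi>" "symb {w\<in>W. length w \<noteq> m} c \<xi>"] by simp
    then have 3: "\<kappa> / 2 * ?x ^ m \<le> norm (symb W c \<xi>)" using 2 \<kappa>(2)[of \<xi>] by simp
    have "(1 + ?x) ^ m \<le> (2 * ?x) ^ m" using x1 by (intro power_mono) auto
    then have "\<kappa> / 2 / 2 ^ m * (1 + ?x) ^ m \<le> \<kappa> / 2 / 2 ^ m * (2 ^ m * ?x ^ m)"
      using \<kappa>(1) by (intro mult_left_mono) (auto simp: power_mult_distrib)
    then show ?thesis using 3 by simp
  qed
  then show thesis using that[of R "\<kappa> / 2 / 2 ^ m"] \<kappa>(1) by (auto simp: R_def)
qed

text \<open>The symbol on the diagonal line through the lattice point \<open>k\<close>, as a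
  polynomial in the parameter of the line; see \<open>poly_line_poly\<close>.\<close>

definition line_poly :: "'n list set \<Rightarrow> ('n::finite list \<Rightarrow> complex) \<Rightarrow> ('n \<Rightarrow> int) \<Rightarrow> complex poly" where
  "line_poly W c k = (\<Sum>w\<in>W. smult (c w) (\<Prod>j\<leftarrow>w. [:of_int (k j), 1:]))"

lemma poly_line_poly: "poly (line_poly W c k) (of_real t) = symb W c (freq (\<chi> j. t) k)"
proof -
  have "poly (\<Prod>j\<leftarrow>w. [:of_int (k j), 1:]) (complex_of_real t) = (\<Prod>j\<leftarrow>w. of_real (freq (\<chi> j. t) k $ j))" for w
    by (induction w) (auto simp: algebra_simps)
  then show ?thesis by (simp add: line_poly_def symb_def poly_sum del: freq_nth)
qed

text \<open>A shift of the lattice along \<open>(1, \<dots>, 1)\<close> avoids the zeros of the symbol, since each lattice line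
  carries only finitely many of them.\<close>

lemma exists_shift:
  fixes c :: "'n::finite list \<Rightarrow> complex"
  assumes "ell W c m"
  obtains \<theta> A \<kappa> where "0 < \<kappa>" "symb_bounds W m A \<kappa> \<theta> c"
proof -
  obtain R \<kappa> where R: "1 \<le> R" "0 < \<kappa>" "\<And>\<xi>. R \<le> norm \<xi> \<Longrightarrow> \<kappa> * (1 + norm \<xi>) ^ m \<le> norm (symb W c \<xi>)"
    using ell_lower_bound_large[OF assms] by blast
  have W: "finite W" "\<And>w. w \<in> W \<Longrightarrow> length w \<le> m" using assms by (auto simp: ell_def)
  have nz: "line_poly W c k \<noteq> 0" for k
  proof
    assume z: "line_poly W c k = 0"
    obtain j :: 'n where True by blast
    let ?\<xi> = "freq (\<chi> j. R - of_int (k j)) k"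
    \<comment> \<open>The corresponding point of the line has a coordinate of size at least
      \<open>R\<close>, and there ellipticity excludes zeros.\<close>
    define t where "t = R + \<bar>of_int (k j)\<bar>"
    have "R \<le> \<bar>freq (\<chi> j. t) k $ j\<bar>" by (simp add: t_def)
    then have n: "R \<le> norm (freq (\<chi> j. t) k)" using component_le_norm_cart[of "freq (\<chi> j. t) k" j] by linarith
    then have "0 < \<kappa> * (1 + norm (freq (\<chi> j. t) k)) ^ m"
      using R(2) by (intro mult_pos_pos zero_less_power) (auto intro: add_pos_nonneg)
    then have "symb W c (freq (\<chi> j. t) k) \<noteq> 0" using R(3)[OF n] by auto
    then show False using poly_line_poly[of W c k t] z by simp
  qed
  define Z where "Z = (\<Union>k. {t :: real. poly (line_poly W c k) (of_real t) = 0})"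
  have "countable Z"
    unfolding Z_def
  proof (rule countable_UN)
    show "countable (UNIV :: ('n \<Rightarrow> int) set)"
    proof -
      have "countable (PiE (UNIV :: 'n set) (\<lambda>_. UNIV :: int set))" by (intro countable_PiE) auto
      then show ?thesis by (simp add: PiE_UNIV_domain)
    qed
    fix k
    have "finite (of_real ` {t :: real. poly (line_poly W c k) (of_real t) = 0} :: complex set)"
      by (rule finite_subset[OF _ poly_roots_finite[OF nz[of k]]]) auto
    then have "finite {t :: real. poly (line_poly W c k) (of_real t) = 0}"
      by (rule finite_imageD) (auto simp: inj_on_def)
    then show "countable {t :: real. poly (line_poly W c k) (of_real t) = 0}" by (rule countable_finite)
  qed
  then have "\<not> {0<..<1} \<subseteq> Z" using uncountable_open_interval[of 0 1] countable_subset by auto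
  then obtain t where t: "t \<notin> Z" by blast
  let ?\<theta> = "\<chi> j. t :: real ^ 'n"
  have s0: "symb W c (freq (\<chi> j. t) k) \<noteq> 0" for k
    using t by (simp add: Z_def poly_line_poly)
  let ?F = "{k. norm (freq (\<chi> j. t) k) < R} :: ('n \<Rightarrow> int) set"
  let ?q = "\<lambda>k. norm (symb W c (freq (\<chi> j. t) k)) / (1 + norm (freq (\<chi> j. t) k)) ^ m"
  have fF: "finite ?F" by (rule finite_freq_bounded)
  \<comment> \<open>From radius \<open>R\<close> on the bound \<kappa> holds; below it only finitely
    many lattice points remain, and the symbol is nonzero at each of them.\<close>
  define \<kappa>' where "\<kappa>' = Min (insert \<kappa> (?q ` ?F))"
  have X: "(1 + norm (freq (\<chi> j. t) k)) ^ m > 0" for k by (intro zero_less_power add_pos_nonneg) auto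
  have "\<kappa>' \<in> insert \<kappa> (?q ` ?F)" unfolding \<kappa>'_def using fF by (intro Min_in) auto
  moreover have "0 < ?q k" for k by (intro divide_pos_pos X) (simp add: s0)
  ultimately have "0 < \<kappa>'" using R(2) by auto
  moreover have "symb_bounds W m (\<Sum>w\<in>W. norm (c w)) \<kappa>' (\<chi> j. t) c"
    unfolding symb_bounds_def
  proof (intro conjI allI ballI)
    show "length w \<le> m" if "w \<in> W" for w using W that by auto
    show "norm (c w) \<le> (\<Sum>w\<in>W. norm (c w))" if "w \<in> W" for w
      using that W by (intro member_le_sum) auto
    fix k
    show "\<kappa>' * (1 + norm (freq (\<chi> j. t) k)) ^ m \<le> norm (symb W c (freq (\<chi> j. t) k))"
    proof (cases "k \<in> ?F")
      case True
      then have "\<kappa>' \<le> ?q k" unfolding \<kappa>'_def using fF by (intro Min_le) auto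
      then show ?thesis using X[of k] by (simp add: pos_le_divide_eq)
    next
      case False
      have "\<kappa>' \<le> \<kappa>" unfolding \<kappa>'_def using fF by (intro Min_le) auto
      then have "\<kappa>' * (1 + norm (freq (\<chi> j. t) k)) ^ m \<le> \<kappa> * (1 + norm (freq (\<chi> j. t) k)) ^ m"
        using X[of k] by (intro mult_right_mono) auto
      also have "\<dots> \<le> norm (symb W c (freq (\<chi> j. t) k))" using False by (intro R(3)) auto
      finally show ?thesis .
    qed
  qed
  ultimately show thesis by (rule that)
qed

text \<open>Two conditions on the transform complement the support: the bound 1 makes estimates
  independent of \<eta>, and the distance to 1 measures the error of the regularisation. At
  \<open>\<xi> = 0\<close> the latter fixes the mass as \<open>(2 * pi) ^ CARD('n)\<close>.\<close>

definition mollifier :: "real \<Rightarrow> (real ^ 'n::finite \<Rightarrow> complex) \<Rightarrow> bool" where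
  "mollifier \<eta> \<rho> \<longleftrightarrow> \<rho> \<in> test_functions (ball 0 \<eta>) \<and> (\<forall>\<xi>. norm (ft \<rho> \<xi>) \<le> 1) \<and> (\<forall>\<xi>. norm (ft \<rho> \<xi> - 1) \<le> \<eta> * norm \<xi>)"

lemma exists_mollifier:
  assumes "\<eta> > 0"
  obtains \<rho> :: "real ^ 'n::finite \<Rightarrow> complex" where "mollifier \<eta> \<rho>"
proof -
  let ?d = "(2 * pi) ^ CARD('n)"
  let ?b = "\<lambda>x::real ^ 'n. flat ((\<eta> / 2)\<^sup>2 - (norm (x - 0))\<^sup>2)"
  have t: "(\<lambda>x. complex_of_real (?b x)) \<in> test_functions (ball 0 \<eta>)"
    by (rule test_bump) (use assms in auto)
  have ib: "integrable lborel ?b"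
    using test_integrable[OF t, of "\<lambda>_. 1"] by (simp add: complex_of_real_integrable_eq)
  define I where "I = (\<integral>x. ?b x \<partial>lborel)"
  have "I > 0"
  proof -
    have cb: "continuous_on UNIV ?b"
    proof -
      have "continuous_on UNIV (\<lambda>x. Re (complex_of_real (?b x)))"
        by (intro continuous_on_Re smooth_continuous_on[OF test_smooth[OF t]])
      then show ?thesis by simp
    qed
    have b0: "?b 0 > 0" using assms by (simp add: flat_simps(3))
    obtain r where r: "r > 0" "\<And>x. norm x < r \<Longrightarrow> ?b x > ?b 0 / 2"
    proof -
      have "\<exists>d>0. \<forall>x. dist x 0 < d \<longrightarrow> dist (?b x) (?b 0) < ?b 0 / 2"
        using cb b0 unfolding continuous_on_iff by (metis UNIV_I half_gt_zero)
      then obtain d where d: "d > 0" "\<And>x. dist x 0 < d \<Longrightarrow> dist (?b x) (?b 0) < ?b 0 / 2" by blast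
      have "?b 0 / 2 < ?b x" if "norm x < d" for x
      proof -
        have "dist x 0 < d" using that by (simp add: dist_norm)
        from d(2)[OF this] show ?thesis unfolding dist_real_def by linarith
      qed
      then show thesis using that d(1) by blast
    qed
    have "(\<integral>x. indicator (ball (0 :: real ^ 'n) r) x * (?b 0 / 2) \<partial>lborel) \<le> I"
      unfolding I_def
    proof (rule Bochner_Integration.integral_mono[OF _ ib])
      show "integrable lborel (\<lambda>x::real ^ 'n. indicator (ball 0 r) x * (?b 0 / 2))"
        using emeasure_lborel_ball_finite[of "0 :: real ^ 'n" r] by (intro integrable_mult_left integrable_real_indicator) auto
      show "indicator (ball 0 r) x * (?b 0 / 2) \<le> ?b x" for x
        using r(2)[of x] flat_simps(2) by (auto simp: indicator_def intro: less_imp_le)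
    qed
    moreover have "(\<integral>x. indicator (ball (0 :: real ^ 'n) r) x * (?b 0 / 2) \<partial>lborel) = measure lborel (ball (0 :: real ^ 'n) r) * (?b 0 / 2)"
      by simp
    moreover have "measure lborel (ball (0 :: real ^ 'n) r) > 0" using r(1) content_ball_pos[of r "0 :: real ^ 'n"] by simp
    ultimately show ?thesis using b0 by (smt (verit) half_gt_zero mult_pos_pos)
  qed
  \<comment> \<open>The factor compensates for the normalisation of \<open>ft\<close>, so that the
    transform is 1 at 0.\<close>
  define \<rho> where "\<rho> x = complex_of_real (?d / I) * complex_of_real (?b x)" for x
  have \<rho>: "\<rho> \<in> test_functions (ball 0 \<eta>)" unfolding \<rho>_def by (rule test_cmult[OF t])
  have n\<rho>: "norm (\<rho> x) = ?d / I * ?b x" for x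
    using \<open>I > 0\<close> flat_simps(2) unfolding \<rho>_def norm_mult norm_of_real by simp
  have int\<rho>: "(\<integral>x. norm (\<rho> x) \<partial>lborel) = ?d"
    unfolding n\<rho> integral_mult_right_zero I_def[symmetric] using \<open>I > 0\<close> by simp
  have int\<rho>': "(\<integral>x. \<rho> x \<partial>lborel) = of_real ?d"
  proof -
    have "\<rho> x = complex_of_real (?d / I * ?b x)" for x by (simp add: \<rho>_def)
    then have "(\<integral>x. \<rho> x \<partial>lborel) = complex_of_real (\<integral>x. ?d / I * ?b x \<partial>lborel)"
      by (simp only: integral_complex_of_real)
    then show ?thesis unfolding integral_mult_right_zero I_def[symmetric] using \<open>I > 0\<close> by simp
  qed
  have i\<rho>: "integrable lborel (\<lambda>x. norm (\<rho> x))" using test_integrable[OF \<rho>, of "\<lambda>_. 1"] by (intro integrable_norm) simp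
  have i\<rho>': "integrable lborel \<rho>" using test_integrable[OF \<rho>, of "\<lambda>_. 1"] by simp
  have nd: "norm (complex_of_real ?d) = ?d" by (simp add: norm_mult norm_power)
  have d0: "?d > 0" by simp
  have 1: "norm (ft \<rho> \<xi>) \<le> 1" for \<xi>
  proof -
    have "norm (\<integral>x. \<rho> x * wave (- \<xi>) x \<partial>lborel) \<le> ?d"
      using integral_norm_bound[of lborel "\<lambda>x. \<rho> x * wave (- \<xi>) x"] int\<rho> by (simp add: norm_mult)
    then show ?thesis unfolding ft_def norm_divide nd using d0 by simp
  qed
  have 2: "norm (ft \<rho> \<xi> - 1) \<le> \<eta> * norm \<xi>" for \<xi>
  proof -
    have "ft \<rho> \<xi> - 1 = ((\<integral>x. \<rho> x * wave (- \<xi>) x \<partial>lborel) - (\<integral>x. \<rho> x \<partial>lborel)) / of_real ?d"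
      unfolding ft_def int\<rho>' using d0 by (simp add: diff_divide_distrib)
    also have "(\<integral>x. \<rho> x * wave (- \<xi>) x \<partial>lborel) - (\<integral>x. \<rho> x \<partial>lborel) = (\<integral>x. \<rho> x * (wave (- \<xi>) x - 1) \<partial>lborel)"
      using ft_integrable[OF \<rho>, of "- \<xi>"] i\<rho>' by (simp add: right_diff_distrib)
    finally have eq: "ft \<rho> \<xi> - 1 = (\<integral>x. \<rho> x * (wave (- \<xi>) x - 1) \<partial>lborel) / of_real ?d" .
    have "norm (\<integral>x. \<rho> x * (wave (- \<xi>) x - 1) \<partial>lborel) \<le> (\<integral>x. norm (\<rho> x) * (\<eta> * norm \<xi>) \<partial>lborel)"
    proof (rule Bochner_Integration.integral_norm_bound_integral)
      show "integrable lborel (\<lambda>x. \<rho> x * (wave (- \<xi>) x - 1))"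
        by (rule test_integrable[OF \<rho>]) (intro continuous_intros continuous_wave)
      show "integrable lborel (\<lambda>x. norm (\<rho> x) * (\<eta> * norm \<xi>))" using i\<rho> by simp
      fix x
      show "norm (\<rho> x * (wave (- \<xi>) x - 1)) \<le> norm (\<rho> x) * (\<eta> * norm \<xi>)"
      proof (cases "x \<in> ball 0 \<eta>")
        case True
        have "norm (wave (- \<xi>) x - 1) \<le> \<bar>- \<xi> \<bullet> x\<bar>" unfolding wave_def by (rule norm_cis_minus_1_le)
        also have "\<dots> \<le> norm \<xi> * norm x" using Cauchy_Schwarz_ineq2[of "- \<xi>" x] by simp
        also have "\<dots> \<le> \<eta> * norm \<xi>" using True by (subst mult.commute) (intro mult_right_mono, auto)
        finally show ?thesis unfolding norm_mult by (intro mult_left_mono) auto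
      next
        case False
        then show ?thesis using test_zero[OF \<rho> False] by simp
      qed
    qed
    also have "\<dots> = ?d * (\<eta> * norm \<xi>)" using int\<rho> by simp
    finally show ?thesis unfolding eq norm_divide nd using d0 by (simp add: pos_divide_le_eq mult.commute)
  qed
  show thesis by (rule that[of \<rho>]) (use \<rho> 1 2 in \<open>auto simp: mollifier_def\<close>)
qed

text \<open>The fundamental solution with multipliers \<open>1 / symb\<close>, convolved with
  \<rho>. The operator maps it to the series of \<rho>, which agrees with \<rho> itself up to
  distance \<open>3 - \<eta>\<close> from the origin.\<close>

definition fsol :: "'n list set \<Rightarrow> ('n::finite list \<Rightarrow> complex) \<Rightarrow> real ^ 'n \<Rightarrow> (real ^ 'n \<Rightarrow> complex) \<Rightarrow> real ^ 'n \<Rightarrow> complex" where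
  "fsol W c \<theta> \<rho> = trig \<theta> (\<lambda>k. ft \<rho> (freq \<theta> k) / symb W c (freq \<theta> k))"

section \<open>The regularised fundamental solution: bounds and representation\<close>

lemma symb_inverse_bound:
  assumes "0 < \<kappa>" "symb_bounds W m A \<kappa> \<theta> c"
  shows "norm (1 / symb W c (freq \<theta> k)) \<le> 1 / \<kappa>" "symb W c (freq \<theta> k) \<noteq> 0"
proof -
  have "\<kappa> * 1 \<le> \<kappa> * (1 + norm (freq \<theta> k)) ^ m"
    using assms(1) by (intro mult_left_mono one_le_power) auto
  also have "\<dots> \<le> norm (symb W c (freq \<theta> k))" using assms(2) by (auto simp: symb_bounds_def)
  finally show "norm (1 / symb W c (freq \<theta> k)) \<le> 1 / \<kappa>" "symb W c (freq \<theta> k) \<noteq> 0"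
    using assms(1) by (auto simp: norm_divide frac_le)
qed

lemma rapid_fsol:
  assumes "0 < \<kappa>" "symb_bounds W m A \<kappa> \<theta> c" "\<rho> \<in> test_functions V"
  shows "rapid \<theta> (\<lambda>k. ft \<rho> (freq \<theta> k) / symb W c (freq \<theta> k))"
  using rapid_mult[OF rapid_ft[OF assms(3)], where b = "\<lambda>k. 1 / symb W c (freq \<theta> k)" and C = "1 / \<kappa>" and r = 0]
    symb_inverse_bound(1)[OF assms(1,2)] by simp

lemma trig_cmult: "trig \<theta> (\<lambda>k. b * a k) x = b * trig \<theta> a x"
  by (simp add: trig_def mult.assoc infsum_cmult_right')

lemma trig_sum:
  assumes "finite I" "\<And>i. i \<in> I \<Longrightarrow> rapid \<theta> (a i)"
  shows "trig \<theta> (\<lambda>k. \<Sum>i\<in>I. a i k) x = (\<Sum>i\<in>I. trig \<theta> (a i) x)"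
proof -
  have "((\<lambda>k. \<Sum>i\<in>I. a i k * wave (freq \<theta> k) x) has_sum (\<Sum>i\<in>I. trig \<theta> (a i) x)) UNIV"
    by (intro has_sum_finite_sum assms(1) trig_has_sum rapid_norm_summable[OF assms(2)])
  then show ?thesis unfolding trig_def by (simp add: sum_distrib_right infsumI)
qed

lemma Lop_trig:
  assumes "rapid \<theta> a" "finite W"
  shows "Lop W c (trig \<theta> a) x = trig \<theta> (\<lambda>k. symb W c (freq \<theta> k) * a k) x"
proof -
  have r: "rapid \<theta> (\<lambda>k. c w * ((\<Prod>j\<leftarrow>w. of_real (freq \<theta> k $ j)) * a k))" for w
    by (rule rapid_mult[OF rapid_word[OF assms(1)], where C = "norm (c w)" and r = 0]) simp
  have "Lop W c (trig \<theta> a) x = (\<Sum>w\<in>W. trig \<theta> (\<lambda>k. c w * ((\<Prod>j\<leftarrow>w. of_real (freq \<theta> k $ j)) * a k)) x)"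
    by (simp add: Lop_def Dw_trig[OF assms(1)] trig_cmult del: freq_nth)
  also have "\<dots> = trig \<theta> (\<lambda>k. \<Sum>w\<in>W. c w * ((\<Prod>j\<leftarrow>w. of_real (freq \<theta> k $ j)) * a k)) x"
    by (rule trig_sum[symmetric, OF assms(2) r])
  finally show ?thesis by (simp add: symb_def sum_distrib_right mult.assoc del: freq_nth)
qed

lemma fsol_Ker:
  assumes W: "finite W" and sb: "0 < \<kappa>" "symb_bounds W m A \<kappa> \<theta> c" and \<rho>: "\<rho> \<in> test_functions (ball 0 \<eta>)"
  shows "fsol W c \<theta> \<rho> \<in> Ker W c {x. \<eta> < norm x \<and> norm x < 3 - \<eta>}"
proof -
  have r: "rapid \<theta> (\<lambda>k. ft \<rho> (freq \<theta> k) / symb W c (freq \<theta> k))" by (rule rapid_fsol[OF sb \<rho>])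
  have "Lop W c (fsol W c \<theta> \<rho>) x = 0" if "\<eta> < norm x" "norm x < 3 - \<eta>" for x
  proof -
    have "Lop W c (fsol W c \<theta> \<rho>) x = trig \<theta> (\<lambda>k. ft \<rho> (freq \<theta> k)) x"
      unfolding fsol_def by (simp add: Lop_trig[OF r W] symb_inverse_bound(2)[OF sb])
    also have "\<dots> = \<rho> x" using that by (intro ft_inversion[OF \<rho>]) auto
    also have "\<dots> = 0" using that by (intro test_zero[OF \<rho>]) auto
    finally show ?thesis .
  qed
  then show ?thesis using smooth_trig[OF r] by (auto simp: Ker_def fsol_def)
qed

text \<open>The coefficients are at most \<open>1 / \<kappa>\<close> for every mollifier. A cutoff
  to an annulus around the pole keeps them bounded, and as the function solves the equation there,
  \<open>interior_estimate\<close> converts this into a bound for its values. Nothing depends on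
  \<eta> or \<rho>.\<close>

lemma fsol_bound:
  fixes c :: "'n::finite list \<Rightarrow> complex"
  assumes W: "finite W" and sb: "0 < \<kappa>" "symb_bounds W m A \<kappa> \<theta> c" and \<delta>: "0 < \<delta>"
  obtains C where "0 \<le> C" "\<And>\<eta> \<rho> x. \<eta> \<le> \<delta> / 2 \<Longrightarrow> \<eta> \<le> 1 \<Longrightarrow> mollifier \<eta> \<rho> \<Longrightarrow> \<delta> \<le> norm x \<Longrightarrow> norm x \<le> 5/4 \<Longrightarrow> norm (fsol W c \<theta> \<rho> x) \<le> C"
proof -
  let ?V = "{x :: real ^ 'n. \<delta> / 2 < norm x \<and> norm x < 4/3}"
  let ?Z = "{x :: real ^ 'n. \<delta> \<le> norm x \<and> norm x \<le> 5/4}"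
  have V: "open ?V" "?V \<subseteq> ball 0 (3/2)"
    by (auto intro!: open_Collect_conj open_Collect_less continuous_intros)
  have "?Z = cball 0 (5/4) \<inter> {x. \<delta> \<le> norm x}" by auto
  moreover have "closed {x :: real ^ 'n. \<delta> \<le> norm x}" by (intro closed_Collect_le continuous_intros)
  ultimately have Z: "compact ?Z" by (simp add: compact_Int_closed)
  have ZV: "?Z \<subseteq> ?V" using \<delta> by auto
  obtain \<zeta> C where \<zeta>: "\<zeta> \<in> test_functions ?V" and C: "0 \<le> C"
    "\<And>c u B x j. symb_bounds W m A \<kappa> \<theta> c \<Longrightarrow> u \<in> Ker W c ?V \<Longrightarrow> (\<And>k. norm (ft (\<lambda>x. \<zeta> x * u x) (freq \<theta> k)) \<le> B) \<Longrightarrow>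
      x \<in> ?Z \<Longrightarrow> norm (u x) \<le> C * B \<and> norm (D_op j u x) \<le> C * B"
    using interior_estimate[OF V W sb(1) Z ZV, of m A \<theta>] by blast
  obtain D where D: "0 \<le> D" "\<And>\<theta> a B k. rapid \<theta> a \<Longrightarrow> (\<And>k. norm (a k) \<le> B) \<Longrightarrow> norm (ft (\<lambda>x. \<zeta> x * trig \<theta> a x) (freq \<theta> k)) \<le> D * B"
    using ft_trig_mult_bound[OF \<zeta>] by blast
  show thesis
  proof (rule that[of "C * (D * (1 / \<kappa>))"])
    show "0 \<le> C * (D * (1 / \<kappa>))" using C(1) D(1) sb(1) by (intro mult_nonneg_nonneg) auto
    fix \<eta> :: real and \<rho> :: "real ^ 'n \<Rightarrow> complex" and x :: "real ^ 'n" assume \<eta>: "\<eta> \<le> \<delta> / 2" "\<eta> \<le> 1" and m: "mollifier \<eta> \<rho>" and x: "\<delta> \<le> norm x" "norm x \<le> 5/4"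
    have \<rho>: "\<rho> \<in> test_functions (ball 0 \<eta>)" using m by (simp add: mollifier_def)
    have r: "rapid \<theta> (\<lambda>k. ft \<rho> (freq \<theta> k) / symb W c (freq \<theta> k))" by (rule rapid_fsol[OF sb \<rho>])
    have b: "norm (ft \<rho> (freq \<theta> k) / symb W c (freq \<theta> k)) \<le> 1 / \<kappa>" for k
    proof -
      have "norm (ft \<rho> (freq \<theta> k) / symb W c (freq \<theta> k)) = norm (ft \<rho> (freq \<theta> k)) * norm (1 / symb W c (freq \<theta> k))"
        by (simp add: norm_divide)
      also have "\<dots> \<le> 1 * (1 / \<kappa>)"
        using m symb_inverse_bound(1)[OF sb] sb(1) by (intro mult_mono) (auto simp: mollifier_def)
      finally show ?thesis by simp
    qed
    have sub: "?V \<subseteq> {x. \<eta> < norm x \<and> norm x < 3 - \<eta>}" using \<eta> by auto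
    have u: "fsol W c \<theta> \<rho> \<in> Ker W c ?V" by (rule Ker_subset[OF fsol_Ker[OF W sb \<rho>] sub])
    have "norm (ft (\<lambda>x. \<zeta> x * fsol W c \<theta> \<rho> x) (freq \<theta> k)) \<le> D * (1 / \<kappa>)" for k
      unfolding fsol_def by (rule D(2)[OF r b])
    from C(2)[OF sb(2) u this] x show "norm (fsol W c \<theta> \<rho> x) \<le> C * (D * (1 / \<kappa>))" by blast
  qed
qed

lemma fsol_derivative_bound:
  fixes c :: "'n::finite list \<Rightarrow> complex"
  assumes el: "ell W c m" and sb: "0 < \<kappa>" "symb_bounds W m A \<kappa> \<theta> c" and \<delta>: "0 < \<delta>"
  obtains B where "1 \<le> B" "\<And>\<eta> \<rho> x w. \<eta> \<le> \<delta> / 4 \<Longrightarrow> \<eta> \<le> 1 \<Longrightarrow> mollifier \<eta> \<rho> \<Longrightarrow> \<delta> \<le> norm x \<Longrightarrow> norm x \<le> 1 \<Longrightarrow>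
    norm (Dw w (fsol W c \<theta> \<rho>) x) \<le> B ^ Suc (length w) * fact (length w)"
proof -
  have W: "finite W" using el by (simp add: ell_def)
  obtain C where C: "0 \<le> C" "\<And>\<eta> \<rho> x. \<eta> \<le> \<delta> / 2 / 2 \<Longrightarrow> \<eta> \<le> 1 \<Longrightarrow> mollifier \<eta> \<rho> \<Longrightarrow> \<delta> / 2 \<le> norm x \<Longrightarrow> norm x \<le> 5/4 \<Longrightarrow> norm (fsol W c \<theta> \<rho> x) \<le> C"
    using fsol_bound[OF W sb half_gt_zero[OF \<delta>]] by blast
  obtain \<delta>0 D where D: "0 < \<delta>0" "1 \<le> D"
    "\<And>r x u B w. 0 < r \<Longrightarrow> r \<le> \<delta>0 \<Longrightarrow> u \<in> Ker W c (ball x r) \<Longrightarrow> (\<And>y. y \<in> ball x r \<Longrightarrow> norm (u y) \<le> B) \<Longrightarrow>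
      norm (Dw w u x) \<le> D * (D / r) ^ length w * fact (length w) * B"
    using Cauchy_estimate[OF el] by blast
  \<comment> \<open>Balls of radius \<open>r\<close> around points with
    \<open>\<delta> \<le> norm x\<close> and \<open>norm x \<le> 1\<close> stay where
    \<open>fsol_bound\<close>, taken for \<open>\<delta> / 2\<close>, applies;
    \<open>\<delta>0\<close> is the limit of the Cauchy estimate.\<close>
  define r where "r = min \<delta>0 (min (\<delta> / 2) (1/4))"
  have r: "0 < r" "r \<le> \<delta>0" "r \<le> \<delta> / 2" "r \<le> 1/4" using D \<delta> by (auto simp: r_def)
  define B where "B = max (D / r) (max 1 (D * C))"
  show thesis
  proof (rule that[of B])
    show "1 \<le> B" by (simp add: B_def)
    fix \<eta> :: real and \<rho> :: "real ^ 'n \<Rightarrow> complex" and x :: "real ^ 'n" and w :: "'n list"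
    assume \<eta>: "\<eta> \<le> \<delta> / 4" "\<eta> \<le> 1" and m: "mollifier \<eta> \<rho>" and x: "\<delta> \<le> norm x" "norm x \<le> 1"
    have nb: "\<delta> / 2 \<le> norm y \<and> norm y \<le> 5/4" and nk: "\<eta> < norm y \<and> norm y < 3 - \<eta>" if "y \<in> ball x r" for y
    proof -
      have "norm (x - y) < r" using that by (simp add: dist_norm)
      then have *: "norm x - r < norm y" "norm y < norm x + r"
        using norm_triangle_ineq2[of x y] norm_triangle_ineq2[of y x] by (auto simp: norm_minus_commute)
      then show "\<delta> / 2 \<le> norm y \<and> norm y \<le> 5/4" using x r by auto
      then show "\<eta> < norm y \<and> norm y < 3 - \<eta>" using \<eta> \<delta> by auto
    qed
    have \<rho>: "\<rho> \<in> test_functions (ball 0 \<eta>)" using m by (simp add: mollifier_def)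
    have u: "fsol W c \<theta> \<rho> \<in> Ker W c (ball x r)"
      by (rule Ker_subset[OF fsol_Ker[OF W sb \<rho>]]) (use nk in auto)
    have "norm (fsol W c \<theta> \<rho> y) \<le> C" if "y \<in> ball x r" for y
      using C(2)[OF _ \<eta>(2) m, of y] nb[OF that] \<eta>(1) by simp
    from D(3)[OF r(1,2) u this, of w]
    have "norm (Dw w (fsol W c \<theta> \<rho>) x) \<le> (D * C) * (D / r) ^ length w * fact (length w)" by (simp add: mult_ac)
    also have "\<dots> \<le> B * B ^ length w * fact (length w)"
      using D(2) r(1) by (intro mult_right_mono mult_mono power_mono) (auto simp: B_def)
    finally show "norm (Dw w (fsol W c \<theta> \<rho>) x) \<le> B ^ Suc (length w) * fact (length w)" by simp
  qed
qed

lemma test_Lop: "\<phi> \<in> test_functions V \<Longrightarrow> Lop W c \<phi> \<in> test_functions V"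
  unfolding Lop_def[abs_def] by (intro test_sum test_cmult test_Dw)

lemma ft_Lop: "\<phi> \<in> test_functions V \<Longrightarrow> ft (Lop W c \<phi>) \<xi> = symb W c \<xi> * ft \<phi> \<xi>"
  unfolding Lop_def[abs_def]
  by (subst ft_sum[where V = V]) (simp_all add: test_cmult test_Dw ft_cmult ft_Dw symb_def sum_distrib_right mult.assoc)

text \<open>On the lattice the symbol coming from \<open>Lop W c \<phi>\<close> cancels the
  denominator in \<open>fsol\<close>, which leaves the product of the transforms of \<rho> and
  \<phi>.\<close>

lemma fsol_convolution:
  fixes \<phi> :: "real ^ 'n::finite \<Rightarrow> complex"
  assumes sb: "0 < \<kappa>" "symb_bounds W m A \<kappa> \<theta> c" and \<rho>: "\<rho> \<in> test_functions U" and \<phi>: "\<phi> \<in> test_functions V"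
  shows "((\<lambda>k. ft \<rho> (freq \<theta> k) * ft \<phi> (freq \<theta> k) * wave (freq \<theta> k) x) has_sum
    (\<integral>y. fsol W c \<theta> \<rho> (x - y) * Lop W c \<phi> y \<partial>lborel) / of_real ((2 * pi) ^ CARD('n))) UNIV"
proof -
  let ?a = "\<lambda>k. ft \<rho> (freq \<theta> k) / symb W c (freq \<theta> k)" and ?d = "complex_of_real ((2 * pi) ^ CARD('n))"
  have r: "rapid \<theta> ?a" by (rule rapid_fsol[OF sb \<rho>])
  have c1: "continuous_on UNIV (\<lambda>y. x - y)" by (intro continuous_intros)
  have "((\<lambda>k. ?a k * (\<integral>y. wave (freq \<theta> k) (x - y) * Lop W c \<phi> y \<partial>lborel)) has_sum
      (\<integral>y. (\<Sum>\<^sub>\<infinity>k. ?a k * wave (freq \<theta> k) (x - y)) * Lop W c \<phi> y \<partial>lborel)) UNIV"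
  proof (rule integral_infsum_mult[OF rapid_norm_summable[OF r]])
    show "continuous_on UNIV (\<lambda>y. wave (freq \<theta> k) (x - y))" for k
      by (rule continuous_on_compose2[OF continuous_wave[of UNIV] c1]) auto
    have "continuous_on UNIV (\<lambda>y. trig \<theta> ?a (x - y))"
      by (rule continuous_on_compose2[OF smooth_continuous_on[OF smooth_trig[OF r, of UNIV]] c1]) auto
    then show "continuous_on UNIV (\<lambda>y. \<Sum>\<^sub>\<infinity>k. ?a k * wave (freq \<theta> k) (x - y))" by (simp add: trig_def)
    show "integrable lborel (Lop W c \<phi>)"
      using test_integrable[OF test_Lop[OF \<phi>], of "\<lambda>_. 1"] by simp
  qed simp
  moreover have "?a k * (\<integral>y. wave (freq \<theta> k) (x - y) * Lop W c \<phi> y \<partial>lborel)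
      = ft \<rho> (freq \<theta> k) * ft \<phi> (freq \<theta> k) * wave (freq \<theta> k) x * ?d" for k
  proof -
    have weq: "wave (freq \<theta> k) (x - y) * Lop W c \<phi> y = wave (freq \<theta> k) x * (Lop W c \<phi> y * wave (- freq \<theta> k) y)" for y
      using wave_add_right[of "freq \<theta> k" x "- y"] by (simp add: wave_minus_right)
    have "(\<integral>y. wave (freq \<theta> k) (x - y) * Lop W c \<phi> y \<partial>lborel) = wave (freq \<theta> k) x * (ft (Lop W c \<phi>) (freq \<theta> k) * ?d)"
      unfolding weq integral_mult_right_zero by (simp add: ft_def)
    then show ?thesis
      using symb_inverse_bound(2)[OF sb, of k] by (simp add: ft_Lop[OF \<phi>])
  qed
  ultimately have "((\<lambda>k. ft \<rho> (freq \<theta> k) * ft \<phi> (freq \<theta> k) * wave (freq \<theta> k) x * ?d) has_sum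
      (\<integral>y. fsol W c \<theta> \<rho> (x - y) * Lop W c \<phi> y \<partial>lborel)) UNIV"
    by (simp add: fsol_def trig_def)
  from has_sum_cmult_left[OF this, of "1 / ?d"] show ?thesis by simp
qed

text \<open>The coefficients of \<phi> and of its regularisation differ by the factor
  \<open>1 - ft \<rho>\<close>, of size at most \<open>\<eta> * norm \<xi>\<close>, and those of
  \<phi> decay fast enough to sum this. The constant depends on \<phi>, which is harmless because
  \<eta> is chosen after \<phi>.\<close>

lemma fsol_representation:
  fixes \<phi> :: "real ^ 'n::finite \<Rightarrow> complex"
  assumes sb: "0 < \<kappa>" "symb_bounds W m A \<kappa> \<theta> c" and \<phi>: "\<phi> \<in> test_functions (ball 0 r)"
  obtains C where "0 \<le> C" "\<And>\<eta> \<rho> x. 0 \<le> \<eta> \<Longrightarrow> mollifier \<eta> \<rho> \<Longrightarrow> norm x + r \<le> 3 \<Longrightarrow>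
    norm (\<phi> x - (\<integral>y. fsol W c \<theta> \<rho> (x - y) * Lop W c \<phi> y \<partial>lborel) / of_real ((2 * pi) ^ CARD('n))) \<le> \<eta> * C"
proof
  let ?f = "\<lambda>k. ft \<phi> (freq \<theta> k)"
  let ?C = "\<Sum>\<^sub>\<infinity>k. norm (?f k) * (1 + norm (freq \<theta> k)) ^ 1"
  have r: "rapid \<theta> ?f" by (rule rapid_ft[OF \<phi>])
  show "0 \<le> ?C" by (intro infsum_nonneg) auto
  fix \<eta> :: real and \<rho> :: "real ^ 'n \<Rightarrow> complex" and x :: "real ^ 'n"
  assume \<eta>: "0 \<le> \<eta>" and m: "mollifier \<eta> \<rho>" and x: "norm x + r \<le> 3"
  have \<rho>: "\<rho> \<in> test_functions (ball 0 \<eta>)" using m by (simp add: mollifier_def)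
  show "norm (\<phi> x - (\<integral>y. fsol W c \<theta> \<rho> (x - y) * Lop W c \<phi> y \<partial>lborel) / of_real ((2 * pi) ^ CARD('n))) \<le> \<eta> * ?C"
  proof (rule norm_infsum_le)
    have "((\<lambda>k. ?f k * wave (freq \<theta> k) x) has_sum \<phi> x) UNIV"
      using trig_has_sum[OF rapid_norm_summable[OF r], where \<theta> = \<theta> and x = x] ft_inversion[OF \<phi> x, of \<theta>] by simp
    from has_sum_diff[OF this fsol_convolution[OF sb \<rho> \<phi>, of x]]
    show "((\<lambda>k. ?f k * wave (freq \<theta> k) x - ft \<rho> (freq \<theta> k) * ?f k * wave (freq \<theta> k) x) has_sum
        (\<phi> x - (\<integral>y. fsol W c \<theta> \<rho> (x - y) * Lop W c \<phi> y \<partial>lborel) / of_real ((2 * pi) ^ CARD('n)))) UNIV" .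
    show "((\<lambda>k. \<eta> * (norm (?f k) * (1 + norm (freq \<theta> k)) ^ 1)) has_sum \<eta> * ?C) UNIV"
      by (intro has_sum_cmult_right has_sum_infsum rapid_summable[OF r])
    fix k
    have "?f k * wave (freq \<theta> k) x - ft \<rho> (freq \<theta> k) * ?f k * wave (freq \<theta> k) x = (1 - ft \<rho> (freq \<theta> k)) * (?f k * wave (freq \<theta> k) x)"
      by (simp add: algebra_simps)
    then have "norm (?f k * wave (freq \<theta> k) x - ft \<rho> (freq \<theta> k) * ?f k * wave (freq \<theta> k) x) = norm (ft \<rho> (freq \<theta> k) - 1) * norm (?f k)"
      by (simp add: norm_mult norm_minus_commute)
    also have "\<dots> \<le> (\<eta> * norm (freq \<theta> k)) * norm (?f k)"
      using m by (intro mult_right_mono) (auto simp: mollifier_def)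
    also have "\<dots> \<le> (\<eta> * (1 + norm (freq \<theta> k))) * norm (?f k)"
      using \<eta> by (intro mult_right_mono mult_left_mono) auto
    finally show "norm (?f k * wave (freq \<theta> k) x - ft \<rho> (freq \<theta> k) * ?f k * wave (freq \<theta> k) x)
        \<le> \<eta> * (norm (?f k) * (1 + norm (freq \<theta> k)) ^ 1)" by (simp add: mult_ac)
  qed
qed

text \<open>The integral becomes a finite superposition of translates with poles in
  \<open>S\<close>. Their number depends on the Lipschitz constant and on \<epsilon> and stays
  uncontrolled; what matters later is the sum of the weights, which the integral of
  \<open>norm (g z)\<close> bounds.\<close>

lemma riemann_sum:
  fixes F g :: "'a::euclidean_space \<Rightarrow> complex"
  assumes g: "integrable lborel g" "compact S" "\<And>z. z \<notin> S \<Longrightarrow> g z = 0"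
    and F: "continuous_on UNIV F" "\<And>z. norm (F z) \<le> B" "\<And>z z'. norm (F z - F z') \<le> L * norm (z - z')" "0 \<le> L"
    and \<epsilon>: "0 < \<epsilon>"
  shows "\<exists>n (y :: nat \<Rightarrow> 'a) c. (\<forall>i<n. y i \<in> S) \<and> (\<Sum>i<n. norm (c i)) \<le> (\<integral>z. norm (g z) \<partial>lborel) \<and>
    (\<forall>x. norm ((\<integral>z. F (x - z) * g z \<partial>lborel) - (\<Sum>i<n. c i * F (x - y i))) \<le> \<epsilon>)"
proof -
  let ?I = "\<integral>z. norm (g z) \<partial>lborel"
  have I0: "0 \<le> ?I" by simp
  define \<zeta> where "\<zeta> = \<epsilon> / (L * ?I + 1)"
  have LI: "0 \<le> L * ?I" using F(4) I0 by simp
  have \<zeta>: "\<zeta> > 0" "L * \<zeta> * ?I \<le> \<epsilon>"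
  proof -
    show "\<zeta> > 0" unfolding \<zeta>_def using LI \<epsilon> by (intro divide_pos_pos) auto
    have "L * \<zeta> * ?I = \<epsilon> * ((L * ?I) / (L * ?I + 1))" by (simp add: \<zeta>_def)
    also have "\<dots> \<le> \<epsilon> * 1" using LI \<epsilon> by (intro mult_left_mono) auto
    finally show "L * \<zeta> * ?I \<le> \<epsilon>" by simp
  qed
  obtain J where J: "finite J" "J \<subseteq> S" "S \<subseteq> (\<Union>y\<in>J. ball y \<zeta>)"
    using seq_compact_imp_totally_bounded[OF compact_imp_seq_compact[OF g(2)], rule_format, OF \<zeta>(1)] by blast
  obtain n and y :: "nat \<Rightarrow> 'a" where y: "y ` {i. i < n} = J"
    using finite_imp_nat_seg_image_inj_on[OF J(1)] by blast
  \<comment> \<open>Successive balls with the earlier ones removed: disjoint measurable pieces that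
    cover \<open>S\<close>, each within the mesh of its centre.\<close>
  define P where "P i = ball (y i) \<zeta> - (\<Union>j<i. ball (y j) \<zeta>)" for i
  have Pm: "P i \<in> sets lborel" for i unfolding P_def by auto
  have Pd: "i = j" if "z \<in> P i" "z \<in> P j" for z i j
    using that unfolding P_def by (metis DiffE UN_I lessThan_iff linorder_less_linear)
  have PS: "\<exists>i<n. z \<in> P i" if "z \<in> S" for z
  proof -
    have ex: "\<exists>i. i < n \<and> z \<in> ball (y i) \<zeta>" using that J(3) y by blast
    define i where "i = (LEAST i. i < n \<and> z \<in> ball (y i) \<zeta>)"
    have i: "i < n" "z \<in> ball (y i) \<zeta>" using LeastI_ex[OF ex] unfolding i_def by blast+
    have "z \<notin> ball (y j) \<zeta>" if "j < i" for j
      using not_less_Least[of j "\<lambda>i. i < n \<and> z \<in> ball (y i) \<zeta>"] that i(1) unfolding i_def by auto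
    then have "z \<in> P i" using i(2) by (auto simp: P_def)
    then show ?thesis using i(1) by blast
  qed
  define c where "c i = (\<integral>z. indicator (P i) z *\<^sub>R g z \<partial>lborel)" for i
  have ind: "integrable lborel (\<lambda>z. indicator (P i) z *\<^sub>R h z)" if "integrable lborel h" for i and h :: "'a \<Rightarrow> complex"
    by (rule integrable_mult_indicator[OF Pm that])
  have one: "(\<Sum>i<n. indicator (P i) z *\<^sub>R h i) = h j" if "j < n" "z \<in> P j" for z j and h :: "nat \<Rightarrow> 'b::real_vector"
  proof -
    have "(\<Sum>i<n. indicator (P i) z *\<^sub>R h i) = (\<Sum>i\<in>{j}. indicator (P i) z *\<^sub>R h i)"
      by (rule sum.mono_neutral_right) (use that Pd in \<open>auto simp: indicator_def\<close>)
    then show ?thesis using that by simp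
  qed
  have sumc: "(\<Sum>i<n. norm (c i)) \<le> ?I"
  proof -
    have ng: "integrable lborel (\<lambda>z. norm (g z))" using g(1) by (rule integrable_norm)
    have "(\<Sum>i<n. norm (c i)) \<le> (\<Sum>i<n. \<integral>z. indicator (P i) z *\<^sub>R norm (g z) \<partial>lborel)"
    proof (rule sum_mono)
      fix i
      have "norm (c i) \<le> (\<integral>z. norm (indicator (P i) z *\<^sub>R g z) \<partial>lborel)"
        unfolding c_def by (rule integral_norm_bound)
      then show "norm (c i) \<le> (\<integral>z. indicator (P i) z *\<^sub>R norm (g z) \<partial>lborel)" by simp
    qed
    also have "\<dots> = (\<integral>z. (\<Sum>i<n. indicator (P i) z *\<^sub>R norm (g z)) \<partial>lborel)"
      by (rule Bochner_Integration.integral_sum[symmetric]) (rule integrable_mult_indicator[OF Pm ng])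
    also have "\<dots> = ?I"
    proof (rule Bochner_Integration.integral_cong[OF refl])
      fix z
      show "(\<Sum>i<n. indicator (P i) z *\<^sub>R norm (g z)) = norm (g z)"
      proof (cases "z \<in> S")
        case True
        then obtain i where "i < n" "z \<in> P i" using PS by blast
        from one[OF this, of "\<lambda>_. norm (g z)"] show ?thesis .
      qed (simp add: g(3))
    qed
    finally show ?thesis .
  qed
  have err: "norm ((\<integral>z. F (x - z) * g z \<partial>lborel) - (\<Sum>i<n. c i * F (x - y i))) \<le> \<epsilon>" for x
  proof -
    have c1: "continuous_on UNIV (\<lambda>z. F (x - z))"
      by (rule continuous_on_compose2[OF F(1)]) (auto intro!: continuous_intros)
    have iF: "integrable lborel (\<lambda>z. F (x - z) * g z)"
    proof (rule Bochner_Integration.integrable_bound[of lborel "\<lambda>z. B * norm (g z)"])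
      show "integrable lborel (\<lambda>z. B * norm (g z))" using g(1) by simp
      show "(\<lambda>z. F (x - z) * g z) \<in> borel_measurable lborel"
        using borel_measurable_continuous_onI[OF c1] borel_measurable_integrable[OF g(1)] by measurable
      have "norm (F (x - z) * g z) \<le> norm (B * norm (g z))" for z
        using F(2)[of "x - z"] norm_ge_zero[of "F (x - z)"] by (simp add: norm_mult abs_mult mult_right_mono)
      then show "AE z in lborel. norm (F (x - z) * g z) \<le> norm (B * norm (g z))" by simp
    qed
    have s: "(\<Sum>i<n. c i * F (x - y i)) = (\<integral>z. (\<Sum>i<n. indicator (P i) z *\<^sub>R (g z * F (x - y i))) \<partial>lborel)"
    proof -
      have "(\<Sum>i<n. c i * F (x - y i)) = (\<Sum>i<n. \<integral>z. indicator (P i) z *\<^sub>R (g z * F (x - y i)) \<partial>lborel)"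
        unfolding c_def by (intro sum.cong refl) (subst integral_mult_left_zero[symmetric], simp)
      also have "\<dots> = (\<integral>z. (\<Sum>i<n. indicator (P i) z *\<^sub>R (g z * F (x - y i))) \<partial>lborel)"
        by (rule Bochner_Integration.integral_sum[symmetric]) (intro ind integrable_mult_left g(1))
      finally show ?thesis .
    qed
    have iS: "integrable lborel (\<lambda>z. \<Sum>i<n. indicator (P i) z *\<^sub>R (g z * F (x - y i)))"
      by (intro Bochner_Integration.integrable_sum ind integrable_mult_left g(1))
    have "(\<integral>z. F (x - z) * g z \<partial>lborel) - (\<Sum>i<n. c i * F (x - y i))
        = (\<integral>z. F (x - z) * g z - (\<Sum>i<n. indicator (P i) z *\<^sub>R (g z * F (x - y i))) \<partial>lborel)"
      unfolding s by (rule Bochner_Integration.integral_diff[OF iF iS, symmetric])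
    also have "norm \<dots> \<le> (\<integral>z. L * \<zeta> * norm (g z) \<partial>lborel)"
    proof (rule Bochner_Integration.integral_norm_bound_integral)
      show "integrable lborel (\<lambda>z. F (x - z) * g z - (\<Sum>i<n. indicator (P i) z *\<^sub>R (g z * F (x - y i))))"
        by (rule Bochner_Integration.integrable_diff[OF iF iS])
      show "integrable lborel (\<lambda>z. L * \<zeta> * norm (g z))" using g(1) by simp
      fix z
      show "norm (F (x - z) * g z - (\<Sum>i<n. indicator (P i) z *\<^sub>R (g z * F (x - y i)))) \<le> L * \<zeta> * norm (g z)"
      proof (cases "z \<in> S")
        case True
        then obtain i where i: "i < n" "z \<in> P i" using PS by blast
        have "F (x - z) * g z - (\<Sum>i<n. indicator (P i) z *\<^sub>R (g z * F (x - y i))) = (F (x - z) - F (x - y i)) * g z"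
          unfolding one[OF i, of "\<lambda>i. g z * F (x - y i)"] by (simp add: algebra_simps)
        moreover have "norm (F (x - z) - F (x - y i)) \<le> L * \<zeta>"
        proof -
          have "norm (F (x - z) - F (x - y i)) \<le> L * norm ((x - z) - (x - y i))" by (rule F(3))
          also have "\<dots> \<le> L * \<zeta>" using i(2) F(4) by (intro mult_left_mono) (auto simp: P_def dist_norm)
          finally show ?thesis .
        qed
        ultimately show ?thesis by (simp add: norm_mult mult_right_mono)
      qed (simp add: g(3))
    qed
    also have "\<dots> = L * \<zeta> * ?I" by simp
    finally show ?thesis using \<zeta>(2) by linarith
  qed
  have "\<forall>i<n. y i \<in> S" using y J(2) by blast
  then show ?thesis using sumc err by blast
qed

section \<open>Taylor's formula over words\<close>

definition words :: "nat \<Rightarrow> 'n::finite list set" where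
  "words n = {w. length w = n}"

lemma finite_words [simp]: "finite (words n)"
  using finite_lists_length_eq[of "UNIV :: 'n::finite set" n] by (simp add: words_def)

lemma card_words: "card (words n :: 'n::finite list set) = CARD('n) ^ n"
  using card_lists_length_eq[of "UNIV :: 'n set" n] by (simp add: words_def)

lemma sum_words_Suc: "(\<Sum>w\<in>words (Suc n). f w) = (\<Sum>w\<in>words n. \<Sum>j\<in>UNIV. f (j # w))"
proof -
  have eq: "words (Suc n) = (\<lambda>(w, j). j # w) ` (words n \<times> UNIV)"
    by (auto simp: words_def length_Suc_conv image_iff)
  have "(\<Sum>w\<in>words (Suc n). f w) = (\<Sum>(w, j)\<in>words n \<times> UNIV. f (j # w))"
    unfolding eq by (subst sum.reindex) (auto simp: inj_on_def intro!: sum.cong)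
  then show ?thesis by (simp add: sum.cartesian_product)
qed

text \<open>The factor \<open>\<i>\<close> per letter undoes the one in \<open>D_op\<close>, so that
  the sum of \<open>wprod h w * Dw w u\<close> over \<open>words n\<close> is the n-th derivative in
  direction \<open>h\<close>.\<close>

definition wprod :: "real ^ 'n \<Rightarrow> 'n::finite list \<Rightarrow> complex" where
  "wprod h w = (\<Prod>j\<leftarrow>w. \<i> * of_real (h $ j))"

lemma norm_wprod_le: "norm (wprod h w) \<le> norm h ^ length w"
  unfolding wprod_def
  by (induction w) (auto simp: norm_mult intro!: mult_mono component_le_norm_cart)

lemma sum_norm_wprod_le: "(\<Sum>w\<in>words n. norm (wprod h w)) \<le> (CARD('n) * norm h) ^ n" for h :: "real ^ 'n::finite"
proof -
  have "(\<Sum>w\<in>words n. norm (wprod h w)) \<le> (\<Sum>w\<in>(words n :: 'n list set). norm h ^ n)"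
    using norm_wprod_le[of h] by (intro sum_mono) (auto simp: words_def)
  then show ?thesis by (simp add: card_words power_mult_distrib)
qed

text \<open>Summing over words counts each mixed derivative with its multinomial multiplicity, so a
  single \<open>fact n\<close> replaces the factorials of multi-indices. The rest is the
  one-variable formula along the segment from \<open>x\<close> to \<open>x + h\<close>.\<close>

lemma taylor_words:
  fixes u :: "real ^ 'n::finite \<Rightarrow> complex"
  assumes S: "open S" "u \<in> smooth_functions S" and x: "\<And>t. t \<in> {0..1} \<Longrightarrow> x + t *\<^sub>R h \<in> S"
    and M: "\<And>t w. t \<in> {0..1} \<Longrightarrow> length w = N \<Longrightarrow> norm (Dw w u (x + t *\<^sub>R h)) \<le> M"
  shows "norm (u (x + h) - (\<Sum>n<N. (\<Sum>w\<in>words n. wprod h w * Dw w u x) / fact n)) \<le> (CARD('n) * norm h) ^ N * M / fact N"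
proof -
  define G where "G n t = (\<Sum>w\<in>words n. wprod h w * Dw w u (x + t *\<^sub>R h))" for n t
  have GN: "norm (G N t) \<le> (CARD('n) * norm h) ^ N * M" if t: "t \<in> {0..1}" for t
  proof -
    \<comment> \<open>Any word of length \<open>N\<close> serves here.\<close>
    have M0: "0 \<le> M"
      using order_trans[OF norm_ge_zero M[OF t, of "replicate N undefined"]] by simp
    have "norm (G N t) \<le> (\<Sum>w\<in>(words N :: 'n list set). norm (wprod h w) * M)"
      unfolding G_def
    proof (rule sum_norm_le)
      fix w :: "'n list" assume "w \<in> words N"
      then show "norm (wprod h w * Dw w u (x + t *\<^sub>R h)) \<le> norm (wprod h w) * M"
        unfolding norm_mult using M[OF t] by (intro mult_left_mono) (auto simp: words_def)
    qed
    also have "\<dots> = (\<Sum>w\<in>(words N :: 'n list set). norm (wprod h w)) * M" by (simp add: sum_distrib_right)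
    also have "\<dots> \<le> (CARD('n) * norm h) ^ N * M" by (rule mult_right_mono[OF sum_norm_wprod_le M0])
    finally show ?thesis .
  qed
  have dG: "(G n has_vector_derivative G (Suc n) t) (at t)" if t: "t \<in> {0..1}" for n t
  proof -
    have d: "((\<lambda>t. Dw w u (x + t *\<^sub>R h)) has_vector_derivative (\<Sum>j\<in>UNIV. \<i> * of_real (h $ j) * Dw (j # w) u (x + t *\<^sub>R h))) (at t)" for w
    proof -
      have 1: "((\<lambda>t. x + t *\<^sub>R h) has_derivative (\<lambda>s. s *\<^sub>R h)) (at t)" by (auto intro!: derivative_eq_intros)
      have 2: "(Dw w u has_derivative (\<lambda>k. \<Sum>j\<in>UNIV. \<i> * of_real (k $ j) * D_op j (Dw w u) (x + t *\<^sub>R h))) (at (x + t *\<^sub>R h))"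
        by (rule has_derivative_D_op[OF smooth_differentiable[OF smooth_Dw[OF S] x[OF t]]])
      have "(\<Sum>j\<in>UNIV. \<i> * of_real ((s *\<^sub>R h) $ j) * D_op j (Dw w u) (x + t *\<^sub>R h))
          = s *\<^sub>R (\<Sum>j\<in>UNIV. \<i> * of_real (h $ j) * Dw (j # w) u (x + t *\<^sub>R h))" for s
        by (simp add: scaleR_sum_right scaleR_conv_of_real[where 'a = complex] sum_distrib_left mult_ac)
      with diff_chain_at[OF 1 2] show ?thesis
        by (simp add: has_vector_derivative_def o_def)
    qed
    have "(G n has_vector_derivative (\<Sum>w\<in>words n. wprod h w * (\<Sum>j\<in>UNIV. \<i> * of_real (h $ j) * Dw (j # w) u (x + t *\<^sub>R h)))) (at t)"
      unfolding G_def[abs_def] by (intro has_vector_derivative_sum has_vector_derivative_mult_right d)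
    also have "(\<Sum>w\<in>words n. wprod h w * (\<Sum>j\<in>UNIV. \<i> * of_real (h $ j) * Dw (j # w) u (x + t *\<^sub>R h))) = G (Suc n) t"
      unfolding G_def sum_words_Suc by (simp add: wprod_def sum_distrib_left mult_ac)
    finally show ?thesis .
  qed
  define r where "r = u (x + h) - (\<Sum>n<N. (\<Sum>w\<in>words n. wprod h w * Dw w u x) / fact n)"
  have u0: "G 0 t = u (x + t *\<^sub>R h)" for t by (simp add: G_def words_def wprod_def)
  have rG: "r = G 0 1 - (\<Sum>n<N. G n 0 / fact n)" by (simp add: r_def u0) (simp add: G_def)
  have "norm r \<le> (CARD('n) * norm h) ^ N * M / fact N"
  proof (cases "N = 0")
    case True
    then show ?thesis using GN[of 1] by (simp add: rG)
  next
    case N: False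
    \<comment> \<open>A rotation that makes the remainder real and nonnegative, so that the real
      Maclaurin formula bounds it without a loss for real and imaginary parts. For
      \<open>r = 0\<close> the quotient is 0, which does no harm.\<close>
    define a where "a = cnj r / norm r"
    have na: "norm a \<le> 1" by (simp add: a_def norm_divide)
    have ar: "Re (a * r) = norm r"
    proof (cases "r = 0")
      case False
      have "a * r = complex_of_real ((norm r)\<^sup>2) / complex_of_real (norm r)"
        unfolding a_def complex_norm_square by (simp add: mult.commute)
      also have "\<dots> = complex_of_real (norm r)" using False by (simp add: power2_eq_square)
      finally show ?thesis by simp
    qed simp
    define D where "D n t = Re (a * G n t)" for n t
    have dD: "(D n has_real_derivative D (Suc n) t) (at t)" if t: "t \<in> {0..1}" for n t
    proof -
      have "((\<lambda>t. Re (a * G n t)) has_vector_derivative Re (a * G (Suc n) t)) (at t)"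
        by (rule bounded_linear.has_vector_derivative[OF bounded_linear_Re has_vector_derivative_mult_right[OF dG[OF t]]])
      then show ?thesis by (simp add: D_def[abs_def] has_real_derivative_iff_has_vector_derivative)
    qed
    obtain t where t: "0 < t" "t < 1" and eq: "D 0 1 = (\<Sum>n<N. D n 0 / fact n * 1 ^ n) + D N t / fact N * 1 ^ N"
      using Maclaurin[of 1 N D "D 0"] N dD by auto
    have "Re (a * r) = D 0 1 - (\<Sum>n<N. D n 0 / fact n)"
    proof -
      have f: "Re (a * (G n 0 / fact n)) = D n 0 / fact n" for n
      proof -
        have "a * (G n 0 / fact n) = (a * G n 0) / of_real (fact n)" by simp
        then show ?thesis unfolding D_def by (simp only: Re_divide_of_real)
      qed
      show ?thesis unfolding rG right_diff_distrib sum_distrib_left minus_complex.sel Re_sum f by (simp add: D_def)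
    qed
    also have "\<dots> = D N t / fact N" using eq by simp
    also have "\<dots> \<le> (CARD('n) * norm h) ^ N * M / fact N"
    proof (rule divide_right_mono)
      have "D N t \<le> norm (a * G N t)" unfolding D_def by (rule complex_Re_le_cmod)
      also have "\<dots> \<le> 1 * norm (G N t)" unfolding norm_mult using na by (intro mult_right_mono) auto
      also have "\<dots> \<le> (CARD('n) * norm h) ^ N * M" using GN[of t] t by simp
      finally show "D N t \<le> (CARD('n) * norm h) ^ N * M" .
    qed simp
    finally show ?thesis using ar by simp
  qed
  then show ?thesis by (simp add: r_def)
qed

section \<open>Pole pushing\<close>

text \<open>\<open>approx W c \<theta> K G q C \<eta>0 S\<close>: the derivatives of order at most \<open>N\<close> of the (regularised) fundamental solution
  with pole in \<open>S\<close> are approximated on \<open>K\<close> up to \<open>q\<^sup>N\<close> by solutions on \<open>G\<close> of size \<open>C\<^sup>N\<close>. In \<open>reach\<close> this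
  holds for every rate \<open>q\<close>.\<close>

definition approx :: "'n list set \<Rightarrow> ('n::finite list \<Rightarrow> complex) \<Rightarrow> real ^ 'n \<Rightarrow> (real ^ 'n) set \<Rightarrow> (real ^ 'n) set \<Rightarrow>
    real \<Rightarrow> real \<Rightarrow> real \<Rightarrow> (real ^ 'n) set \<Rightarrow> bool" where
  "approx W c \<theta> K G q C \<eta>0 S \<longleftrightarrow> (\<forall>\<eta> \<rho> N w a. \<eta> \<le> \<eta>0 \<longrightarrow> mollifier \<eta> \<rho> \<longrightarrow> length w \<le> N \<longrightarrow> a \<in> S \<longrightarrow>
    (\<exists>h\<in>Ker W c G. (\<forall>x\<in>K. norm (Dw w (fsol W c \<theta> \<rho>) (x - a) - h x) \<le> C * fact (length w) * q ^ N) \<and>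
      (\<forall>x\<in>G. norm (h x) \<le> C ^ Suc N * fact (length w))))"

definition reach :: "'n list set \<Rightarrow> ('n::finite list \<Rightarrow> complex) \<Rightarrow> real ^ 'n \<Rightarrow> (real ^ 'n) set \<Rightarrow> (real ^ 'n) set \<Rightarrow>
    (real ^ 'n) set \<Rightarrow> bool" where
  "reach W c \<theta> K G S \<longleftrightarrow> (\<forall>q. 0 < q \<longrightarrow> q < 1 \<longrightarrow> (\<exists>C \<eta>0. 1 \<le> C \<and> 0 < \<eta>0 \<and> approx W c \<theta> K G q C \<eta>0 S))"

lemma approx_mono:
  fixes c :: "'n::finite list \<Rightarrow> complex"
  assumes "approx W c \<theta> K G q C \<eta>0 S" "0 < q" "1 \<le> C" "C \<le> C'" "\<eta>0' \<le> \<eta>0"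
  shows "approx W c \<theta> K G q C' \<eta>0' S"
  unfolding approx_def
proof (intro allI impI)
  fix \<eta> :: real and \<rho> :: "real ^ 'n \<Rightarrow> complex" and N :: nat and w :: "'n list" and a :: "real ^ 'n"
    assume *: "\<eta> \<le> \<eta>0'" "mollifier \<eta> \<rho>" "length w \<le> N" "a \<in> S"
  then obtain h where h: "h \<in> Ker W c G" "\<forall>x\<in>K. norm (Dw w (fsol W c \<theta> \<rho>) (x - a) - h x) \<le> C * fact (length w) * q ^ N"
      "\<forall>x\<in>G. norm (h x) \<le> C ^ Suc N * fact (length w)"
    using assms(1)[unfolded approx_def, rule_format, of \<eta> \<rho> w N a] assms(5) by auto
  have 1: "C * fact (length w) * q ^ N \<le> C' * fact (length w) * q ^ N"
    using assms by (intro mult_right_mono) auto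
  have 2: "C ^ Suc N * fact (length w) \<le> C' ^ Suc N * fact (length w)"
    using assms by (intro mult_right_mono power_mono) auto
  show "\<exists>h\<in>Ker W c G. (\<forall>x\<in>K. norm (Dw w (fsol W c \<theta> \<rho>) (x - a) - h x) \<le> C' * fact (length w) * q ^ N) \<and>
      (\<forall>x\<in>G. norm (h x) \<le> C' ^ Suc N * fact (length w))"
    using h 1 2 by (intro bexI[of _ h]) (auto intro: order_trans)
qed

lemma approx_subset: "approx W c \<theta> K G q C \<eta>0 S \<Longrightarrow> T \<subseteq> S \<Longrightarrow> approx W c \<theta> K G q C \<eta>0 T"
  unfolding approx_def by blast

lemma reach_subset: "reach W c \<theta> K G S \<Longrightarrow> T \<subseteq> S \<Longrightarrow> reach W c \<theta> K G T"
  unfolding reach_def using approx_subset by meson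

lemma reach_empty: "reach W c \<theta> K G {}"
  unfolding reach_def approx_def by (auto intro!: exI[of _ 1])

lemma reach_Un:
  assumes "reach W c \<theta> K G S" "reach W c \<theta> K G T"
  shows "reach W c \<theta> K G (S \<union> T)"
  unfolding reach_def
proof (intro allI impI)
  fix q :: real assume q: "0 < q" "q < 1"
  obtain C1 e1 where 1: "1 \<le> C1" "0 < e1" "approx W c \<theta> K G q C1 e1 S"
    using assms(1)[unfolded reach_def, rule_format, OF q] by blast
  obtain C2 e2 where 2: "1 \<le> C2" "0 < e2" "approx W c \<theta> K G q C2 e2 T"
    using assms(2)[unfolded reach_def, rule_format, OF q] by blast
  have "approx W c \<theta> K G q (max C1 C2) (min e1 e2) S" by (rule approx_mono[OF 1(3) q(1) 1(1)]) auto
  moreover have "approx W c \<theta> K G q (max C1 C2) (min e1 e2) T" by (rule approx_mono[OF 2(3) q(1) 2(1)]) auto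
  ultimately have "approx W c \<theta> K G q (max C1 C2) (min e1 e2) (S \<union> T)"
    unfolding approx_def by blast
  then show "\<exists>C \<eta>0. 1 \<le> C \<and> 0 < \<eta>0 \<and> approx W c \<theta> K G q C \<eta>0 (S \<union> T)" using 1 2
    by (intro exI[of _ "max C1 C2"] exI[of _ "min e1 e2"]) auto
qed

lemma reach_UN: "finite I \<Longrightarrow> (\<And>i. i \<in> I \<Longrightarrow> reach W c \<theta> K G (S i)) \<Longrightarrow> reach W c \<theta> K G (\<Union>i\<in>I. S i)"
  by (induction I rule: finite_induct) (simp_all add: reach_empty reach_Un)

text \<open>The binomial coefficient is at most \<open>2 ^ (n + k)\<close>. The bound separates the
  factorial of a concatenated word into that of the Taylor term and that of the given word; the
  powers of two are absorbed in the rates.\<close>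

lemma fact_add_le: "(fact (n + k) :: real) \<le> 2 ^ (n + k) * fact n * fact k"
proof -
  have "(fact (n + k) :: real) = real ((n + k) choose n) * fact n * fact k"
    using binomial_fact[of n "n + k", where 'a = real] by (simp add: field_simps)
  also have "\<dots> \<le> 2 ^ (n + k) * fact n * fact k"
  proof -
    have "real ((n + k) choose n) \<le> real (2 ^ (n + k))" using binomial_le_pow2[of "n + k" n] by (simp only: of_nat_le_iff)
    then show ?thesis by (intro mult_right_mono) auto
  qed
  finally show ?thesis .
qed

text \<open>An operator together with a lattice on which its symbol is bounded below;
  \<open>exists_shift\<close> provides such a lattice for every elliptic operator.\<close>

locale shifted_op =
  fixes W :: "'n::finite list set" and c :: "'n list \<Rightarrow> complex" and m :: nat and \<theta> :: "real ^ 'n" and A \<kappa> :: real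
  assumes el: "ell W c m" and \<kappa>: "0 < \<kappa>" and sb: "symb_bounds W m A \<kappa> \<theta> c"
begin

lemma finite_W: "finite W"
  using el by (simp add: ell_def)

lemma smooth_fsol: "mollifier \<eta> \<rho> \<Longrightarrow> fsol W c \<theta> \<rho> \<in> smooth_functions S"
  unfolding fsol_def mollifier_def using smooth_trig[OF rapid_fsol[OF \<kappa> sb]] by blast

text \<open>The first inequality keeps \<open>x\<close> off the mollified pole at \<open>a\<close>,
  the second off its periodic copies.\<close>

lemma Ker_fsol_shift:
  assumes "mollifier \<eta> \<rho>" "\<And>x. x \<in> G \<Longrightarrow> \<eta> < norm (x - a) \<and> norm (x - a) < 3 - \<eta>"
  shows "(\<lambda>x. Dw w (fsol W c \<theta> \<rho>) (x - a)) \<in> Ker W c G"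
proof -
  let ?V = "{x :: real ^ 'n. \<eta> < norm x \<and> norm x < 3 - \<eta>}"
  have V: "open ?V" by (auto intro!: open_Collect_conj open_Collect_less continuous_intros)
  have \<rho>: "\<rho> \<in> test_functions (ball 0 \<eta>)" using assms(1) by (simp add: mollifier_def)
  have "(\<lambda>x. Dw w (fsol W c \<theta> \<rho>) (- a + 1 *\<^sub>R x)) \<in> Ker W c {x. - a + 1 *\<^sub>R x \<in> ?V}"
    by (rule Ker_affine[OF V Ker_Dw[OF V fsol_Ker[OF finite_W \<kappa> sb \<rho>]], where b = 1]) simp
  then have "(\<lambda>x. Dw w (fsol W c \<theta> \<rho>) (x - a)) \<in> Ker W c {x. x - a \<in> ?V}" by simp
  then show ?thesis by (rule Ker_subset) (use assms(2) in auto)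
qed

text \<open>With its pole at positive distance from \<open>G\<close> the function is itself a
  solution on \<open>G\<close>: the error is 0, and its derivative bound gives the size.\<close>

lemma reach_base:
  assumes \<delta>: "0 < \<delta>" "\<And>x. x \<in> G \<Longrightarrow> \<delta> \<le> norm (x - b) \<and> norm (x - b) \<le> 1"
  shows "reach W c \<theta> K G {b}"
  unfolding reach_def
proof (intro allI impI)
  fix q :: real assume q: "0 < q" "q < 1"
  obtain B where B: "1 \<le> B" "\<And>\<eta> \<rho> x w. \<eta> \<le> \<delta> / 4 \<Longrightarrow> \<eta> \<le> 1 \<Longrightarrow> mollifier \<eta> \<rho> \<Longrightarrow> \<delta> \<le> norm x \<Longrightarrow> norm x \<le> 1 \<Longrightarrow>
    norm (Dw w (fsol W c \<theta> \<rho>) x) \<le> B ^ Suc (length w) * fact (length w)"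
    using fsol_derivative_bound[OF el \<kappa> sb \<delta>(1)] by blast
  have "approx W c \<theta> K G q B (min (\<delta> / 4) 1) {b}"
    unfolding approx_def
  proof (intro allI impI)
    fix \<eta> :: real and \<rho> :: "real ^ 'n \<Rightarrow> complex" and N :: nat and w :: "'n list" and a :: "real ^ 'n"
    assume *: "\<eta> \<le> min (\<delta> / 4) 1" "mollifier \<eta> \<rho>" "length w \<le> N" "a \<in> {b}"
    let ?h = "\<lambda>x. Dw w (fsol W c \<theta> \<rho>) (x - b)"
    have "?h \<in> Ker W c G"
    proof (rule Ker_fsol_shift[OF *(2)])
      fix x assume "x \<in> G"
      from \<delta>(2)[OF this] show "\<eta> < norm (x - b) \<and> norm (x - b) < 3 - \<eta>" using *(1) \<delta>(1) by auto
    qed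
    moreover have "norm (?h x) \<le> B ^ Suc N * fact (length w)" if "x \<in> G" for x
    proof -
      have "norm (?h x) \<le> B ^ Suc (length w) * fact (length w)"
        using \<delta>(2)[OF that] *(1,2) by (intro B(2)) auto
      also have "\<dots> \<le> B ^ Suc N * fact (length w)"
        using *(3) B(1) by (intro mult_right_mono power_increasing) auto
      finally show ?thesis .
    qed
    ultimately show "\<exists>h\<in>Ker W c G. (\<forall>x\<in>K. norm (Dw w (fsol W c \<theta> \<rho>) (x - a) - h x) \<le> B * fact (length w) * q ^ N) \<and>
      (\<forall>x\<in>G. norm (h x) \<le> B ^ Suc N * fact (length w))"
      using *(4) B(1) q by (intro bexI[of _ ?h]) auto
  qed
  then show "\<exists>C \<eta>0. 1 \<le> C \<and> 0 < \<eta>0 \<and> approx W c \<theta> K G q C \<eta>0 {b}"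
    using B(1) \<delta>(1) by (intro exI[of _ B] exI[of _ "min (\<delta> / 4) 1"]) auto
qed

text \<open>\<open>E(x - a)\<close> is expanded around \<open>x - a1\<close>. The radius is limited
  by the derivative bound \<open>B\<close> and is the same for all rates; a faster rate is reached
  by taking \<open>p * N\<close> Taylor terms. These involve words of length up to
  \<open>p * N + N\<close>, for which the hypothesis on \<open>a1\<close> supplies solutions. The
  weights cost a factor \<open>2 ^ N\<close>, paid by using the rate \<open>q / 2\<close> at
  \<open>a1\<close>; this is why \<open>reach\<close> asks for all rates.\<close>

lemma reach_transfer:
  assumes G: "open G" and \<delta>: "0 < \<delta>" and r: "0 < r"
    and sep: "\<And>x a. x \<in> K \<Longrightarrow> a \<in> ball a0 r \<Longrightarrow> \<delta> \<le> norm (x - a) \<and> norm (x - a) \<le> 1"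
    and B: "1 \<le> B" "\<And>\<eta> \<rho> x w. \<eta> \<le> \<delta> / 4 \<Longrightarrow> \<eta> \<le> 1 \<Longrightarrow> mollifier \<eta> \<rho> \<Longrightarrow> \<delta> \<le> norm x \<Longrightarrow> norm x \<le> 1 \<Longrightarrow>
      norm (Dw w (fsol W c \<theta> \<rho>) x) \<le> B ^ Suc (length w) * fact (length w)"
    and rB: "8 * B * CARD('n) * r \<le> 1"
    and a1: "a1 \<in> ball a0 r" "reach W c \<theta> K G {a1}"
  shows "reach W c \<theta> K G (ball a0 r)"
  unfolding reach_def
proof (intro allI impI)
  fix q :: real assume q: "0 < q" "q < 1"
  \<comment> \<open>The remainder after \<open>p * N\<close> terms is of size
    \<open>(1/2) ^ (p * N) * (2 * B) ^ N\<close> up to constants and the factorial, so this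
    \<open>p\<close> brings it down to \<open>q ^ N\<close>.\<close>
  obtain p :: nat where "(1 / 2) ^ p < q / (2 * B)"
    using real_arch_pow_inv[of "q / (2 * B)" "1/2"] q B(1) by auto
  then have p: "2 * B * (1 / 2) ^ p \<le> q" using B(1) by (simp add: field_simps)
  obtain D e where D: "1 \<le> D" "0 < e" "approx W c \<theta> K G (q / 2) D e {a1}"
    using a1(2)[unfolded reach_def, rule_format, of "q / 2"] q by auto
  \<comment> \<open>The first entry collects the error, from the Taylor remainder and from the
    replaced terms. The second is the growth, since orders up to \<open>(p + 1) * N\<close> at the
    pole \<open>a1\<close> are used.\<close>
  define C where "C = max (B + 2 * D) (2 * D ^ Suc p)"
  define \<eta>0 where "\<eta>0 = min e (min (\<delta> / 4) 1)"
  have C1: "1 \<le> C" using B(1) D(1) by (simp add: C_def)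
  have "approx W c \<theta> K G q C \<eta>0 (ball a0 r)"
    unfolding approx_def
  proof (intro allI impI)
    fix \<eta> :: real and \<rho> :: "real ^ 'n \<Rightarrow> complex" and N :: nat and w :: "'n list" and a :: "real ^ 'n"
    assume *: "\<eta> \<le> \<eta>0" "mollifier \<eta> \<rho>" "length w \<le> N" "a \<in> ball a0 r"
    let ?E = "fsol W c \<theta> \<rho>" and ?d = "real CARD('n)" and ?l = "length w"
    define h where "h = a1 - a"
    have h: "norm h < 2 * r"
    proof -
      have "h = (a1 - a0) + (a0 - a)" by (simp add: h_def)
      then have "norm h \<le> norm (a1 - a0) + norm (a0 - a)" by (metis norm_triangle_ineq)
      then show ?thesis using a1(1) *(4) by (simp add: dist_norm norm_minus_commute)
    qed
    have dh: "?d * norm h * (2 * B) \<le> 1 / 2"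
    proof -
      have "?d * norm h * (2 * B) \<le> ?d * (2 * r) * (2 * B)" using h B(1) by (intro mult_right_mono mult_left_mono) auto
      also have "\<dots> \<le> 1 / 2" using rB by (simp add: mult_ac)
      finally show ?thesis .
    qed
    have dh2: "2 * (?d * norm h) \<le> 1 / 2"
    proof -
      have "?d * norm h * 2 * 1 \<le> ?d * norm h * 2 * B" using B(1) by (intro mult_left_mono) auto
      then show ?thesis using dh by (simp add: mult_ac)
    qed
    define P where "P = p * N"
    define N' where "N' = P + N"
    have "\<forall>v. \<exists>g. length v \<le> N' \<longrightarrow> g \<in> Ker W c G \<and> (\<forall>x\<in>K. norm (Dw v ?E (x - a1) - g x) \<le> D * fact (length v) * (q / 2) ^ N') \<and>
      (\<forall>x\<in>G. norm (g x) \<le> D ^ Suc N' * fact (length v))"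
    proof
      fix v :: "'n list"
      show "\<exists>g. length v \<le> N' \<longrightarrow> g \<in> Ker W c G \<and> (\<forall>x\<in>K. norm (Dw v ?E (x - a1) - g x) \<le> D * fact (length v) * (q / 2) ^ N') \<and>
        (\<forall>x\<in>G. norm (g x) \<le> D ^ Suc N' * fact (length v))"
        using D(3)[unfolded approx_def, rule_format, of \<eta> \<rho> v N' a1] *(1,2) by (auto simp: \<eta>0_def)
    qed
    from choice[OF this] obtain g where g: "\<forall>v. length v \<le> N' \<longrightarrow> g v \<in> Ker W c G \<and>
      (\<forall>x\<in>K. norm (Dw v ?E (x - a1) - g v x) \<le> D * fact (length v) * (q / 2) ^ N') \<and>
      (\<forall>x\<in>G. norm (g v x) \<le> D ^ Suc N' * fact (length v))" ..
    have g1: "g v \<in> Ker W c G" and g2: "x \<in> K \<Longrightarrow> norm (Dw v ?E (x - a1) - g v x) \<le> D * fact (length v) * (q / 2) ^ N'"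
      and g3: "x \<in> G \<Longrightarrow> norm (g v x) \<le> D ^ Suc N' * fact (length v)" if "length v \<le> N'" for v x
      using g that by auto
    have lv: "length (v @ w) \<le> N'" if "v \<in> words n" "n < P" for v n
      using that *(3) by (auto simp: words_def N'_def)
    define H where "H x = (\<Sum>n<P. \<Sum>v\<in>words n. (wprod h v / fact n) * g (v @ w) x)" for x
    have HK: "H \<in> Ker W c G"
      unfolding H_def[abs_def] by (intro Ker_sum[OF G] Ker_cmult[OF G] g1 lv) auto
    \<comment> \<open>One estimate for both weighted sums below. \<open>fact_add_le\<close> splits
      the factorial; its factor \<open>2 ^ n\<close> goes into a geometric series of ratio at most
      1/2, and \<open>2 ^ N\<close> remains.\<close>
    have sumbound: "(\<Sum>n<P. \<Sum>v\<in>words n. norm (wprod h v / fact n) * (Y * fact (length (v @ w)))) \<le> 2 * 2 ^ N * Y * fact ?l"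
      if Y: "0 \<le> Y" for Y :: real
    proof -
      have "(\<Sum>v\<in>words n. norm (wprod h v / fact n) * (Y * fact (length (v @ w)))) \<le> (1 / 2) ^ n * (2 ^ N * Y * fact ?l)" for n
      proof -
        have "(\<Sum>v\<in>words n. norm (wprod h v / fact n) * (Y * fact (length (v @ w))))
            = (\<Sum>v\<in>words n. norm (wprod h v)) * (Y * fact (n + ?l) / fact n)"
          unfolding sum_distrib_right by (intro sum.cong refl) (simp add: words_def norm_divide)
        also have "\<dots> \<le> (?d * norm h) ^ n * (Y * (2 ^ n * 2 ^ N * fact ?l))"
        proof (rule mult_mono[OF sum_norm_wprod_le])
          have "fact (n + ?l) / fact n \<le> (2 ^ (n + ?l) * fact ?l :: real)"
            using fact_add_le[of n ?l] by (simp add: pos_divide_le_eq mult_ac)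
          also have "\<dots> \<le> 2 ^ n * 2 ^ N * fact ?l"
            unfolding power_add using *(3) by (intro mult_right_mono mult_left_mono power_increasing) auto
          finally have "Y * (fact (n + ?l) / fact n) \<le> Y * (2 ^ n * 2 ^ N * fact ?l)" by (rule mult_left_mono[OF _ Y])
          then show "Y * fact (n + ?l) / fact n \<le> Y * (2 ^ n * 2 ^ N * fact ?l)" by simp
        qed (use Y in auto)
        also have "\<dots> = (2 * (?d * norm h)) ^ n * (2 ^ N * Y * fact ?l)" by (simp add: power_mult_distrib mult_ac)
        also have "\<dots> \<le> (1 / 2) ^ n * (2 ^ N * Y * fact ?l)"
          using dh2 Y by (intro mult_right_mono power_mono) auto
        finally show ?thesis .
      qed
      then have "(\<Sum>n<P. \<Sum>v\<in>words n. norm (wprod h v / fact n) * (Y * fact (length (v @ w)))) \<le> (\<Sum>n<P. (1 / 2) ^ n * (2 ^ N * Y * fact ?l))"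
        by (intro sum_mono)
      also have "\<dots> = (\<Sum>n<P. (1 / 2) ^ n) * (2 ^ N * Y * fact ?l)" by (simp add: sum_distrib_right)
      also have "\<dots> \<le> 2 * (2 ^ N * Y * fact ?l)"
        using Y by (intro mult_right_mono) (auto simp: sum_gp_strict)
      finally show ?thesis by (simp add: mult_ac)
    qed
    have bG: "norm (H x) \<le> C ^ Suc N * fact ?l" if x: "x \<in> G" for x
    proof -
      have "norm (H x) \<le> (\<Sum>n<P. \<Sum>v\<in>words n. norm (wprod h v / fact n) * (D ^ Suc N' * fact (length (v @ w))))"
        unfolding H_def
      proof (intro sum_norm_le)
        fix n and v :: "'n list" assume n: "n \<in> {..<P}" and v: "v \<in> words n"
        have "norm (g (v @ w) x) \<le> D ^ Suc N' * fact (length (v @ w))" using g3[OF lv[OF v] x] n by simp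
        then show "norm ((wprod h v / fact n) * g (v @ w) x) \<le> norm (wprod h v / fact n) * (D ^ Suc N' * fact (length (v @ w)))"
          unfolding norm_mult by (intro mult_left_mono) auto
      qed
      also have "\<dots> \<le> 2 * 2 ^ N * D ^ Suc N' * fact ?l" by (rule sumbound) (use D(1) in auto)
      also have "\<dots> \<le> (2 * D ^ Suc p) ^ Suc N * fact ?l"
      proof (rule mult_right_mono)
        have "Suc N' \<le> Suc p * Suc N" by (simp add: N'_def P_def)
        then have "D ^ Suc N' \<le> D ^ (Suc p * Suc N)" using D(1) by (rule power_increasing)
        moreover have "(2 * D ^ Suc p) ^ Suc N = 2 * 2 ^ N * D ^ (Suc p * Suc N)"
          unfolding power_mult_distrib power_mult power_Suc[of 2 N] ..
        ultimately show "2 * 2 ^ N * D ^ Suc N' \<le> (2 * D ^ Suc p) ^ Suc N"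
          using mult_left_mono[of "D ^ Suc N'" "D ^ (Suc p * Suc N)" "2 * 2 ^ N"] by (simp del: power_Suc)
      qed simp
      also have "\<dots> \<le> C ^ Suc N * fact ?l"
        using D(1) by (intro mult_right_mono power_mono) (auto simp: C_def)
      finally show ?thesis .
    qed
    have bK: "norm (Dw w ?E (x - a) - H x) \<le> C * fact ?l * q ^ N" if x: "x \<in> K" for x
    proof -
      let ?T = "\<Sum>n<P. (\<Sum>v\<in>words n. wprod h v * Dw v (Dw w ?E) (x - a1)) / fact n"
      have seg: "\<delta> \<le> norm (x - a1 + t *\<^sub>R h) \<and> norm (x - a1 + t *\<^sub>R h) \<le> 1" if t: "t \<in> {0..1}" for t
      proof -
        have eq: "x - a1 + t *\<^sub>R h = x - ((1 - t) *\<^sub>R a1 + t *\<^sub>R a)" by (simp add: h_def algebra_simps)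
        have "(1 - t) *\<^sub>R a1 + t *\<^sub>R a \<in> ball a0 r"
          by (rule convexD[OF convex_ball a1(1) *(4)]) (use t in auto)
        from sep[OF x this] show ?thesis unfolding eq .
      qed
      have "norm (Dw w ?E (x - a1 + h) - ?T) \<le> (?d * norm h) ^ P * (B ^ Suc (P + ?l) * fact (P + ?l)) / fact P"
      proof (rule taylor_words[OF open_UNIV smooth_Dw[OF open_UNIV smooth_fsol[OF *(2)]] UNIV_I])
        fix t :: real and v :: "'n list" assume t: "t \<in> {0..1}" and v: "length v = P"
        have "norm (Dw (v @ w) ?E (x - a1 + t *\<^sub>R h)) \<le> B ^ Suc (length (v @ w)) * fact (length (v @ w))"
          using *(1) seg[OF t] by (intro B(2)[OF _ _ *(2)]) (auto simp: \<eta>0_def)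
        then show "norm (Dw v (Dw w ?E) (x - a1 + t *\<^sub>R h)) \<le> B ^ Suc (P + ?l) * fact (P + ?l)" using v by simp
      qed
      also have "\<dots> = (?d * norm h) ^ P * B ^ Suc (P + ?l) * (fact (P + ?l) / fact P)" by simp
      also have "\<dots> \<le> (?d * norm h) ^ P * B ^ Suc (P + ?l) * (2 ^ (P + ?l) * fact ?l)"
        using fact_add_le[of P ?l] B(1) by (intro mult_left_mono) (auto simp: pos_divide_le_eq mult_ac)
      also have "\<dots> = (?d * norm h * (2 * B)) ^ P * (B * (2 * B) ^ ?l * fact ?l)"
        by (simp add: power_mult_distrib power_add mult_ac)
      also have "\<dots> \<le> (1 / 2) ^ P * (B * (2 * B) ^ N * fact ?l)"
      proof (rule mult_mono)
        show "(?d * norm h * (2 * B)) ^ P \<le> (1 / 2) ^ P" using dh B(1) by (intro power_mono) auto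
        show "B * (2 * B) ^ ?l * fact ?l \<le> B * (2 * B) ^ N * fact ?l"
          using B(1) *(3) by (intro mult_right_mono mult_left_mono power_increasing) auto
      qed (use B(1) in auto)
      also have "\<dots> = B * fact ?l * (2 * B * (1 / 2) ^ p) ^ N"
      proof -
        have "((1 / 2) ^ P :: real) = ((1 / 2) ^ p) ^ N" by (simp only: P_def power_mult)
        then show ?thesis by (simp only: power_mult_distrib mult_ac)
      qed
      also have "\<dots> \<le> B * fact ?l * q ^ N"
        using p B(1) by (intro mult_left_mono power_mono) auto
      finally have t1: "norm (Dw w ?E (x - a1 + h) - ?T) \<le> B * fact ?l * q ^ N" .
      have "?T = (\<Sum>n<P. \<Sum>v\<in>words n. (wprod h v / fact n) * Dw (v @ w) ?E (x - a1))"
        by (simp add: sum_divide_distrib)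
      then have "?T - H x = (\<Sum>n<P. \<Sum>v\<in>words n. (wprod h v / fact n) * (Dw (v @ w) ?E (x - a1) - g (v @ w) x))"
        by (simp add: H_def sum_subtractf right_diff_distrib)
      also have "norm \<dots> \<le> (\<Sum>n<P. \<Sum>v\<in>words n. norm (wprod h v / fact n) * (D * (q / 2) ^ N' * fact (length (v @ w))))"
      proof (intro sum_norm_le)
        fix n and v :: "'n list" assume n: "n \<in> {..<P}" and v: "v \<in> words n"
        have "norm (Dw (v @ w) ?E (x - a1) - g (v @ w) x) \<le> D * (q / 2) ^ N' * fact (length (v @ w))"
          using g2[OF lv[OF v] x] n by (simp add: mult_ac)
        then show "norm ((wprod h v / fact n) * (Dw (v @ w) ?E (x - a1) - g (v @ w) x))
            \<le> norm (wprod h v / fact n) * (D * (q / 2) ^ N' * fact (length (v @ w)))"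
          unfolding norm_mult by (intro mult_left_mono) auto
      qed
      also have "\<dots> \<le> 2 * 2 ^ N * (D * (q / 2) ^ N') * fact ?l" by (rule sumbound) (use D(1) q in auto)
      \<comment> \<open>Of the \<open>N'\<close> factors \<open>q / 2\<close> only \<open>N\<close>
        are kept; together with \<open>2 ^ N\<close> they give \<open>q ^ N\<close>.\<close>
      also have "\<dots> \<le> 2 * 2 ^ N * (D * (q / 2) ^ N) * fact ?l"
        using D(1) q by (intro mult_right_mono mult_left_mono power_decreasing) (auto simp: N'_def)
      also have "\<dots> = 2 * D * fact ?l * q ^ N" by (simp add: power_divide)
      finally have t2: "norm (?T - H x) \<le> 2 * D * fact ?l * q ^ N" .
      have "x - a1 + h = x - a" by (simp add: h_def)
      then have "norm (Dw w ?E (x - a) - H x) \<le> norm (Dw w ?E (x - a1 + h) - ?T) + norm (?T - H x)"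
        using dist_triangle[of "Dw w ?E (x - a)" "H x" ?T] by (simp only: dist_norm)
      also have "\<dots> \<le> (B + 2 * D) * fact ?l * q ^ N" using t1 t2 by (simp add: algebra_simps)
      also have "\<dots> \<le> C * fact ?l * q ^ N" using q by (intro mult_right_mono) (auto simp: C_def)
      finally show ?thesis .
    qed
    show "\<exists>h\<in>Ker W c G. (\<forall>x\<in>K. norm (Dw w ?E (x - a) - h x) \<le> C * fact ?l * q ^ N) \<and>
      (\<forall>x\<in>G. norm (h x) \<le> C ^ Suc N * fact ?l)"
      using HK bG bK by (intro bexI[of _ H]) auto
  qed
  moreover have "0 < \<eta>0" using D(2) \<delta> by (simp add: \<eta>0_def)
  ultimately show "\<exists>C \<eta>0. 1 \<le> C \<and> 0 < \<eta>0 \<and> approx W c \<theta> K G q C \<eta>0 (ball a0 r)" using C1 by blast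
qed

text \<open>The radius depends on the room around \<open>a0\<close> and not on the starting pole
  \<open>a1\<close>, so the property spreads from any point of the ball to all of it. Poles and
  \<open>K\<close> lie in the ball of radius 1/2, which gives
  \<open>norm (x - a) \<le> 1\<close>.\<close>

lemma reach_local:
  assumes K: "compact K" "K \<subseteq> ball 0 (1/2)" and G: "open G" and a0: "a0 \<in> ball 0 (1/2) - K"
  obtains r where "0 < r" "ball a0 r \<subseteq> ball 0 (1/2) - K"
    "\<And>a1. a1 \<in> ball a0 r \<Longrightarrow> reach W c \<theta> K G {a1} \<Longrightarrow> reach W c \<theta> K G (ball a0 r)"
proof -
  have "open (ball 0 (1/2) - K)" using K(1) by (intro open_Diff compact_imp_closed) auto
  then obtain r1 where r1: "0 < r1" "ball a0 r1 \<subseteq> ball 0 (1/2) - K" using a0 open_contains_ball by blast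
  define \<delta> where "\<delta> = r1 / 2"
  have \<delta>: "0 < \<delta>" using r1 by (simp add: \<delta>_def)
  obtain B where B: "1 \<le> B" "\<And>\<eta> \<rho> x w. \<eta> \<le> \<delta> / 4 \<Longrightarrow> \<eta> \<le> 1 \<Longrightarrow> mollifier \<eta> \<rho> \<Longrightarrow> \<delta> \<le> norm x \<Longrightarrow> norm x \<le> 1 \<Longrightarrow>
    norm (Dw w (fsol W c \<theta> \<rho>) x) \<le> B ^ Suc (length w) * fact (length w)"
    using fsol_derivative_bound[OF el \<kappa> sb \<delta>] by blast
  define r where "r = min \<delta> (1 / (8 * B * CARD('n)))"
  have pos: "0 < 8 * B * CARD('n)" using B(1) by simp
  have r: "0 < r" "r \<le> \<delta>" using \<delta> pos by (auto simp: r_def)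
  have "r \<le> 1 / (8 * B * CARD('n))" by (simp add: r_def)
  then have rB: "8 * B * CARD('n) * r \<le> 1" using pos by (simp add: pos_le_divide_eq mult.commute)
  have sub: "ball a0 r \<subseteq> ball 0 (1/2) - K"
    using r1 r \<delta>_def by (intro order_trans[OF subset_ball[of r r1] r1(2)]) auto
  have sep: "\<delta> \<le> norm (x - a) \<and> norm (x - a) \<le> 1" if x: "x \<in> K" and a: "a \<in> ball a0 r" for x a
  proof
    have "norm (x - a) \<le> norm x + norm a" by (rule norm_triangle_ineq4)
    also have "\<dots> \<le> 1" using x a K(2) sub by force
    finally show "norm (x - a) \<le> 1" .
    have "x \<notin> ball a0 r1" using x r1(2) by blast
    then have "r1 \<le> norm (x - a0)" by (simp add: dist_norm norm_minus_commute)
    also have "\<dots> \<le> norm (x - a) + norm (a - a0)" using norm_triangle_ineq[of "x - a" "a - a0"] by simp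
    also have "norm (a - a0) \<le> \<delta>" using a r(2) by (simp add: dist_norm norm_minus_commute)
    finally show "\<delta> \<le> norm (x - a)" by (simp add: \<delta>_def)
  qed
  show thesis
    by (rule that[OF r(1) sub]) (rule reach_transfer[OF G \<delta> r(1) sep B rB])
qed

text \<open>On a ball from \<open>reach_local\<close> the property holds at one pole only if it
  holds at all of them. It is therefore locally constant, hence constant on connected sets. The
  constants may grow from ball to ball, since \<open>reach\<close> only asserts their
  existence.\<close>

lemma reach_connected:
  assumes K: "compact K" "K \<subseteq> ball 0 (1/2)" and G: "open G"
    and C: "connected C" "C \<subseteq> ball 0 (1/2) - K" "a \<in> C" "b \<in> C" and b: "reach W c \<theta> K G {b}"
  shows "reach W c \<theta> K G {a}"
proof (rule connected_induction_simple[OF C(1) C(4,3), where P = "\<lambda>a. reach W c \<theta> K G {a}", OF b])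
  fix a0 assume a0: "a0 \<in> C"
  then have "a0 \<in> ball 0 (1/2) - K" using C(2) by blast
  from reach_local[OF K G this] obtain r where r: "0 < r"
    "\<And>a1. a1 \<in> ball a0 r \<Longrightarrow> reach W c \<theta> K G {a1} \<Longrightarrow> reach W c \<theta> K G (ball a0 r)" by metis
  show "\<exists>T. openin (top_of_set C) T \<and> a0 \<in> T \<and> (\<forall>x\<in>T. \<forall>y\<in>T. reach W c \<theta> K G {x} \<longrightarrow> reach W c \<theta> K G {y})"
  proof (intro exI[of _ "C \<inter> ball a0 r"] conjI ballI impI)
    show "openin (top_of_set C) (C \<inter> ball a0 r)" by (simp add: openin_open_Int)
    show "a0 \<in> C \<inter> ball a0 r" using a0 r(1) by simp
    fix x y assume "x \<in> C \<inter> ball a0 r" "y \<in> C \<inter> ball a0 r" "reach W c \<theta> K G {x}"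
    then show "reach W c \<theta> K G {y}" using reach_subset[OF r(2)[of x], of "{y}"] by auto
  qed
qed

text \<open>For single poles the constants may depend on the pole; covering \<open>S\<close> by
  finitely many of the balls from \<open>reach_local\<close> makes them common.\<close>

lemma reach_compact:
  assumes K: "compact K" "K \<subseteq> ball 0 (1/2)" and G: "open G"
    and S: "compact S" "S \<subseteq> ball 0 (1/2) - K" "\<And>a. a \<in> S \<Longrightarrow> reach W c \<theta> K G {a}"
  shows "reach W c \<theta> K G S"
proof -
  have "\<exists>r>0. reach W c \<theta> K G (ball a r)" if a: "a \<in> S" for a
  proof -
    have "a \<in> ball 0 (1/2) - K" using a S(2) by blast
    from reach_local[OF K G this] obtain r where r: "0 < r"
      "\<And>a1. a1 \<in> ball a r \<Longrightarrow> reach W c \<theta> K G {a1} \<Longrightarrow> reach W c \<theta> K G (ball a r)" by metis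
    then show ?thesis using r(2)[of a] S(3)[OF a] by (intro exI[of _ r]) auto
  qed
  then obtain r where r: "\<And>a. a \<in> S \<Longrightarrow> 0 < r a \<and> reach W c \<theta> K G (ball a (r a))" by metis
  obtain J where J: "J \<subseteq> S" "finite J" "S \<subseteq> (\<Union>a\<in>J. ball a (r a))"
  proof (rule compactE_image[OF S(1), of S "\<lambda>a. ball a (r a)"])
    show "S \<subseteq> (\<Union>a\<in>S. ball a (r a))" using r by force
  qed auto
  have "reach W c \<theta> K G (\<Union>a\<in>J. ball a (r a))" by (rule reach_UN[OF J(2)]) (use J(1) r in blast)
  then show ?thesis using J(3) by (rule reach_subset)
qed

end

text \<open>Leibniz rule without binomials. The induction peels off the last letter, which acts on
  the product first, so that the hypothesis applies to \<open>D_op j \<zeta>\<close> with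
  \<open>u\<close> and to \<zeta> with \<open>D_op j u\<close>. The constant is independent of
  \<open>u\<close>, \<open>V\<close> and \<open>x\<close>.\<close>

lemma Dw_test_mult_bound:
  fixes \<zeta> :: "real ^ 'n::finite \<Rightarrow> complex"
  assumes "\<zeta> \<in> test_functions U"
  shows "\<exists>D\<ge>0. \<forall>V u x B. open V \<longrightarrow> u \<in> smooth_functions V \<longrightarrow> x \<in> V \<longrightarrow>
    (\<forall>v. length v \<le> length w \<longrightarrow> norm (Dw v u x) \<le> B) \<longrightarrow> norm (Dw w (\<lambda>y. \<zeta> y * u y) x) \<le> D * B"
  using assms
proof (induction w arbitrary: \<zeta> rule: rev_induct)
  case Nil
  obtain D where D: "0 \<le> D" "\<And>x. norm (\<zeta> x) \<le> D" using test_bounded[OF Nil] by blast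
  have "norm (\<zeta> x * u x) \<le> D * B" if "norm (u x) \<le> B" for u x B
    unfolding norm_mult using D that by (intro mult_mono) auto
  then show ?case using D(1) by (intro exI[of _ D]) auto
next
  case (snoc j w)
  obtain D1 where D1: "0 \<le> D1" "\<And>V u x B. open V \<Longrightarrow> u \<in> smooth_functions V \<Longrightarrow> x \<in> V \<Longrightarrow>
    (\<forall>v. length v \<le> length w \<longrightarrow> norm (Dw v u x) \<le> B) \<Longrightarrow> norm (Dw w (\<lambda>y. \<zeta> y * u y) x) \<le> D1 * B"
    using snoc.IH[OF snoc.prems] by blast
  obtain D2 where D2: "0 \<le> D2" "\<And>V u x B. open V \<Longrightarrow> u \<in> smooth_functions V \<Longrightarrow> x \<in> V \<Longrightarrow>
    (\<forall>v. length v \<le> length w \<longrightarrow> norm (Dw v u x) \<le> B) \<Longrightarrow> norm (Dw w (\<lambda>y. D_op j \<zeta> y * u y) x) \<le> D2 * B"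
    using snoc.IH[OF test_D_op[OF snoc.prems]] by blast
  have "norm (Dw (w @ [j]) (\<lambda>y. \<zeta> y * u y) x) \<le> (D2 + D1) * B"
    if V: "open V" "u \<in> smooth_functions V" "x \<in> V" and B: "\<forall>v. length v \<le> length (w @ [j]) \<longrightarrow> norm (Dw v u x) \<le> B" for V u x B
  proof -
    have s1: "(\<lambda>y. D_op j \<zeta> y * u y) \<in> smooth_functions V" "(\<lambda>y. \<zeta> y * D_op j u y) \<in> smooth_functions V"
      by (intro smooth_mult[OF V(1)] test_smooth[OF snoc.prems] test_smooth[OF test_D_op[OF snoc.prems]] smooth_D_op V(1,2))+
    have "Dw (w @ [j]) (\<lambda>y. \<zeta> y * u y) x = Dw w (\<lambda>y. D_op j \<zeta> y * u y + \<zeta> y * D_op j u y) x"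
    proof -
      have "Dw w (D_op j (\<lambda>y. \<zeta> y * u y)) x = Dw w (\<lambda>y. D_op j \<zeta> y * u y + \<zeta> y * D_op j u y) x"
      proof (rule Dw_cong[OF V(1) _ V(3)])
        fix y assume y: "y \<in> V"
        show "D_op j (\<lambda>y. \<zeta> y * u y) y = D_op j \<zeta> y * u y + \<zeta> y * D_op j u y"
          by (intro D_op_mult smooth_differentiable[OF test_smooth[OF snoc.prems] y] smooth_differentiable[OF V(2) y])
      qed
      then show ?thesis by simp
    qed
    also have "\<dots> = Dw w (\<lambda>y. D_op j \<zeta> y * u y) x + Dw w (\<lambda>y. \<zeta> y * D_op j u y) x"
      by (rule Dw_add[OF V(1) s1 V(3)])
    finally have "norm (Dw (w @ [j]) (\<lambda>y. \<zeta> y * u y) x) \<le> norm (Dw w (\<lambda>y. D_op j \<zeta> y * u y) x) + norm (Dw w (\<lambda>y. \<zeta> y * D_op j u y) x)"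
      by (simp only: norm_triangle_ineq)
    also have "\<dots> \<le> D2 * B + D1 * B"
    proof (intro add_mono D1(2)[OF V(1) smooth_D_op[OF V(1,2)] V(3)] D2(2)[OF V] allI impI)
      fix v :: "'n list" assume v: "length v \<le> length w"
      then show "norm (Dw v u x) \<le> B" using B by simp
      have "norm (Dw (v @ [j]) u x) \<le> B" using B v by (simp del: foldr_append)
      then show "norm (Dw v (D_op j u) x) \<le> B" by simp
    qed
    finally show ?thesis by (simp add: distrib_right)
  qed
  then show ?case using D1(1) D2(1) by (intro exI[of _ "D2 + D1"]) auto
qed

text \<open>Serves to pick the order \<open>N\<close>: \<open>(1/2) ^ N\<close> becomes as small as
  a multiple of \<epsilon>, while \<open>2 ^ N\<close> stays of the order of
  \<open>1 / \<epsilon>\<close>.\<close>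

lemma exists_power_between:
  fixes x :: real
  assumes "1 \<le> x"
  obtains N :: nat where "x \<le> 2 ^ N" "2 ^ N \<le> 2 * x"
proof -
  obtain n :: nat where n: "x < 2 ^ n" using real_arch_pow[of 2 x] by auto
  define N where "N = (LEAST n. x \<le> 2 ^ n)"
  have N: "x \<le> 2 ^ N" unfolding N_def by (rule LeastI[of _ n]) (use n in simp)
  have "2 ^ N \<le> 2 * x"
  proof (cases N)
    case 0
    then show ?thesis using assms by simp
  next
    case (Suc k)
    then have "\<not> x \<le> 2 ^ k" using not_less_Least[of k "\<lambda>n. x \<le> 2 ^ n"] unfolding N_def by simp
    then show ?thesis using Suc by simp
  qed
  with N show thesis by (rule that)
qed

section \<open>Quantitative Runge approximation near compact sets\<close>

text \<open>\<open>Y\<close> is quantified inside, so the constants do not depend on the domain of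
  \<open>u\<close>. An arbitrary bound \<Lambda> on \<open>L\<close> stands for the supremum norm,
  and the exponent is a natural number; both are converted at the very end.\<close>

definition runge :: "'n list set \<Rightarrow> ('n::finite list \<Rightarrow> complex) \<Rightarrow> (real ^ 'n) set \<Rightarrow> (real ^ 'n) set \<Rightarrow>
    (real ^ 'n) set \<Rightarrow> (real ^ 'n) set \<Rightarrow> bool" where
  "runge W c K L V M \<longleftrightarrow> (\<exists>s::nat. \<exists>C>0. \<forall>Y u \<Lambda> \<epsilon>. open Y \<longrightarrow> L \<subseteq> Y \<longrightarrow> u \<in> Ker W c Y \<longrightarrow> 0 \<le> \<Lambda> \<longrightarrow>
    (\<forall>x\<in>L. norm (u x) \<le> \<Lambda>) \<longrightarrow> 0 < \<epsilon> \<longrightarrow> \<epsilon> < 1 \<longrightarrow>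
    (\<exists>h\<in>Ker W c V. (\<forall>x\<in>K. norm (u x - h x) \<le> \<epsilon> * \<Lambda>) \<and> (\<forall>x\<in>M. norm (h x) \<le> C / \<epsilon> ^ s * \<Lambda>)))"

lemma rungeI:
  assumes "0 < C"
    and "\<And>Y u \<Lambda> \<epsilon>. open Y \<Longrightarrow> L \<subseteq> Y \<Longrightarrow> u \<in> Ker W c Y \<Longrightarrow> 0 \<le> \<Lambda> \<Longrightarrow> \<forall>x\<in>L. norm (u x) \<le> \<Lambda> \<Longrightarrow> 0 < \<epsilon> \<Longrightarrow> \<epsilon> < 1 \<Longrightarrow>
      \<exists>h\<in>Ker W c V. (\<forall>x\<in>K. norm (u x - h x) \<le> \<epsilon> * \<Lambda>) \<and> (\<forall>x\<in>M. norm (h x) \<le> C / \<epsilon> ^ s * \<Lambda>)"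
  shows "runge W c K L V M"
  unfolding runge_def using assms by blast

lemma rungeE:
  assumes "runge W c K L V M"
  obtains C and s :: nat where "0 < C"
    "\<And>Y u \<Lambda> \<epsilon>. open Y \<Longrightarrow> L \<subseteq> Y \<Longrightarrow> u \<in> Ker W c Y \<Longrightarrow> 0 \<le> \<Lambda> \<Longrightarrow> \<forall>x\<in>L. norm (u x) \<le> \<Lambda> \<Longrightarrow> 0 < \<epsilon> \<Longrightarrow> \<epsilon> < 1 \<Longrightarrow>
      \<exists>h\<in>Ker W c V. (\<forall>x\<in>K. norm (u x - h x) \<le> \<epsilon> * \<Lambda>) \<and> (\<forall>x\<in>M. norm (h x) \<le> C / \<epsilon> ^ s * \<Lambda>)"
  using assms unfolding runge_def by blast

context shifted_op
begin

text \<open>These bounds depend on \<rho>. They only make the Riemann sums converge, where no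
  uniformity is required.\<close>

lemma fsol_regular:
  assumes "mollifier \<eta> \<rho>"
  obtains B L where "0 \<le> L" "continuous_on UNIV (fsol W c \<theta> \<rho>)" "\<And>x. norm (fsol W c \<theta> \<rho> x) \<le> B"
    "\<And>x y. norm (fsol W c \<theta> \<rho> x - fsol W c \<theta> \<rho> y) \<le> L * norm (x - y)"
proof -
  let ?a = "\<lambda>k. ft \<rho> (freq \<theta> k) / symb W c (freq \<theta> k)"
  have r: "rapid \<theta> ?a" using assms rapid_fsol[OF \<kappa> sb] by (auto simp: mollifier_def)
  define D where "D j = (\<Sum>\<^sub>\<infinity>k. norm (of_real (freq \<theta> k $ j) * ?a k))" for j
  have D0: "0 \<le> D j" for j unfolding D_def by (intro infsum_nonneg) auto
  have "norm (D_op j (fsol W c \<theta> \<rho>) x) \<le> (\<Sum>j\<in>UNIV. D j)" for j x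
  proof -
    have "norm (D_op j (fsol W c \<theta> \<rho>) x) \<le> D j"
      unfolding fsol_def D_op_trig[OF r] D_def
      by (rule norm_trig_le[OF rapid_norm_summable[OF rapid_component[OF r]]])
    also have "\<dots> \<le> (\<Sum>j\<in>UNIV. D j)" using D0 by (intro member_le_sum) auto
    finally show ?thesis .
  qed
  from smooth_lipschitz[OF convex_UNIV smooth_differentiable[OF smooth_fsol[OF assms] UNIV_I] this UNIV_I UNIV_I]
  have L: "norm (fsol W c \<theta> \<rho> x - fsol W c \<theta> \<rho> y) \<le> real CARD('n) * (\<Sum>j\<in>UNIV. D j) * norm (x - y)" for x y .
  show thesis
  proof (rule that[OF _ _ _ L])
    show "0 \<le> real CARD('n) * (\<Sum>j\<in>UNIV. D j)" by (intro mult_nonneg_nonneg sum_nonneg D0) auto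
    show "continuous_on UNIV (fsol W c \<theta> \<rho>)" by (rule smooth_continuous_on[OF smooth_fsol[OF assms]])
    show "norm (fsol W c \<theta> \<rho> x) \<le> (\<Sum>\<^sub>\<infinity>k. norm (?a k))" for x
      unfolding fsol_def by (rule norm_trig_le[OF rapid_norm_summable[OF r]])
  qed
qed

text \<open>All constants are fixed by the cutoff, the Cauchy estimates on \<open>L\<close> and the
  approximation of poles in \<open>S\<close> at rate 1/2. Only then, for given \<open>u\<close> and
  \<epsilon>, the mollifier and the Riemann sum are chosen; they add a prescribed small error and no
  constant. The assumption \<open>conn\<close> gives each pole in \<open>S\<close> a connected route
  to a point off \<open>closure G\<close>.\<close>

lemma runge_step:
  assumes K: "compact K" and L: "compact L" "K \<subseteq> interior L" "L \<subseteq> ball 0 (1/2)" and G: "open G" "G \<subseteq> ball 0 (1/2)"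
    and conn: "\<And>y. y \<in> ball 0 (1/2) - K \<Longrightarrow> \<exists>b \<in> connected_component_set (ball 0 (1/2) - K) y. b \<notin> closure G"
  shows "runge W c K L G G"
proof -
  have KL: "K \<subseteq> L" using L(2) interior_subset by blast
  have Kb: "K \<subseteq> ball 0 (1/2)" using KL L(3) by blast
  obtain \<zeta> U where \<zeta>: "\<zeta> \<in> test_functions (interior L)" and U: "open U" "K \<subseteq> U" "\<And>x. x \<in> U \<Longrightarrow> \<zeta> x = 1"
    using cutoff[OF K open_interior L(2)] by blast
  obtain C1 where C1: "compact C1" "C1 \<subseteq> interior L" "\<And>x. x \<notin> C1 \<Longrightarrow> \<zeta> x = 0" using test_supportE[OF \<zeta>] by blast
  \<comment> \<open>The operator applied to \<open>\<zeta> u\<close> lives on \<open>S\<close>: near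
    \<open>K\<close> the product is the solution \<open>u\<close>, and outside \<open>C1\<close> it
    vanishes.\<close>
  define S where "S = C1 - U"
  have S: "compact S" unfolding S_def using C1(1) U(1) by (rule compact_diff)
  have SL: "S \<subseteq> ball 0 (1/2) - K" using C1(2) interior_subset L(3) U(2) by (auto simp: S_def)
  have rS: "reach W c \<theta> K G S"
  proof (rule reach_compact[OF K Kb G(1) S SL])
    fix a assume "a \<in> S"
    then have a: "a \<in> ball 0 (1/2) - K" using SL by blast
    obtain b where b: "b \<in> connected_component_set (ball 0 (1/2) - K) a" "b \<notin> closure G" using conn[OF a] by blast
    obtain \<delta> where \<delta>: "0 < \<delta>" "ball b \<delta> \<inter> G = {}"
    proof -
      obtain \<delta> where "0 < \<delta>" "\<forall>y\<in>G. \<not> dist y b < \<delta>" using b(2) unfolding closure_approachable by blast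
      then show thesis by (intro that[of \<delta>]) (auto simp: dist_commute)
    qed
    have sub: "connected_component_set (ball 0 (1/2) - K) a \<subseteq> ball 0 (1/2) - K" by (rule connected_component_subset)
    have rb: "reach W c \<theta> K G {b}"
    proof (rule reach_base[OF \<delta>(1)])
      fix x assume x: "x \<in> G"
      have "norm (x - b) \<le> norm x + norm b" by (rule norm_triangle_ineq4)
      also have "\<dots> \<le> 1" using x G(2) b(1) sub by force
      finally show "\<delta> \<le> norm (x - b) \<and> norm (x - b) \<le> 1"
        using \<delta>(2) x by (auto simp: dist_norm norm_minus_commute disjoint_iff not_less)
    qed
    have "a \<in> connected_component_set (ball 0 (1/2) - K) a" using a by simp
    from this b(1) rb show "reach W c \<theta> K G {a}"
      by (rule reach_connected[OF K Kb G(1) connected_connected_component sub])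
  qed
  obtain C0 \<eta>0 where C0: "1 \<le> C0" "0 < \<eta>0" "approx W c \<theta> K G (1/2) C0 \<eta>0 S"
    using rS[unfolded reach_def, rule_format, of "1/2"] by auto
  have "\<exists>r>0. (\<Union>x\<in>C1. ball x r) \<subseteq> interior L"
    using compact_subset_open_imp_ball_epsilon_subset[OF C1(1) open_interior C1(2)] by metis
  then obtain r0 where r0: "0 < r0" "\<And>x. x \<in> C1 \<Longrightarrow> ball x r0 \<subseteq> interior L" by blast
  obtain \<delta>0 A0 where A0: "0 < \<delta>0" "1 \<le> A0"
    "\<And>r x u B w. 0 < r \<Longrightarrow> r \<le> \<delta>0 \<Longrightarrow> u \<in> Ker W c (ball x r) \<Longrightarrow> (\<And>y. y \<in> ball x r \<Longrightarrow> norm (u y) \<le> B) \<Longrightarrow>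
      norm (Dw w u x) \<le> A0 * (A0 / r) ^ length w * fact (length w) * B"
    using Cauchy_estimate[OF el] by blast
  define r where "r = min r0 \<delta>0"
  have r: "0 < r" "r \<le> \<delta>0" "\<And>x. x \<in> C1 \<Longrightarrow> ball x r \<subseteq> interior L"
    using r0 A0(1) subset_ball[of r r0] by (auto simp: r_def)
  define E where "E = (\<Sum>n\<le>m. A0 * (A0 / r) ^ n * fact n)"
  have E0: "0 \<le> E" unfolding E_def using A0(2) r(1) by (intro sum_nonneg) auto
  have "\<forall>w. \<exists>D\<ge>0. \<forall>V u x B. open V \<longrightarrow> u \<in> smooth_functions V \<longrightarrow> x \<in> V \<longrightarrow>
    (\<forall>v. length v \<le> length w \<longrightarrow> norm (Dw v u x) \<le> B) \<longrightarrow> norm (Dw w (\<lambda>y. \<zeta> y * u y) x) \<le> D * B"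
    using Dw_test_mult_bound[OF \<zeta>] by blast
  from choice[OF this] obtain Dz where Dz: "\<forall>w. 0 \<le> Dz w \<and> (\<forall>V u x B. open V \<longrightarrow> u \<in> smooth_functions V \<longrightarrow> x \<in> V \<longrightarrow>
    (\<forall>v. length v \<le> length w \<longrightarrow> norm (Dw v u x) \<le> B) \<longrightarrow> norm (Dw w (\<lambda>y. \<zeta> y * u y) x) \<le> Dz w * B)" ..
  define F where "F = (\<Sum>w\<in>W. norm (c w) * Dz w) * E"
  have F0: "0 \<le> F" unfolding F_def using Dz E0 by (intro mult_nonneg_nonneg sum_nonneg) auto
  define T where "T = 1 / (2 * pi) ^ CARD('n)"
  have T0: "0 < T" by (simp add: T_def)
  define V0 where "V0 = measure lborel (ball (0 :: real ^ 'n) 1)"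
  have V00: "0 \<le> V0" by (simp add: V0_def)
  \<comment> \<open>Bounds the total weight of the translates per unit of \<Lambda>: normalisation
    \<open>T\<close>, volume \<open>V0\<close> of a ball containing \<open>S\<close>, and bound
    \<open>F\<close> for the operator applied to \<open>\<zeta> u\<close>.\<close>
  define H where "H = T * (V0 * F)"
  have H0: "0 \<le> H" unfolding H_def using T0 V00 F0 by (intro mult_nonneg_nonneg) auto
  \<comment> \<open>With this \<open>Q\<close> the inequality
    \<open>Q / \<epsilon> \<le> 2 ^ N\<close> forces the error of moving the poles below
    \<open>\<epsilon> / 2\<close> times \<Lambda>; the summand 1 ensures
    \<open>1 \<le> Q / \<epsilon>\<close>.\<close>
  define Q where "Q = 2 * H * C0 + 1"
  have Q1: "1 \<le> Q" unfolding Q_def using H0 C0(1) by simp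
  \<comment> \<open>Origin of the power of \<open>1 / \<epsilon>\<close>: \<open>C0 ^ N\<close> is
    at most \<open>(2 ^ N) ^ k\<close>, and \<open>2 ^ N\<close> is at most
    \<open>2 * (Q / \<epsilon>)\<close>.\<close>
  obtain k :: nat where k: "C0 \<le> 2 ^ k" using real_arch_pow[of 2 C0] by (auto intro: less_imp_le)
  define C where "C = H * C0 * (2 * Q) ^ k + 1"
  have C: "0 < C" unfolding C_def using H0 C0(1) Q1 by (intro add_nonneg_pos mult_nonneg_nonneg) auto
  have main: "\<exists>h\<in>Ker W c G. (\<forall>x\<in>K. norm (u x - h x) \<le> \<epsilon> * \<Lambda>) \<and> (\<forall>x\<in>G. norm (h x) \<le> C / \<epsilon> ^ k * \<Lambda>)"
    if Y: "open Y" "L \<subseteq> Y" and u: "u \<in> Ker W c Y" and \<Lambda>: "0 \<le> \<Lambda>" "\<forall>x\<in>L. norm (u x) \<le> \<Lambda>" and \<epsilon>: "0 < \<epsilon>" "\<epsilon> < 1" for Y u \<Lambda> \<epsilon>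
  \<comment> \<open>The mollifier and the Riemann sum are chosen according to the error
    \<open>\<epsilon> * \<Lambda> / 4\<close>, which has to be positive.\<close>
  proof (cases "\<Lambda> = 0")
    case True
    then have "\<forall>x\<in>K. u x = 0" using \<Lambda>(2) KL by auto
    then show ?thesis using True by (intro bexI[of _ "\<lambda>x. 0"] Ker_zero) auto
  next
    case False
    then have \<Lambda>0: "0 < \<Lambda>" using \<Lambda>(1) by simp
    have su: "u \<in> smooth_functions Y" by (rule Ker_smooth[OF u])
    have iY: "interior L \<subseteq> Y" using Y(2) interior_subset by blast
    define \<phi> where "\<phi> = (\<lambda>x. \<zeta> x * u x)"
    have t\<phi>: "\<phi> \<in> test_functions (interior L)"
      unfolding \<phi>_def by (rule test_mult[OF \<zeta> open_interior smooth_subset[OF iY su]])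
    have t\<phi>': "\<phi> \<in> test_functions (ball 0 (1/2))"
      by (rule test_mono[OF t\<phi>]) (use interior_subset L(3) in blast)
    define g where "g = Lop W c \<phi>"
    have g0: "g x = 0" if x: "x \<notin> S" for x
    proof (cases "x \<in> C1")
      case True
      then have xU: "x \<in> U" "x \<in> Y" using x C1(2) iY by (auto simp: S_def)
      have "Dw w \<phi> x = Dw w u x" for w
        by (rule Dw_cong[of "U \<inter> Y"]) (use U Y(1) xU in \<open>auto simp: \<phi>_def\<close>)
      then have "g x = Lop W c u x" by (simp add: g_def Lop_def)
      then show ?thesis using u xU by (simp add: Ker_def)
    next
      case False
      have "Dw w \<phi> x = Dw w (\<lambda>x. 0) x" for w
        by (rule Dw_cong[of "- C1"]) (use C1 False in \<open>auto simp: \<phi>_def compact_imp_closed\<close>)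
      then show ?thesis by (simp add: g_def Lop_def)
    qed
    have gb: "norm (g x) \<le> F * \<Lambda>" for x
    proof (cases "x \<in> S")
      case True
      then have xC: "x \<in> C1" by (simp add: S_def)
      have bL: "ball x r \<subseteq> L" using r(3)[OF xC] interior_subset by blast
      have xY: "x \<in> Y" using xC C1(2) iY by blast
      have "norm (Dw v u x) \<le> E * \<Lambda>" if v: "length v \<le> m" for v
      proof -
        have "norm (Dw v u x) \<le> A0 * (A0 / r) ^ length v * fact (length v) * \<Lambda>"
          by (rule A0(3)[OF r(1,2) Ker_subset[OF u]]) (use bL Y(2) \<Lambda>(2) in auto)
        also have "\<dots> \<le> E * \<Lambda>"
          unfolding E_def using A0(2) r(1) v \<Lambda>(1)
          by (intro mult_right_mono member_le_sum[of "length v" "{..m}" "\<lambda>n. A0 * (A0 / r) ^ n * fact n"]) auto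
        finally show ?thesis .
      qed
      then have dw: "norm (Dw w \<phi> x) \<le> Dz w * (E * \<Lambda>)" if "w \<in> W" for w
        unfolding \<phi>_def using Dz[rule_format, of w, THEN conjunct2, rule_format, OF Y(1) su xY, of "E * \<Lambda>"]
          el that by (auto simp: ell_def)
      have "norm (g x) \<le> (\<Sum>w\<in>W. norm (c w) * (Dz w * (E * \<Lambda>)))"
        unfolding g_def Lop_def by (rule sum_norm_le) (auto simp: norm_mult intro!: mult_left_mono dw)
      also have "\<dots> = F * \<Lambda>" by (simp add: F_def sum_distrib_left sum_distrib_right mult_ac)
      finally show ?thesis .
    qed (use g0 F0 \<Lambda>(1) in simp)
    have ig: "integrable lborel g"
      using test_integrable[OF test_Lop[OF t\<phi>], of "\<lambda>_. 1" W c] by (simp add: g_def)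
    have Ig: "(\<integral>z. norm (g z) \<partial>lborel) \<le> V0 * F * \<Lambda>"
    proof -
      have "(\<integral>z. norm (g z) \<partial>lborel) \<le> (\<integral>z. indicator (ball (0 :: real ^ 'n) 1) z * (F * \<Lambda>) \<partial>lborel)"
      proof (rule Bochner_Integration.integral_mono)
        show "integrable lborel (\<lambda>z. norm (g z))" using ig by (rule integrable_norm)
        show "integrable lborel (\<lambda>z. indicator (ball (0 :: real ^ 'n) 1) z * (F * \<Lambda>))"
          using emeasure_lborel_ball_finite[of "0 :: real ^ 'n" 1] by (intro integrable_mult_left integrable_real_indicator) auto
        fix z :: "real ^ 'n"
        have "z \<in> ball 0 1" if "z \<in> S" using that SL by auto
        then show "norm (g z) \<le> indicator (ball 0 1) z * (F * \<Lambda>)"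
          using gb[of z] g0[of z] F0 \<Lambda>(1) by (cases "z \<in> S") (auto simp: indicator_def)
      qed
      then show ?thesis by (simp add: V0_def mult_ac)
    qed
    obtain C\<phi> where C\<phi>: "0 \<le> C\<phi>" "\<And>\<eta> \<rho> x. 0 \<le> \<eta> \<Longrightarrow> mollifier \<eta> \<rho> \<Longrightarrow> norm x + 1/2 \<le> 3 \<Longrightarrow>
      norm (\<phi> x - (\<integral>y. fsol W c \<theta> \<rho> (x - y) * g y \<partial>lborel) / of_real ((2 * pi) ^ CARD('n))) \<le> \<eta> * C\<phi>"
      using fsol_representation[OF \<kappa> sb t\<phi>'] unfolding g_def by blast
    \<comment> \<open>The width may depend on \<open>u\<close> through \<open>C\<phi>\<close>,
      because the pole approximation holds with the same constants for every width up to
      \<eta>0.\<close>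
    define \<eta> where "\<eta> = min \<eta>0 (\<epsilon> * \<Lambda> / 4 / (C\<phi> + 1))"
    have \<eta>: "0 < \<eta>" "\<eta> \<le> \<eta>0" "\<eta> * C\<phi> \<le> \<epsilon> * \<Lambda> / 4"
    proof -
      show "0 < \<eta>" "\<eta> \<le> \<eta>0" using C0(2) C\<phi>(1) \<epsilon>(1) \<Lambda>0 by (auto simp: \<eta>_def)
      have "\<eta> * C\<phi> \<le> \<epsilon> * \<Lambda> / 4 / (C\<phi> + 1) * (C\<phi> + 1)"
        using C\<phi>(1) \<epsilon>(1) \<Lambda>0 by (intro mult_mono) (auto simp: \<eta>_def)
      moreover have "z / (C\<phi> + 1) * (C\<phi> + 1) = z" for z using C\<phi>(1) by simp
      ultimately show "\<eta> * C\<phi> \<le> \<epsilon> * \<Lambda> / 4" by metis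
    qed
    obtain \<rho> :: "real ^ 'n \<Rightarrow> complex" where \<rho>: "mollifier \<eta> \<rho>" using exists_mollifier[OF \<eta>(1)] by blast
    let ?E = "fsol W c \<theta> \<rho>"
    obtain BE LE where BE: "0 \<le> LE" "continuous_on UNIV ?E" "\<And>x. norm (?E x) \<le> BE" "\<And>x y. norm (?E x - ?E y) \<le> LE * norm (x - y)"
      by (rule fsol_regular[OF \<rho>]) (rule that)
    have pos: "0 < \<epsilon> * \<Lambda> / (4 * T)" using \<epsilon>(1) \<Lambda>0 T0 by simp
    have "\<exists>(n::nat) y d. (\<forall>i<n. y i \<in> S) \<and> (\<Sum>i<n. norm (d i)) \<le> (\<integral>z. norm (g z) \<partial>lborel) \<and>
      (\<forall>x. norm ((\<integral>z. ?E (x - z) * g z \<partial>lborel) - (\<Sum>i<n. d i * ?E (x - y i))) \<le> \<epsilon> * \<Lambda> / (4 * T))"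
      by (rule riemann_sum[OF ig S _ BE(2,3,4,1) pos]) (rule g0)
    then obtain n :: nat and y d where y: "\<forall>i<n. y i \<in> S"
      and d: "(\<Sum>i<n. norm (d i)) \<le> (\<integral>z. norm (g z) \<partial>lborel)"
      and rs: "\<forall>x. norm ((\<integral>z. ?E (x - z) * g z \<partial>lborel) - (\<Sum>i<n. d i * ?E (x - y i))) \<le> \<epsilon> * \<Lambda> / (4 * T)"
      by (elim exE conjE) (rule that)
    have "1 \<le> Q / \<epsilon>" using Q1 \<epsilon> by (simp add: pos_le_divide_eq)
    then obtain N :: nat where N: "Q / \<epsilon> \<le> 2 ^ N" "2 ^ N \<le> 2 * (Q / \<epsilon>)" using exists_power_between by blast
    have "\<forall>i. \<exists>h. i < n \<longrightarrow> h \<in> Ker W c G \<and> (\<forall>x\<in>K. norm (?E (x - y i) - h x) \<le> C0 * (1/2) ^ N) \<and> (\<forall>x\<in>G. norm (h x) \<le> C0 ^ Suc N)"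
    proof
      fix i
      show "\<exists>h. i < n \<longrightarrow> h \<in> Ker W c G \<and> (\<forall>x\<in>K. norm (?E (x - y i) - h x) \<le> C0 * (1/2) ^ N) \<and> (\<forall>x\<in>G. norm (h x) \<le> C0 ^ Suc N)"
        using C0(3)[unfolded approx_def, rule_format, OF \<eta>(2) \<rho>, of "[]" N "y i"] y by auto
    qed
    from choice[OF this] obtain h where h: "\<forall>i. i < n \<longrightarrow> h i \<in> Ker W c G \<and> (\<forall>x\<in>K. norm (?E (x - y i) - h i x) \<le> C0 * (1/2) ^ N) \<and>
      (\<forall>x\<in>G. norm (h i x) \<le> C0 ^ Suc N)" ..
    define hh where "hh x = (\<Sum>i<n. (of_real T * d i) * h i x)" for x
    have dT: "(\<Sum>i<n. norm (of_real T * d i)) \<le> H * \<Lambda>"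
    proof -
      have "(\<Sum>i<n. norm (of_real T * d i)) = T * (\<Sum>i<n. norm (d i))"
        using T0 by (simp add: norm_mult sum_distrib_left)
      also have "\<dots> \<le> T * (V0 * F * \<Lambda>)" using d Ig T0 by (intro mult_left_mono) auto
      finally show ?thesis by (simp add: H_def mult_ac)
    qed
    have sb2: "norm (\<Sum>i<n. (of_real T * d i) * z i) \<le> H * \<Lambda> * Z" if "\<And>i. i < n \<Longrightarrow> norm (z i) \<le> Z" "0 \<le> Z" for z :: "nat \<Rightarrow> complex" and Z
    proof -
      have "norm (\<Sum>i<n. (of_real T * d i) * z i) \<le> (\<Sum>i<n. norm (of_real T * d i) * Z)"
        by (rule sum_norm_le) (use that in \<open>auto simp: norm_mult intro!: mult_left_mono\<close>)
      also have "\<dots> = (\<Sum>i<n. norm (of_real T * d i)) * Z" by (simp add: sum_distrib_right)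
      also have "\<dots> \<le> H * \<Lambda> * Z" using dT that(2) by (rule mult_right_mono)
      finally show ?thesis .
    qed
    have "hh \<in> Ker W c G"
      unfolding hh_def[abs_def] using h by (intro Ker_sum[OF G(1)] Ker_cmult[OF G(1)]) auto
    moreover have "norm (hh x) \<le> C / \<epsilon> ^ k * \<Lambda>" if x: "x \<in> G" for x
    proof -
      have "norm (hh x) \<le> H * \<Lambda> * C0 ^ Suc N"
        unfolding hh_def using h x C0(1) by (intro sb2) auto
      also have "\<dots> = H * C0 * C0 ^ N * \<Lambda>" by simp
      also have "\<dots> \<le> H * C0 * ((2 * Q) ^ k / \<epsilon> ^ k) * \<Lambda>"
      proof (intro mult_right_mono mult_left_mono)
        have "C0 ^ N \<le> (2 ^ k) ^ N" using k C0(1) by (intro power_mono) auto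
        also have "\<dots> = (2 ^ N) ^ k" by (simp add: power_mult[symmetric] mult.commute)
        also have "\<dots> \<le> (2 * (Q / \<epsilon>)) ^ k" by (intro power_mono N(2)) auto
        finally show "C0 ^ N \<le> (2 * Q) ^ k / \<epsilon> ^ k" by (simp add: power_divide power_mult_distrib)
      qed (use H0 C0(1) \<Lambda> in auto)
      also have "\<dots> = (C - 1) / \<epsilon> ^ k * \<Lambda>" by (simp add: C_def)
      also have "\<dots> \<le> C / \<epsilon> ^ k * \<Lambda>" using \<epsilon>(1) \<Lambda>(1) by (intro mult_right_mono divide_right_mono) auto
      finally show ?thesis .
    qed
    moreover have "norm (u x - hh x) \<le> \<epsilon> * \<Lambda>" if x: "x \<in> K" for x
    proof -
      \<comment> \<open>Error budget: a quarter of \<open>\<epsilon> * \<Lambda>\<close> each for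
        the regularisation and the Riemann sum, and one half for moving the poles.\<close>
      let ?I = "\<integral>z. ?E (x - z) * g z \<partial>lborel"
      have ux: "\<phi> x = u x" using U(2,3) x by (auto simp: \<phi>_def)
      have "norm x + 1/2 \<le> 3" using x Kb by force
      from C\<phi>(2)[OF less_imp_le[OF \<eta>(1)] \<rho> this]
      have 1: "norm (u x - of_real T * ?I) \<le> \<epsilon> * \<Lambda> / 4" using \<eta>(3) by (simp add: ux T_def)
      have "norm (of_real T * ?I - of_real T * (\<Sum>i<n. d i * ?E (x - y i))) = T * norm (?I - (\<Sum>i<n. d i * ?E (x - y i)))"
        using T0 by (simp add: norm_mult flip: right_diff_distrib)
      also have "\<dots> \<le> T * (\<epsilon> * \<Lambda> / (4 * T))" using rs T0 by (intro mult_left_mono) auto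
      finally have 2: "norm (of_real T * ?I - of_real T * (\<Sum>i<n. d i * ?E (x - y i))) \<le> \<epsilon> * \<Lambda> / 4" using T0 by simp
      have "of_real T * (\<Sum>i<n. d i * ?E (x - y i)) - hh x = (\<Sum>i<n. (of_real T * d i) * (?E (x - y i) - h i x))"
        by (simp add: hh_def sum_distrib_left sum_subtractf right_diff_distrib mult.assoc)
      also have "norm \<dots> \<le> H * \<Lambda> * (C0 * (1/2) ^ N)" using h x C0(1) by (intro sb2) auto
      also have "\<dots> \<le> \<epsilon> * \<Lambda> / 2"
      proof -
        have "2 * H * C0 \<le> Q" by (simp add: Q_def)
        also have "\<dots> \<le> \<epsilon> * 2 ^ N" using N(1) \<epsilon>(1) by (simp add: pos_divide_le_eq mult.commute)
        finally have "H * C0 * (1/2) ^ N \<le> \<epsilon> / 2" by (simp add: power_divide field_simps)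
        from mult_right_mono[OF this \<Lambda>(1)] show ?thesis by (simp add: mult_ac)
      qed
      finally have 3: "norm (of_real T * (\<Sum>i<n. d i * ?E (x - y i)) - hh x) \<le> \<epsilon> * \<Lambda> / 2" .
      define a1 where "a1 = of_real T * ?I"
      define a2 where "a2 = of_real T * (\<Sum>i<n. d i * ?E (x - y i))"
      have "norm (u x - hh x) \<le> norm (u x - a1) + norm (a1 - a2) + norm (a2 - hh x)"
        using norm_triangle_ineq[of "u x - a1" "a1 - a2"] norm_triangle_ineq[of "u x - a2" "a2 - hh x"] by simp
      then show ?thesis using 1 2 3 unfolding a1_def[symmetric] a2_def[symmetric] by linarith
    qed
    ultimately show ?thesis by blast
  qed
  show ?thesis
    by (rule rungeI[OF C]) (rule main)
qed

end

text \<open>Reduction to radius 1/2 by a dilation with factor \<open>2 * R\<close>, under which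
  solutions, components and closures correspond.\<close>

lemma runge_step_ball:
  fixes K L G :: "(real ^ 'n::finite) set"
  assumes el: "ell W c m" and R: "0 < R"
    and K: "compact K" and L: "compact L" "K \<subseteq> interior L" "L \<subseteq> ball 0 R" and G: "open G" "G \<subseteq> ball 0 R"
    and conn: "\<And>y. y \<in> ball 0 R - K \<Longrightarrow> \<exists>b \<in> connected_component_set (ball 0 R - K) y. b \<notin> closure G"
  shows "runge W c K L G G"
proof -
  define t where "t = 2 * R"
  have t: "0 < t" using R by (simp add: t_def)
  let ?p = "(*\<^sub>R) (1 / t) :: real ^ 'n \<Rightarrow> real ^ 'n"
  have tp: "t *\<^sub>R ?p x = x" "?p (t *\<^sub>R x) = x" for x using t by auto
  have inj: "inj ?p" using t by (intro injI) simp
  have im: "x \<in> ?p ` S \<longleftrightarrow> t *\<^sub>R x \<in> S" for x S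
  proof
    show "t *\<^sub>R x \<in> S" if "x \<in> ?p ` S" using that tp(1) by auto
    show "x \<in> ?p ` S" if "t *\<^sub>R x \<in> S" by (rule image_eqI[of _ _ "t *\<^sub>R x"]) (use tp that in auto)
  qed
  have bl: "?p x \<in> ball 0 (1/2) \<longleftrightarrow> x \<in> ball 0 R" for x using t by (simp add: t_def field_simps)
  \<comment> \<open>The operator satisfied by the dilated function; each letter of a word
    contributes a factor \<open>t\<close>.\<close>
  define c' where "c' w = c w / of_real t ^ length w" for w :: "'n list"
  have el': "ell W c' m"
  proof -
    obtain \<kappa> where \<kappa>: "0 < \<kappa>" "\<forall>\<xi>. \<kappa> * norm \<xi> ^ m \<le> norm (symb {w\<in>W. length w = m} c \<xi>)"
      using el by (auto simp: ell_def)
    have "symb {w\<in>W. length w = m} c' \<xi> = symb {w\<in>W. length w = m} c \<xi> / of_real t ^ m" for \<xi>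
      unfolding symb_def sum_divide_distrib by (intro sum.cong refl) (simp add: c'_def)
    then have "\<kappa> / t ^ m * norm \<xi> ^ m \<le> norm (symb {w\<in>W. length w = m} c' \<xi>)" for \<xi>
      using \<kappa>(2)[rule_format, of \<xi>] t by (simp add: norm_divide norm_power divide_right_mono)
    then show ?thesis using el \<kappa>(1) t by (auto simp: ell_def intro!: exI[of _ "\<kappa> / t ^ m"])
  qed
  obtain \<theta> A \<kappa> where sh: "0 < \<kappa>" "symb_bounds W m A \<kappa> \<theta> c'" using exists_shift[OF el'] by blast
  interpret shifted_op W c' m \<theta> A \<kappa> by unfold_locales (use el' sh in auto)
  have "runge W c' (?p ` K) (?p ` L) (?p ` G) (?p ` G)"
  proof (rule runge_step)
    show "compact (?p ` K)" "compact (?p ` L)" using K L(1) by (auto intro: compact_scaling)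
    show "open (?p ` G)" using G(1) t by (intro open_scaling) auto
    have "open (?p ` interior L)" using t by (intro open_scaling) auto
    moreover have "?p ` interior L \<subseteq> ?p ` L" using interior_subset by (rule image_mono)
    ultimately have "?p ` interior L \<subseteq> interior (?p ` L)" by (intro interior_maximal)
    then show "?p ` K \<subseteq> interior (?p ` L)" using L(2) by blast
    show "?p ` L \<subseteq> ball 0 (1/2)" "?p ` G \<subseteq> ball 0 (1/2)" using bl L(3) G(2) by blast+
    fix y assume y: "y \<in> ball 0 (1/2) - ?p ` K"
    have eq: "ball 0 (1/2) - ?p ` K = ?p ` (ball 0 R - K)"
    proof (rule set_eqI)
      fix x :: "real ^ 'n"
      show "x \<in> ball 0 (1/2) - ?p ` K \<longleftrightarrow> x \<in> ?p ` (ball 0 R - K)"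
        using bl[of "t *\<^sub>R x"] by (simp only: Diff_iff im tp(2))
    qed
    have ty: "t *\<^sub>R y \<in> ball 0 R - K" using y unfolding eq im .
    from conn[OF this] obtain b where b: "b \<in> connected_component_set (ball 0 R - K) (t *\<^sub>R y)" "b \<notin> closure G" by blast
    let ?D = "connected_component_set (ball 0 R - K) (t *\<^sub>R y)"
    have "connected (?p ` ?D)" by (intro connected_continuous_image continuous_intros connected_connected_component)
    moreover have "?p ` ?D \<subseteq> ball 0 (1/2) - ?p ` K" unfolding eq by (intro image_mono connected_component_subset)
    moreover have "y \<in> ?p ` ?D" unfolding im using ty by simp
    ultimately have "?p ` ?D \<subseteq> connected_component_set (ball 0 (1/2) - ?p ` K) y" by (intro connected_component_maximal)
    then have "?p b \<in> connected_component_set (ball 0 (1/2) - ?p ` K) y" using b(1) by blast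
    moreover have "?p b \<notin> closure (?p ` G)" using b(2) inj unfolding closure_scaleR[symmetric] by (simp add: inj_image_mem_iff)
    ultimately show "\<exists>b\<in>connected_component_set (ball 0 (1/2) - ?p ` K) y. b \<notin> closure (?p ` G)" by blast
  qed
  then obtain C and s :: nat where C: "0 < C" and H: "\<And>Y u \<Lambda> \<epsilon>. open Y \<Longrightarrow> ?p ` L \<subseteq> Y \<Longrightarrow> u \<in> Ker W c' Y \<Longrightarrow> 0 \<le> \<Lambda> \<Longrightarrow> \<forall>x\<in>?p ` L. norm (u x) \<le> \<Lambda> \<Longrightarrow> 0 < \<epsilon> \<Longrightarrow> \<epsilon> < 1 \<Longrightarrow>
    \<exists>h\<in>Ker W c' (?p ` G). (\<forall>x\<in>?p ` K. norm (u x - h x) \<le> \<epsilon> * \<Lambda>) \<and> (\<forall>x\<in>?p ` G. norm (h x) \<le> C / \<epsilon> ^ s * \<Lambda>)"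
    by (rule rungeE) (rule that)
  have "\<exists>h\<in>Ker W c G. (\<forall>x\<in>K. norm (u x - h x) \<le> \<epsilon> * \<Lambda>) \<and> (\<forall>x\<in>G. norm (h x) \<le> C / \<epsilon> ^ s * \<Lambda>)"
    if Y: "open Y" "L \<subseteq> Y" and u: "u \<in> Ker W c Y" and \<Lambda>: "0 \<le> \<Lambda>" "\<forall>x\<in>L. norm (u x) \<le> \<Lambda>" and \<epsilon>: "0 < \<epsilon>" "\<epsilon> < 1" for Y u \<Lambda> \<epsilon>
  proof -
    have Yeq: "{x. 0 + t *\<^sub>R x \<in> Y} = ?p ` Y" using im by auto
    have "(\<lambda>x. u (0 + t *\<^sub>R x)) \<in> Ker W c' {x. 0 + t *\<^sub>R x \<in> Y}"
      by (rule Ker_affine[OF Y(1) u, of _ _ 1]) (use t in \<open>simp add: c'_def\<close>)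
    then have u': "(\<lambda>x. u (t *\<^sub>R x)) \<in> Ker W c' (?p ` Y)" unfolding Yeq by simp
    have "open (?p ` Y)" "?p ` L \<subseteq> ?p ` Y" using Y t by (auto intro!: open_scaling)
    moreover have "\<forall>x\<in>?p ` L. norm (u (t *\<^sub>R x)) \<le> \<Lambda>" using \<Lambda>(2) im by blast
    ultimately obtain h where h: "h \<in> Ker W c' (?p ` G)" "\<forall>x\<in>?p ` K. norm (u (t *\<^sub>R x) - h x) \<le> \<epsilon> * \<Lambda>" "\<forall>x\<in>?p ` G. norm (h x) \<le> C / \<epsilon> ^ s * \<Lambda>"
      using H[OF _ _ u' \<Lambda>(1) _ \<epsilon>] by blast
    have Geq: "{x. 0 + (1 / t) *\<^sub>R x \<in> ?p ` G} = G" using inj by (auto simp: inj_image_mem_iff)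
    have oG: "open (?p ` G)" using G(1) t by (intro open_scaling) auto
    have "(\<lambda>x. h (0 + (1 / t) *\<^sub>R x)) \<in> Ker W c {x. 0 + (1 / t) *\<^sub>R x \<in> ?p ` G}"
      by (rule Ker_affine[OF oG h(1), of _ _ 1]) (use t in \<open>simp add: c'_def power_divide\<close>)
    then have "(\<lambda>x. h (?p x)) \<in> Ker W c G" unfolding Geq by simp
    moreover have "norm (u x - h (?p x)) \<le> \<epsilon> * \<Lambda>" if "x \<in> K" for x
      using h(2)[rule_format, OF imageI[OF that]] by (simp only: tp(1))
    moreover have "norm (h (?p x)) \<le> C / \<epsilon> ^ s * \<Lambda>" if "x \<in> G" for x
      by (rule h(3)[rule_format, OF imageI[OF that]])
    ultimately show ?thesis by (intro bexI[of _ "\<lambda>x. h (?p x)"]) auto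
  qed
  then show ?thesis by (rule rungeI[OF C])
qed

text \<open>A component of \<open>ball 0 R - K\<close> inside \<open>Z\<close> does not touch the sphere, so it would be a component of \<open>- K\<close>.\<close>

lemma component_escapes:
  fixes K X Z :: "(real ^ 'n::finite) set"
  assumes K: "compact K" and hull: "\<not> (\<exists>C\<in>components (- K). bounded C \<and> C \<subseteq> X)"
    and Z: "compact Z" "Z \<subseteq> X" "Z \<subseteq> ball 0 R" and y: "y \<in> ball 0 R - K"
  shows "\<exists>b\<in>connected_component_set (ball 0 R - K) y. b \<notin> Z"
proof (rule ccontr)
  let ?D = "connected_component_set (ball 0 R - K) y"
  assume "\<not> ?thesis"
  then have DZ: "?D \<subseteq> Z" by blast
  have "open (ball 0 R - K)" using K by (intro open_Diff compact_imp_closed) auto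
  then have op: "open ?D" by (rule open_connected_component)
  have yD: "y \<in> ?D" using y by simp
  have sub: "?D \<subseteq> ball 0 R - K" by (rule connected_component_subset)
  have cD: "connected ?D" by (rule connected_connected_component)
  \<comment> \<open>Limit points of \<open>?D\<close> stay in \<open>Z\<close> and hence in the open
    ball, so those off \<open>K\<close> can be added to \<open>?D\<close> without leaving
    \<open>ball 0 R - K\<close>.\<close>
  have cl: "closure ?D - K \<subseteq> ?D"
  proof
    fix x assume x: "x \<in> closure ?D - K"
    have "closure ?D \<subseteq> Z" using DZ Z(1) by (intro closure_minimal compact_imp_closed)
    then have "insert x ?D \<subseteq> ball 0 R - K" using x sub Z(3) by blast
    moreover have "connected (insert x ?D)"
      by (rule connected_intermediate_closure[OF cD]) (use x closure_subset[of ?D] in auto)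
    ultimately have "insert x ?D \<subseteq> ?D" using yD by (intro connected_component_maximal) auto
    then show "x \<in> ?D" by blast
  qed
  have "?D \<in> components (- K)"
    unfolding in_components_maximal
  proof (intro conjI allI impI)
    show "?D \<noteq> {}" using yD by blast
    show "?D \<subseteq> - K" using sub by blast
    show "connected ?D" by (rule cD)
    fix d assume d: "d \<noteq> {} \<and> ?D \<subseteq> d \<and> d \<subseteq> - K \<and> connected d"
    \<comment> \<open>\<open>?D\<close> is open, and by \<open>cl\<close> closed relative to
      \<open>d\<close>; a connected \<open>d\<close> has no proper nonempty part of this
      kind.\<close>
    have "openin (top_of_set d) ?D" using op d by (simp add: open_subset)
    moreover have "?D = d \<inter> closure ?D" using cl d closure_subset[of ?D] by blast
    then have "closedin (top_of_set d) ?D" by (metis closed_closure closedin_closed_Int)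
    ultimately have "?D = {} \<or> ?D = d" using d connected_clopen by blast
    then show "d = ?D" using yD by blast
  qed
  moreover have "bounded ?D" using DZ Z(1) bounded_subset compact_imp_bounded by blast
  moreover have "?D \<subseteq> X" using DZ Z(2) by blast
  ultimately show False using hull by blast
qed

text \<open>The compact \<open>Z\<close> between \<open>G\<close> and \<open>X\<close> turns the
  hypothesis on the components into the escape condition of \<open>runge_step_ball\<close>: a point
  off \<open>Z\<close> is off \<open>closure G\<close>.\<close>

lemma runge_compact:
  fixes K L X Z G :: "(real ^ 'n::finite) set"
  assumes el: "ell W c m" and K: "compact K" and hull: "\<not> (\<exists>C\<in>components (- K). bounded C \<and> C \<subseteq> X)"
    and L: "compact L" "K \<subseteq> interior L" and G: "open G" "G \<subseteq> Z" "compact Z" "Z \<subseteq> X"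
  shows "runge W c K L G G"
proof -
  have "bounded (L \<union> Z)" using L(1) G(3) by (simp add: compact_imp_bounded)
  then obtain R where R: "0 < R" "L \<union> Z \<subseteq> ball 0 R" using bounded_subset_ballD[of "L \<union> Z" 0] by blast
  show ?thesis
  proof (rule runge_step_ball[OF el R(1) K L _ G(1)])
    show "L \<subseteq> ball 0 R" "G \<subseteq> ball 0 R" using R(2) G(2) by auto
    fix y assume "y \<in> ball 0 R - K"
    from component_escapes[OF K hull G(3,4) _ this] R(2)
    obtain b where b: "b \<in> connected_component_set (ball 0 R - K) y" "b \<notin> Z" by auto
    have "closure G \<subseteq> Z" using G(2,3) by (intro closure_minimal compact_imp_closed)
    then show "\<exists>b\<in>connected_component_set (ball 0 R - K) y. b \<notin> closure G" using b by blast
  qed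
qed

section \<open>Exhaustion and passage to the limit\<close>

text \<open>Removing balls around the points of the complement, rather than using the distance to
  it, also covers \<open>X = UNIV\<close>; the summand 1 keeps the radius meaningful for
  \<open>n = 0\<close>.\<close>

definition exhaust :: "'a::metric_space set \<Rightarrow> 'a \<Rightarrow> nat \<Rightarrow> 'a set" where
  "exhaust X a n = cball a (real n) - (\<Union>z\<in>- X. ball z (1 / (real n + 1)))"

lemma compact_exhaust: "compact (exhaust X a n)" for a :: "'a::heine_borel"
  unfolding exhaust_def by (intro compact_diff compact_cball open_UN) auto

lemma exhaust_subset: "exhaust X a n \<subseteq> X"
  by (force simp: exhaust_def)

lemma exhaust_interior: "exhaust X a n \<subseteq> interior (exhaust X a (Suc n))" for a :: "'a::metric_space"
proof
  fix x assume x: "x \<in> exhaust X a n"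
  \<comment> \<open>The gap between consecutive radii of the removed balls. A move by less than
    \<open>d\<close> stays off the smaller balls and, as \<open>d < 1\<close>, inside the larger
    \<open>cball\<close>.\<close>
  define d where "d = 1 / (real n + 1) - 1 / (real n + 2)"
  have "1 / (real n + 2) < 1 / (real n + 1)" by (intro divide_strict_left_mono) auto
  moreover have "0 < 1 / (real n + 2)" "1 / (real n + 1) \<le> 1" by simp_all
  ultimately have d: "0 < d" "d < 1" unfolding d_def by linarith+
  have "ball x d \<subseteq> exhaust X a (Suc n)"
  proof
    fix y assume y: "y \<in> ball x d"
    have "dist a y \<le> real (Suc n)"
      using x y d(2) dist_triangle[of a y x] by (simp add: exhaust_def)
    moreover have "1 / (real (Suc n) + 1) \<le> dist z y" if "z \<in> - X" for z
    proof -
      have "1 / (real n + 1) \<le> dist z x" using x that by (force simp: exhaust_def)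
      moreover have "1 / (real (Suc n) + 1) = 1 / (real n + 1) - d" by (simp add: d_def add_ac)
      ultimately show ?thesis using y dist_triangle[of z x y] by (simp add: dist_commute)
    qed
    ultimately show "y \<in> exhaust X a (Suc n)" by (force simp: exhaust_def)
  qed
  then show "x \<in> interior (exhaust X a (Suc n))" using d(1) by (auto simp: mem_interior)
qed

lemma exhaust_mono: "n \<le> k \<Longrightarrow> exhaust X a n \<subseteq> exhaust X a k"
  by (rule lift_Suc_mono_le[of "exhaust X a"]) (use exhaust_interior interior_subset in blast)

lemma compact_subset_exhaust:
  fixes X M :: "'a::heine_borel set"
  assumes "open X" "compact M" "M \<subseteq> X"
  obtains n where "M \<subseteq> exhaust X a n"
proof -
  have "\<exists>e>0. (\<Union>x\<in>M. ball x e) \<subseteq> X"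
    using compact_subset_open_imp_ball_epsilon_subset[OF assms(2,1,3)] by metis
  then obtain e where e: "0 < e" "(\<Union>x\<in>M. ball x e) \<subseteq> X" by blast
  obtain r where r: "M \<subseteq> cball a r"
    using bounded_subset_ballD[OF compact_imp_bounded[OF assms(2)], of a] ball_subset_cball by (metis subset_trans)
  obtain n :: nat where n: "max r (1 / e) \<le> real n" using real_arch_simple by blast
  have "1 \<le> e * real n" using n e(1) by (simp add: pos_divide_le_eq mult.commute)
  also have "\<dots> \<le> e * (real n + 1)" using e(1) by (intro mult_left_mono) auto
  finally have en: "1 / (real n + 1) \<le> e" by (simp add: pos_divide_le_eq)
  have "M \<subseteq> exhaust X a n"
  proof
    fix x assume x: "x \<in> M"
    have "x \<in> cball a (real n)" using subsetD[OF r x] n by simp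
    moreover have "x \<notin> ball z (1 / (real n + 1))" if "z \<in> - X" for z
    proof
      assume "x \<in> ball z (1 / (real n + 1))"
      then have "z \<in> ball x e" using en by (simp add: dist_commute)
      then show False using e(2) x that by blast
    qed
    ultimately show "x \<in> exhaust X a n" by (simp add: exhaust_def)
  qed
  then show thesis by (rule that)
qed

text \<open>A point off the set either lies beyond radius \<open>n\<close>, and its outward ray
  stays off the set, so that its component is unbounded; or it lies in a removed ball around some
  \<open>z \<notin> X\<close>, and the segment to \<open>z\<close> shows that its component is not
  inside \<open>X\<close>. The centre 0 makes the ray \<open>s *\<^sub>R y\<close>.\<close>

lemma exhaust_hull:
  fixes X :: "'a::euclidean_space set"
  shows "\<not> (\<exists>C\<in>components (- exhaust X 0 n). bounded C \<and> C \<subseteq> X)"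
proof
  assume "\<exists>C\<in>components (- exhaust X 0 n). bounded C \<and> C \<subseteq> X"
  then obtain C where C: "C \<in> components (- exhaust X 0 n)" "bounded C" "C \<subseteq> X" by blast
  obtain y where y: "y \<in> C" using in_components_nonempty[OF C(1)] by blast
  have max: "T \<subseteq> C" if "connected T" "y \<in> T" "T \<inter> exhaust X 0 n = {}" for T
    by (rule components_maximal[OF C(1)]) (use that y in auto)
  have "y \<notin> exhaust X 0 n" using y in_components_subset[OF C(1)] by blast
  then consider "real n < norm y" | z where "z \<notin> X" "y \<in> ball z (1 / (real n + 1))"
    by (force simp: exhaust_def)
  then show False
  proof cases
    case 1
    have "(\<lambda>s. s *\<^sub>R y) ` {1..} \<subseteq> C"
    proof (rule max)
      show "connected ((\<lambda>s. s *\<^sub>R y) ` {1..})" by (intro connected_continuous_image continuous_intros) auto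
      show "y \<in> (\<lambda>s. s *\<^sub>R y) ` {1..}" by (rule image_eqI[of _ _ 1]) auto
      have "norm y \<le> \<bar>s\<bar> * norm y" if "1 \<le> s" for s :: real using mult_right_mono[of 1 "\<bar>s\<bar>" "norm y"] that by simp
      then show "(\<lambda>s. s *\<^sub>R y) ` {1..} \<inter> exhaust X 0 n = {}" using 1 by (fastforce simp: exhaust_def)
    qed
    moreover obtain B where B: "\<forall>x\<in>C. norm x \<le> B" using C(2) by (auto simp: bounded_iff)
    ultimately have *: "norm (s *\<^sub>R y) \<le> B" if "1 \<le> s" for s using that by blast
    have y0: "0 < norm y" using 1 by (meson le_less_trans of_nat_0_le_iff)
    have "norm ((1 + \<bar>B\<bar> / norm y) *\<^sub>R y) = norm y + \<bar>B\<bar>"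
      using y0 by (simp add: field_simps)
    then have "norm y + \<bar>B\<bar> \<le> B" using *[of "1 + \<bar>B\<bar> / norm y"] y0 by simp
    then show False using y0 by linarith
  next
    case 2
    have "closed_segment y z \<subseteq> C"
    proof (rule max)
      have "closed_segment y z \<subseteq> ball z (1 / (real n + 1))" using 2(2) by (intro closed_segment_subset) auto
      then show "closed_segment y z \<inter> exhaust X 0 n = {}" using 2(1) by (auto simp: exhaust_def)
    qed auto
    then show False using C(3) 2(1) by auto
  qed
qed

section \<open>Locality and limits of solutions\<close>

lemma Ker_local:
  assumes "open V" "\<And>x. x \<in> V \<Longrightarrow> \<exists>T. open T \<and> x \<in> T \<and> u \<in> Ker W c T"
  shows "u \<in> Ker W c V"
proof -
  have "u \<in> smooth_functions V"
  proof (rule smooth_local[OF assms(1)])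
    fix x assume "x \<in> V"
    from assms(2)[OF this] show "\<exists>T. open T \<and> x \<in> T \<and> u \<in> smooth_functions T" by (elim ex_forward conj_forward Ker_smooth)
  qed
  moreover have "Lop W c u x = 0" if x: "x \<in> V" for x
    using assms(2)[OF x] by (auto simp: Ker_def)
  ultimately show ?thesis by (simp add: Ker_def)
qed

text \<open>Cauchy estimates for the differences turn uniform convergence into locally uniform
  convergence of all derivatives. The limits \<open>g w\<close> of the derivatives along words form
  a family closed under differentiation up to scalars, hence are smooth, and the equation passes to
  the limit.\<close>

lemma Ker_uniform_limit:
  fixes f :: "nat \<Rightarrow> real ^ 'n::finite \<Rightarrow> complex"
  assumes el: "ell W c m" and V: "open V" and f: "\<And>n. f n \<in> Ker W c V" and lim: "uniform_limit V f h sequentially"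
  shows "h \<in> Ker W c V"
proof -
  obtain \<delta>0 A where A: "0 < \<delta>0" "1 \<le> A"
    "\<And>\<rho> x u B w. 0 < \<rho> \<Longrightarrow> \<rho> \<le> \<delta>0 \<Longrightarrow> u \<in> Ker W c (ball x \<rho>) \<Longrightarrow> (\<And>y. y \<in> ball x \<rho> \<Longrightarrow> norm (u y) \<le> B) \<Longrightarrow>
      norm (Dw w u x) \<le> A * (A / \<rho>) ^ length w * fact (length w) * B"
    using Cauchy_estimate[OF el] by blast
  have sf: "f n \<in> smooth_functions V" for n by (rule Ker_smooth[OF f])
  define g where "g w x = lim (\<lambda>n. Dw w (f n) x)" for w x
  \<comment> \<open>Twice the radius is kept inside \<open>V\<close>, so that the Cauchy estimate
    with radius \<open>r\<close> applies at every point of \<open>ball x r\<close>.\<close>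
  have uc: "uniformly_Cauchy_on (ball x r) (\<lambda>n. Dw w (f n))" if r: "0 < r" "r \<le> \<delta>0" "ball x (2 * r) \<subseteq> V" for x r w
    unfolding uniformly_Cauchy_on_def
  proof (intro allI impI)
    fix e :: real assume e: "0 < e"
    define Q where "Q = A * (A / r) ^ length w * fact (length w)"
    have Q: "0 < Q" using A(2) r(1) by (simp add: Q_def)
    have "uniformly_Cauchy_on V f" using lim by (auto simp: uniformly_convergent_eq_Cauchy[symmetric] uniformly_convergent_on_def)
    from this[unfolded uniformly_Cauchy_on_def, rule_format, of "e / (2 * Q)"] e Q
    obtain M where M: "\<And>y k n. y \<in> V \<Longrightarrow> k \<ge> M \<Longrightarrow> n \<ge> M \<Longrightarrow> dist (f k y) (f n y) < e / (2 * Q)" by auto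
    show "\<exists>M. \<forall>y\<in>ball x r. \<forall>k\<ge>M. \<forall>n\<ge>M. dist (Dw w (f k) y) (Dw w (f n) y) < e"
    proof (rule exI[of _ M], intro ballI allI impI)
      fix y k n assume y: "y \<in> ball x r" and kn: "M \<le> k" "M \<le> n"
      have "ball y r \<subseteq> ball x (2 * r)"
      proof
        fix z assume "z \<in> ball y r"
        then show "z \<in> ball x (2 * r)" using y dist_triangle[of x z y] by simp
      qed
      then have sub: "ball y r \<subseteq> V" using r(3) by blast
      have yV: "y \<in> V" using sub r(1) by auto
      have "norm (Dw w (\<lambda>z. f k z - f n z) y) \<le> A * (A / r) ^ length w * fact (length w) * (e / (2 * Q))"
        by (rule A(3)[OF r(1,2) Ker_subset[OF Ker_diff[OF V f f] sub]])
          (use M kn sub in \<open>auto simp: dist_norm intro!: less_imp_le\<close>)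
      also have "\<dots> = e / 2" using Q by (simp add: Q_def[symmetric])
      finally have "norm (Dw w (\<lambda>z. f k z - f n z) y) < e" using e by linarith
      then show "dist (Dw w (f k) y) (Dw w (f n) y) < e"
        by (simp add: dist_norm Dw_diff[OF V sf sf yV])
    qed
  qed
  have nb: "\<exists>r>0. r \<le> \<delta>0 \<and> ball x (2 * r) \<subseteq> V" if x: "x \<in> V" for x
  proof -
    obtain e where e: "0 < e" "ball x e \<subseteq> V" using V x open_contains_ball by blast
    have "ball x (2 * min \<delta>0 (e / 2)) \<subseteq> ball x e" by (rule subset_ball) (auto simp: min_def)
    then show ?thesis using e A(1) by (intro exI[of _ "min \<delta>0 (e / 2)"]) auto
  qed
  have ul: "uniform_limit (ball x r) (\<lambda>n. Dw w (f n)) (g w) sequentially" if r: "0 < r" "r \<le> \<delta>0" "ball x (2 * r) \<subseteq> V" for x r w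
  proof -
    obtain l where l: "uniform_limit (ball x r) (\<lambda>n. Dw w (f n)) l sequentially"
      using uc[OF r] by (auto simp: uniformly_convergent_eq_Cauchy[symmetric] uniformly_convergent_on_def)
    have "g w y = l y" if "y \<in> ball x r" for y
      unfolding g_def using tendsto_uniform_limitI[OF l that] by (rule limI)
    then have "uniform_limit (ball x r) (\<lambda>n. Dw w (f n)) (g w) sequentially \<longleftrightarrow> uniform_limit (ball x r) (\<lambda>n. Dw w (f n)) l sequentially"
      by (intro uniform_limit_cong') auto
    then show ?thesis using l by blast
  qed
  have pl: "(\<lambda>n. Dw w (f n) x) \<longlonglongrightarrow> g w x" if x: "x \<in> V" for w x
  proof -
    obtain r where r: "0 < r" "r \<le> \<delta>0" "ball x (2 * r) \<subseteq> V" using nb[OF x] by blast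
    show ?thesis using tendsto_uniform_limitI[OF ul[OF r]] r(1) by simp
  qed
  have der: "(g w has_derivative (\<lambda>k. \<Sum>j\<in>UNIV. \<i> * of_real (k $ j) * g (j # w) x)) (at x)" if x: "x \<in> V" for w x
  proof -
    obtain r where r: "0 < r" "r \<le> \<delta>0" "ball x (2 * r) \<subseteq> V" using nb[OF x] by blast
    have bV: "ball x r \<subseteq> V" using r subset_ball[of r "2 * r" x] by auto
    have "\<exists>G. \<forall>y\<in>ball x r. (\<lambda>n. Dw w (f n) y) \<longlonglongrightarrow> G y \<and> (G has_derivative (\<lambda>k. \<Sum>j\<in>UNIV. \<i> * of_real (k $ j) * g (j # w) y)) (at y within ball x r)"
    proof (rule has_derivative_sequence)
      show "convex (ball x r)" by simp
      show "x \<in> ball x r" using r(1) by simp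
      show "(\<lambda>n. Dw w (f n) x) \<longlonglongrightarrow> g w x" by (rule pl[OF x])
      show "(Dw w (f n) has_derivative (\<lambda>k. \<Sum>j\<in>UNIV. \<i> * of_real (k $ j) * Dw (j # w) (f n) y)) (at y within ball x r)"
        if "y \<in> ball x r" for n y
        unfolding Dw_Cons
        by (rule has_derivative_at_withinI[OF has_derivative_D_op[OF smooth_differentiable[OF smooth_Dw[OF V sf]]]])
          (use that bV in auto)
      fix e :: real assume e: "0 < e"
      let ?d = "real CARD('n)"
      have "\<forall>\<^sub>F n in sequentially. \<forall>j. \<forall>y\<in>ball x r. dist (Dw (j # w) (f n) y) (g (j # w) y) < e / ?d"
      proof (intro eventually_all_finite)
        fix j
        have "0 < e / ?d" using e by simp
        then show "\<forall>\<^sub>F n in sequentially. \<forall>y\<in>ball x r. dist (Dw (j # w) (f n) y) (g (j # w) y) < e / ?d"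
          by (rule uniform_limitD[OF ul[OF r]])
      qed
      then show "\<forall>\<^sub>F n in sequentially. \<forall>y\<in>ball x r. \<forall>k. norm ((\<Sum>j\<in>UNIV. \<i> * of_real (k $ j) * Dw (j # w) (f n) y) -
          (\<Sum>j\<in>UNIV. \<i> * of_real (k $ j) * g (j # w) y)) \<le> e * norm k"
      proof (rule eventually_mono, intro ballI allI)
        fix n y and k :: "real ^ 'n"
        assume E: "\<forall>j. \<forall>y\<in>ball x r. dist (Dw (j # w) (f n) y) (g (j # w) y) < e / ?d" and y: "y \<in> ball x r"
        have "norm (\<Sum>j\<in>UNIV. \<i> * of_real (k $ j) * (Dw (j # w) (f n) y - g (j # w) y)) \<le> (\<Sum>j::'n\<in>UNIV. norm k * (e / ?d))"
        proof (rule sum_norm_le)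
          fix j
          have "norm (Dw (j # w) (f n) y - g (j # w) y) \<le> e / ?d" using E y by (simp add: dist_norm less_imp_le)
          then show "norm (\<i> * of_real (k $ j) * (Dw (j # w) (f n) y - g (j # w) y)) \<le> norm k * (e / ?d)"
            unfolding norm_mult using component_le_norm_cart[of k j] by (intro mult_mono) auto
        qed
        also have "\<dots> = e * norm k" by simp
        finally show "norm ((\<Sum>j\<in>UNIV. \<i> * of_real (k $ j) * Dw (j # w) (f n) y) -
          (\<Sum>j\<in>UNIV. \<i> * of_real (k $ j) * g (j # w) y)) \<le> e * norm k"
          by (simp only: sum_subtractf right_diff_distrib)
      qed
    qed
    then obtain G where G: "\<And>y. y \<in> ball x r \<Longrightarrow> (\<lambda>n. Dw w (f n) y) \<longlonglongrightarrow> G y"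
      "\<And>y. y \<in> ball x r \<Longrightarrow> (G has_derivative (\<lambda>k. \<Sum>j\<in>UNIV. \<i> * of_real (k $ j) * g (j # w) y)) (at y within ball x r)" by blast
    have eq: "G y = g w y" if y: "y \<in> ball x r" for y
      by (rule LIMSEQ_unique[OF G(1)[OF y] pl]) (use y bV in auto)
    have "(G has_derivative (\<lambda>k. \<Sum>j\<in>UNIV. \<i> * of_real (k $ j) * g (j # w) x)) (at x)"
      using G(2)[of x] at_within_open[of x "ball x r"] r(1) by simp
    then show ?thesis by (rule has_derivative_transform_within_open[of _ _ _ _ "ball x r"]) (use r(1) eq in auto)
  qed
  have Dg: "D_op j (g w) x = g (j # w) x" if "x \<in> V" for j w x
    using D_op_eq[OF der[OF that]] sum_axis_coeff[of j "\<lambda>i. g (i # w) x"]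
    by (simp add: sum_distrib_left[symmetric] mult.assoc)
  have pg: "partial_deriv j (g w) x = \<i> * g (j # w) x" if "x \<in> V" for j w x
    unfolding Dg[OF that, of j w, symmetric] by (simp add: D_op_def mult.assoc[symmetric])
  have sg: "g [] \<in> smooth_functions V"
  \<comment> \<open>The scalar \<open>b\<close> absorbs the factor \<open>\<i>\<close> between
    \<open>partial_deriv\<close> and \<open>D_op\<close>.\<close>
  proof (rule smooth_coinduct[OF V, of _ "{\<lambda>x. b * g w x | b w. True}"])
    show "g [] \<in> {\<lambda>x. b * g w x | b w. True}" by (rule CollectI, rule exI[of _ 1], rule exI[of _ "[]"]) simp
    show "G differentiable (at x)" if G: "G \<in> {\<lambda>x. b * g w x | b w. True}" and x: "x \<in> V" for G x
    proof -
      obtain b w where Geq: "G = (\<lambda>x. b * g w x)" using G by blast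
      show ?thesis unfolding Geq using has_derivative_mult_right[OF der[OF x]] by (auto simp: differentiable_def)
    qed
    show "\<exists>g'\<in>{\<lambda>x. b * g w x | b w. True}. \<forall>x\<in>V. partial_deriv j G x = g' x" if G: "G \<in> {\<lambda>x. b * g w x | b w. True}" for G j
    proof -
      obtain b w where Geq: "G = (\<lambda>x. b * g w x)" using G by blast
      have "partial_deriv j G x = (b * \<i>) * g (j # w) x" if x: "x \<in> V" for x
        unfolding Geq using partial_deriv_eq[OF has_derivative_mult_right[OF der[OF x]]] partial_deriv_eq[OF der[OF x]] pg[OF x, of j w]
        by simp
      then show ?thesis
        by (intro bexI[of _ "\<lambda>x. (b * \<i>) * g (j # w) x"] CollectI exI[of _ "b * \<i>"] exI[of _ "j # w"]) auto
    qed
  qed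
  have Dwg: "Dw w (g []) x = g w x" if "x \<in> V" for w x
    using that
  proof (induction w arbitrary: x)
    case (Cons j w)
    have "Dw (j # w) (g []) x = D_op j (g w) x" unfolding Dw_Cons by (rule D_op_cong[OF V Cons.prems Cons.IH])
    then show ?case using Dg[OF Cons.prems] by simp
  qed simp
  have "Lop W c (g []) x = 0" if x: "x \<in> V" for x
  proof -
    have "(\<lambda>n. Lop W c (f n) x) \<longlonglongrightarrow> (\<Sum>w\<in>W. c w * g w x)"
      unfolding Lop_def by (intro tendsto_intros pl[OF x])
    moreover have "(\<lambda>n. Lop W c (f n) x) = (\<lambda>n. 0)" using f x by (auto simp: Ker_def)
    ultimately have "(\<Sum>w\<in>W. c w * g w x) = 0" using LIMSEQ_unique tendsto_const by metis
    then show ?thesis by (simp add: Lop_def Dwg[OF x])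
  qed
  then have "g [] \<in> Ker W c V" using sg by (simp add: Ker_def)
  moreover have "g [] x = h x" if x: "x \<in> V" for x
    using LIMSEQ_unique[OF pl[OF x, of "[]"], of "h x"] tendsto_uniform_limitI[OF lim x] by simp
  ultimately show ?thesis using Ker_cong[OF V, of "g []" h] by blast
qed

text \<open>One step along the exhaustion, where only the error of the approximation is kept. A
  solution on the interior of stage \<open>n + 2\<close> is bounded on the compact stage
  \<open>n + 1\<close>, and \<epsilon> is adapted to this bound.\<close>

lemma runge_qualitative:
  fixes X :: "(real ^ 'n::finite) set"
  assumes el: "ell W c m" and f: "f \<in> Ker W c (interior (exhaust X 0 (n + 2)))" and \<delta>: "0 < \<delta>"
  shows "\<exists>f'\<in>Ker W c (interior (exhaust X 0 (n + 3))). \<forall>x\<in>exhaust X 0 n. norm (f' x - f x) \<le> \<delta>"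
proof -
  let ?E = "exhaust X 0"
  have L: "?E (n + 1) \<subseteq> interior (?E (n + 2))" using exhaust_interior[of X 0 "n + 1"] by simp
  have "continuous_on (?E (n + 1)) f"
    by (rule continuous_on_subset[OF smooth_continuous_on[OF Ker_smooth[OF f]] L])
  then have "bounded (f ` ?E (n + 1))" using compact_exhaust by (intro compact_imp_bounded compact_continuous_image)
  then obtain B where B: "0 < B" "\<forall>x\<in>?E (n + 1). norm (f x) \<le> B" by (auto simp: bounded_pos)
  have L': "?E n \<subseteq> interior (?E (n + 1))" using exhaust_interior[of X 0 n] by simp
  have "runge W c (?E n) (?E (n + 1)) (interior (?E (n + 3))) (interior (?E (n + 3)))"
    by (rule runge_compact[OF el compact_exhaust exhaust_hull compact_exhaust L' open_interior interior_subset compact_exhaust exhaust_subset])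
  then obtain C and s :: nat where C: "\<And>Y u \<Lambda> \<epsilon>. open Y \<Longrightarrow> ?E (n + 1) \<subseteq> Y \<Longrightarrow> u \<in> Ker W c Y \<Longrightarrow> 0 \<le> \<Lambda> \<Longrightarrow> \<forall>x\<in>?E (n + 1). norm (u x) \<le> \<Lambda> \<Longrightarrow> 0 < \<epsilon> \<Longrightarrow> \<epsilon> < 1 \<Longrightarrow>
    \<exists>h\<in>Ker W c (interior (?E (n + 3))). (\<forall>x\<in>?E n. norm (u x - h x) \<le> \<epsilon> * \<Lambda>) \<and> (\<forall>x\<in>interior (?E (n + 3)). norm (h x) \<le> C / \<epsilon> ^ s * \<Lambda>)"
    by (rule rungeE) (rule that)
  define \<epsilon> where "\<epsilon> = min (1/2) (\<delta> / B)"
  have \<epsilon>: "0 < \<epsilon>" "\<epsilon> < 1" "\<epsilon> * B \<le> \<delta>" using \<delta> B(1) by (auto simp: \<epsilon>_def min_def pos_le_divide_eq not_le)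
  obtain h where "h \<in> Ker W c (interior (?E (n + 3)))" "\<forall>x\<in>?E n. norm (f x - h x) \<le> \<epsilon> * B"
    using C[OF open_interior L f less_imp_le[OF B(1)] B(2) \<epsilon>(1,2)] by blast
  then show ?thesis using \<epsilon>(3) by (intro bexI[of _ h]) (auto simp: norm_minus_commute intro: order_trans)
qed

text \<open>The size estimate comes from a single approximation on the interior of
  \<open>E 2\<close>. The later corrections are geometrically small on \<open>E 0\<close>, which
  contains \<open>K\<close> and \<open>M\<close>, so they spoil neither the error nor the
  size.\<close>

lemma runge_quantitative:
  fixes K L M X :: "(real ^ 'n::finite) set"
  assumes el: "ell W c m" and X: "open X" and K: "compact K" "K \<subseteq> X" and hull: "\<not> (\<exists>C\<in>components (- K). bounded C \<and> C \<subseteq> X)"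
    and L: "compact L" "K \<subseteq> interior L" and M: "compact M" "M \<subseteq> X"
  shows "runge W c K L X M"
proof -
  obtain n0 where n0: "K \<union> M \<subseteq> exhaust X 0 n0" using compact_subset_exhaust[OF X, of "K \<union> M" 0] K M by auto
  define E where "E k = exhaust X 0 (n0 + k)" for k
  have Eint: "E k \<subseteq> interior (E (Suc k))" for k using exhaust_interior[of X 0 "n0 + k"] by (simp add: E_def)
  have Emono: "E k \<subseteq> E l" if "k \<le> l" for k l unfolding E_def using that by (intro exhaust_mono) simp
  have Ecov: "\<exists>k. x \<in> interior (E k)" if x: "x \<in> X" for x
  proof -
    obtain n where "{x} \<subseteq> exhaust X 0 n" using compact_subset_exhaust[OF X, of "{x}" 0] x by auto
    then have "x \<in> E n" using exhaust_mono[of n "n0 + n" X 0] by (auto simp: E_def)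
    then show ?thesis using Eint by blast
  qed
  have step: "\<exists>f'\<in>Ker W c (interior (E (k + 3))). \<forall>x\<in>E k. norm (f' x - f x) \<le> \<delta>"
    if "f \<in> Ker W c (interior (E (k + 2)))" "0 < \<delta>" for k f \<delta>
    using runge_qualitative[OF el, of f X "n0 + k" \<delta>] that by (simp add: E_def add.assoc)
  have "compact (E 2)" "E 2 \<subseteq> X" unfolding E_def by (rule compact_exhaust exhaust_subset)+
  then have "runge W c K L (interior (E 2)) (interior (E 2))"
    by (rule runge_compact[OF el K(1) hull L open_interior interior_subset])
  then obtain C and s :: nat where C: "0 < C" and H: "\<And>Y u \<Lambda> \<epsilon>. open Y \<Longrightarrow> L \<subseteq> Y \<Longrightarrow> u \<in> Ker W c Y \<Longrightarrow> 0 \<le> \<Lambda> \<Longrightarrow> \<forall>x\<in>L. norm (u x) \<le> \<Lambda> \<Longrightarrow> 0 < \<epsilon> \<Longrightarrow> \<epsilon> < 1 \<Longrightarrow>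
    \<exists>h\<in>Ker W c (interior (E 2)). (\<forall>x\<in>K. norm (u x - h x) \<le> \<epsilon> * \<Lambda>) \<and> (\<forall>x\<in>interior (E 2). norm (h x) \<le> C / \<epsilon> ^ s * \<Lambda>)"
    by (rule rungeE) (rule that)
  show ?thesis
  \<comment> \<open>The first solution is taken for \<open>\<epsilon> / 2\<close>, which costs
    \<open>2 ^ s\<close>; the summand 1 pays for the corrections.\<close>
  proof (rule rungeI[of "1 + C * 2 ^ s" _ _ _ _ _ _ s])
    show "0 < 1 + C * 2 ^ s" using C by (simp add: add_pos_pos)
    fix Y u \<Lambda> and \<epsilon> :: real
    assume Y: "open Y" "L \<subseteq> Y" and u: "u \<in> Ker W c Y" and \<Lambda>: "0 \<le> \<Lambda>" "\<forall>x\<in>L. norm (u x) \<le> \<Lambda>" and \<epsilon>: "0 < \<epsilon>" "\<epsilon> < 1"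
    show "\<exists>h\<in>Ker W c X. (\<forall>x\<in>K. norm (u x - h x) \<le> \<epsilon> * \<Lambda>) \<and> (\<forall>x\<in>M. norm (h x) \<le> (1 + C * 2 ^ s) / \<epsilon> ^ s * \<Lambda>)"
    proof (cases "\<Lambda> = 0")
      case True
      have "\<forall>x\<in>K. u x = 0" using \<Lambda>(2) L(2) interior_subset[of L] True by auto
      then show ?thesis using True by (intro bexI[of _ "\<lambda>x. 0"] Ker_zero) auto
    next
      case False
      then have \<Lambda>0: "0 < \<Lambda>" using \<Lambda>(1) by simp
      have "0 < \<epsilon> / 2" "\<epsilon> / 2 < 1" using \<epsilon> by auto
      then obtain h0 where h0: "h0 \<in> Ker W c (interior (E 2))" "\<forall>x\<in>K. norm (u x - h0 x) \<le> \<epsilon> / 2 * \<Lambda>"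
        "\<forall>x\<in>interior (E 2). norm (h0 x) \<le> C / (\<epsilon> / 2) ^ s * \<Lambda>"
        using H[OF Y u \<Lambda>] by blast
      \<comment> \<open>The sum of all terms from \<open>k\<close> on is
        \<open>2 * \<delta> k\<close>; for \<open>k = 0\<close> this is the remaining half of
        \<open>\<epsilon> * \<Lambda>\<close>.\<close>
      define \<delta> where "\<delta> k = \<epsilon> * \<Lambda> / 4 * (1/2) ^ k" for k :: nat
      have \<delta>: "0 < \<delta> k" for k using \<epsilon>(1) \<Lambda>0 by (simp add: \<delta>_def)
      obtain f where f0: "f 0 = h0" and fK: "\<And>k. f k \<in> Ker W c (interior (E (k + 2)))"
        and fs: "\<And>k x. x \<in> E k \<Longrightarrow> norm (f (Suc k) x - f k x) \<le> \<delta> k"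
      proof -
        \<comment> \<open>The clause for \<open>k = 0\<close> makes the invariant force the sequence
          to start at \<open>h0\<close>.\<close>
        have "\<exists>f. \<forall>k. (f k \<in> Ker W c (interior (E (k + 2))) \<and> (k = 0 \<longrightarrow> f k = h0)) \<and> (\<forall>x\<in>E k. norm (f (Suc k) x - f k x) \<le> \<delta> k)"
        proof (rule dependent_nat_choice)
          show "\<exists>x. x \<in> Ker W c (interior (E (0 + 2))) \<and> (0 = 0 \<longrightarrow> x = h0)" using h0(1) by (simp add: numeral_2_eq_2)
          fix x k assume "x \<in> Ker W c (interior (E (k + 2))) \<and> (k = 0 \<longrightarrow> x = h0)"
          then have "x \<in> Ker W c (interior (E (k + 2)))" by blast
          from step[OF this \<delta>[of k]]
          show "\<exists>y. (y \<in> Ker W c (interior (E (Suc k + 2))) \<and> (Suc k = 0 \<longrightarrow> y = h0)) \<and> (\<forall>xa\<in>E k. norm (y xa - x xa) \<le> \<delta> k)"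
            by (auto simp: numeral_3_eq_3)
        qed
        then obtain f where "\<forall>k. (f k \<in> Ker W c (interior (E (k + 2))) \<and> (k = 0 \<longrightarrow> f k = h0)) \<and> (\<forall>x\<in>E k. norm (f (Suc k) x - f k x) \<le> \<delta> k)"
          by (elim exE) (rule that)
        then show thesis by (intro that[of f]) blast+
      qed
      \<comment> \<open>The geometric steps telescope exactly, because
        \<open>\<delta> k = 2 * \<delta> (Suc k)\<close>.\<close>
      have dist: "norm (f (k + i) x - f k x) \<le> 2 * \<delta> k - 2 * \<delta> (k + i)" if x: "x \<in> E k" for k i x
      proof (induction i)
        case (Suc i)
        have "x \<in> E (k + i)" using x Emono[of k "k + i"] by auto
        then have "norm (f (Suc (k + i)) x - f (k + i) x) \<le> \<delta> (k + i)" by (rule fs)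
        moreover have "\<delta> (k + i) = 2 * \<delta> (Suc (k + i))" by (simp add: \<delta>_def)
        moreover have "norm (f (Suc (k + i)) x - f k x) \<le> norm (f (Suc (k + i)) x - f (k + i) x) + norm (f (k + i) x - f k x)"
          by (metis dist_norm dist_triangle)
        ultimately show ?case using Suc.IH by simp
      qed simp
      define h where "h x = lim (\<lambda>n. f n x)" for x
      have \<delta>0: "\<delta> \<longlonglongrightarrow> 0" unfolding \<delta>_def by (rule tendsto_mult_right_zero[OF LIMSEQ_power_zero]) simp
      have bd: "norm (f i x - f k x) \<le> 2 * \<delta> k" if "x \<in> E k" "k \<le> i" for i k x
        using dist[OF that(1), of "i - k"] \<delta>[of i] that(2) by simp
      have lim: "(\<lambda>n. f n x) \<longlonglongrightarrow> h x" if x: "x \<in> E k" for x k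
      proof -
        have "Cauchy (\<lambda>n. f n x)"
          unfolding Cauchy_altdef2
        proof (intro allI impI)
          fix e :: real assume "0 < e"
          then obtain N0 where "\<forall>n\<ge>N0. norm (\<delta> n - 0) < e / 2" using LIMSEQ_D[OF \<delta>0, of "e / 2"] by auto
          then have "2 * \<delta> (N0 + k) < e" by (auto dest!: spec[of _ "N0 + k"])
          moreover have "x \<in> E (N0 + k)" using x Emono[of k "N0 + k"] by auto
          ultimately have "\<forall>n\<ge>N0 + k. dist (f n x) (f (N0 + k) x) < e" using bd by (auto simp: dist_norm intro: le_less_trans)
          then show "\<exists>N. \<forall>n\<ge>N. dist (f n x) (f N x) < e" by blast
        qed
        then show ?thesis unfolding h_def by (simp add: Cauchy_convergent_iff convergent_LIMSEQ_iff)
      qed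
      have hb: "norm (h x - f k x) \<le> 2 * \<delta> k" if x: "x \<in> E k" for x k
      proof (rule LIMSEQ_le_const2)
        show "(\<lambda>n. norm (f n x - f k x)) \<longlonglongrightarrow> norm (h x - f k x)" by (intro tendsto_intros lim[OF x])
        show "\<exists>N. \<forall>n\<ge>N. norm (f n x - f k x) \<le> 2 * \<delta> k" using bd[OF x] by blast
      qed
      \<comment> \<open>The sequence is shifted by \<open>k\<close>, so that all its members are
        solutions on \<open>interior (E k)\<close>.\<close>
      have hE: "h \<in> Ker W c (interior (E k))" for k
      proof (rule Ker_uniform_limit[OF el open_interior])
        show "f (i + k) \<in> Ker W c (interior (E k))" for i
          by (rule Ker_subset[OF fK[of "i + k"] interior_mono[OF Emono]]) simp
        show "uniform_limit (interior (E k)) (\<lambda>i. f (i + k)) h sequentially"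
        proof (rule uniform_limitI)
          fix e :: real assume e: "0 < e"
          then obtain N0 where N0: "\<forall>n\<ge>N0. norm (\<delta> n - 0) < e / 2" using LIMSEQ_D[OF \<delta>0, of "e / 2"] by auto
          have "dist (f (i + k) x) (h x) < e" if i: "N0 \<le> i" and x: "x \<in> interior (E k)" for i x
          proof -
            have "x \<in> E (i + k)" using x interior_subset[of "E k"] Emono[of k "i + k"] by auto
            then have "dist (f (i + k) x) (h x) \<le> 2 * \<delta> (i + k)" using hb by (simp add: dist_norm norm_minus_commute)
            also have "\<dots> < e" using N0[rule_format, of "i + k"] i by auto
            finally show ?thesis .
          qed
          then show "\<forall>\<^sub>F i in sequentially. \<forall>x\<in>interior (E k). dist (f (i + k) x) (h x) < e"
            unfolding eventually_sequentially by blast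
        qed
      qed
      have "h \<in> Ker W c X"
      proof (rule Ker_local[OF X])
        fix x assume "x \<in> X"
        then obtain k where "x \<in> interior (E k)" using Ecov by blast
        then show "\<exists>T. open T \<and> x \<in> T \<and> h \<in> Ker W c T" using hE[of k] by (intro exI[of _ "interior (E k)"]) simp
      qed
      moreover have h0h: "norm (h x - h0 x) \<le> \<epsilon> * \<Lambda> / 2" if "x \<in> E 0" for x
        using hb[OF that] by (simp add: f0 \<delta>_def mult.commute)
      have KM: "K \<subseteq> E 0" "M \<subseteq> E 0" using n0 by (auto simp: E_def)
      have "norm (u x - h x) \<le> \<epsilon> * \<Lambda>" if x: "x \<in> K" for x
      proof -
        have "norm (u x - h x) \<le> norm (u x - h0 x) + norm (h0 x - h x)" by (metis dist_norm dist_triangle)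
        also have "\<dots> \<le> \<epsilon> / 2 * \<Lambda> + \<epsilon> * \<Lambda> / 2"
          using h0(2) x h0h[of x] KM(1) by (intro add_mono) (auto simp: norm_minus_commute)
        finally show ?thesis by (simp add: mult.commute)
      qed
      moreover have "norm (h x) \<le> (1 + C * 2 ^ s) / \<epsilon> ^ s * \<Lambda>" if x: "x \<in> M" for x
      proof -
        have xE: "x \<in> E 0" "x \<in> interior (E 2)" using KM(2) x Eint[of 1] Emono[of 0 1] by (auto simp: numeral_2_eq_2)
        have "norm (h x) \<le> norm (h x - h0 x) + norm (h0 x)" using norm_triangle_ineq[of "h x - h0 x" "h0 x"] by simp
        also have "\<dots> \<le> \<epsilon> * \<Lambda> / 2 + C / (\<epsilon> / 2) ^ s * \<Lambda>" using h0h[OF xE(1)] h0(3) xE(2) by (intro add_mono) auto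
        also have "\<dots> \<le> 1 / \<epsilon> ^ s * \<Lambda> + C / (\<epsilon> / 2) ^ s * \<Lambda>"
        proof (intro add_right_mono)
          have "\<epsilon> ^ s \<le> 1" using \<epsilon> by (intro power_le_one) auto
          then have "1 \<le> 1 / \<epsilon> ^ s" using \<epsilon>(1) by (simp add: pos_le_divide_eq)
          then have "\<epsilon> / 2 \<le> 1 / \<epsilon> ^ s" using \<epsilon> by linarith
          from mult_right_mono[OF this \<Lambda>(1)] show "\<epsilon> * \<Lambda> / 2 \<le> 1 / \<epsilon> ^ s * \<Lambda>" by simp
        qed
        also have "\<dots> = (1 + C * 2 ^ s) / \<epsilon> ^ s * \<Lambda>" by (simp add: power_divide add_divide_distrib distrib_right)
        finally show ?thesis .
      qed
      ultimately show ?thesis by blast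
    qed
  qed
qed

section \<open>Polynomials as operators on words\<close>

text \<open>The letters come in the order in which \<open>D_multi\<close> composes its factors, so
  both iterated derivatives are the same composition.\<close>

definition monom_word :: "('n::{finite,linorder} \<Rightarrow>\<^sub>0 nat) \<Rightarrow> 'n list" where
  "monom_word \<alpha> = concat (map (\<lambda>j. replicate (Poly_Mapping.lookup \<alpha> j) j) (sorted_list_of_set UNIV))"

definition poly_words :: "('n::{finite,linorder}) cpoly \<Rightarrow> 'n list set" where
  "poly_words P = monom_word ` Poly_Mapping.keys P"

text \<open>Summing over the fibre of \<open>monom_word\<close> lets sums over exponents become sums
  over words without showing that distinct exponents give distinct words.\<close>

definition poly_coeff :: "('n::{finite,linorder}) cpoly \<Rightarrow> 'n list \<Rightarrow> complex" where
  "poly_coeff P w = (\<Sum>\<alpha>\<in>{\<alpha>\<in>Poly_Mapping.keys P. monom_word \<alpha> = w}. Poly_Mapping.lookup P \<alpha>)"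

lemma D_multi_eq_Dw: "D_multi \<alpha> f = Dw (monom_word \<alpha>) f"
proof -
  have "foldr (\<lambda>j g. (D_op j ^^ Poly_Mapping.lookup \<alpha> j) g) js f =
    Dw (concat (map (\<lambda>j. replicate (Poly_Mapping.lookup \<alpha> j) j) js)) f" for js
    by (induction js) simp_all
  then show ?thesis by (simp add: D_multi_def monom_word_def)
qed

lemma length_monom_word: "length (monom_word \<alpha>) = multideg \<alpha>"
  by (simp add: monom_word_def multideg_def length_concat comp_def sum_list_distinct_conv_sum_set)

lemma prod_monom_word: "(\<Prod>j\<leftarrow>monom_word \<alpha>. g j) = (\<Prod>j\<in>UNIV. g j ^ Poly_Mapping.lookup \<alpha> j)"
  for g :: "'n::{finite,linorder} \<Rightarrow> complex"
proof -
  have "(\<Prod>j\<leftarrow>concat (map (\<lambda>j. replicate (a j) j) js). g j) = (\<Prod>j\<leftarrow>js. g j ^ a j)" for js and a :: "'n \<Rightarrow> nat"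
    by (induction js) simp_all
  then show ?thesis by (simp add: monom_word_def prod.distinct_set_conv_list[symmetric])
qed

lemma sum_poly_words:
  assumes "\<And>\<alpha>. \<alpha> \<in> Poly_Mapping.keys P \<Longrightarrow> Q (monom_word \<alpha>) \<longleftrightarrow> R \<alpha>"
  shows "(\<Sum>w\<in>{w\<in>poly_words P. Q w}. poly_coeff P w * F w) =
    (\<Sum>\<alpha>\<in>{\<alpha>\<in>Poly_Mapping.keys P. R \<alpha>}. Poly_Mapping.lookup P \<alpha> * F (monom_word \<alpha>))"
proof -
  have "(\<Sum>\<alpha>\<in>{\<alpha>\<in>Poly_Mapping.keys P. R \<alpha>}. Poly_Mapping.lookup P \<alpha> * F (monom_word \<alpha>)) =
    (\<Sum>w\<in>monom_word ` {\<alpha>\<in>Poly_Mapping.keys P. R \<alpha>}. \<Sum>\<alpha>\<in>{\<beta>\<in>{\<alpha>\<in>Poly_Mapping.keys P. R \<alpha>}. monom_word \<beta> = w}.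
      Poly_Mapping.lookup P \<alpha> * F (monom_word \<alpha>))"
    by (rule sum.image_gen) simp
  also have "\<dots> = (\<Sum>w\<in>{w\<in>poly_words P. Q w}. poly_coeff P w * F w)"
  proof (rule sum.cong)
    show "monom_word ` {\<alpha>\<in>Poly_Mapping.keys P. R \<alpha>} = {w\<in>poly_words P. Q w}"
      using assms by (auto simp: poly_words_def)
    fix w assume "w \<in> {w\<in>poly_words P. Q w}"
    then have "{\<beta>\<in>{\<alpha>\<in>Poly_Mapping.keys P. R \<alpha>}. monom_word \<beta> = w} = {\<alpha>\<in>Poly_Mapping.keys P. monom_word \<alpha> = w}"
      using assms by auto
    then show "(\<Sum>\<alpha>\<in>{\<beta>\<in>{\<alpha>\<in>Poly_Mapping.keys P. R \<alpha>}. monom_word \<beta> = w}. Poly_Mapping.lookup P \<alpha> * F (monom_word \<alpha>)) =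
      poly_coeff P w * F w"
      unfolding poly_coeff_def sum_distrib_right by (intro sum.cong) auto
  qed
  finally show ?thesis by simp
qed

lemma kernel_functions_eq_Ker: "kernel_functions P V = Ker (poly_words P) (poly_coeff P) V"
proof -
  have "diff_op P f x = Lop (poly_words P) (poly_coeff P) f x" for f x
    using sum_poly_words[of P "\<lambda>_. True" "\<lambda>_. True" "\<lambda>w. Dw w f x"]
    by (simp add: diff_op_def Lop_def D_multi_eq_Dw)
  then show ?thesis by (simp add: kernel_functions_def Ker_def)
qed

lemma symb_principal_part:
  "symb {w\<in>poly_words P. length w = total_degree P} (poly_coeff P) \<xi> =
    poly_eval (principal_part P) (\<chi> j. complex_of_real (\<xi> $ j))"
proof -
  have "poly_eval (principal_part P) (\<chi> j. complex_of_real (\<xi> $ j)) =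
    (\<Sum>\<alpha>\<in>{\<alpha>\<in>Poly_Mapping.keys P. multideg \<alpha> = total_degree P}. Poly_Mapping.lookup P \<alpha> * (\<Prod>j\<in>UNIV. of_real (\<xi> $ j) ^ Poly_Mapping.lookup \<alpha> j))"
    unfolding poly_eval_def
  proof (rule sum.mono_neutral_cong_left)
    show "Poly_Mapping.keys (principal_part P) \<subseteq> {\<alpha>\<in>Poly_Mapping.keys P. multideg \<alpha> = total_degree P}"
      by (auto simp: principal_part_def in_keys_iff lookup_mapp split: if_splits)
  qed (auto simp: principal_part_def in_keys_iff lookup_mapp)
  also have "\<dots> = symb {w\<in>poly_words P. length w = total_degree P} (poly_coeff P) \<xi>"
    unfolding symb_def
    by (subst sum_poly_words[where R = "\<lambda>\<alpha>. multideg \<alpha> = total_degree P"]) (simp_all add: length_monom_word prod_monom_word)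
  finally show ?thesis by simp
qed

section \<open>Ellipticity as a lower bound for the leading symbol\<close>

lemma symb_homogeneous: "symb {w\<in>W. length w = m} c (t *\<^sub>R \<xi>) = of_real t ^ m * symb {w\<in>W. length w = m} c \<xi>"
proof -
  have "(\<Prod>j\<leftarrow>w. complex_of_real ((t *\<^sub>R \<xi>) $ j)) = of_real t ^ length w * (\<Prod>j\<leftarrow>w. of_real (\<xi> $ j))" for w
    by (induction w) simp_all
  then show ?thesis unfolding symb_def sum_distrib_left by (intro sum.cong refl) simp
qed

text \<open>The modulus of the leading symbol has a positive minimum on the compact unit sphere, and
  homogeneity carries it over to all \<xi>.\<close>

lemma elliptic_ell:
  fixes P :: "('n::{finite,linorder}) cpoly"
  assumes "elliptic P"
  shows "ell (poly_words P) (poly_coeff P) (total_degree P)"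
proof -
  let ?m = "total_degree P"
  let ?S = "symb {w\<in>poly_words P. length w = ?m} (poly_coeff P)"
  have co: "continuous_on (sphere (0 :: real ^ 'n::{finite,linorder}) 1) (\<lambda>\<xi>. norm (?S \<xi>))"
    unfolding symb_principal_part poly_eval_def by (intro continuous_intros) 
  \<comment> \<open>Some unit vector, so that the minimum over the sphere is attained.\<close>
  have "axis undefined 1 \<in> sphere (0 :: real ^ 'n::{finite,linorder}) 1" by simp
  then obtain e where e: "e \<in> sphere (0 :: real ^ 'n::{finite,linorder}) 1" "\<And>\<xi>. \<xi> \<in> sphere 0 1 \<Longrightarrow> norm (?S e) \<le> norm (?S \<xi>)"
    using continuous_attains_inf[OF compact_sphere _ co] by blast
  have "e \<noteq> 0" using e(1) by auto
  then have pos: "0 < norm (?S e)" using assms unfolding symb_principal_part by (simp add: elliptic_def)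
  have "norm (?S e) * norm \<xi> ^ ?m \<le> norm (?S \<xi>)" for \<xi>
  proof -
    obtain v where v: "v \<in> sphere (0 :: real ^ 'n::{finite,linorder}) 1" "\<xi> = norm \<xi> *\<^sub>R v"
    proof (cases "\<xi> = 0")
      case True
      then show thesis using that[of e] e(1) by simp
    next
      case False
      then show thesis using that[of "(1 / norm \<xi>) *\<^sub>R \<xi>"] by simp
    qed
    have "norm (?S e) * norm \<xi> ^ ?m \<le> norm (?S v) * norm \<xi> ^ ?m" using e(2)[OF v(1)] by (intro mult_right_mono) auto
    also have "\<dots> = norm (?S (norm \<xi> *\<^sub>R v))" unfolding symb_homogeneous by (simp add: norm_mult norm_power)
    finally show ?thesis using v(2) by simp
  qed
  moreover have "length w \<le> ?m" if "w \<in> poly_words P" for w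
    using that by (auto simp: poly_words_def length_monom_word total_degree_def)
  moreover have "finite (poly_words P)" by (simp add: poly_words_def)
  ultimately show ?thesis unfolding ell_def using pos by blast
qed

section \<open>Supremum norms and the approximation theorem\<close>

lemma norm_le_sup_norm_on:
  assumes "compact L" "continuous_on L f" "x \<in> L"
  shows "norm (f x) \<le> sup_norm_on L f"
proof -
  have "bdd_above ((\<lambda>x. norm (f x)) ` L)"
    by (intro bounded_imp_bdd_above compact_imp_bounded compact_continuous_image continuous_on_norm assms(1,2))
  then show ?thesis using assms(3) by (auto simp: sup_norm_on_def intro: cSUP_upper)
qed

lemma sup_norm_on_le:
  assumes "0 \<le> B" "\<And>x. x \<in> K \<Longrightarrow> norm (f x) \<le> B"
  shows "sup_norm_on K f \<le> B"
  using assms by (auto simp: sup_norm_on_def intro: cSUP_least)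

lemma sup_norm_on_nonneg:
  assumes "compact L" "continuous_on L f"
  shows "0 \<le> sup_norm_on L f"
proof (cases "L = {}")
  case False
  then obtain x where "x \<in> L" by blast
  from norm_le_sup_norm_on[OF assms this] show ?thesis by (rule order_trans[OF norm_ge_zero])
qed (simp add: sup_norm_on_def)

theorem theorem1p2:
  fixes P :: "('n::{finite,linorder}) cpoly"
    and X Y K :: "(real ^ 'n::{finite,linorder}) set"
  assumes "elliptic P"
    and "open X"
    and "compact K" and "K \<subseteq> X"
    and "\<exists>U. open U \<and> has_continuous_boundary U \<and> K = closure U"
    and "\<not> (\<exists>C\<in>components (- K). bounded C \<and> C \<subseteq> X)"
    and "open Y" and "K \<subseteq> Y" and "Y \<subseteq> X"
  shows "\<forall>L M. compact L \<and> L \<subseteq> Y \<and> K \<subseteq> interior L \<and> compact M \<and> M \<subseteq> X \<longrightarrow>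
    (\<exists>s C. s > 0 \<and> C > 0 \<and>
      (\<forall>f\<in>kernel_functions P Y. \<forall>\<epsilon>\<in>{0<..<1}. \<exists>h\<in>kernel_functions P X.
         sup_norm_on K (\<lambda>x. f x - h x) \<le> \<epsilon> * sup_norm_on L f \<and>
         sup_norm_on M h \<le> C / \<epsilon> powr s * sup_norm_on L f))"
proof (intro allI impI, elim conjE)
  fix L M :: "(real ^ 'n::{finite,linorder}) set"
  assume L: "compact L" "L \<subseteq> Y" "K \<subseteq> interior L" and M: "compact M" "M \<subseteq> X"
  let ?W = "poly_words P" and ?c = "poly_coeff P"
  have "runge ?W ?c K L X M"
    by (rule runge_quantitative[OF elliptic_ell[OF assms(1)] assms(2,3,4,6) L(1,3) M])
  then obtain C and s :: nat where C: "0 < C" and H: "\<And>Y u \<Lambda> \<epsilon>. open Y \<Longrightarrow> L \<subseteq> Y \<Longrightarrow> u \<in> Ker ?W ?c Y \<Longrightarrow> 0 \<le> \<Lambda> \<Longrightarrow> \<forall>x\<in>L. norm (u x) \<le> \<Lambda> \<Longrightarrow>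
    0 < \<epsilon> \<Longrightarrow> \<epsilon> < 1 \<Longrightarrow> \<exists>h\<in>Ker ?W ?c X. (\<forall>x\<in>K. norm (u x - h x) \<le> \<epsilon> * \<Lambda>) \<and> (\<forall>x\<in>M. norm (h x) \<le> C / \<epsilon> ^ s * \<Lambda>)"
    by (rule rungeE) (rule that)
  have main: "\<exists>h\<in>kernel_functions P X. sup_norm_on K (\<lambda>x. f x - h x) \<le> \<epsilon> * sup_norm_on L f \<and>
    sup_norm_on M h \<le> C / \<epsilon> powr real (Suc s) * sup_norm_on L f"
    if f: "f \<in> kernel_functions P Y" and \<epsilon>: "\<epsilon> \<in> {0<..<1}" for f \<epsilon>
  proof -
    let ?\<Lambda> = "sup_norm_on L f"
    have cf: "continuous_on L f"
      using f L(2) unfolding kernel_functions_def by (blast intro: continuous_on_subset smooth_continuous_on)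
    have \<Lambda>: "0 \<le> ?\<Lambda>" by (rule sup_norm_on_nonneg[OF L(1) cf])
    have \<epsilon>': "0 < \<epsilon>" "\<epsilon> < 1" using \<epsilon> by auto
    obtain h where h: "h \<in> Ker ?W ?c X" "\<forall>x\<in>K. norm (f x - h x) \<le> \<epsilon> * ?\<Lambda>" "\<forall>x\<in>M. norm (h x) \<le> C / \<epsilon> ^ s * ?\<Lambda>"
      using H[OF assms(7) L(2) f[unfolded kernel_functions_eq_Ker] \<Lambda> _ \<epsilon>'] norm_le_sup_norm_on[OF L(1) cf] by blast
    \<comment> \<open>The exponent in the claim is positive while \<open>s\<close> may be 0. As
      \<epsilon> is below 1, passing to \<open>Suc s\<close> only weakens the bound.\<close>
    have "C / \<epsilon> ^ s \<le> C / \<epsilon> powr real (Suc s)"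
    proof (rule divide_left_mono)
      show "\<epsilon> powr real (Suc s) \<le> \<epsilon> ^ s"
        using \<epsilon>' by (simp add: powr_realpow mult_left_le_one_le del: of_nat_Suc)
    qed (use C \<epsilon>' in auto)
    then have le: "C / \<epsilon> ^ s * ?\<Lambda> \<le> C / \<epsilon> powr real (Suc s) * ?\<Lambda>" using \<Lambda> by (rule mult_right_mono)
    have "sup_norm_on M h \<le> C / \<epsilon> ^ s * ?\<Lambda>"
      using h(3) \<Lambda> C \<epsilon>' by (intro sup_norm_on_le) auto
    then have "sup_norm_on M h \<le> C / \<epsilon> powr real (Suc s) * ?\<Lambda>" using le by (rule order_trans)
    moreover have "sup_norm_on K (\<lambda>x. f x - h x) \<le> \<epsilon> * ?\<Lambda>"
      using h(2) \<Lambda> \<epsilon>' by (intro sup_norm_on_le) auto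
    ultimately show ?thesis using h(1) unfolding kernel_functions_eq_Ker by blast
  qed
  show "\<exists>s C. s > 0 \<and> C > 0 \<and>
      (\<forall>f\<in>kernel_functions P Y. \<forall>\<epsilon>\<in>{0<..<1}. \<exists>h\<in>kernel_functions P X.
         sup_norm_on K (\<lambda>x. f x - h x) \<le> \<epsilon> * sup_norm_on L f \<and>
         sup_norm_on M h \<le> C / \<epsilon> powr s * sup_norm_on L f)"
    by (rule exI[of _ "real (Suc s)"], rule exI[of _ C]) (use C main in simp)
qed

end
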